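(* The co-unit of the adjunction $\mathsf{KSp}\dashv\mathsf{KPs}$, $$\mathsf{KSp}:\underleftarrow{\mathsf{oplaxlim}}\,\mathsf{X}\rightleftarrows\mathsf{LocSph}(\triangle_{\mathsf{st}}):\mathsf{KPs},$$ is a natural isomorphism, whence $\mathsf{KPs}:\mathsf{LocSph}(\triangle_{\mathsf{st}})\to\underleftarrow{\mathsf{oplaxlim}}\,\mathsf{X}$ is full-and-faithful.
   Context: **Kan suspension.** $\triangle$ is the simplex category; $\widehat{\mathsf{A}}_\bullet$ denotes presheaves of pointed sets on $\mathsf{A}$; $(-)_+$ adds a disjoint base-point. $K:\triangle\to\triangle$ is the functor $[n]\mapsto[n+1]$, $d^i\mapsto d^i$, $s^j\mapsto s^j$. $\Sigma_K:\widehat{\triangle}_\bullet\to\widehat{\triangle}_\bullet$ is the colimit-preserving functor with $\Sigma_K(\triangle[n]_+)=\triangle[n+1]_+/(\triangle[n]_+\vee\triangle[0]_+)$, where $\triangle[n]\to\triangle[n+1]$ is $d^{n+1}$ and $\triangle[0]\to\triangle[n+1]$ is the vertex $n+1$; $\Omega_K$ is its right adjoint. There is a natural quotient map $\triangle[n+1]_+\to\Sigma_K\triangle[n]_+$. **Spectrum objects.** $\underleftarrow{\mathsf{oplaxlim}}\,\mathsf{X}$ is the oplax limit in $\mathsf{CAT}$ of $\cdots\xrightarrow{\Omega_K}\widehat{\triangle}_\bullet\xrightarrow{\Omega_K}\widehat{\triangle}_\bullet$ (indexed by $\mathbf{Z}_{\le0}$): objects are families $(Y_{-i})_{i\in\mathbf{N}}$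 of pointed simplicial sets with maps $Y_{-i}\to\Omega_KY_{-(i+1)}$ (equivalently $\Sigma_KY_{-i}\to Y_{-(i+1)}$); morphisms are compatible families of maps. **Index categories.** $\triangle_{\mathsf{coll}}$ has objects $([n],-m)$, $n,m\in\mathbf{N}$, with $\mathrm{Hom}(([n],-(m+k)),([\ell],-m))=\triangle([n],[\ell+k])$ for $k\ge0$, no other morphisms, and composition of $\psi\in\triangle([n],[\ell+j])$ with $\varphi\in\triangle([\ell],[p+k])$ given by $K^j(\varphi)\circ\psi$. $\triangle_{\mathsf{st}}$ has objects $[z]$, $z\in\mathbf{Z}$, and morphisms generated by $d^i:[z-1]\to[z]$ and $s^j:[z+1]\to[z]$ for all $i,j\in\mathbf{N}$, subject to the (unbounded) cosimplicial identities. $\rho:\triangle_{\mathsf{coll}}\to\triangle_{\mathsf{st}}$ sends $([n],-m)$ to $[n-m]$ and sends a morphism given by a word in the $d^i,s^j$ to the same word in $\triangle_{\mathsf{st}}$. $\rho_{\bullet!}:\widehat{\triangle_{\mathsf{coll}}}_\bullet\to\widehat{\triangle_{\mathsf{st}}}_\bullet$ is the left adjoint of restriction along $\rho$. **The functor $\triangle_{\mathsf{X}}\Phi$.** $\triangle_{\mathsf{X}}\Phi:\triangle_{\mathsf{coll}}\to\underleftarrow{\mathsf{oplaxlim}}\,\mathsf{X}$ sends $([n],-k)$ to the spectrum object with $(-i)$-th term $\bullet$ for $i<k$ and $\Sigma_K^{i-k}\triangle[n]_+$ for $i\ge k$ (evident structure maps), and sends $\varphi\in\triangle([n],[\ell+k]):([n],-(m+k))\to([\ell],-m)$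 to the map given at levels $-i$, $i\ge m+k$, by $\Sigma_K^{i-m-k}$ of the composite $\triangle[n]_+\xrightarrow{\varphi}\triangle[\ell+k]_+\to\Sigma_K^k\triangle[\ell]_+$, the second map being the iterated quotient. $(\triangle_{\mathsf{X}}\Phi)_\bullet^*(Y)$ is the pointed presheaf $\mathrm{Hom}(\triangle_{\mathsf{X}}\Phi(-),Y)$. **Spherical objects.** For $n\in\mathbf{N}$, $z\in\mathbf{Z}$, $S^{(z-n)}[n]\in\widehat{\triangle_{\mathsf{st}}}_\bullet$ is the quotient of the pointed representable $\triangle_{\mathsf{st}}[z]_+$ collapsing to the base-point the images of $d^{n+i}:\triangle_{\mathsf{st}}[z-1]_+\to\triangle_{\mathsf{st}}[z]_+$ for all $i\ge1$ and of $d^nd^{n-1}\cdots d^1d^0:\triangle_{\mathsf{st}}[z-(n+1)]_+\to\triangle_{\mathsf{st}}[z]_+$. $\mathsf{LocSph}(\triangle_{\mathsf{st}})$ is the full subcategory of $\widehat{\triangle_{\mathsf{st}}}_\bullet$ on colimits of objects of the form $S^{(z-n)}[n]$. **The adjunction.** The functor $\rho_{\bullet!}\circ(\triangle_{\mathsf{X}}\Phi)^*_\bullet$ takes values in $\mathsf{LocSph}(\triangle_{\mathsf{st}})$; $\mathsf{KSp}$ is the resulting functor and $\mathsf{KPs}$ is its right adjoint, given by $\mathsf{KPs}(Z)_{-i}([n])=\widehat{\triangle_{\mathsf{st}}}_\bullet(S^{-i}[n],Z)$. *)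

theory Defs
  imports Main "HOL-Library.FuncSet" "HOL-Library.Infinite_Typeclass"
begin

section \<open>Categories, functors, adjunctions, colimits\<close>

text \<open>
  Hom-sets of different pairs of objects may overlap, so composition and the action of a functor on
  morphisms take the objects as arguments: \<open>cmp C a b c g f\<close> is the composite of \<open>f : a \<rightarrow> b\<close> and
  \<open>g : b \<rightarrow> c\<close>.
\<close>

record ('o, 'm) cat =
  obj :: "'o set"
  hom :: "'o \<Rightarrow> 'o \<Rightarrow> 'm set"
  ide :: "'o \<Rightarrow> 'm"
  cmp :: "'o \<Rightarrow> 'o \<Rightarrow> 'o \<Rightarrow> 'm \<Rightarrow> 'm \<Rightarrow> 'm"

definition category :: "('o, 'm) cat \<Rightarrow> bool" where
  "category C \<longleftrightarrow>
     (\<forall>a\<in>obj C. ide C a \<in> hom C a a) \<and>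
     (\<forall>a\<in>obj C. \<forall>b\<in>obj C. \<forall>c\<in>obj C. \<forall>f\<in>hom C a b. \<forall>g\<in>hom C b c.
        cmp C a b c g f \<in> hom C a c) \<and>
     (\<forall>a\<in>obj C. \<forall>b\<in>obj C. \<forall>f\<in>hom C a b.
        cmp C a a b f (ide C a) = f \<and> cmp C a b b (ide C b) f = f) \<and>
     (\<forall>a\<in>obj C. \<forall>b\<in>obj C. \<forall>c\<in>obj C. \<forall>d\<in>obj C.
        \<forall>f\<in>hom C a b. \<forall>g\<in>hom C b c. \<forall>h\<in>hom C c d.
        cmp C a b d (cmp C b c d h g) f = cmp C a c d h (cmp C a b c g f))"

definition is_iso :: "('o, 'm) cat \<Rightarrow> 'o \<Rightarrow> 'o \<Rightarrow> 'm \<Rightarrow> bool" where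
  "is_iso C a b f \<longleftrightarrow> f \<in> hom C a b \<and>
     (\<exists>g\<in>hom C b a. cmp C a b a g f = ide C a \<and> cmp C b a b f g = ide C b)"

definition full_subcat :: "('o, 'm) cat \<Rightarrow> 'o set \<Rightarrow> ('o, 'm) cat" where
  "full_subcat C A = C\<lparr>obj := obj C \<inter> A\<rparr>"

record ('o, 'm, 'p, 'n) ftor =
  fobj :: "'o \<Rightarrow> 'p"
  fmap :: "'o \<Rightarrow> 'o \<Rightarrow> 'm \<Rightarrow> 'n"

definition is_functor :: "('o, 'm) cat \<Rightarrow> ('p, 'n) cat \<Rightarrow> ('o, 'm, 'p, 'n) ftor \<Rightarrow> bool" where
  "is_functor C D F \<longleftrightarrow> category C \<and> category D \<and>
     (\<forall>a\<in>obj C. fobj F a \<in> obj D) \<and>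
     (\<forall>a\<in>obj C. \<forall>b\<in>obj C. \<forall>f\<in>hom C a b. fmap F a b f \<in> hom D (fobj F a) (fobj F b)) \<and>
     (\<forall>a\<in>obj C. fmap F a a (ide C a) = ide D (fobj F a)) \<and>
     (\<forall>a\<in>obj C. \<forall>b\<in>obj C. \<forall>c\<in>obj C. \<forall>f\<in>hom C a b. \<forall>g\<in>hom C b c.
        fmap F a c (cmp C a b c g f)
          = cmp D (fobj F a) (fobj F b) (fobj F c) (fmap F b c g) (fmap F a b f))"

definition id_ftor :: "('o, 'm, 'o, 'm) ftor" where
  "id_ftor = \<lparr>fobj = (\<lambda>a. a), fmap = (\<lambda>a b f. f)\<rparr>"

definition comp_ftor ::
    "('p, 'n, 'q, 'l) ftor \<Rightarrow> ('o, 'm, 'p, 'n) ftor \<Rightarrow> ('o, 'm, 'q, 'l) ftor" where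
  "comp_ftor G F = \<lparr>fobj = (\<lambda>a. fobj G (fobj F a)),
     fmap = (\<lambda>a b f. fmap G (fobj F a) (fobj F b) (fmap F a b f))\<rparr>"

definition natural_transformation ::
    "('o, 'm) cat \<Rightarrow> ('p, 'n) cat \<Rightarrow> ('o, 'm, 'p, 'n) ftor \<Rightarrow> ('o, 'm, 'p, 'n) ftor
      \<Rightarrow> ('o \<Rightarrow> 'n) \<Rightarrow> bool" where
  "natural_transformation C D F G \<tau> \<longleftrightarrow> is_functor C D F \<and> is_functor C D G \<and>
     (\<forall>a\<in>obj C. \<tau> a \<in> hom D (fobj F a) (fobj G a)) \<and>
     (\<forall>a\<in>obj C. \<forall>b\<in>obj C. \<forall>f\<in>hom C a b.
        cmp D (fobj F a) (fobj F b) (fobj G b) (\<tau> b) (fmap F a b f)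
          = cmp D (fobj F a) (fobj G a) (fobj G b) (fmap G a b f) (\<tau> a))"

definition natural_isomorphism ::
    "('o, 'm) cat \<Rightarrow> ('p, 'n) cat \<Rightarrow> ('o, 'm, 'p, 'n) ftor \<Rightarrow> ('o, 'm, 'p, 'n) ftor
      \<Rightarrow> ('o \<Rightarrow> 'n) \<Rightarrow> bool" where
  "natural_isomorphism C D F G \<tau> \<longleftrightarrow> natural_transformation C D F G \<tau> \<and>
     (\<forall>a\<in>obj C. is_iso D (fobj F a) (fobj G a) (\<tau> a))"

text \<open>\<open>F : C \<rightarrow> D\<close> is left adjoint to \<open>G : D \<rightarrow> C\<close> with unit \<open>\<eta>\<close> and co-unit \<open>\<epsilon>\<close>.\<close>

definition adjunction ::
    "('o, 'm) cat \<Rightarrow> ('p, 'n) cat \<Rightarrow> ('o, 'm, 'p, 'n) ftor \<Rightarrow> ('p, 'n, 'o, 'm) ftor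
      \<Rightarrow> ('o \<Rightarrow> 'm) \<Rightarrow> ('p \<Rightarrow> 'n) \<Rightarrow> bool" where
  "adjunction C D F G \<eta> \<epsilon> \<longleftrightarrow>
     is_functor C D F \<and> is_functor D C G \<and>
     natural_transformation C C id_ftor (comp_ftor G F) \<eta> \<and>
     natural_transformation D D (comp_ftor F G) id_ftor \<epsilon> \<and>
     (\<forall>c\<in>obj C. cmp D (fobj F c) (fobj F (fobj G (fobj F c))) (fobj F c)
          (\<epsilon> (fobj F c)) (fmap F c (fobj G (fobj F c)) (\<eta> c)) = ide D (fobj F c)) \<and>
     (\<forall>d\<in>obj D. cmp C (fobj G d) (fobj G (fobj F (fobj G d))) (fobj G d)
          (fmap G (fobj F (fobj G d)) d (\<epsilon> d)) (\<eta> (fobj G d)) = ide C (fobj G d))"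

definition left_adjoint ::
    "('o, 'm) cat \<Rightarrow> ('p, 'n) cat \<Rightarrow> ('p, 'n, 'o, 'm) ftor \<Rightarrow> ('o, 'm, 'p, 'n) ftor" where
  "left_adjoint C D G = (SOME F. \<exists>\<eta> \<epsilon>. adjunction C D F G \<eta> \<epsilon>)"

definition full_ftor :: "('o, 'm) cat \<Rightarrow> ('p, 'n) cat \<Rightarrow> ('o, 'm, 'p, 'n) ftor \<Rightarrow> bool" where
  "full_ftor C D F \<longleftrightarrow> is_functor C D F \<and>
     (\<forall>a\<in>obj C. \<forall>b\<in>obj C. fmap F a b ` hom C a b = hom D (fobj F a) (fobj F b))"

definition faithful_ftor :: "('o, 'm) cat \<Rightarrow> ('p, 'n) cat \<Rightarrow> ('o, 'm, 'p, 'n) ftor \<Rightarrow> bool" where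
  "faithful_ftor C D F \<longleftrightarrow> is_functor C D F \<and>
     (\<forall>a\<in>obj C. \<forall>b\<in>obj C. inj_on (fmap F a b) (hom C a b))"

definition is_cocone ::
    "('j, 'k) cat \<Rightarrow> ('o, 'm) cat \<Rightarrow> ('j, 'k, 'o, 'm) ftor \<Rightarrow> 'o \<Rightarrow> ('j \<Rightarrow> 'm) \<Rightarrow> bool" where
  "is_cocone J C F Z \<iota> \<longleftrightarrow> is_functor J C F \<and> Z \<in> obj C \<and>
     (\<forall>j\<in>obj J. \<iota> j \<in> hom C (fobj F j) Z) \<and>
     (\<forall>i\<in>obj J. \<forall>j\<in>obj J. \<forall>k\<in>hom J i j.
        cmp C (fobj F i) (fobj F j) Z (\<iota> j) (fmap F i j k) = \<iota> i)"

definition is_colimit ::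
    "('j, 'k) cat \<Rightarrow> ('o, 'm) cat \<Rightarrow> ('j, 'k, 'o, 'm) ftor \<Rightarrow> 'o \<Rightarrow> ('j \<Rightarrow> 'm) \<Rightarrow> bool" where
  "is_colimit J C F Z \<iota> \<longleftrightarrow> is_cocone J C F Z \<iota> \<and>
     (\<forall>W \<kappa>. is_cocone J C F W \<kappa> \<longrightarrow>
        (\<exists>!h. h \<in> hom C Z W \<and> (\<forall>j\<in>obj J. cmp C (fobj F j) Z W h (\<iota> j) = \<kappa> j)))"


section \<open>Presheaves of pointed sets\<close>

text \<open>
  A type \<open>'u\<close> of class \<open>infinite\<close> serves as the universe: a small set is a subset of \<open>'u\<close>, and
  \<open>psh C\<close> below, used at this \<open>'u\<close>, is the category of presheaves of small pointed sets.
  For \<open>f : a \<rightarrow> b\<close>, \<open>act P a b f\<close> is the restriction map from \<open>el P b\<close> to \<open>el P a\<close>.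
\<close>

record ('o, 'm, 'u) ppsh =
  el :: "'o \<Rightarrow> 'u set"
  pt :: "'o \<Rightarrow> 'u"
  act :: "'o \<Rightarrow> 'o \<Rightarrow> 'm \<Rightarrow> 'u \<Rightarrow> 'u"

definition pointed_presheaf :: "('o, 'm) cat \<Rightarrow> ('o, 'm, 'u) ppsh \<Rightarrow> bool" where
  "pointed_presheaf C P \<longleftrightarrow>
     (\<forall>a\<in>obj C. pt P a \<in> el P a) \<and>
     (\<forall>a\<in>obj C. \<forall>b\<in>obj C. \<forall>f\<in>hom C a b.
        act P a b f \<in> el P b \<rightarrow> el P a \<and> act P a b f (pt P b) = pt P a) \<and>
     (\<forall>a\<in>obj C. \<forall>x\<in>el P a. act P a a (ide C a) x = x) \<and>
     (\<forall>a\<in>obj C. \<forall>b\<in>obj C. \<forall>c\<in>obj C. \<forall>f\<in>hom C a b. \<forall>g\<in>hom C b c. \<forall>x\<in>el P c.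
        act P a c (cmp C a b c g f) x = act P a b f (act P b c g x))"

text \<open>
  \<open>P\<close> and \<open>Q\<close> may have different value types here; this is used for auxiliary presheaves that
  have not been transported to the universe yet.
\<close>

definition psh_hom ::
    "('o, 'm) cat \<Rightarrow> ('o, 'm, 'u) ppsh \<Rightarrow> ('o, 'm, 'v) ppsh \<Rightarrow> ('o \<Rightarrow> 'u \<Rightarrow> 'v) set" where
  "psh_hom C P Q = {\<alpha> \<in> (\<Pi>\<^sub>E c\<in>obj C. el P c \<rightarrow>\<^sub>E el Q c).
     (\<forall>a\<in>obj C. \<alpha> a (pt P a) = pt Q a) \<and>
     (\<forall>a\<in>obj C. \<forall>b\<in>obj C. \<forall>f\<in>hom C a b. \<forall>x\<in>el P b.
        \<alpha> a (act P a b f x) = act Q a b f (\<alpha> b x))}"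

definition psh_id :: "('o, 'm) cat \<Rightarrow> ('o, 'm, 'u) ppsh \<Rightarrow> 'o \<Rightarrow> 'u \<Rightarrow> 'u" where
  "psh_id C P = (\<lambda>c\<in>obj C. \<lambda>x\<in>el P c. x)"

definition psh_comp ::
    "('o, 'm) cat \<Rightarrow> ('o, 'm, 'u) ppsh \<Rightarrow> ('o \<Rightarrow> 'v \<Rightarrow> 'w) \<Rightarrow> ('o \<Rightarrow> 'u \<Rightarrow> 'v) \<Rightarrow> 'o \<Rightarrow> 'u \<Rightarrow> 'w" where
  "psh_comp C P \<beta> \<alpha> = (\<lambda>c\<in>obj C. compose (el P c) (\<beta> c) (\<alpha> c))"

definition psh_zero ::
    "('o, 'm) cat \<Rightarrow> ('o, 'm, 'u) ppsh \<Rightarrow> ('o, 'm, 'v) ppsh \<Rightarrow> 'o \<Rightarrow> 'u \<Rightarrow> 'v" where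
  "psh_zero C P Q = (\<lambda>c\<in>obj C. \<lambda>x\<in>el P c. pt Q c)"

definition psh :: "('o, 'm) cat \<Rightarrow> (('o, 'm, 'u) ppsh, 'o \<Rightarrow> 'u \<Rightarrow> 'u) cat" where
  "psh C = \<lparr>obj = {P. pointed_presheaf C P}, hom = psh_hom C, ide = psh_id C,
            cmp = (\<lambda>P Q R \<beta> \<alpha>. psh_comp C P \<beta> \<alpha>)\<rparr>"

definition restrict_psh ::
    "('c, 'k, 'o, 'm) ftor \<Rightarrow> ('o, 'm, 'u) ppsh \<Rightarrow> ('c, 'k, 'u) ppsh" where
  "restrict_psh F P = \<lparr>el = (\<lambda>c. el P (fobj F c)), pt = (\<lambda>c. pt P (fobj F c)),
     act = (\<lambda>a b f. act P (fobj F a) (fobj F b) (fmap F a b f))\<rparr>"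

definition restrict_ftor ::
    "('c, 'k) cat \<Rightarrow> ('c, 'k, 'o, 'm) ftor
      \<Rightarrow> (('o, 'm, 'u) ppsh, 'o \<Rightarrow> 'u \<Rightarrow> 'u, ('c, 'k, 'u) ppsh, 'c \<Rightarrow> 'u \<Rightarrow> 'u) ftor" where
  "restrict_ftor C F = \<lparr>fobj = restrict_psh F, fmap = (\<lambda>P Q \<alpha>. \<lambda>c\<in>obj C. \<alpha> (fobj F c))\<rparr>"

text \<open>The pointed representable \<open>C(-, c)\<^sub>+\<close>; the base-point is \<open>None\<close>.\<close>

definition rep_plus :: "('o, 'm) cat \<Rightarrow> 'o \<Rightarrow> ('o, 'm, 'm option) ppsh" where
  "rep_plus C c = \<lparr>el = (\<lambda>a. insert None (Some ` hom C a c)), pt = (\<lambda>a. None),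
     act = (\<lambda>a b f. map_option (\<lambda>g. cmp C a b c g f))\<rparr>"

text \<open>
  The quotient of \<open>P\<close> that collapses the sub-presheaf \<open>A\<close> (adjoined the base-point) to the
  base-point, and the quotient map on elements.
\<close>

definition quot_el :: "('o, 'm, 'h) ppsh \<Rightarrow> ('o \<Rightarrow> 'h set) \<Rightarrow> 'o \<Rightarrow> 'h \<Rightarrow> 'h" where
  "quot_el P A a x = (if x \<in> A a then pt P a else x)"

definition collapse :: "('o, 'm, 'h) ppsh \<Rightarrow> ('o \<Rightarrow> 'h set) \<Rightarrow> ('o, 'm, 'h) ppsh" where
  "collapse P A = \<lparr>el = (\<lambda>a. quot_el P A a ` el P a), pt = pt P,
     act = (\<lambda>a b f x. quot_el P A a (act P a b f x))\<rparr>"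

text \<open>
  Transport to the universe. Hom-sets, quotients etc. are first formed with values in some other
  type and then replaced by an isomorphic copy inside \<open>'u\<close>. Every set to which this is applied
  below has cardinality at most that of the infinite type \<open>'u\<close>, so the injection exists.
\<close>

definition enc :: "'h set \<Rightarrow> 'h \<Rightarrow> 'u" where
  "enc A = (SOME e. inj_on e A)"

definition dec :: "'h set \<Rightarrow> 'u \<Rightarrow> 'h" where
  "dec A = inv_into A (enc A)"

definition small :: "('o, 'm, 'h) ppsh \<Rightarrow> ('o, 'm, 'u) ppsh" where
  "small P = \<lparr>el = (\<lambda>a. enc (el P a) ` el P a), pt = (\<lambda>a. enc (el P a) (pt P a)),
     act = (\<lambda>a b f u. enc (el P a) (act P a b f (dec (el P b) u)))\<rparr>"

definition small_map ::
    "('o, 'm) cat \<Rightarrow> ('o, 'm, 'h) ppsh \<Rightarrow> ('o, 'm, 'k) ppsh \<Rightarrow> ('o \<Rightarrow> 'h \<Rightarrow> 'k)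
      \<Rightarrow> 'o \<Rightarrow> 'u \<Rightarrow> 'u" where
  "small_map C P Q \<alpha> =
     (\<lambda>a\<in>obj C. \<lambda>u\<in>enc (el P a) ` el P a. enc (el Q a) (\<alpha> a (dec (el P a) u)))"


section \<open>The simplex category and the functor \<open>K\<close>\<close>

text \<open>The object \<open>[n]\<close> is the number \<open>n\<close>; a map \<open>[n] \<rightarrow> [m]\<close> is extensional on \<open>{..n}\<close>.\<close>

definition smp :: "(nat, nat \<Rightarrow> nat) cat" where
  "smp = \<lparr>obj = UNIV, hom = (\<lambda>n m. {f \<in> {..n} \<rightarrow>\<^sub>E {..m}. mono_on {..n} f}),
          ide = (\<lambda>n. \<lambda>x\<in>{..n}. x), cmp = (\<lambda>n m p g f. compose {..n} g f)\<rparr>"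

text \<open>\<open>coface n i\<close> is \<open>d\<^sup>i : [n] \<rightarrow> [n+1]\<close> and \<open>codegen n j\<close> is \<open>s\<^sup>j : [n+1] \<rightarrow> [n]\<close>.\<close>

definition coface :: "nat \<Rightarrow> nat \<Rightarrow> nat \<Rightarrow> nat" where
  "coface n i = (\<lambda>x\<in>{..n}. if x < i then x else Suc x)"

definition codegen :: "nat \<Rightarrow> nat \<Rightarrow> nat \<Rightarrow> nat" where
  "codegen n j = (\<lambda>x\<in>{..Suc n}. if x \<le> j then x else x - 1)"

definition Kmap :: "nat \<Rightarrow> nat \<Rightarrow> (nat \<Rightarrow> nat) \<Rightarrow> nat \<Rightarrow> nat" where
  "Kmap n m \<phi> = (\<lambda>x\<in>{..Suc n}. if x = Suc n then Suc m else \<phi> x)"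

fun Kpow :: "nat \<Rightarrow> nat \<Rightarrow> nat \<Rightarrow> (nat \<Rightarrow> nat) \<Rightarrow> nat \<Rightarrow> nat" where
  "Kpow 0 n m \<phi> = \<phi>"
| "Kpow (Suc j) n m \<phi> = Kmap (n + j) (m + j) (Kpow j n m \<phi>)"

text \<open>
  \<open>Kmap\<close> is the functor determined by \<open>d\<^sup>i \<mapsto> d\<^sup>i\<close> and \<open>s\<^sup>j \<mapsto> s\<^sup>j\<close>.
\<close>

lemma Kmap_coface: "i \<le> Suc n \<Longrightarrow> Kmap n (Suc n) (coface n i) = coface (Suc n) i"
  by (auto simp: Kmap_def coface_def fun_eq_iff)

lemma Kmap_codegen: "j \<le> n \<Longrightarrow> Kmap (Suc n) n (codegen n j) = codegen (Suc n) j"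
  by (auto simp: Kmap_def codegen_def fun_eq_iff)

lemma Kmap_hom: "\<phi> \<in> hom smp n m \<Longrightarrow> Kmap n m \<phi> \<in> hom smp (Suc n) (Suc m)"
  by (fastforce simp: smp_def Kmap_def mono_on_def PiE_iff Pi_iff le_Suc_eq)

lemma Kmap_ide: "Kmap n n (ide smp n) = ide smp (Suc n)"
  by (auto simp: smp_def Kmap_def fun_eq_iff)

lemma Kmap_cmp:
  "\<phi> \<in> hom smp n m \<Longrightarrow> \<psi> \<in> hom smp m p \<Longrightarrow>
     Kmap n p (cmp smp n m p \<psi> \<phi>)
       = cmp smp (Suc n) (Suc m) (Suc p) (Kmap m p \<psi>) (Kmap n m \<phi>)"
  by (auto simp: smp_def Kmap_def compose_def fun_eq_iff PiE_iff Pi_iff le_Suc_eq)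
    (metis Suc_n_not_le_n atMost_iff)+


section \<open>The index categories\<close>

text \<open>The pair \<open>(n, a)\<close> stands for the object \<open>([n], -a)\<close>.\<close>

definition coll :: "(nat \<times> nat, nat \<Rightarrow> nat) cat" where
  "coll = \<lparr>obj = UNIV,
     hom = (\<lambda>(n, a) (l, b). if b \<le> a then hom smp n (l + (a - b)) else {}),
     ide = (\<lambda>(n, a). ide smp n),
     cmp = (\<lambda>(n, a) (l, b) (p, c) \<phi> \<psi>.
       cmp smp n (l + (a - b)) (p + (b - c) + (a - b)) (Kpow (a - b) l (p + (b - c)) \<phi>) \<psi>)\<rparr>"

text \<open>
  Words are written in the order of composition: \<open>[g\<^sub>1, \<dots>, g\<^sub>r]\<close> is \<open>g\<^sub>1 \<circ> \<dots> \<circ> g\<^sub>r\<close>.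
\<close>

datatype gen = Face nat | Degen nat

fun gdeg :: "gen \<Rightarrow> int" where
  "gdeg (Face i) = 1"
| "gdeg (Degen j) = -1"

definition wdeg :: "gen list \<Rightarrow> int" where
  "wdeg w = sum_list (map gdeg w)"

inductive cosimp_eq :: "gen list \<Rightarrow> gen list \<Rightarrow> bool" where
  face_face:    "i < j \<Longrightarrow> cosimp_eq [Face j, Face i] [Face i, Face (j - 1)]"
| degen_degen:  "i \<le> j \<Longrightarrow> cosimp_eq [Degen j, Degen i] [Degen i, Degen (j + 1)]"
| degen_face_lt: "i < j \<Longrightarrow> cosimp_eq [Degen j, Face i] [Face i, Degen (j - 1)]"
| degen_face_id: "i = j \<or> i = j + 1 \<Longrightarrow> cosimp_eq [Degen j, Face i] []"
| degen_face_gt: "i > j + 1 \<Longrightarrow> cosimp_eq [Degen j, Face i] [Face (i - 1), Degen j]"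
| refl:  "cosimp_eq w w"
| sym:   "cosimp_eq v w \<Longrightarrow> cosimp_eq w v"
| trans: "cosimp_eq u v \<Longrightarrow> cosimp_eq v w \<Longrightarrow> cosimp_eq u w"
| cong:  "cosimp_eq v w \<Longrightarrow> cosimp_eq (x @ v @ y) (x @ w @ y)"

definition wcls :: "gen list \<Rightarrow> gen list set" where
  "wcls w = {v. cosimp_eq w v}"

text \<open>
  The presented category: as every generator exists at every object, a path from \<open>[z]\<close> to \<open>[w]\<close>
  in the generating graph is the same as a word of degree \<open>w - z\<close>.
\<close>

definition stab :: "(int, gen list set) cat" where
  "stab = \<lparr>obj = UNIV, hom = (\<lambda>z w. {wcls u | u. wdeg u = w - z}), ide = (\<lambda>z. wcls []),
     cmp = (\<lambda>a b c g f. {w. \<exists>u\<in>g. \<exists>v\<in>f. cosimp_eq (u @ v) w})\<rparr>"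

text \<open>\<open>word_rep n m w \<phi>\<close>: the word \<open>w\<close> is composable in the simplex category, with value
  \<open>\<phi> : [n] \<rightarrow> [m]\<close>.\<close>

inductive word_rep :: "nat \<Rightarrow> nat \<Rightarrow> gen list \<Rightarrow> (nat \<Rightarrow> nat) \<Rightarrow> bool" where
  empty: "word_rep n n [] (ide smp n)"
| face:  "word_rep n m w \<phi> \<Longrightarrow> i \<le> Suc m \<Longrightarrow>
            word_rep n (Suc m) (Face i # w) (cmp smp n m (Suc m) (coface m i) \<phi>)"
| degen: "word_rep n (Suc m) w \<phi> \<Longrightarrow> j \<le> m \<Longrightarrow>
            word_rep n m (Degen j # w) (cmp smp n (Suc m) m (codegen m j) \<phi>)"

definition stab_word :: "nat \<Rightarrow> nat \<Rightarrow> (nat \<Rightarrow> nat) \<Rightarrow> gen list set" where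
  "stab_word n m \<phi> = {v. \<exists>w. word_rep n m w \<phi> \<and> cosimp_eq w v}"

definition rho :: "(nat \<times> nat, nat \<Rightarrow> nat, int, gen list set) ftor" where
  "rho = \<lparr>fobj = (\<lambda>(n, a). int n - int a),
          fmap = (\<lambda>(n, a) (l, b) \<phi>. stab_word n (l + (a - b)) \<phi>)\<rparr>"

type_synonym 'u smp_psh = "(nat, nat \<Rightarrow> nat, 'u) ppsh"
type_synonym 'u smp_mor = "nat \<Rightarrow> 'u \<Rightarrow> 'u"
type_synonym 'u coll_psh = "(nat \<times> nat, nat \<Rightarrow> nat, 'u) ppsh"
type_synonym 'u coll_mor = "nat \<times> nat \<Rightarrow> 'u \<Rightarrow> 'u"
type_synonym 'u stab_psh = "(int, gen list set, 'u) ppsh"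
type_synonym 'u stab_mor = "int \<Rightarrow> 'u \<Rightarrow> 'u"

text \<open>
  A left adjoint is determined up to isomorphism only; \<open>left_adjoint\<close> picks one. One exists because
  the index categories are countable and \<open>'u\<close> is infinite, so that left Kan extensions exist.
\<close>

definition rho_shriek :: "('u coll_psh, 'u coll_mor, 'u stab_psh, 'u stab_mor) ftor" where
  "rho_shriek = left_adjoint (psh coll) (psh stab) (restrict_ftor coll rho)"


section \<open>Kan suspension\<close>

text \<open>
  \<open>bd n\<close> is the part of \<open>\<triangle>[n+1]\<close> collapsed in \<open>cof n\<close>, the pointed simplicial set
  \<open>\<triangle>[n+1]\<^sub>+ / (\<triangle>[n]\<^sub>+ \<or> \<triangle>[0]\<^sub>+)\<close>. It is functorial in \<open>[n]\<close> through \<open>K\<close>.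
\<close>

definition bd :: "nat \<Rightarrow> nat \<Rightarrow> (nat \<Rightarrow> nat) option set" where
  "bd n p = {Some (cmp smp p n (Suc n) (coface n (Suc n)) h) | h. h \<in> hom smp p n} \<union>
            {Some (cmp smp p 0 (Suc n) (\<lambda>x\<in>{..0}. Suc n) h) | h. h \<in> hom smp p 0}"

definition cof :: "nat \<Rightarrow> (nat \<Rightarrow> nat) option smp_psh" where
  "cof n = collapse (rep_plus smp (Suc n)) (bd n)"

definition cof_map ::
    "nat \<Rightarrow> nat \<Rightarrow> (nat \<Rightarrow> nat) \<Rightarrow> nat \<Rightarrow> (nat \<Rightarrow> nat) option \<Rightarrow> (nat \<Rightarrow> nat) option" where
  "cof_map n m \<phi> p y = quot_el (rep_plus smp (Suc m)) (bd m) p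
     (map_option (\<lambda>g. cmp smp p (Suc n) (Suc m) (Kmap n m \<phi>) g) y)"

text \<open>
  The colimit-preserving extension of \<open>[n] \<mapsto> cof n\<close> is the coend of the pointed simplicial sets
  \<open>X\<^sub>n \<and> cof n\<close>. In degree \<open>p\<close>, \<open>Some (n, x, y)\<close> stands for the element \<open>x \<and> y\<close> of the \<open>n\<close>-th
  summand and \<open>None\<close> for the base-point.
\<close>

type_synonym 'u susp_term = "(nat \<times> 'u \<times> (nat \<Rightarrow> nat) option) option"

definition susp_terms :: "'u smp_psh \<Rightarrow> nat \<Rightarrow> 'u susp_term set" where
  "susp_terms X p = insert None {Some (n, x, y) | n x y. x \<in> el X n \<and> y \<in> el (cof n) p}"

definition susp_gen :: "'u smp_psh \<Rightarrow> nat \<Rightarrow> ('u susp_term \<times> 'u susp_term) set" where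
  "susp_gen X p =
     {(Some (n, pt X n, y), None) | n y. y \<in> el (cof n) p} \<union>
     {(Some (n, x, pt (cof n) p), None) | n x. x \<in> el X n} \<union>
     {(Some (n, act X n m \<phi> x, y), Some (m, x, cof_map n m \<phi> p y)) | n m \<phi> x y.
        \<phi> \<in> hom smp n m \<and> x \<in> el X m \<and> y \<in> el (cof n) p}"

definition susp_eq :: "'u smp_psh \<Rightarrow> nat \<Rightarrow> ('u susp_term \<times> 'u susp_term) set" where
  "susp_eq X p = (susp_gen X p \<union> (susp_gen X p)\<inverse>)\<^sup>*"

fun susp_term_act :: "nat \<Rightarrow> nat \<Rightarrow> (nat \<Rightarrow> nat) \<Rightarrow> 'u susp_term \<Rightarrow> 'u susp_term" where
  "susp_term_act p q \<theta> None = None"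
| "susp_term_act p q \<theta> (Some (n, x, y)) = Some (n, x, act (cof n) p q \<theta> y)"

fun susp_term_map :: "'u smp_mor \<Rightarrow> 'u susp_term \<Rightarrow> 'u susp_term" where
  "susp_term_map \<alpha> None = None"
| "susp_term_map \<alpha> (Some (n, x, y)) = Some (n, \<alpha> n x, y)"

definition susp_raw :: "'u smp_psh \<Rightarrow> 'u susp_term set smp_psh" where
  "susp_raw X = \<lparr>el = (\<lambda>p. susp_terms X p // susp_eq X p), pt = (\<lambda>p. susp_eq X p `` {None}),
     act = (\<lambda>p q \<theta> c. susp_eq X p `` (susp_term_act p q \<theta> ` c))\<rparr>"

definition susp :: "'u smp_psh \<Rightarrow> 'u smp_psh" where
  "susp X = small (susp_raw X)"

definition susp_map :: "'u smp_psh \<Rightarrow> 'u smp_psh \<Rightarrow> 'u smp_mor \<Rightarrow> 'u smp_mor" where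
  "susp_map X Y \<alpha> = small_map smp (susp_raw X) (susp_raw Y)
     (\<lambda>p c. susp_eq Y p `` (susp_term_map \<alpha> ` c))"

fun susp_pow :: "nat \<Rightarrow> 'u smp_psh \<Rightarrow> 'u smp_psh" where
  "susp_pow 0 X = X"
| "susp_pow (Suc j) X = susp (susp_pow j X)"

fun susp_pow_map :: "nat \<Rightarrow> 'u smp_psh \<Rightarrow> 'u smp_psh \<Rightarrow> 'u smp_mor \<Rightarrow> 'u smp_mor" where
  "susp_pow_map 0 X Y \<alpha> = \<alpha>"
| "susp_pow_map (Suc j) X Y \<alpha> =
     susp_map (susp_pow j X) (susp_pow j Y) (susp_pow_map j X Y \<alpha>)"

definition simplex :: "nat \<Rightarrow> 'u smp_psh" where
  "simplex n = small (rep_plus smp n)"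

definition simplex_map :: "nat \<Rightarrow> nat \<Rightarrow> (nat \<Rightarrow> nat) \<Rightarrow> 'u smp_mor" where
  "simplex_map n m \<phi> = small_map smp (rep_plus smp n) (rep_plus smp m)
     (\<lambda>p. map_option (\<lambda>g. cmp smp p n m \<phi> g))"

text \<open>
  The quotient map from \<open>simplex (n + 1)\<close> to \<open>susp (simplex n)\<close>, which sends \<open>y\<close> to the class of
  \<open>id \<and> y\<close>, and its iterate from \<open>simplex (n + k)\<close> to \<open>susp_pow k (simplex n)\<close>.
\<close>

definition susp_quot :: "nat \<Rightarrow> 'u smp_mor" where
  "susp_quot n = small_map smp (rep_plus smp (Suc n)) (susp_raw (simplex n :: 'u smp_psh))
     (\<lambda>p y. susp_eq (simplex n) p ``
        {Some (n, enc (el (rep_plus smp n) n) (Some (ide smp n)),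
               quot_el (rep_plus smp (Suc n)) (bd n) p y)})"

fun susp_quot_pow :: "nat \<Rightarrow> nat \<Rightarrow> 'u smp_mor" where
  "susp_quot_pow 0 n = psh_id smp (simplex n)"
| "susp_quot_pow (Suc k) n = psh_comp smp (simplex (n + Suc k))
     (susp_map (simplex (n + k)) (susp_pow k (simplex n)) (susp_quot_pow k n))
     (susp_quot (n + k))"


section \<open>Spectrum objects\<close>

text \<open>
  The oplax limit, with the structure maps given in the adjoint form \<open>\<Sigma>\<^sub>K (lev Y i) \<rightarrow> lev Y (i+1)\<close>;
  \<open>lev Y i\<close> is the term of index \<open>-i\<close>.
\<close>

record 'u spectrum =
  lev :: "nat \<Rightarrow> 'u smp_psh"
  bond :: "nat \<Rightarrow> 'u smp_mor"

type_synonym 'u spec_mor = "nat \<Rightarrow> 'u smp_mor"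

definition spec_hom :: "'u spectrum \<Rightarrow> 'u spectrum \<Rightarrow> 'u spec_mor set" where
  "spec_hom Y Y' = {f. \<forall>i. f i \<in> psh_hom smp (lev Y i) (lev Y' i) \<and>
     psh_comp smp (susp (lev Y i)) (f (Suc i)) (bond Y i)
       = psh_comp smp (susp (lev Y i)) (bond Y' i) (susp_map (lev Y i) (lev Y' i) (f i))}"

definition spec_comp :: "'u spectrum \<Rightarrow> 'u spec_mor \<Rightarrow> 'u spec_mor \<Rightarrow> 'u spec_mor" where
  "spec_comp Y g f = (\<lambda>i. psh_comp smp (lev Y i) (g i) (f i))"

definition spec_zero :: "'u spectrum \<Rightarrow> 'u spectrum \<Rightarrow> 'u spec_mor" where
  "spec_zero Y Y' = (\<lambda>i. psh_zero smp (lev Y i) (lev Y' i))"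

definition oplaxlim :: "('u spectrum, 'u spec_mor) cat" where
  "oplaxlim = \<lparr>obj = {Y. \<forall>i. pointed_presheaf smp (lev Y i) \<and>
                           bond Y i \<in> psh_hom smp (susp (lev Y i)) (lev Y (Suc i))},
     hom = spec_hom, ide = (\<lambda>Y i. psh_id smp (lev Y i)), cmp = (\<lambda>Y Y' Y'' g f. spec_comp Y g f)\<rparr>"

definition point_raw :: "unit smp_psh" where
  "point_raw = \<lparr>el = (\<lambda>n. {()}), pt = (\<lambda>n. ()), act = (\<lambda>n m \<phi> x. ())\<rparr>"

definition point :: "'u smp_psh" where
  "point = small point_raw"

fun Phi_obj :: "nat \<times> nat \<Rightarrow> 'u spectrum" where
  "Phi_obj (n, k) = \<lparr>
     lev = (\<lambda>i. if i < k then point else susp_pow (i - k) (simplex n)),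
     bond = (\<lambda>i. if i < k
       then psh_zero smp (susp point) (if Suc i < k then point else simplex n)
       else psh_id smp (susp_pow (Suc i - k) (simplex n)))\<rparr>"

fun Phi_map :: "nat \<times> nat \<Rightarrow> nat \<times> nat \<Rightarrow> (nat \<Rightarrow> nat) \<Rightarrow> 'u spec_mor" where
  "Phi_map (n, a) (l, b) \<phi> = (\<lambda>i. if i < a
     then psh_zero smp point (lev (Phi_obj (l, b)) i)
     else susp_pow_map (i - a) (simplex n) (susp_pow (a - b) (simplex l))
       (psh_comp smp (simplex n) (susp_quot_pow (a - b) l) (simplex_map n (l + (a - b)) \<phi>)))"

definition Phi :: "(nat \<times> nat, nat \<Rightarrow> nat, 'u spectrum, 'u spec_mor) ftor" where
  "Phi = \<lparr>fobj = Phi_obj, fmap = Phi_map\<rparr>"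

definition Phi_star_raw :: "'u spectrum \<Rightarrow> 'u spec_mor coll_psh" where
  "Phi_star_raw Y = \<lparr>el = (\<lambda>c. spec_hom (fobj Phi c) Y), pt = (\<lambda>c. spec_zero (fobj Phi c) Y),
     act = (\<lambda>c c' \<phi> h. spec_comp (fobj Phi c) h (fmap Phi c c' \<phi>))\<rparr>"

definition Phi_star :: "('u spectrum, 'u spec_mor, 'u coll_psh, 'u coll_mor) ftor" where
  "Phi_star = \<lparr>fobj = (\<lambda>Y. small (Phi_star_raw Y)),
     fmap = (\<lambda>Y Y' f. small_map coll (Phi_star_raw Y) (Phi_star_raw Y')
       (\<lambda>c h. spec_comp (fobj Phi c) f h))\<rparr>"


section \<open>Spherical objects\<close>

text \<open>\<open>sph n z\<close> is the spherical object \<open>S^(z-n)[n]\<close>, a quotient of \<open>\<triangle>\<^sub>s\<^sub>t[z]\<^sub>+\<close>.\<close>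

definition sph_bd :: "nat \<Rightarrow> int \<Rightarrow> int \<Rightarrow> gen list set option set" where
  "sph_bd n z w =
     {Some (cmp stab w (z - 1) z (wcls [Face (n + i)]) h) | i h. 1 \<le> i \<and> h \<in> hom stab w (z - 1)} \<union>
     {Some (cmp stab w (z - int (n + 1)) z (wcls (map Face (rev [0..<n + 1]))) h) | h.
        h \<in> hom stab w (z - int (n + 1))}"

definition sph_raw :: "nat \<Rightarrow> int \<Rightarrow> gen list set option stab_psh" where
  "sph_raw n z = collapse (rep_plus stab z) (sph_bd n z)"

definition sph :: "nat \<Rightarrow> int \<Rightarrow> 'u stab_psh" where
  "sph n z = small (sph_raw n z)"

text \<open>
  The map of spherical objects induced by a map \<open>\<gamma> : [z] \<rightarrow> [z']\<close> that respects the collapsed parts.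
\<close>

definition sph_map :: "nat \<Rightarrow> int \<Rightarrow> nat \<Rightarrow> int \<Rightarrow> gen list set \<Rightarrow> 'u stab_mor" where
  "sph_map n z n' z' \<gamma> = small_map stab (sph_raw n z) (sph_raw n' z')
     (\<lambda>w y. quot_el (rep_plus stab z') (sph_bd n' z') w
        (map_option (\<lambda>g. cmp stab w z z' \<gamma> g) y))"

text \<open>Colimits are those of small diagrams, that is, diagrams indexed by a category in \<open>'u\<close>.\<close>

definition LocSph :: "('u stab_psh, 'u stab_mor) cat" where
  "LocSph = full_subcat (psh stab)
     {Z. \<exists>(J :: ('u, 'u) cat) F \<iota>. (\<forall>j\<in>obj J. \<exists>n z. fobj F j = sph n z) \<and>
          is_colimit J (psh stab) F Z \<iota>}"


section \<open>The functors \<open>KSp\<close> and \<open>KPs\<close>\<close>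

definition KSp :: "('u spectrum, 'u spec_mor, 'u stab_psh, 'u stab_mor) ftor" where
  "KSp = comp_ftor rho_shriek Phi_star"

text \<open>
  \<open>KPs_raw Z i\<close> is the pointed simplicial set of index \<open>-i\<close>, with \<open>n\<close>-simplices the maps
  \<open>S^(-i)[n] \<rightarrow> Z\<close>; a simplicial operator \<open>\<phi> : [n] \<rightarrow> [m]\<close> acts through \<open>\<rho>(\<phi>)\<close>.
\<close>

definition KPs_raw :: "'u stab_psh \<Rightarrow> nat \<Rightarrow> 'u stab_mor smp_psh" where
  "KPs_raw Z i = \<lparr>el = (\<lambda>n. psh_hom stab (sph n (int n - int i)) Z),
     pt = (\<lambda>n. psh_zero stab (sph n (int n - int i)) Z),
     act = (\<lambda>n m \<phi> h. psh_comp stab (sph n (int n - int i)) h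
       (sph_map n (int n - int i) m (int m - int i) (fmap rho (n, i) (m, i) \<phi>)))\<rparr>"

text \<open>
  The structure map is the transpose of the map from the \<open>n\<close>-simplices of index \<open>-i\<close> to the
  \<open>(n+1)\<close>-simplices of index \<open>-(i+1)\<close> given by precomposition with the quotient map
  \<open>S^(-(i+1))[n+1] \<rightarrow> S^(-i)[n]\<close>; both objects are quotients of \<open>\<triangle>\<^sub>s\<^sub>t[n-i]\<^sub>+\<close>.
\<close>

definition KPs_shift :: "'u stab_psh \<Rightarrow> nat \<Rightarrow> nat \<Rightarrow> 'u \<Rightarrow> 'u stab_mor" where
  "KPs_shift Z i n x = psh_comp stab (sph (Suc n) (int n - int i))
     (dec (el (KPs_raw Z i) n) x)
     (sph_map (Suc n) (int n - int i) n (int n - int i) (ide stab (int n - int i)))"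

fun KPs_bond_term :: "'u stab_psh \<Rightarrow> nat \<Rightarrow> nat \<Rightarrow> 'u susp_term \<Rightarrow> 'u stab_mor" where
  "KPs_bond_term Z i p None = pt (KPs_raw Z (Suc i)) p"
| "KPs_bond_term Z i p (Some (n, x, None)) = pt (KPs_raw Z (Suc i)) p"
| "KPs_bond_term Z i p (Some (n, x, Some g)) =
     act (KPs_raw Z (Suc i)) p (Suc n) g (KPs_shift Z i n x)"

text \<open>\<open>KPs_bond_term\<close> is constant on classes, whence \<open>the_elem\<close>.\<close>

definition KPs_obj :: "'u stab_psh \<Rightarrow> 'u spectrum" where
  "KPs_obj Z = \<lparr>lev = (\<lambda>i. small (KPs_raw Z i)),
     bond = (\<lambda>i. small_map smp (susp_raw (small (KPs_raw Z i))) (KPs_raw Z (Suc i))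
       (\<lambda>p c. the_elem (KPs_bond_term Z i p ` c)))\<rparr>"

definition KPs :: "('u stab_psh, 'u stab_mor, 'u spectrum, 'u spec_mor) ftor" where
  "KPs = \<lparr>fobj = KPs_obj,
     fmap = (\<lambda>Z Z' f i. small_map smp (KPs_raw Z i) (KPs_raw Z' i)
       (\<lambda>n h. psh_comp stab (sph n (int n - int i)) f h))\<rparr>"

end

theory Submission
  imports Defs "HOL-Library.Countable_Set"
begin

text \<open>
  A morphism of \<open>stab\<close> is a monotone self-map of the natural numbers that is eventually a translation,
  and in high enough dimension each of them is in the image of \<open>\<rho>\<close>. Call an element of \<open>Z\<close> over \<open>[z]\<close>
  \<open>n\<close>-spherical if it is classified by a map \<open>S^(z-n)[n] \<rightarrow> Z\<close>. An \<open>n\<close>-spherical element is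
  \<open>(n+1)\<close>-spherical, and \<open>Z\<close> is a colimit of spherical objects iff each of its elements is \<open>n\<close>-spherical
  for some \<open>n\<close>. As the \<open>n\<close>-simplices of \<open>KPs Z\<close> of index \<open>-i\<close> are the \<open>n\<close>-spherical elements over \<open>[n-i]\<close>, a
  map \<open>KPs Z \<rightarrow> KPs Z'\<close> is a compatible family of partial maps, which glue to a map \<open>Z \<rightarrow> Z'\<close> when \<open>Z\<close> is
  such a colimit. Thus \<open>KPs\<close> is full and faithful, and the co-unit of any adjunction is invertible.
  The adjunction exists because the relations that hold for the shift maps of a spectrum object \<open>Y\<close> force
  every map \<open>\<Phi>\<^sup>* Y \<rightarrow> \<rho>\<^sup>* Z\<close> to take spherical values. Applied to the unit \<open>\<Phi>\<^sup>* Y \<rightarrow> \<rho>\<^sup>* \<rho>\<^sub>! \<Phi>\<^sup>* Y\<close>, this also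
  shows that \<open>\<rho>\<^sub>! \<Phi>\<^sup>* Y\<close> is a retract of its spherical part.
\<close>

section \<open>Categories and adjunctions\<close>

text \<open>Why shift maps produce spherical values: an n-simplex of the Kan loop object of W is an
  (n+1)-simplex of W with trivial last face and trivial last vertex. Stably, the last face is
  d^(n+1), the vertex n+1 is d^n ... d^0, and after j further shifts the last face is d^(n+1+j).
  These are exactly the maps collapsed in a spherical object. Two obstacles shape the proof. Words
  modulo the cosimplicial identities are awkward to compare, so completeness of normal forms
  replaces them by functions; the twist by K^j in \<open>coll\<close> then disappears, since \<phi>
  and K^j \<phi> extend to the same function. And hom-sets are transported to the universe by a
  choice operator, which is harmless only where an injection exists; hom-sets of spectra and those
  out of spherical objects are bounded by evaluation at a fundamental simplex or element. The same
  evaluations reduce identities between morphisms to identities between elements. The retract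
  argument spares a computation of the left Kan extension along \<rho>: only its universal property
  enters.\<close>

lemma cat_ide: "category C \<Longrightarrow> a \<in> obj C \<Longrightarrow> ide C a \<in> hom C a a"
  by (simp add: category_def)

lemma cat_cmp:
  "category C \<Longrightarrow> f \<in> hom C a b \<Longrightarrow> g \<in> hom C b c \<Longrightarrow> a \<in> obj C \<Longrightarrow> b \<in> obj C \<Longrightarrow> c \<in> obj C \<Longrightarrow>
    cmp C a b c g f \<in> hom C a c"
  by (simp add: category_def)

lemma cat_idr:
  "category C \<Longrightarrow> f \<in> hom C a b \<Longrightarrow> a \<in> obj C \<Longrightarrow> b \<in> obj C \<Longrightarrow> cmp C a a b f (ide C a) = f"
  by (simp add: category_def)

lemma cat_idl:
  "category C \<Longrightarrow> f \<in> hom C a b \<Longrightarrow> a \<in> obj C \<Longrightarrow> b \<in> obj C \<Longrightarrow> cmp C a b b (ide C b) f = f"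
  by (simp add: category_def)

lemma cat_assoc:
  "category C \<Longrightarrow> f \<in> hom C a b \<Longrightarrow> g \<in> hom C b c \<Longrightarrow> h \<in> hom C c d \<Longrightarrow>
    a \<in> obj C \<Longrightarrow> b \<in> obj C \<Longrightarrow> c \<in> obj C \<Longrightarrow> d \<in> obj C \<Longrightarrow>
    cmp C a b d (cmp C b c d h g) f = cmp C a c d h (cmp C a b c g f)"
  by (simp add: category_def)

lemma fun_cat: "is_functor C D F \<Longrightarrow> category C" "is_functor C D F \<Longrightarrow> category D"
  by (simp_all add: is_functor_def)

lemma fun_obj: "is_functor C D F \<Longrightarrow> a \<in> obj C \<Longrightarrow> fobj F a \<in> obj D"
  by (simp add: is_functor_def)

lemma fun_hom:
  "is_functor C D F \<Longrightarrow> f \<in> hom C a b \<Longrightarrow> a \<in> obj C \<Longrightarrow> b \<in> obj C \<Longrightarrow>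
    fmap F a b f \<in> hom D (fobj F a) (fobj F b)"
  by (simp add: is_functor_def)

lemma fun_ide:
  "is_functor C D F \<Longrightarrow> a \<in> obj C \<Longrightarrow> fmap F a a (ide C a) = ide D (fobj F a)"
  by (simp add: is_functor_def)

lemma fun_cmp:
  "is_functor C D F \<Longrightarrow> f \<in> hom C a b \<Longrightarrow> g \<in> hom C b c \<Longrightarrow>
    a \<in> obj C \<Longrightarrow> b \<in> obj C \<Longrightarrow> c \<in> obj C \<Longrightarrow>
    fmap F a c (cmp C a b c g f)
      = cmp D (fobj F a) (fobj F b) (fobj F c) (fmap F b c g) (fmap F a b f)"
  by (simp add: is_functor_def)

lemma id_functor: "category C \<Longrightarrow> is_functor C C id_ftor"
  by (simp add: is_functor_def id_ftor_def)

lemma comp_functor: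
  assumes "is_functor C D F" "is_functor D E G"
  shows "is_functor C E (comp_ftor G F)"
  using assms unfolding is_functor_def comp_ftor_def by simp

lemma category_full_subcat: "category C \<Longrightarrow> category (full_subcat C A)"
  unfolding category_def full_subcat_def by simp

section \<open>Adjunctions: universal arrows, restriction to full subcategories, invertible
  co-units\<close>

lemma adjunctionD:
  assumes "adjunction C D F G \<eta> \<epsilon>"
  shows "is_functor C D F" "is_functor D C G"
    and "c \<in> obj C \<Longrightarrow> \<eta> c \<in> hom C c (fobj G (fobj F c))"
    and "d \<in> obj D \<Longrightarrow> \<epsilon> d \<in> hom D (fobj F (fobj G d)) d"
    and "c \<in> obj C \<Longrightarrow> c' \<in> obj C \<Longrightarrow> f \<in> hom C c c' \<Longrightarrow>
      cmp C c c' (fobj G (fobj F c')) (\<eta> c') f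
        = cmp C c (fobj G (fobj F c)) (fobj G (fobj F c'))
            (fmap G (fobj F c) (fobj F c') (fmap F c c' f)) (\<eta> c)"
    and "d \<in> obj D \<Longrightarrow> d' \<in> obj D \<Longrightarrow> g \<in> hom D d d' \<Longrightarrow>
      cmp D (fobj F (fobj G d)) (fobj F (fobj G d')) d' (\<epsilon> d')
          (fmap F (fobj G d) (fobj G d') (fmap G d d' g))
        = cmp D (fobj F (fobj G d)) d d' g (\<epsilon> d)"
    and "c \<in> obj C \<Longrightarrow> cmp D (fobj F c) (fobj F (fobj G (fobj F c))) (fobj F c)
          (\<epsilon> (fobj F c)) (fmap F c (fobj G (fobj F c)) (\<eta> c)) = ide D (fobj F c)"
    and "d \<in> obj D \<Longrightarrow> cmp C (fobj G d) (fobj G (fobj F (fobj G d))) (fobj G d)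
          (fmap G (fobj F (fobj G d)) d (\<epsilon> d)) (\<eta> (fobj G d)) = ide C (fobj G d)"
  using assms
  unfolding adjunction_def natural_transformation_def comp_ftor_def id_ftor_def
  by simp_all

lemma adjunctionI:
  assumes "is_functor C D F" "is_functor D C G"
    and "\<And>c. c \<in> obj C \<Longrightarrow> \<eta> c \<in> hom C c (fobj G (fobj F c))"
    and "\<And>d. d \<in> obj D \<Longrightarrow> \<epsilon> d \<in> hom D (fobj F (fobj G d)) d"
    and "\<And>c c' f. c \<in> obj C \<Longrightarrow> c' \<in> obj C \<Longrightarrow> f \<in> hom C c c' \<Longrightarrow>
      cmp C c c' (fobj G (fobj F c')) (\<eta> c') f
        = cmp C c (fobj G (fobj F c)) (fobj G (fobj F c'))
            (fmap G (fobj F c) (fobj F c') (fmap F c c' f)) (\<eta> c)"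
    and "\<And>d d' g. d \<in> obj D \<Longrightarrow> d' \<in> obj D \<Longrightarrow> g \<in> hom D d d' \<Longrightarrow>
      cmp D (fobj F (fobj G d)) (fobj F (fobj G d')) d' (\<epsilon> d')
          (fmap F (fobj G d) (fobj G d') (fmap G d d' g))
        = cmp D (fobj F (fobj G d)) d d' g (\<epsilon> d)"
    and "\<And>c. c \<in> obj C \<Longrightarrow> cmp D (fobj F c) (fobj F (fobj G (fobj F c))) (fobj F c)
          (\<epsilon> (fobj F c)) (fmap F c (fobj G (fobj F c)) (\<eta> c)) = ide D (fobj F c)"
    and "\<And>d. d \<in> obj D \<Longrightarrow> cmp C (fobj G d) (fobj G (fobj F (fobj G d))) (fobj G d)
          (fmap G (fobj F (fobj G d)) d (\<epsilon> d)) (\<eta> (fobj G d)) = ide C (fobj G d)"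
  shows "adjunction C D F G \<eta> \<epsilon>"
proof -
  have "is_functor C C (comp_ftor G F)" "is_functor D D (comp_ftor F G)"
    using assms(1,2) by (blast intro: comp_functor)+
  moreover have "is_functor C C id_ftor" "is_functor D D id_ftor"
    using assms(1,2) by (blast intro: id_functor fun_cat)+
  ultimately show ?thesis
    using assms unfolding adjunction_def natural_transformation_def
    by (simp add: comp_ftor_def id_ftor_def)
qed

text \<open>The preimage of \<open>f\<close> is \<open>\<epsilon> d\<close> after
  \<open>F f\<close>. The uniqueness half later identifies two endomorphisms of a value of the left
  adjoint by comparing them after the unit.\<close>

lemma adjunction_transpose_ex1:
  assumes adj: "adjunction C D F G \<eta> \<epsilon>" and c: "c \<in> obj C" and d: "d \<in> obj D"
    and f: "f \<in> hom C c (fobj G d)"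
  shows "\<exists>!h. h \<in> hom D (fobj F c) d \<and>
    cmp C c (fobj G (fobj F c)) (fobj G d) (fmap G (fobj F c) d h) (\<eta> c) = f"
proof -
  note A = adjunctionD[OF adj]
  have catC: "category C" and catD: "category D" using A(1) fun_cat by blast+
  have Fc: "fobj F c \<in> obj D" and Gd: "fobj G d \<in> obj C" and GFc: "fobj G (fobj F c) \<in> obj C"
    and FGd: "fobj F (fobj G d) \<in> obj D" and GFGd: "fobj G (fobj F (fobj G d)) \<in> obj C"
    and FGFc: "fobj F (fobj G (fobj F c)) \<in> obj D"
    using A(1,2) c d by (meson fun_obj)+
  note O = c d Fc Gd GFc FGd GFGd FGFc
  have Ff: "fmap F c (fobj G d) f \<in> hom D (fobj F c) (fobj F (fobj G d))"
    using A(1) f O by (blast intro: fun_hom)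
  have eta: "\<eta> c \<in> hom C c (fobj G (fobj F c))" and eps: "\<epsilon> d \<in> hom D (fobj F (fobj G d)) d"
    using A O by blast+
  show ?thesis
  proof (rule ex1I[where a = "cmp D (fobj F c) (fobj F (fobj G d)) d (\<epsilon> d) (fmap F c (fobj G d) f)"],
      intro conjI)
    let ?h = "cmp D (fobj F c) (fobj F (fobj G d)) d (\<epsilon> d) (fmap F c (fobj G d) f)"
    show "?h \<in> hom D (fobj F c) d" using catD Ff eps O by (blast intro: cat_cmp)
    have "fmap G (fobj F c) d ?h = cmp C (fobj G (fobj F c)) (fobj G (fobj F (fobj G d))) (fobj G d)
        (fmap G (fobj F (fobj G d)) d (\<epsilon> d)) (fmap G (fobj F c) (fobj F (fobj G d)) (fmap F c (fobj G d) f))"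
      using A(2) Ff eps O by (blast intro: fun_cmp)
    hence "cmp C c (fobj G (fobj F c)) (fobj G d) (fmap G (fobj F c) d ?h) (\<eta> c)
      = cmp C c (fobj G (fobj F (fobj G d))) (fobj G d) (fmap G (fobj F (fobj G d)) d (\<epsilon> d))
         (cmp C c (fobj G (fobj F c)) (fobj G (fobj F (fobj G d)))
           (fmap G (fobj F c) (fobj F (fobj G d)) (fmap F c (fobj G d) f)) (\<eta> c))"
      using cat_assoc[OF catC eta fun_hom[OF A(2) Ff] fun_hom[OF A(2) eps]] O by simp
    also have "\<dots> = cmp C c (fobj G (fobj F (fobj G d))) (fobj G d) (fmap G (fobj F (fobj G d)) d (\<epsilon> d))
         (cmp C c (fobj G d) (fobj G (fobj F (fobj G d))) (\<eta> (fobj G d)) f)"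
      using A(5)[OF c Gd f] by simp
    also have "\<dots> = cmp C c (fobj G d) (fobj G d)
        (cmp C (fobj G d) (fobj G (fobj F (fobj G d))) (fobj G d)
          (fmap G (fobj F (fobj G d)) d (\<epsilon> d)) (\<eta> (fobj G d))) f"
      using cat_assoc[OF catC f A(3)[OF Gd] fun_hom[OF A(2) eps]] O by simp
    also have "\<dots> = f" using A(8)[OF d] cat_idl[OF catC f] O by simp
    finally show "cmp C c (fobj G (fobj F c)) (fobj G d) (fmap G (fobj F c) d ?h) (\<eta> c) = f" .
  next
    fix h assume h: "h \<in> hom D (fobj F c) d \<and>
        cmp C c (fobj G (fobj F c)) (fobj G d) (fmap G (fobj F c) d h) (\<eta> c) = f"
    hence h1: "h \<in> hom D (fobj F c) d"
      and h2: "f = cmp C c (fobj G (fobj F c)) (fobj G d) (fmap G (fobj F c) d h) (\<eta> c)" by auto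
    have Gh: "fmap G (fobj F c) d h \<in> hom C (fobj G (fobj F c)) (fobj G d)"
      using A(2) h1 O by (blast intro: fun_hom)
    have "fmap F c (fobj G d) f = cmp D (fobj F c) (fobj F (fobj G (fobj F c))) (fobj F (fobj G d))
       (fmap F (fobj G (fobj F c)) (fobj G d) (fmap G (fobj F c) d h)) (fmap F c (fobj G (fobj F c)) (\<eta> c))"
      unfolding h2 using A(1) eta Gh O by (blast intro: fun_cmp)
    hence "cmp D (fobj F c) (fobj F (fobj G d)) d (\<epsilon> d) (fmap F c (fobj G d) f)
      = cmp D (fobj F c) (fobj F (fobj G (fobj F c))) d
          (cmp D (fobj F (fobj G (fobj F c))) (fobj F (fobj G d)) d (\<epsilon> d)
             (fmap F (fobj G (fobj F c)) (fobj G d) (fmap G (fobj F c) d h)))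
          (fmap F c (fobj G (fobj F c)) (\<eta> c))"
      using cat_assoc[OF catD fun_hom[OF A(1) eta] fun_hom[OF A(1) Gh] eps] O by simp
    also have "\<dots> = cmp D (fobj F c) (fobj F (fobj G (fobj F c))) d
          (cmp D (fobj F (fobj G (fobj F c))) (fobj F c) d h (\<epsilon> (fobj F c)))
          (fmap F c (fobj G (fobj F c)) (\<eta> c))"
      using A(6)[OF Fc d h1] by simp
    also have "\<dots> = cmp D (fobj F c) (fobj F c) d h (ide D (fobj F c))"
      using cat_assoc[OF catD fun_hom[OF A(1) eta] A(4)[OF Fc] h1] O A(7)[OF c] by simp
    also have "\<dots> = h" using cat_idr[OF catD h1] O by simp
    finally show "h = cmp D (fobj F c) (fobj F (fobj G d)) d (\<epsilon> d) (fmap F c (fobj G d) f)" ..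
  qed
qed

text \<open>Needed because the Kan extension comes only as objects \<open>F0 c\<close> with a unit.
  The action of \<open>F\<close> on morphisms and the co-unit are then forced: both are transposes
  \<open>tr\<close>.\<close>

lemma left_adjoint_from_universal_arrows:
  assumes G: "is_functor D C G"
    and F0: "\<And>c. c \<in> obj C \<Longrightarrow> F0 c \<in> obj D"
    and eta: "\<And>c. c \<in> obj C \<Longrightarrow> \<eta> c \<in> hom C c (fobj G (F0 c))"
    and univ: "\<And>c d f. c \<in> obj C \<Longrightarrow> d \<in> obj D \<Longrightarrow> f \<in> hom C c (fobj G d) \<Longrightarrow>
      \<exists>!h. h \<in> hom D (F0 c) d \<and> cmp C c (fobj G (F0 c)) (fobj G d) (fmap G (F0 c) d h) (\<eta> c) = f"
  shows "\<exists>F \<eta> \<epsilon>. adjunction C D F G \<eta> \<epsilon>"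
proof -
  have catC: "category C" and catD: "category D" using G fun_cat by blast+
  define tr where "tr c d f = (THE h. h \<in> hom D (F0 c) d \<and>
     cmp C c (fobj G (F0 c)) (fobj G d) (fmap G (F0 c) d h) (\<eta> c) = f)" for c d f
  have tr: "tr c d f \<in> hom D (F0 c) d"
    "cmp C c (fobj G (F0 c)) (fobj G d) (fmap G (F0 c) d (tr c d f)) (\<eta> c) = f"
    if "c \<in> obj C" "d \<in> obj D" "f \<in> hom C c (fobj G d)" for c d f
    using theI'[OF univ[OF that]] unfolding tr_def by blast+
  \<comment> \<open>A map out of \<open>F0 c\<close> is determined by its composite with the unit.
    Functoriality, naturality of the co-unit and the first triangle identity are all checked through
    this.\<close>
  have un: "h = h'" if "c \<in> obj C" "d \<in> obj D" "h \<in> hom D (F0 c) d" "h' \<in> hom D (F0 c) d"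
    "cmp C c (fobj G (F0 c)) (fobj G d) (fmap G (F0 c) d h) (\<eta> c)
      = cmp C c (fobj G (F0 c)) (fobj G d) (fmap G (F0 c) d h') (\<eta> c)" for c d h h'
  proof -
    have "cmp C c (fobj G (F0 c)) (fobj G d) (fmap G (F0 c) d h) (\<eta> c) \<in> hom C c (fobj G d)"
      using that F0 eta G catC by (meson cat_cmp fun_hom fun_obj)
    from univ[OF that(1,2) this] that show ?thesis by metis
  qed
  have GO: "fobj G d \<in> obj C" if "d \<in> obj D" for d using G that by (rule fun_obj)
  have cc: "cmp C c c' (fobj G (F0 c')) (\<eta> c') f \<in> hom C c (fobj G (F0 c'))"
    if "c \<in> obj C" "c' \<in> obj C" "f \<in> hom C c c'" for c c' f
    using that eta catC F0 GO by (meson cat_cmp)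
  define F where "F = \<lparr>fobj = F0, fmap = (\<lambda>c c' f. tr c (F0 c') (cmp C c c' (fobj G (F0 c')) (\<eta> c') f))\<rparr>"
  have F_simps: "fobj F c = F0 c"
    "fmap F c c' f = tr c (F0 c') (cmp C c c' (fobj G (F0 c')) (\<eta> c') f)" for c c' f
    by (simp_all add: F_def)
  have Gcmp: "cmp C c (fobj G (F0 c)) (fobj G e) (fmap G (F0 c) e (cmp D (F0 c) d e k h)) (\<eta> c)
     = cmp C c (fobj G d) (fobj G e) (fmap G d e k)
         (cmp C c (fobj G (F0 c)) (fobj G d) (fmap G (F0 c) d h) (\<eta> c))"
    if "c \<in> obj C" "d \<in> obj D" "e \<in> obj D" "h \<in> hom D (F0 c) d" "k \<in> hom D d e" for c d e h k
    using that fun_cmp[OF G that(4,5)] F0 GO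
      cat_assoc[OF catC eta fun_hom[OF G that(4)] fun_hom[OF G that(5)]] by simp
  have Fmap: "fmap F c c' f \<in> hom D (F0 c) (F0 c')"
    "cmp C c (fobj G (F0 c)) (fobj G (F0 c')) (fmap G (F0 c) (F0 c') (fmap F c c' f)) (\<eta> c)
      = cmp C c c' (fobj G (F0 c')) (\<eta> c') f"
    if "c \<in> obj C" "c' \<in> obj C" "f \<in> hom C c c'" for c c' f
    using tr[OF that(1) F0[OF that(2)] cc[OF that]] by (simp_all add: F_simps)
  have Ff: "is_functor C D F"
    unfolding is_functor_def F_simps(1)
  proof (intro conjI ballI catC catD F0 Fmap(1); (assumption)?)
    fix a assume a: "a \<in> obj C"
    have "cmp C a a (fobj G (F0 a)) (\<eta> a) (ide C a) = \<eta> a"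
      using cat_idr[OF catC eta] a F0 GO by blast
    moreover have "cmp C a (fobj G (F0 a)) (fobj G (F0 a)) (fmap G (F0 a) (F0 a) (ide D (F0 a))) (\<eta> a) = \<eta> a"
      using fun_ide[OF G] cat_idl[OF catC eta] a F0 GO by simp
    ultimately show "fmap F a a (ide C a) = ide D (F0 a)"
      using un[OF a F0[OF a] Fmap(1) cat_ide] Fmap(2) a F0 cat_ide catC catD by metis
  next
    fix a b c f g assume H: "a \<in> obj C" "b \<in> obj C" "c \<in> obj C" "f \<in> hom C a b" "g \<in> hom C b c"
    let ?k = "cmp D (F0 a) (F0 b) (F0 c) (fmap F b c g) (fmap F a b f)"
    have k: "?k \<in> hom D (F0 a) (F0 c)"
      using H by (intro cat_cmp[OF catD] Fmap F0)
    have gf: "cmp C a b c g f \<in> hom C a c" using H catC by (meson cat_cmp)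
    have "cmp C a (fobj G (F0 a)) (fobj G (F0 c)) (fmap G (F0 a) (F0 c) ?k) (\<eta> a)
      = cmp C a (fobj G (F0 b)) (fobj G (F0 c)) (fmap G (F0 b) (F0 c) (fmap F b c g))
          (cmp C a b (fobj G (F0 b)) (\<eta> b) f)"
      using Gcmp[OF H(1) F0[OF H(2)] F0[OF H(3)] Fmap(1) Fmap(1)] H Fmap(2) by simp
    also have "\<dots> = cmp C a b (fobj G (F0 c)) (cmp C b c (fobj G (F0 c)) (\<eta> c) g) f"
      using cat_assoc[OF catC H(4) eta fun_hom[OF G Fmap(1)]] H F0 GO Fmap(2) by metis
    also have "\<dots> = cmp C a c (fobj G (F0 c)) (\<eta> c) (cmp C a b c g f)"
      using cat_assoc[OF catC H(4,5) eta] H F0 GO by metis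
    finally show "fmap F a c (cmp C a b c g f) = ?k"
      using un[OF H(1) F0[OF H(3)] Fmap(1)[OF H(1,3) gf] k] Fmap(2)[OF H(1,3) gf] by simp
  qed
  define \<epsilon> where "\<epsilon> d = tr (fobj G d) d (ide C (fobj G d))" for d
  have eps: "\<epsilon> d \<in> hom D (F0 (fobj G d)) d"
    "cmp C (fobj G d) (fobj G (F0 (fobj G d))) (fobj G d) (fmap G (F0 (fobj G d)) d (\<epsilon> d)) (\<eta> (fobj G d))
      = ide C (fobj G d)" if "d \<in> obj D" for d
    using tr[OF GO[OF that] that cat_ide[OF catC GO[OF that]]] by (simp_all add: \<epsilon>_def)
  have "adjunction C D F G \<eta> \<epsilon>"
  proof (rule adjunctionI[OF Ff G]; (unfold F_simps(1))?)
    fix c assume "c \<in> obj C" thus "\<eta> c \<in> hom C c (fobj G (F0 c))" by (rule eta)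
  next
    fix d assume "d \<in> obj D" thus "\<epsilon> d \<in> hom D (F0 (fobj G d)) d" by (rule eps)
  next
    fix c c' f assume "c \<in> obj C" "c' \<in> obj C" "f \<in> hom C c c'"
    thus "cmp C c c' (fobj G (F0 c')) (\<eta> c') f
      = cmp C c (fobj G (F0 c)) (fobj G (F0 c')) (fmap G (F0 c) (F0 c') (fmap F c c' f)) (\<eta> c)"
      using Fmap(2) by simp
  next
    fix d d' g assume H: "d \<in> obj D" "d' \<in> obj D" "g \<in> hom D d d'"
    note Gg = fun_hom[OF G H(3) H(1,2)]
    let ?l = "cmp D (F0 (fobj G d)) (F0 (fobj G d')) d' (\<epsilon> d') (fmap F (fobj G d) (fobj G d') (fmap G d d' g))"
    let ?r = "cmp D (F0 (fobj G d)) d d' g (\<epsilon> d)"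
    have l: "?l \<in> hom D (F0 (fobj G d)) d'"
      by (intro cat_cmp[OF catD] Fmap eps GO F0 H Gg)
    have r: "?r \<in> hom D (F0 (fobj G d)) d'"
      by (intro cat_cmp[OF catD] Fmap eps GO F0 H Gg)
    have "cmp C (fobj G d) (fobj G (F0 (fobj G d))) (fobj G d') (fmap G (F0 (fobj G d)) d' ?l) (\<eta> (fobj G d))
      = cmp C (fobj G d) (fobj G (F0 (fobj G d'))) (fobj G d') (fmap G (F0 (fobj G d')) d' (\<epsilon> d'))
          (cmp C (fobj G d) (fobj G d') (fobj G (F0 (fobj G d'))) (\<eta> (fobj G d')) (fmap G d d' g))"
      using Gcmp[OF GO[OF H(1)] F0[OF GO[OF H(2)]] H(2) Fmap(1) eps(1)] H GO Gg Fmap(2) by simp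
    also have "\<dots> = cmp C (fobj G d) (fobj G d') (fobj G d') (ide C (fobj G d')) (fmap G d d' g)"
      using cat_assoc[OF catC Gg eta fun_hom[OF G eps(1)]] H F0 GO eps(2) by metis
    also have "\<dots> = fmap G d d' g" using cat_idl[OF catC Gg] H GO by simp
    also have "\<dots> = cmp C (fobj G d) (fobj G d) (fobj G d') (fmap G d d' g) (ide C (fobj G d))"
      using cat_idr[OF catC Gg] H GO by simp
    also have "\<dots> = cmp C (fobj G d) (fobj G (F0 (fobj G d))) (fobj G d') (fmap G (F0 (fobj G d)) d' ?r) (\<eta> (fobj G d))"
      using Gcmp[OF GO[OF H(1)] H(1,2) eps(1) H(3)] H eps(2) by simp
    finally show "?l = ?r" using un[OF GO[OF H(1)] H(2) l r] by simp
  next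
    fix c assume c: "c \<in> obj C"
    let ?F = "F0 c" let ?G = "fobj G ?F"
    let ?k = "cmp D ?F (F0 ?G) ?F (\<epsilon> ?F) (fmap F c ?G (\<eta> c))"
    have k: "?k \<in> hom D ?F ?F"
      by (intro cat_cmp[OF catD] Fmap eps GO F0 c eta)
    have "cmp C c ?G ?G (fmap G ?F ?F ?k) (\<eta> c)
      = cmp C c (fobj G (F0 ?G)) ?G (fmap G (F0 ?G) ?F (\<epsilon> ?F)) (cmp C c ?G (fobj G (F0 ?G)) (\<eta> ?G) (\<eta> c))"
      using Gcmp[OF c F0[OF GO[OF F0[OF c]]] F0[OF c] Fmap(1) eps(1)] c F0 GO eta Fmap(2) by simp
    also have "\<dots> = cmp C c ?G ?G (ide C ?G) (\<eta> c)"
      using cat_assoc[OF catC eta eta fun_hom[OF G eps(1)]] c F0 GO eps(2) by metis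
    also have "\<dots> = cmp C c ?G ?G (fmap G ?F ?F (ide D ?F)) (\<eta> c)" using fun_ide[OF G] F0 c by simp
    finally show "?k = ide D ?F"
      using un[OF c F0[OF c] k cat_ide[OF catD F0[OF c]]] by simp
  next
    fix d assume "d \<in> obj D"
    thus "cmp C (fobj G d) (fobj G (F0 (fobj G d))) (fobj G d)
          (fmap G (F0 (fobj G d)) d (\<epsilon> d)) (\<eta> (fobj G d)) = ide C (fobj G d)"
      by (rule eps)
  qed
  thus ?thesis by blast
qed

text \<open>The dual situation, except that both functors are given in advance, as
  \<open>KSp\<close> and \<open>KPs\<close> are. Only the unit is constructed, and naturality of
  \<open>\<epsilon>\<close> relates the given action of \<open>G\<close> on morphisms to the
  couniversal property.\<close>

lemma adjunction_from_couniversal_arrows: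
  assumes F: "is_functor C D F" and G: "is_functor D C G"
    and eps: "\<And>d. d \<in> obj D \<Longrightarrow> \<epsilon> d \<in> hom D (fobj F (fobj G d)) d"
    and nat: "\<And>d d' g. d \<in> obj D \<Longrightarrow> d' \<in> obj D \<Longrightarrow> g \<in> hom D d d' \<Longrightarrow>
      cmp D (fobj F (fobj G d)) (fobj F (fobj G d')) d' (\<epsilon> d')
          (fmap F (fobj G d) (fobj G d') (fmap G d d' g))
        = cmp D (fobj F (fobj G d)) d d' g (\<epsilon> d)"
    and univ: "\<And>c d f. c \<in> obj C \<Longrightarrow> d \<in> obj D \<Longrightarrow> f \<in> hom D (fobj F c) d \<Longrightarrow>
      \<exists>!g. g \<in> hom C c (fobj G d) \<and>
        cmp D (fobj F c) (fobj F (fobj G d)) d (\<epsilon> d) (fmap F c (fobj G d) g) = f"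
  shows "\<exists>\<eta>. adjunction C D F G \<eta> \<epsilon>"
proof -
  have catC: "category C" and catD: "category D" using G fun_cat by blast+
  have FO: "fobj F c \<in> obj D" if "c \<in> obj C" for c using F that by (rule fun_obj)
  have GO: "fobj G c \<in> obj C" if "c \<in> obj D" for c using G that by (rule fun_obj)
  have un: "g = g'" if "c \<in> obj C" "d \<in> obj D" "g \<in> hom C c (fobj G d)" "g' \<in> hom C c (fobj G d)"
    "cmp D (fobj F c) (fobj F (fobj G d)) d (\<epsilon> d) (fmap F c (fobj G d) g)
      = cmp D (fobj F c) (fobj F (fobj G d)) d (\<epsilon> d) (fmap F c (fobj G d) g')" for c d g g'
  proof -
    have "cmp D (fobj F c) (fobj F (fobj G d)) d (\<epsilon> d) (fmap F c (fobj G d) g) \<in> hom D (fobj F c) d"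
      using that by (intro cat_cmp[OF catD] fun_hom[OF F] eps FO GO)
    from univ[OF that(1,2) this] that show ?thesis by metis
  qed
  define \<eta> where "\<eta> c = (THE g. g \<in> hom C c (fobj G (fobj F c)) \<and>
    cmp D (fobj F c) (fobj F (fobj G (fobj F c))) (fobj F c) (\<epsilon> (fobj F c))
      (fmap F c (fobj G (fobj F c)) g) = ide D (fobj F c))" for c
  have eta: "\<eta> c \<in> hom C c (fobj G (fobj F c))"
    "cmp D (fobj F c) (fobj F (fobj G (fobj F c))) (fobj F c) (\<epsilon> (fobj F c))
      (fmap F c (fobj G (fobj F c)) (\<eta> c)) = ide D (fobj F c)" if "c \<in> obj C" for c
    using theI'[OF univ[OF that FO[OF that] cat_ide[OF catD FO[OF that]]]] unfolding \<eta>_def by blast+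
  have Fcmp: "cmp D (fobj F a) (fobj F (fobj G d)) d (\<epsilon> d) (fmap F a (fobj G d) (cmp C a b (fobj G d) k h))
     = cmp D (fobj F a) (fobj F b) d
         (cmp D (fobj F b) (fobj F (fobj G d)) d (\<epsilon> d) (fmap F b (fobj G d) k)) (fmap F a b h)"
    if "a \<in> obj C" "b \<in> obj C" "d \<in> obj D" "h \<in> hom C a b" "k \<in> hom C b (fobj G d)" for a b d h k
    using that fun_cmp[OF F that(4,5)] FO GO
      cat_assoc[OF catD fun_hom[OF F that(4)] fun_hom[OF F that(5)] eps] by simp
  have "adjunction C D F G \<eta> \<epsilon>"
  proof (rule adjunctionI[OF F G])
    fix c c' f assume H: "c \<in> obj C" "c' \<in> obj C" "f \<in> hom C c c'"
    let ?l = "cmp C c c' (fobj G (fobj F c')) (\<eta> c') f"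
    let ?r = "cmp C c (fobj G (fobj F c)) (fobj G (fobj F c'))
            (fmap G (fobj F c) (fobj F c') (fmap F c c' f)) (\<eta> c)"
    have l: "?l \<in> hom C c (fobj G (fobj F c'))"
      using H by (intro cat_cmp[OF catC] eta FO GO)
    have r: "?r \<in> hom C c (fobj G (fobj F c'))"
      using H by (intro cat_cmp[OF catC] eta FO GO fun_hom[OF G] fun_hom[OF F])
    have "cmp D (fobj F c) (fobj F (fobj G (fobj F c'))) (fobj F c') (\<epsilon> (fobj F c')) (fmap F c (fobj G (fobj F c')) ?l)
      = fmap F c c' f"
      using Fcmp[OF H(1,2) FO[OF H(2)] H(3) eta(1)] H eta(2) cat_idl[OF catD fun_hom[OF F H(3)]] FO by simp
    also have "\<dots> = cmp D (fobj F c) (fobj F c) (fobj F c') (fmap F c c' f)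
        (cmp D (fobj F c) (fobj F (fobj G (fobj F c))) (fobj F c) (\<epsilon> (fobj F c))
          (fmap F c (fobj G (fobj F c)) (\<eta> c)))"
      using H eta(2) cat_idr[OF catD fun_hom[OF F H(3)]] FO by simp
    also have "\<dots> = cmp D (fobj F c) (fobj F (fobj G (fobj F c))) (fobj F c')
        (cmp D (fobj F (fobj G (fobj F c))) (fobj F c) (fobj F c') (fmap F c c' f) (\<epsilon> (fobj F c)))
          (fmap F c (fobj G (fobj F c)) (\<eta> c))"
      using cat_assoc[OF catD fun_hom[OF F eta(1)] eps fun_hom[OF F H(3)]] H FO GO by simp
    also have "\<dots> = cmp D (fobj F c) (fobj F (fobj G (fobj F c'))) (fobj F c') (\<epsilon> (fobj F c')) (fmap F c (fobj G (fobj F c')) ?r)"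
      using Fcmp[OF H(1) GO[OF FO[OF H(1)]] FO[OF H(2)] eta(1) fun_hom[OF G fun_hom[OF F H(3)]]]
        H FO GO nat[OF FO FO fun_hom[OF F H(3)]] by simp
    finally show "?l = ?r" using un[OF H(1) FO[OF H(2)] l r] by simp
  next
    fix d assume d: "d \<in> obj D"
    let ?G = "fobj G d" let ?F = "fobj F (fobj G d)"
    let ?l = "cmp C ?G (fobj G ?F) ?G (fmap G ?F d (\<epsilon> d)) (\<eta> ?G)"
    have l: "?l \<in> hom C ?G ?G"
      using d by (intro cat_cmp[OF catC] eta FO GO eps fun_hom[OF G])
    have "cmp D ?F ?F d (\<epsilon> d) (fmap F ?G ?G ?l)
      = cmp D ?F (fobj F (fobj G ?F)) d (cmp D (fobj F (fobj G ?F)) ?F d (\<epsilon> d) (\<epsilon> ?F)) (fmap F ?G (fobj G ?F) (\<eta> ?G))"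
      using Fcmp[OF GO[OF d] GO[OF FO[OF GO[OF d]]] d eta(1) fun_hom[OF G eps]] d FO GO
        nat[OF FO[OF GO[OF d]] d eps] by simp
    also have "\<dots> = cmp D ?F ?F d (\<epsilon> d) (ide D ?F)"
      using cat_assoc[OF catD fun_hom[OF F eta(1)] eps eps] d FO GO eta(2) by simp
    also have "\<dots> = cmp D ?F ?F d (\<epsilon> d) (fmap F ?G ?G (ide C ?G))"
      using fun_ide[OF F GO[OF d]] by simp
    finally show "?l = ide C ?G" using un[OF GO[OF d] d l cat_ide[OF catC GO[OF d]]] by simp
  qed (use eps nat eta in blast)+
  thus ?thesis by blast
qed

text \<open>
  The shape of the main theorem: a left adjoint \<open>F\<close> precomposed with \<open>P\<close> acquires a right adjoint \<open>K\<close>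
  once \<open>P K d\<close> is couniversal over \<open>G d\<close>.
\<close>

lemma relative_adjunction:
  assumes adj: "adjunction A B F G \<eta> \<epsilon>" and P: "is_functor S A P"
    and K: "is_functor (full_subcat B X) S K"
    and land: "\<And>s. s \<in> obj S \<Longrightarrow> fobj F (fobj P s) \<in> X"
    and j: "\<And>d. d \<in> obj B \<Longrightarrow> d \<in> X \<Longrightarrow> j d \<in> hom A (fobj P (fobj K d)) (fobj G d)"
    and jnat: "\<And>d d' g. d \<in> obj B \<Longrightarrow> d \<in> X \<Longrightarrow> d' \<in> obj B \<Longrightarrow> d' \<in> X \<Longrightarrow> g \<in> hom B d d' \<Longrightarrow>
      cmp A (fobj P (fobj K d)) (fobj P (fobj K d')) (fobj G d') (j d')
          (fmap P (fobj K d) (fobj K d') (fmap K d d' g))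
        = cmp A (fobj P (fobj K d)) (fobj G d) (fobj G d') (fmap G d d' g) (j d)"
    and univ: "\<And>s d f. s \<in> obj S \<Longrightarrow> d \<in> obj B \<Longrightarrow> d \<in> X \<Longrightarrow> f \<in> hom A (fobj P s) (fobj G d) \<Longrightarrow>
      \<exists>!g. g \<in> hom S s (fobj K d) \<and>
        cmp A (fobj P s) (fobj P (fobj K d)) (fobj G d) (j d) (fmap P s (fobj K d) g) = f"
  shows "\<exists>\<eta> \<epsilon>. adjunction S (full_subcat B X) (comp_ftor F P) K \<eta> \<epsilon>"
proof -
  let ?L = "full_subcat B X"
  have Ls: "obj ?L = obj B \<inter> X" "hom ?L = hom B" "cmp ?L = cmp B" "ide ?L = ide B"
    by (simp_all add: full_subcat_def)
  note AD = adjunctionD[OF adj]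
  have F: "is_functor A B F" and G: "is_functor B A G" using AD by blast+
  have catA: "category A" and catB: "category B"
    using F fun_cat by blast+
  have PO: "fobj P s \<in> obj A" if "s \<in> obj S" for s using P that by (rule fun_obj)
  have FO: "fobj F s \<in> obj B" if "s \<in> obj A" for s using F that by (rule fun_obj)
  have GO: "fobj G s \<in> obj A" if "s \<in> obj B" for s using G that by (rule fun_obj)
  have KO: "fobj K s \<in> obj S" if "s \<in> obj B" "s \<in> X" for s using fun_obj[OF K] that by (simp add: Ls)
  note OO = PO FO GO KO
  have Kh: "fmap K d d' g \<in> hom S (fobj K d) (fobj K d')"
    if "d \<in> obj B" "d \<in> X" "d' \<in> obj B" "d' \<in> X" "g \<in> hom B d d'" for d d' g
    using fun_hom[OF K] that by (simp add: Ls)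
  have FP: "is_functor S ?L (comp_ftor F P)"
    using comp_functor[OF P F] land unfolding is_functor_def
    by (simp add: Ls category_full_subcat) (simp add: comp_ftor_def)
  have FPs: "fobj (comp_ftor F P) s = fobj F (fobj P s)"
    "fmap (comp_ftor F P) s s' g = fmap F (fobj P s) (fobj P s') (fmap P s s' g)" for s s' g
    by (simp_all add: comp_ftor_def)
  \<comment> \<open>\<open>T\<close> is the bijection from maps \<open>a \<rightarrow> G d\<close>
    to maps \<open>F a \<rightarrow> d\<close>; \<open>T1\<close> and \<open>T2\<close> are its
    naturality in the two variables. The co-unit of the composite adjunction will be
    \<open>T\<close> of \<open>j d\<close>.\<close>
  define T where "T a d f = cmp B (fobj F a) (fobj F (fobj G d)) d (\<epsilon> d) (fmap F a (fobj G d) f)" for a d f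
  have T: "T a d f \<in> hom B (fobj F a) d" if "a \<in> obj A" "d \<in> obj B" "f \<in> hom A a (fobj G d)" for a d f
    unfolding T_def using that by (intro cat_cmp[OF catB] fun_hom[OF F] AD OO)
  have T1: "T a d (cmp A a a' (fobj G d) f h) = cmp B (fobj F a) (fobj F a') d (T a' d f) (fmap F a a' h)"
    if "a \<in> obj A" "a' \<in> obj A" "d \<in> obj B" "f \<in> hom A a' (fobj G d)" "h \<in> hom A a a'" for a a' d f h
    unfolding T_def using that fun_cmp[OF F that(5,4)] OO
      cat_assoc[OF catB fun_hom[OF F that(5)] fun_hom[OF F that(4)] AD(4)] by simp
  have T2: "T a d' (cmp A a (fobj G d) (fobj G d') (fmap G d d' g) f) = cmp B (fobj F a) d d' g (T a d f)"
    if "a \<in> obj A" "d \<in> obj B" "d' \<in> obj B" "f \<in> hom A a (fobj G d)" "g \<in> hom B d d'" for a d d' f g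
  proof -
    have "T a d' (cmp A a (fobj G d) (fobj G d') (fmap G d d' g) f)
       = cmp B (fobj F a) (fobj F (fobj G d)) d'
           (cmp B (fobj F (fobj G d)) (fobj F (fobj G d')) d' (\<epsilon> d') (fmap F (fobj G d) (fobj G d') (fmap G d d' g)))
           (fmap F a (fobj G d) f)"
      using T1[OF that(1) GO[OF that(2)] that(3) fun_hom[OF G that(5)] that(4)] that by (simp add: T_def)
    also have "\<dots> = cmp B (fobj F a) d d' g (T a d f)"
      unfolding AD(6)[OF that(2,3,5)] T_def
      using cat_assoc[OF catB fun_hom[OF F that(4)] AD(4) that(5)] that OO by simp
    finally show ?thesis .
  qed
  have Tbij: "\<exists>!f. f \<in> hom A a (fobj G d) \<and> T a d f = h"
    if H: "a \<in> obj A" "d \<in> obj B" "h \<in> hom B (fobj F a) d" for a d h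
  proof (rule ex1I[where a = "cmp A a (fobj G (fobj F a)) (fobj G d) (fmap G (fobj F a) d h) (\<eta> a)"])
    let ?f = "cmp A a (fobj G (fobj F a)) (fobj G d) (fmap G (fobj F a) d h) (\<eta> a)"
    have f: "?f \<in> hom A a (fobj G d)" using H by (intro cat_cmp[OF catA] fun_hom[OF G] AD OO)
    have "T a d ?f = cmp B (fobj F a) (fobj F a) d h (T a (fobj F a) (\<eta> a))"
      using T2[OF H(1) FO[OF H(1)] H(2) AD(3)[OF H(1)] H(3)] .
    also have "\<dots> = h" using AD(7)[OF H(1)] cat_idr[OF catB H(3)] H OO by (simp add: T_def)
    finally show "?f \<in> hom A a (fobj G d) \<and> T a d ?f = h" using f by blast
    fix f' assume f': "f' \<in> hom A a (fobj G d) \<and> T a d f' = h"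
    have "cmp A a (fobj G (fobj F a)) (fobj G d) (fmap G (fobj F a) d h) (\<eta> a)
      = cmp A a (fobj G (fobj F (fobj G d))) (fobj G d) (fmap G (fobj F (fobj G d)) d (\<epsilon> d))
         (cmp A a (fobj G (fobj F a)) (fobj G (fobj F (fobj G d)))
           (fmap G (fobj F a) (fobj F (fobj G d)) (fmap F a (fobj G d) f')) (\<eta> a))"
    proof -
      have a: "fmap F a (fobj G d) f' \<in> hom B (fobj F a) (fobj F (fobj G d))"
        using f' H by (intro fun_hom[OF F] OO) auto
      have "fmap G (fobj F a) d h = cmp A (fobj G (fobj F a)) (fobj G (fobj F (fobj G d))) (fobj G d)
         (fmap G (fobj F (fobj G d)) d (\<epsilon> d)) (fmap G (fobj F a) (fobj F (fobj G d)) (fmap F a (fobj G d) f'))"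
        using f' fun_cmp[OF G a AD(4)] H OO by (simp add: T_def)
      thus ?thesis
        using cat_assoc[OF catA AD(3) fun_hom[OF G a] fun_hom[OF G AD(4)]] H OO by simp
    qed
    also have "\<dots> = f'"
      using AD(5)[OF H(1) GO[OF H(2)]] f' AD(8)[OF H(2)] H OO
        cat_assoc[OF catA _ AD(3) fun_hom[OF G AD(4)], of f' a] cat_idl[OF catA, of f' a] by metis
    finally show "f' = ?f" ..
  qed
  let ?e = "\<lambda>d. T (fobj P (fobj K d)) d (j d)"
  have Pg: "fmap P s (fobj K d) g \<in> hom A (fobj P s) (fobj P (fobj K d))"
    if "s \<in> obj S" "d \<in> obj B" "d \<in> X" "g \<in> hom S s (fobj K d)" for s d g
    using that by (intro fun_hom[OF P] OO)
  have eg: "cmp B (fobj F (fobj P s)) (fobj F (fobj P (fobj K d))) d (?e d)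
       (fmap F (fobj P s) (fobj P (fobj K d)) (fmap P s (fobj K d) g))
     = T (fobj P s) d (cmp A (fobj P s) (fobj P (fobj K d)) (fobj G d) (j d) (fmap P s (fobj K d) g))"
    if "s \<in> obj S" "d \<in> obj B" "d \<in> X" "g \<in> hom S s (fobj K d)" for s d g
    using T1[OF _ _ _ j Pg] that OO by simp
  have "\<exists>\<eta>. adjunction S ?L (comp_ftor F P) K \<eta> ?e"
  proof (rule adjunction_from_couniversal_arrows[OF FP K]; unfold Ls FPs Int_iff)
    fix d assume "d \<in> obj B \<and> d \<in> X"
    thus "?e d \<in> hom B (fobj F (fobj P (fobj K d))) d" by (intro T j OO) auto
  next
    fix d d' g assume H: "d \<in> obj B \<and> d \<in> X" "d' \<in> obj B \<and> d' \<in> X" "g \<in> hom B d d'"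
    thus "cmp B (fobj F (fobj P (fobj K d))) (fobj F (fobj P (fobj K d'))) d' (?e d')
          (fmap F (fobj P (fobj K d)) (fobj P (fobj K d')) (fmap P (fobj K d) (fobj K d') (fmap K d d' g)))
        = cmp B (fobj F (fobj P (fobj K d))) d d' g (?e d)"
      using eg[OF KO _ _ Kh] jnat T2[OF _ _ _ j] OO by simp
  next
    fix s d f assume H: "s \<in> obj S" "d \<in> obj B \<and> d \<in> X" "f \<in> hom B (fobj F (fobj P s)) d"
    \<comment> \<open>Couniversality splits into two bijections: from \<open>f\<close> back to
      \<open>f0\<close> by \<open>Tbij\<close>, and from \<open>f0\<close> to \<open>g\<close> by
      \<open>univ\<close>.\<close>
    obtain f0 where f0: "f0 \<in> hom A (fobj P s) (fobj G d)" "T (fobj P s) d f0 = f"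
      and un0: "\<And>f'. f' \<in> hom A (fobj P s) (fobj G d) \<Longrightarrow> T (fobj P s) d f' = f \<Longrightarrow> f' = f0"
      using Tbij[OF PO[OF H(1)] _ H(3)] H(2) by metis
    obtain g where g: "g \<in> hom S s (fobj K d)"
        "cmp A (fobj P s) (fobj P (fobj K d)) (fobj G d) (j d) (fmap P s (fobj K d) g) = f0"
      and un: "\<And>g'. g' \<in> hom S s (fobj K d) \<Longrightarrow>
        cmp A (fobj P s) (fobj P (fobj K d)) (fobj G d) (j d) (fmap P s (fobj K d) g') = f0 \<Longrightarrow> g' = g"
      using univ[OF H(1) _ _ f0(1)] H(2) by metis
    show "\<exists>!g. g \<in> hom S s (fobj K d) \<and>
        cmp B (fobj F (fobj P s)) (fobj F (fobj P (fobj K d))) d (?e d)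
          (fmap F (fobj P s) (fobj P (fobj K d)) (fmap P s (fobj K d) g)) = f"
    proof (rule ex1I[where a = g])
      show "g \<in> hom S s (fobj K d) \<and>
        cmp B (fobj F (fobj P s)) (fobj F (fobj P (fobj K d))) d (?e d)
          (fmap F (fobj P s) (fobj P (fobj K d)) (fmap P s (fobj K d) g)) = f"
        using eg[OF H(1) _ _ g(1)] H(2) g f0 by simp
      fix g' assume g': "g' \<in> hom S s (fobj K d) \<and>
        cmp B (fobj F (fobj P s)) (fobj F (fobj P (fobj K d))) d (?e d)
          (fmap F (fobj P s) (fobj P (fobj K d)) (fmap P s (fobj K d) g')) = f"
      show "g' = g"
      proof (rule un)
        show "cmp A (fobj P s) (fobj P (fobj K d)) (fobj G d) (j d) (fmap P s (fobj K d) g') = f0"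
        proof (rule un0)
          show "cmp A (fobj P s) (fobj P (fobj K d)) (fobj G d) (j d) (fmap P s (fobj K d) g')
              \<in> hom A (fobj P s) (fobj G d)"
            using g' H by (intro cat_cmp[OF catA] Pg j OO) auto
        qed (use eg[OF H(1) _ _ conjunct1[OF g']] H(2) g' in simp)
      qed (use g' in blast)
    qed
  qed
  thus ?thesis by blast
qed

text \<open>Fullness gives \<open>s : d \<rightarrow> F G d\<close> over the unit at
  \<open>G d\<close>, and this is the inverse of \<open>\<epsilon> d\<close>. One composite becomes
  the identity after \<open>G\<close>, by a triangle identity, and faithfulness removes
  \<open>G\<close>.\<close>

lemma counit_iso_if_full_faithful:
  assumes adj: "adjunction C D F G \<eta> \<epsilon>" and full: "full_ftor D C G" and faith: "faithful_ftor D C G"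
  shows "natural_isomorphism D D (comp_ftor F G) id_ftor \<epsilon>"
  unfolding natural_isomorphism_def
proof (intro conjI ballI)
  show "natural_transformation D D (comp_ftor F G) id_ftor \<epsilon>" using adj by (simp add: adjunction_def)
  note A = adjunctionD[OF adj]
  have F: "is_functor C D F" and G: "is_functor D C G" using A by blast+
  have catD: "category D" using G fun_cat by blast
  fix d assume d: "d \<in> obj D"
  let ?G = "fobj G d" let ?F = "fobj F ?G"
  have Gd: "?G \<in> obj C" using G d by (rule fun_obj)
  have Fd: "?F \<in> obj D" using F Gd by (rule fun_obj)
  have GF: "fobj G ?F \<in> obj C" using G Fd by (rule fun_obj)
  obtain s where s: "s \<in> hom D d ?F" "fmap G d ?F s = \<eta> ?G"
    using full A(3)[OF Gd] d Fd unfolding full_ftor_def by (metis imageE)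
  have e: "\<epsilon> d \<in> hom D ?F d" using A(4) d by blast
  have es: "cmp D d ?F d (\<epsilon> d) s \<in> hom D d d" using cat_cmp[OF catD s(1) e] d Fd by blast
  have "fmap G d d (cmp D d ?F d (\<epsilon> d) s) = fmap G d d (ide D d)"
    using fun_cmp[OF G s(1) e d Fd d] s(2) A(8)[OF d] fun_ide[OF G d] by simp
  hence 1: "cmp D d ?F d (\<epsilon> d) s = ide D d"
    using faith es cat_ide[OF catD d] d unfolding faithful_ftor_def inj_on_def by blast
  \<comment> \<open>Naturality of the co-unit at \<open>s\<close> turns
    \<open>s \<circ> \<epsilon> d\<close> into the left-hand side of the other triangle identity,
    because \<open>G s\<close> is the unit.\<close>
  have 2: "cmp D ?F d ?F s (\<epsilon> d) = ide D ?F"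
    using A(6)[OF d Fd s(1)] s(2) A(7)[OF Gd] by simp
  show "is_iso D (fobj (comp_ftor F G) d) (fobj id_ftor d) (\<epsilon> d)"
    unfolding is_iso_def using e s(1) 1 2 by (auto simp: comp_ftor_def id_ftor_def)
qed

section \<open>Presheaves of pointed sets\<close>

lemma presheafD:
  assumes "pointed_presheaf C P"
  shows "a \<in> obj C \<Longrightarrow> pt P a \<in> el P a"
    and "x \<in> el P b \<Longrightarrow> f \<in> hom C a b \<Longrightarrow> a \<in> obj C \<Longrightarrow> b \<in> obj C \<Longrightarrow> act P a b f x \<in> el P a"
    and "f \<in> hom C a b \<Longrightarrow> a \<in> obj C \<Longrightarrow> b \<in> obj C \<Longrightarrow> act P a b f (pt P b) = pt P a"
    and "x \<in> el P a \<Longrightarrow> a \<in> obj C \<Longrightarrow> act P a a (ide C a) x = x"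
    and "f \<in> hom C a b \<Longrightarrow> g \<in> hom C b c \<Longrightarrow> x \<in> el P c \<Longrightarrow>
      a \<in> obj C \<Longrightarrow> b \<in> obj C \<Longrightarrow> c \<in> obj C \<Longrightarrow>
      act P a c (cmp C a b c g f) x = act P a b f (act P b c g x)"
  using assms unfolding pointed_presheaf_def by (simp_all add: Pi_iff)

text \<open>\<open>psh_hom\<close> without its extensionality conditions. Morphisms are given by a
  formula, shown to be a \<open>pmap\<close>, and then cut down by
  \<open>restrict_pmap\<close>.\<close>

definition pmap ::
    "('o, 'm) cat \<Rightarrow> ('o, 'm, 'u) ppsh \<Rightarrow> ('o, 'm, 'v) ppsh \<Rightarrow> ('o \<Rightarrow> 'u \<Rightarrow> 'v) \<Rightarrow> bool" where
  "pmap C P Q \<alpha> \<longleftrightarrow> (\<forall>c\<in>obj C. \<forall>x\<in>el P c. \<alpha> c x \<in> el Q c) \<and>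
     (\<forall>a\<in>obj C. \<alpha> a (pt P a) = pt Q a) \<and>
     (\<forall>a\<in>obj C. \<forall>b\<in>obj C. \<forall>f\<in>hom C a b. \<forall>x\<in>el P b.
        \<alpha> a (act P a b f x) = act Q a b f (\<alpha> b x))"

lemma pmapD:
  assumes "pmap C P Q \<alpha>"
  shows "x \<in> el P c \<Longrightarrow> c \<in> obj C \<Longrightarrow> \<alpha> c x \<in> el Q c"
    and "a \<in> obj C \<Longrightarrow> \<alpha> a (pt P a) = pt Q a"
    and "f \<in> hom C a b \<Longrightarrow> x \<in> el P b \<Longrightarrow> a \<in> obj C \<Longrightarrow> b \<in> obj C \<Longrightarrow>
      \<alpha> a (act P a b f x) = act Q a b f (\<alpha> b x)"
  using assms unfolding pmap_def by simp_all

lemma psh_hom_iff: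
  "\<alpha> \<in> psh_hom C P Q \<longleftrightarrow> pmap C P Q \<alpha> \<and> \<alpha> \<in> extensional (obj C) \<and>
     (\<forall>c\<in>obj C. \<alpha> c \<in> extensional (el P c))"
  unfolding psh_hom_def pmap_def PiE_def Pi_iff by auto

lemma psh_hom_pmap: "\<alpha> \<in> psh_hom C P Q \<Longrightarrow> pmap C P Q \<alpha>"
  by (simp add: psh_hom_iff)

lemma psh_hom_eqI:
  assumes "\<alpha> \<in> psh_hom C P Q" "\<beta> \<in> psh_hom C P R"
    and "\<And>c x. c \<in> obj C \<Longrightarrow> x \<in> el P c \<Longrightarrow> \<alpha> c x = \<beta> c x"
  shows "\<alpha> = \<beta>"
proof (rule extensionalityI[where A = "obj C"])
  fix c assume c: "c \<in> obj C"
  show "\<alpha> c = \<beta> c"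
    by (rule extensionalityI[where A = "el P c"]) (use assms c in \<open>auto simp: psh_hom_iff\<close>)
qed (use assms in \<open>auto simp: psh_hom_iff\<close>)

lemma restrict_pmap:
  assumes "pmap C P Q \<alpha>" "pointed_presheaf C P"
  shows "(\<lambda>c\<in>obj C. \<lambda>x\<in>el P c. \<alpha> c x) \<in> psh_hom C P Q"
  using assms presheafD(1,2)[OF assms(2)] unfolding psh_hom_iff pmap_def by simp

lemma psh_comp_apply:
  "c \<in> obj C \<Longrightarrow> x \<in> el P c \<Longrightarrow> psh_comp C P \<beta> \<alpha> c x = \<beta> c (\<alpha> c x)"
  by (simp add: psh_comp_def compose_def)

lemma psh_comp_hom:
  assumes "\<alpha> \<in> psh_hom C P Q" "\<beta> \<in> psh_hom C Q R" "pointed_presheaf C P"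
  shows "psh_comp C P \<beta> \<alpha> \<in> psh_hom C P R"
  using assms presheafD(1,2)[OF assms(3)] unfolding psh_hom_iff pmap_def psh_comp_def
  by (simp add: compose_def)

lemma psh_id_apply: "c \<in> obj C \<Longrightarrow> x \<in> el P c \<Longrightarrow> psh_id C P c x = x"
  by (simp add: psh_id_def)

lemma psh_id_hom: "pointed_presheaf C P \<Longrightarrow> psh_id C P \<in> psh_hom C P P"
  unfolding psh_id_def by (rule restrict_pmap) (simp_all add: pmap_def presheafD)

lemma psh_zero_apply: "c \<in> obj C \<Longrightarrow> x \<in> el P c \<Longrightarrow> psh_zero C P Q c x = pt Q c"
  by (simp add: psh_zero_def)

lemma psh_zero_hom:
  "pointed_presheaf C P \<Longrightarrow> pointed_presheaf C Q \<Longrightarrow> psh_zero C P Q \<in> psh_hom C P Q"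
  unfolding psh_zero_def by (rule restrict_pmap) (simp_all add: pmap_def presheafD)

lemma psh_simps:
  "obj (psh C) = {P. pointed_presheaf C P}" "hom (psh C) = psh_hom C" "ide (psh C) = psh_id C"
  "cmp (psh C) = (\<lambda>P Q R \<beta> \<alpha>. psh_comp C P \<beta> \<alpha>)"
  by (simp_all add: psh_def)

lemma psh_comp_assoc:
  assumes "\<alpha> \<in> psh_hom C P Q" "\<beta> \<in> psh_hom C Q R" "\<gamma> \<in> psh_hom C R S" "pointed_presheaf C P"
    "pointed_presheaf C Q"
  shows "psh_comp C P (psh_comp C Q \<gamma> \<beta>) \<alpha> = psh_comp C P \<gamma> (psh_comp C P \<beta> \<alpha>)"
proof (rule psh_hom_eqI)
  show "psh_comp C P (psh_comp C Q \<gamma> \<beta>) \<alpha> \<in> psh_hom C P S"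
    "psh_comp C P \<gamma> (psh_comp C P \<beta> \<alpha>) \<in> psh_hom C P S"
    using assms by (blast intro: psh_comp_hom)+
  fix c x assume "c \<in> obj C" "x \<in> el P c"
  thus "psh_comp C P (psh_comp C Q \<gamma> \<beta>) \<alpha> c x = psh_comp C P \<gamma> (psh_comp C P \<beta> \<alpha>) c x"
    using pmapD(1)[OF psh_hom_pmap[OF assms(1)]] by (simp add: psh_comp_apply)
qed

lemma psh_comp_id:
  assumes "\<alpha> \<in> psh_hom C P Q" "pointed_presheaf C P" "pointed_presheaf C Q"
  shows "psh_comp C P \<alpha> (psh_id C P) = \<alpha>" "psh_comp C P (psh_id C Q) \<alpha> = \<alpha>"
  by (rule psh_hom_eqI[OF psh_comp_hom[OF _ _ assms(2)] assms(1)];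
      use assms pmapD(1)[OF psh_hom_pmap[OF assms(1)]]
      in \<open>auto simp: psh_comp_apply psh_id_apply intro: psh_id_hom\<close>)+

lemma category_psh: "category (psh C)"
  unfolding category_def psh_simps
  by (auto intro: psh_id_hom psh_comp_hom psh_comp_id psh_comp_assoc)

lemma restrict_psh_simps:
  "el (restrict_psh F P) c = el P (fobj F c)" "pt (restrict_psh F P) c = pt P (fobj F c)"
  "act (restrict_psh F P) a b f = act P (fobj F a) (fobj F b) (fmap F a b f)"
  by (simp_all add: restrict_psh_def)

lemma restrict_psh_presheaf:
  assumes "is_functor C D F" "pointed_presheaf D P"
  shows "pointed_presheaf C (restrict_psh F P)"
  using assms presheafD[OF assms(2)] unfolding is_functor_def
  by (simp add: pointed_presheaf_def restrict_psh_simps)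

lemma restrict_ftor_functor:
  assumes F: "is_functor C D F"
  shows "is_functor (psh D) (psh C) (restrict_ftor C F)"
proof -
  have O: "fobj F c \<in> obj D" if "c \<in> obj C" for c using fun_obj[OF F that] .
  have hom: "(\<lambda>c\<in>obj C. \<alpha> (fobj F c)) \<in> psh_hom C (restrict_psh F P) (restrict_psh F Q)"
    if "\<alpha> \<in> psh_hom D P Q" for \<alpha> P Q
    using that O fun_hom[OF F] unfolding psh_hom_iff pmap_def restrict_psh_simps by simp
  show ?thesis
    unfolding is_functor_def
    using hom O fun_hom[OF F]
    by (auto simp: category_psh psh_simps restrict_ftor_def restrict_psh_presheaf[OF F]
        psh_id_def psh_comp_def restrict_psh_simps fun_eq_iff)
qed

lemma rep_plus_presheaf:
  assumes "category C" "c \<in> obj C"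
  shows "pointed_presheaf C (rep_plus C c)"
proof -
  have 1: "map_option (\<lambda>g. cmp C a b c g f) x \<in> insert None (Some ` hom C a c)"
    if "a \<in> obj C" "b \<in> obj C" "f \<in> hom C a b" "x \<in> insert None (Some ` hom C b c)" for a b f x
    using that assms cat_cmp[OF assms(1)] by auto
  have 2: "map_option (\<lambda>h. cmp C a b' c h (cmp C a b b' g f)) x
      = map_option (\<lambda>h. cmp C a b c h f) (map_option (\<lambda>h. cmp C b b' c h g) x)"
    if "a \<in> obj C" "b \<in> obj C" "b' \<in> obj C" "f \<in> hom C a b" "g \<in> hom C b b'"
      "x \<in> insert None (Some ` hom C b' c)" for a b b' f g x
    using that assms cat_assoc[OF assms(1)] by auto
  show ?thesis
    unfolding pointed_presheaf_def rep_plus_def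
    using assms 1 2 cat_idr[OF assms(1)] by auto
qed

lemma rep_plus_simps:
  "el (rep_plus C c) a = insert None (Some ` hom C a c)" "pt (rep_plus C c) a = None"
  "act (rep_plus C c) a b f = map_option (\<lambda>g. cmp C a b c g f)"
  by (simp_all add: rep_plus_def)

lemma collapse_simps:
  "el (collapse P A) a = quot_el P A a ` el P a" "pt (collapse P A) a = pt P a"
  "act (collapse P A) a b f x = quot_el P A a (act P a b f x)"
  by (simp_all add: collapse_def)

lemma quot_el_pt: "quot_el P A a (pt P a) = pt P a"
  by (simp add: quot_el_def)

lemma quot_el_quot_el: "quot_el P A a (quot_el P A a x) = quot_el P A a x"
  by (simp add: quot_el_def)

text \<open>If \<open>x\<close> lies in the collapsed part, both sides are the base-point, because
  that part is stable under restriction.\<close>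

lemma act_collapse:
  assumes P: "pointed_presheaf C P"
    and stable: "\<And>a b f x. a \<in> obj C \<Longrightarrow> b \<in> obj C \<Longrightarrow> f \<in> hom C a b \<Longrightarrow> x \<in> A b \<Longrightarrow>
      act P a b f x \<in> A a"
    and "a \<in> obj C" "b \<in> obj C" "f \<in> hom C a b"
  shows "act (collapse P A) a b f (quot_el P A b x) = quot_el P A a (act P a b f x)"
  using assms presheafD(3)[OF P] by (auto simp: collapse_simps quot_el_def)

lemma collapse_presheaf:
  assumes P: "pointed_presheaf C P"
    and stable: "\<And>a b f x. a \<in> obj C \<Longrightarrow> b \<in> obj C \<Longrightarrow> f \<in> hom C a b \<Longrightarrow> x \<in> A b \<Longrightarrow>
      act P a b f x \<in> A a"
  shows "pointed_presheaf C (collapse P A)"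
proof -
  note act = act_collapse[of C P A, OF P stable]
  show ?thesis
    unfolding pointed_presheaf_def collapse_simps(1,2)
  proof (intro conjI ballI)
    fix a assume a: "a \<in> obj C"
    show "pt P a \<in> quot_el P A a ` el P a"
      using presheafD(1)[OF P a] quot_el_pt[of P A a] by force
    show "act (collapse P A) a a (ide C a) x = x" if x: "x \<in> quot_el P A a ` el P a" for x
    proof -
      from x obtain y where y: "y \<in> el P a" "x = quot_el P A a y" by blast
      \<comment> \<open>An element of the quotient is itself an element of \<open>P\<close>, either
        the base-point or a point outside \<open>A\<close>, so the laws of \<open>P\<close> apply to
        it directly.\<close>
      have x': "x \<in> el P a" using y presheafD(1)[OF P a] by (simp add: quot_el_def)
      have "quot_el P A a x = x" using y quot_el_quot_el by metis
      thus ?thesis using presheafD(4)[OF P x' a] by (simp add: collapse_simps)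
    qed
    fix b f assume b: "b \<in> obj C" "f \<in> hom C a b"
    show "act (collapse P A) a b f \<in> quot_el P A b ` el P b \<rightarrow> quot_el P A a ` el P a"
      using presheafD(2)[OF P _ b(2) a b(1)] act[OF _ _ _ _ a b] by auto
    show "act (collapse P A) a b f (pt P b) = pt P a"
      using presheafD(3)[OF P b(2) a b(1)] by (simp add: collapse_simps quot_el_pt)
    fix c g x assume c: "c \<in> obj C" "g \<in> hom C b c" "x \<in> quot_el P A c ` el P c"
    then obtain y where y: "y \<in> el P c" "x = quot_el P A c y" by blast
    have yc: "x \<in> el P c" using y presheafD(1)[OF P c(1)] by (simp add: quot_el_def)
    show "act (collapse P A) a c (cmp C a b c g f) x = act (collapse P A) a b f (act (collapse P A) b c g x)"
      using presheafD(5)[OF P b(2) c(2) yc a b(1) c(1)] act[OF _ _ _ _ a b]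
      by (simp add: collapse_simps)
  qed
qed

section \<open>Transport to the universe\<close>

text \<open>\<open>enc\<close> is a choice, hence injective only once some injection into the
  universe exists; this predicate carries that size condition. The first argument fixes the universe
  type.\<close>

definition fits :: "'u itself \<Rightarrow> 'h set \<Rightarrow> bool" where
  "fits T A \<longleftrightarrow> (\<exists>e :: 'h \<Rightarrow> 'u. inj_on e A)"

lemma fits_UNIV: "fits TYPE('u) (A :: 'u set)"
  unfolding fits_def by (rule exI[where x = id]) simp

lemma fits_inj: "fits TYPE('u) A \<Longrightarrow> inj_on f B \<Longrightarrow> f ` B \<subseteq> A \<Longrightarrow> fits TYPE('u) B"
  unfolding fits_def by (meson comp_inj_on inj_on_subset)

lemma fits_subset: "fits TYPE('u) A \<Longrightarrow> B \<subseteq> A \<Longrightarrow> fits TYPE('u) B"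
  using fits_inj[of A id B] by simp

lemma fits_image: "fits TYPE('u) A \<Longrightarrow> fits TYPE('u) (f ` A)"
  by (rule fits_inj[where f = "inv_into A f"]) (auto simp: inj_on_inv_into inv_into_into)

lemma fits_countable: "countable A \<Longrightarrow> fits TYPE('u::infinite) A"
proof -
  assume "countable A"
  moreover obtain e :: "nat \<Rightarrow> 'u" where "inj e"
    using infinite_UNIV infinite_countable_subset by blast
  ultimately have "inj_on (e \<circ> to_nat_on A) A"
    by (meson comp_inj_on inj_on_subset inj_on_to_nat_on subset_UNIV)
  thus ?thesis unfolding fits_def by blast
qed

text \<open>An infinite type is in bijection with its square.\<close>

lemma fits_Times:
  assumes "fits TYPE('u::infinite) A" "fits TYPE('u) B"
  shows "fits TYPE('u) (A \<times> B)"
proof -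
  obtain e f where e: "inj_on (e :: _ \<Rightarrow> 'u) A" "inj_on (f :: _ \<Rightarrow> 'u) B"
    using assms unfolding fits_def by blast
  have "(card_of (UNIV \<times> UNIV :: ('u \<times> 'u) set), card_of (UNIV :: 'u set)) \<in> ordIso"
    by (rule card_of_Times_same_infinite) (rule infinite_UNIV)
  then obtain p :: "'u \<times> 'u \<Rightarrow> 'u" where "bij_betw p (UNIV \<times> UNIV) UNIV"
    using card_of_ordIso by blast
  hence "inj p" by (simp add: bij_betw_def)
  moreover have "inj_on (map_prod e f) (A \<times> B)" using e by (rule map_prod_inj_on)
  ultimately have "inj_on (p \<circ> map_prod e f) (A \<times> B)"
    by (meson comp_inj_on inj_on_subset subset_UNIV)
  thus ?thesis unfolding fits_def by blast
qed

text \<open>For non-empty \<open>A\<close>, the product \<open>bool \<times> A\<close> maps onto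
  \<open>insert a A\<close>, so the closure under products and images gives the bound.\<close>

lemma fits_insert:
  assumes "fits TYPE('u::infinite) A" shows "fits TYPE('u) (insert a A)"
proof (cases "A = {}")
  case False
  then obtain b where b: "b \<in> A" by blast
  have "fits TYPE('u) ((\<lambda>(i, x). if i then a else x) ` ((UNIV :: bool set) \<times> A))"
    by (intro fits_image fits_Times fits_countable assms) simp
  moreover have "insert a A \<subseteq> (\<lambda>(i, x). if i then a else x) ` (UNIV \<times> A)"
  proof
    fix x assume "x \<in> insert a A"
    thus "x \<in> (\<lambda>(i, x). if i then a else x) ` (UNIV \<times> A)"
      using b image_eqI[of x "\<lambda>(i, x). if i then a else x" "(x = a, if x = a then b else x)"] by auto
  qed
  ultimately show ?thesis by (rule fits_subset)
qed (simp add: fits_countable)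

lemma enc_inj: "fits TYPE('u) A \<Longrightarrow> inj_on (enc A :: _ \<Rightarrow> 'u) A"
  unfolding fits_def enc_def by (rule someI_ex[of "\<lambda>e. inj_on e A"])

lemma dec_enc: "fits TYPE('u) A \<Longrightarrow> x \<in> A \<Longrightarrow> dec A (enc A x :: 'u) = x"
  unfolding dec_def by (simp add: enc_inj)

lemma small_simps:
  "el (small P) a = enc (el P a) ` el P a" "pt (small P) a = enc (el P a) (pt P a)"
  by (simp_all add: small_def)

definition psh_fits :: "'u itself \<Rightarrow> ('o, 'm) cat \<Rightarrow> ('o, 'm, 'h) ppsh \<Rightarrow> bool" where
  "psh_fits T C P \<longleftrightarrow> (\<forall>a\<in>obj C. fits TYPE('u) (el P a))"

lemma act_small:
  assumes "psh_fits TYPE('u) C P" "b \<in> obj C" "x \<in> el P b"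
  shows "act (small P) a b f (enc (el P b) x :: 'u) = enc (el P a) (act P a b f x)"
  using assms by (simp add: small_def psh_fits_def dec_enc)

lemma small_presheaf:
  assumes "pointed_presheaf C P" "psh_fits TYPE('u) C P"
  shows "pointed_presheaf C (small P :: (_, _, 'u) ppsh)"
  unfolding pointed_presheaf_def
  by (auto simp: small_simps act_small[OF assms(2)] presheafD[OF assms(1)])

lemma small_map_enc:
  assumes "psh_fits TYPE('u) C P" "a \<in> obj C" "x \<in> el P a"
  shows "small_map C P Q \<alpha> a (enc (el P a) x :: 'u) = enc (el Q a) (\<alpha> a x)"
  using assms by (simp add: small_map_def psh_fits_def dec_enc)

lemma small_map_hom:
  assumes P: "pointed_presheaf C P" "psh_fits TYPE('u) C P" and Q: "psh_fits TYPE('u) C Q"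
    and \<alpha>: "pmap C P Q \<alpha>"
  shows "small_map C P Q \<alpha> \<in> psh_hom C (small P :: (_, _, 'u) ppsh) (small Q)"
proof -
  have "pmap C (small P :: (_, _, 'u) ppsh) (small Q) (small_map C P Q \<alpha>)"
    unfolding pmap_def
    by (auto simp: small_simps small_map_enc[OF P(2)] act_small[OF P(2)] act_small[OF Q]
        presheafD[OF P(1)] pmapD[OF \<alpha>])
  thus ?thesis
    unfolding psh_hom_iff by (simp add: small_map_def small_simps)
qed

section \<open>Left Kan extensions of pointed presheaves\<close>

text \<open>
  The left Kan extension of \<open>P\<close> at \<open>z\<close> consists of formal elements \<open>x \<cdot> g\<close>. Instead of generating the
  equivalence relation, two formal elements are identified if no morphism from \<open>P\<close> to a restricted
  presheaf distinguishes them.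
\<close>

fun kan_val :: "('c, 'k, 'o, 'm) ftor \<Rightarrow> ('o, 'm, 'u) ppsh \<Rightarrow> ('c \<Rightarrow> 'u \<Rightarrow> 'u) \<Rightarrow> 'o \<Rightarrow>
    ('c \<times> 'u \<times> 'm) option \<Rightarrow> 'u" where
  "kan_val F Z f z None = pt Z z"
| "kan_val F Z f z (Some (c, x, g)) = act Z z (fobj F c) g (f c x)"

fun kan_pre :: "('o, 'm) cat \<Rightarrow> ('c, 'k, 'o, 'm) ftor \<Rightarrow> 'o \<Rightarrow> 'o \<Rightarrow> 'm \<Rightarrow>
    ('c \<times> 'u \<times> 'm) option \<Rightarrow> ('c \<times> 'u \<times> 'm) option" where
  "kan_pre D F z w h None = None"
| "kan_pre D F z w h (Some (c, x, g)) = Some (c, x, cmp D z w (fobj F c) g h)"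

definition kan_terms :: "('c, 'k) cat \<Rightarrow> ('o, 'm) cat \<Rightarrow> ('c, 'k, 'o, 'm) ftor \<Rightarrow>
    ('c, 'k, 'u) ppsh \<Rightarrow> 'o \<Rightarrow> ('c \<times> 'u \<times> 'm) option set" where
  "kan_terms C D F P z =
     insert None {Some (c, x, g) | c x g. c \<in> obj C \<and> x \<in> el P c \<and> g \<in> hom D z (fobj F c)}"

text \<open>The test presheaves \<open>Z\<close> take values in the same universe as
  \<open>P\<close>, so one quantifier covers all targets for which the universal property is
  wanted.\<close>

definition kan_cls :: "('c, 'k) cat \<Rightarrow> ('o, 'm) cat \<Rightarrow> ('c, 'k, 'o, 'm) ftor \<Rightarrow>
    ('c, 'k, 'u) ppsh \<Rightarrow> 'o \<Rightarrow> ('c \<times> 'u \<times> 'm) option \<Rightarrow> ('c \<times> 'u \<times> 'm) option set" where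
  "kan_cls C D F P z t = {t' \<in> kan_terms C D F P z.
     \<forall>Z f. pointed_presheaf D Z \<longrightarrow> f \<in> psh_hom C P (restrict_psh F Z) \<longrightarrow>
       kan_val F Z f z t = kan_val F Z f z t'}"

definition kan_rep :: "('c, 'k) cat \<Rightarrow> ('o, 'm) cat \<Rightarrow> ('c, 'k, 'o, 'm) ftor \<Rightarrow>
    ('c, 'k, 'u) ppsh \<Rightarrow> 'o \<Rightarrow> ('c \<times> 'u \<times> 'm) option set \<Rightarrow> ('c \<times> 'u \<times> 'm) option" where
  "kan_rep C D F P z q = (SOME t. t \<in> kan_terms C D F P z \<and> kan_cls C D F P z t = q)"

definition kan :: "('c, 'k) cat \<Rightarrow> ('o, 'm) cat \<Rightarrow> ('c, 'k, 'o, 'm) ftor \<Rightarrow>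
    ('c, 'k, 'u) ppsh \<Rightarrow> ('o, 'm, ('c \<times> 'u \<times> 'm) option set) ppsh" where
  "kan C D F P = \<lparr>el = (\<lambda>z. kan_cls C D F P z ` kan_terms C D F P z),
     pt = (\<lambda>z. kan_cls C D F P z None),
     act = (\<lambda>z w h q. kan_cls C D F P z (kan_pre D F z w h (kan_rep C D F P w q)))\<rparr>"

context
  fixes C :: "('c, 'k) cat" and D :: "('o, 'm) cat" and F :: "('c, 'k, 'o, 'm) ftor"
    and P :: "('c, 'k, 'u::infinite) ppsh"
  assumes F: "is_functor C D F" and P: "pointed_presheaf C P"
begin

private abbreviation "T \<equiv> kan_terms C D F P"
private abbreviation "cls \<equiv> kan_cls C D F P"
private abbreviation "K \<equiv> kan C D F P"

lemma kan_cls_eqI: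
  assumes "\<And>Z f. pointed_presheaf D Z \<Longrightarrow> f \<in> psh_hom C P (restrict_psh F Z) \<Longrightarrow>
    kan_val F Z f z t = kan_val F Z f z t'"
  shows "cls z t = cls z t'"
  using assms unfolding kan_cls_def by auto

lemma kan_cls_eqD:
  assumes "cls z t = cls z t'" "t \<in> T z" "pointed_presheaf D Z" "f \<in> psh_hom C P (restrict_psh F Z)"
  shows "kan_val F Z f z t = kan_val F Z f z t'"
proof -
  have "t \<in> cls z t" using assms(2) unfolding kan_cls_def by auto
  hence "t \<in> cls z t'" unfolding assms(1) .
  hence "kan_val F Z f z t' = kan_val F Z f z t" using assms(3,4) unfolding kan_cls_def by blast
  thus ?thesis by simp
qed

lemma kan_rep: "q \<in> cls z ` T z \<Longrightarrow> kan_rep C D F P z q \<in> T z \<and> cls z (kan_rep C D F P z q) = q"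
  unfolding kan_rep_def by (rule someI_ex) blast

lemma kan_val_rep:
  assumes "t \<in> T z" "pointed_presheaf D Z" "f \<in> psh_hom C P (restrict_psh F Z)"
  shows "kan_val F Z f z (kan_rep C D F P z (cls z t)) = kan_val F Z f z t"
  using kan_cls_eqD[OF _ _ assms(2,3)] kan_rep assms(1) by blast

lemma kan_pre_terms:
  "t \<in> T w \<Longrightarrow> h \<in> hom D z w \<Longrightarrow> z \<in> obj D \<Longrightarrow> w \<in> obj D \<Longrightarrow> kan_pre D F z w h t \<in> T z"
  using fun_obj[OF F] cat_cmp[OF fun_cat(2)[OF F]] unfolding kan_terms_def by auto

lemma kan_val_pre:
  assumes "t \<in> T w" "h \<in> hom D z w" "z \<in> obj D" "w \<in> obj D" "pointed_presheaf D Z"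
    "f \<in> psh_hom C P (restrict_psh F Z)"
  shows "kan_val F Z f z (kan_pre D F z w h t) = act Z z w h (kan_val F Z f w t)"
proof -
  have "f c x \<in> el Z (fobj F c)" if "x \<in> el P c" "c \<in> obj C" for c x
    using pmapD(1)[OF psh_hom_pmap[OF assms(6)]] that by (simp add: restrict_psh_simps)
  thus ?thesis
    using assms presheafD[OF assms(5)] fun_obj[OF F] unfolding kan_terms_def by auto
qed

lemma kan_simps:
  "el K z = cls z ` T z" "pt K z = cls z None"
  by (simp_all add: kan_def)

lemma kan_act:
  assumes "t \<in> T w" "h \<in> hom D z w" "z \<in> obj D" "w \<in> obj D"
  shows "act K z w h (cls w t) = cls z (kan_pre D F z w h t)"
proof -
  have r: "kan_rep C D F P w (cls w t) \<in> T w" using kan_rep assms(1) by blast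
  show ?thesis
    unfolding kan_def using assms r
    by (auto intro!: kan_cls_eqI simp: kan_val_pre kan_val_rep)
qed

lemma kan_presheaf: "pointed_presheaf D K"
  unfolding pointed_presheaf_def
proof (intro conjI ballI)
  have N: "None \<in> T z" for z by (simp add: kan_terms_def)
  note catD = fun_cat(2)[OF F]
  fix a assume a: "a \<in> obj D"
  show "pt K a \<in> el K a" using N by (auto simp: kan_simps)
  {
    fix b f assume b: "b \<in> obj D" "f \<in> hom D a b"
    show "act K a b f \<in> el K b \<rightarrow> el K a"
      using a b kan_pre_terms by (auto simp: kan_simps kan_act)
    show "act K a b f (pt K b) = pt K a"
      using kan_act[OF N b(2) a b(1)] by (simp add: kan_simps)
    fix c g x assume c: "c \<in> obj D" "g \<in> hom D b c" "x \<in> el K c"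
    then obtain t where t: "t \<in> T c" "x = cls c t" by (auto simp: kan_simps)
    have gf: "cmp D a b c g f \<in> hom D a c" using cat_cmp[OF catD b(2) c(2) a b(1) c(1)] .
    have "kan_pre D F a c (cmp D a b c g f) t = kan_pre D F a b f (kan_pre D F b c g t)"
      using t(1) cat_assoc[OF catD b(2) c(2)] a b c fun_obj[OF F] unfolding kan_terms_def by auto
    thus "act K a c (cmp D a b c g f) x = act K a b f (act K b c g x)"
      using t a b c gf kan_pre_terms by (simp add: kan_act)
  }
  fix x assume "x \<in> el K a"
  then obtain t where t: "t \<in> T a" "x = cls a t" by (auto simp: kan_simps)
  have "kan_pre D F a a (ide D a) t = t"
    using t(1) cat_idr[OF catD] a fun_obj[OF F] unfolding kan_terms_def by auto
  thus "act K a a (ide D a) x = x"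
    using t a cat_ide[OF catD] by (simp add: kan_act)
qed

text \<open>A formal element consists of an object, an element of the universe and a morphism from a
  countable set; this is where countability of the index categories enters.\<close>

lemma kan_fits:
  assumes "countable (obj C)" "\<And>z w. countable (hom D z w)"
  shows "psh_fits TYPE('u) D K"
  unfolding psh_fits_def
proof
  fix z
  let ?H = "\<Union>c\<in>obj C. hom D z (fobj F c)"
  have "fits TYPE('u) (insert None (Some ` (obj C \<times> (UNIV :: 'u set) \<times> ?H)))"
    using assms by (intro fits_insert fits_image fits_Times fits_countable fits_UNIV) auto
  hence "fits TYPE('u) (T z)"
    by (rule fits_subset) (auto simp: kan_terms_def)
  thus "fits TYPE('u) (el K z)" unfolding kan_simps by (rule fits_image)
qed

text \<open>The unit sends \<open>x\<close> to the class of \<open>x \<cdot> id\<close>. For its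
  naturality, both sides only need equal values under every test morphism, which is how the classes
  are defined.\<close>

lemma kan_universal:
  assumes fit: "psh_fits TYPE('u) D K"
  shows "\<exists>R \<eta>. pointed_presheaf D (R :: ('o, 'm, 'u) ppsh) \<and> \<eta> \<in> psh_hom C P (restrict_psh F R) \<and>
    (\<forall>(Z :: ('o, 'm, 'u) ppsh) f. pointed_presheaf D Z \<longrightarrow> f \<in> psh_hom C P (restrict_psh F Z) \<longrightarrow>
      (\<exists>!h. h \<in> psh_hom D R Z \<and> psh_comp C P (\<lambda>c\<in>obj C. h (fobj F c)) \<eta> = f))"
proof -
  let ?R = "small K :: ('o, 'm, 'u) ppsh"
  note catD = fun_cat(2)[OF F]
  have R: "pointed_presheaf D ?R" by (rule small_presheaf[OF kan_presheaf fit])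
  define u where "u = (\<lambda>c x. enc (el K (fobj F c)) (cls (fobj F c) (Some (c, x, ide D (fobj F c)))) :: 'u)"
  have t: "Some (c, x, ide D (fobj F c)) \<in> T (fobj F c)" if "c \<in> obj C" "x \<in> el P c" for c x
    using that cat_ide[OF catD] fun_obj[OF F] unfolding kan_terms_def by auto
  have fl: "f c x \<in> el Z (fobj F c)" if "f \<in> psh_hom C P (restrict_psh F Z)" "x \<in> el P c" "c \<in> obj C" for f Z c x
    using pmapD(1)[OF psh_hom_pmap[OF that(1)]] that by (simp add: restrict_psh_simps)
  have "pmap C P (restrict_psh F ?R) u"
    unfolding pmap_def restrict_psh_simps
  proof (intro conjI ballI)
    fix c assume c: "c \<in> obj C"
    { fix x assume "x \<in> el P c"
      thus "u c x \<in> el ?R (fobj F c)" unfolding u_def small_simps kan_simps using t c by blast }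
    have "cls (fobj F c) (Some (c, pt P c, ide D (fobj F c))) = cls (fobj F c) None"
    proof (rule kan_cls_eqI)
      fix Z :: "('o, 'm, 'u) ppsh" and f assume Z: "pointed_presheaf D Z" "f \<in> psh_hom C P (restrict_psh F Z)"
      have "f c (pt P c) = pt Z (fobj F c)"
        using pmapD(2)[OF psh_hom_pmap[OF Z(2)] c] by (simp add: restrict_psh_simps)
      thus "kan_val F Z f (fobj F c) (Some (c, pt P c, ide D (fobj F c))) = kan_val F Z f (fobj F c) None"
        using presheafD(3)[OF Z(1) cat_ide[OF catD]] fun_obj[OF F c] by simp
    qed
    thus "u c (pt P c) = pt ?R (fobj F c)" by (simp add: u_def small_simps kan_simps)
    fix b g x assume b: "b \<in> obj C" "g \<in> hom C c b" "x \<in> el P b"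
    let ?g = "fmap F c b g"
    have g: "?g \<in> hom D (fobj F c) (fobj F b)" using fun_hom[OF F b(2) c b(1)] .
    have "cls (fobj F c) (Some (c, act P c b g x, ide D (fobj F c)))
      = cls (fobj F c) (kan_pre D F (fobj F c) (fobj F b) ?g (Some (b, x, ide D (fobj F b))))"
    proof (rule kan_cls_eqI)
      fix Z :: "('o, 'm, 'u) ppsh" and f assume Z: "pointed_presheaf D Z" "f \<in> psh_hom C P (restrict_psh F Z)"
      have "f c (act P c b g x) = act Z (fobj F c) (fobj F b) ?g (f b x)"
        using pmapD(3)[OF psh_hom_pmap[OF Z(2)] b(2,3) c b(1)] by (simp add: restrict_psh_simps)
      moreover have "act Z (fobj F c) (fobj F b) ?g (f b x) \<in> el Z (fobj F c)"
        using presheafD(2)[OF Z(1) fl[OF Z(2) b(3,1)] g] fun_obj[OF F] c b by blast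
      ultimately show "kan_val F Z f (fobj F c) (Some (c, act P c b g x, ide D (fobj F c)))
        = kan_val F Z f (fobj F c) (kan_pre D F (fobj F c) (fobj F b) ?g (Some (b, x, ide D (fobj F b))))"
        using kan_val_pre[OF t[OF b(1,3)] g _ _ Z] fun_obj[OF F] c b presheafD(4)[OF Z(1)] fl[OF Z(2) b(3,1)]
        by simp
    qed
    thus "u c (act P c b g x) = act ?R (fobj F c) (fobj F b) ?g (u b x)"
      unfolding u_def
      using act_small[OF fit, of "fobj F b" "cls (fobj F b) (Some (b, x, ide D (fobj F b)))" "fobj F c" ?g]
        t[OF b(1,3)] fun_obj[OF F] b c g kan_act[OF t[OF b(1,3)] g] by (simp add: kan_simps)
  qed
  define \<eta> where "\<eta> = (\<lambda>c\<in>obj C. \<lambda>x\<in>el P c. u c x)"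
  have \<eta>: "\<eta> \<in> psh_hom C P (restrict_psh F ?R)"
    unfolding \<eta>_def by (rule restrict_pmap) fact+
  have univ: "\<exists>!h. h \<in> psh_hom D ?R Z \<and> psh_comp C P (\<lambda>c\<in>obj C. h (fobj F c)) \<eta> = f"
    if Z: "pointed_presheaf D Z" "f \<in> psh_hom C P (restrict_psh F Z)" for Z :: "('o, 'm, 'u) ppsh" and f
  proof -
    \<comment> \<open>Evaluate a chosen representative of the decoded class; by
      \<open>kan_val_rep\<close> the choice does not matter.\<close>
    let ?v = "\<lambda>z (y :: 'u). kan_val F Z f z (kan_rep C D F P z (dec (el K z) y))"
    have v: "?v z (enc (el K z) (cls z t)) = kan_val F Z f z t" if "z \<in> obj D" "t \<in> T z" for z t
      using that fit kan_val_rep[OF that(2) Z] imageI[OF that(2), of "cls z"]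
      by (simp add: psh_fits_def dec_enc kan_simps)
    have vT: "kan_val F Z f z t \<in> el Z z" if "z \<in> obj D" "t \<in> T z" for z t
      using that presheafD[OF Z(1)] fl[OF Z(2)] fun_obj[OF F] by (auto simp: kan_terms_def)
    have N: "None \<in> T z" for z by (simp add: kan_terms_def)
    have "pmap D ?R Z ?v"
      unfolding pmap_def
    proof (intro conjI ballI)
      fix z assume z: "z \<in> obj D"
      { fix y assume "y \<in> el ?R z"
        then obtain t where "t \<in> T z" "y = enc (el K z) (cls z t)" by (auto simp: small_simps kan_simps)
        thus "?v z y \<in> el Z z" using v[OF z] vT[OF z] by simp }
      show "?v z (pt ?R z) = pt Z z" using v[OF z N] by (simp add: small_simps kan_simps)
      fix w h y assume w: "w \<in> obj D" "h \<in> hom D z w" "y \<in> el ?R w"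
      then obtain t where t: "t \<in> T w" "y = enc (el K w) (cls w t)" by (auto simp: small_simps kan_simps)
      have "act ?R z w h y = enc (el K z) (cls z (kan_pre D F z w h t))"
        using act_small[OF fit w(1)] kan_act[OF t(1) w(2) z w(1)] t by (simp add: kan_simps)
      thus "?v z (act ?R z w h y) = act Z z w h (?v w y)"
        using v[OF z kan_pre_terms[OF t(1) w(2) z w(1)]] v[OF w(1) t(1)] t(2)
          kan_val_pre[OF t(1) w(2) z w(1) Z] by simp
    qed
    hence h: "(\<lambda>z\<in>obj D. \<lambda>y\<in>el ?R z. ?v z y) \<in> psh_hom D ?R Z" (is "?h \<in> _")
      by (rule restrict_pmap[OF _ R])
    have el\<eta>: "\<eta> c x \<in> el ?R (fobj F c)" if "c \<in> obj C" "x \<in> el P c" for c x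
      using pmapD(1)[OF psh_hom_pmap[OF \<eta>] that(2,1)] by (simp add: restrict_psh_simps)
    have lift: "psh_comp C P (\<lambda>c\<in>obj C. k (fobj F c)) \<eta> \<in> psh_hom C P (restrict_psh F Z)"
      if "k \<in> psh_hom D ?R Z" for k
    proof (rule psh_comp_hom[OF \<eta> _ P])
      show "(\<lambda>c\<in>obj C. k (fobj F c)) \<in> psh_hom C (restrict_psh F ?R) (restrict_psh F Z)"
        using fun_hom[OF restrict_ftor_functor[OF F], of k ?R Z] that R Z by (simp add: psh_simps restrict_ftor_def)
    qed
    show ?thesis
    proof (rule ex1I[where a = ?h], intro conjI h)
      show "psh_comp C P (\<lambda>c\<in>obj C. ?h (fobj F c)) \<eta> = f"
      proof (rule psh_hom_eqI[OF lift[OF h] Z(2)])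
        fix c x assume c: "c \<in> obj C" "x \<in> el P c"
        have "psh_comp C P (\<lambda>c\<in>obj C. ?h (fobj F c)) \<eta> c x = ?v (fobj F c) (\<eta> c x)"
          using c el\<eta> fun_obj[OF F] by (simp add: psh_comp_apply)
        also have "\<dots> = f c x"
          using v[OF fun_obj[OF F c(1)] t[OF c]] c presheafD(4)[OF Z(1) fl[OF Z(2) c(2,1)]] fun_obj[OF F]
          by (simp add: \<eta>_def u_def)
        finally show "psh_comp C P (\<lambda>c\<in>obj C. ?h (fobj F c)) \<eta> c x = f c x" .
      qed
      fix k assume k: "k \<in> psh_hom D ?R Z \<and> psh_comp C P (\<lambda>c\<in>obj C. k (fobj F c)) \<eta> = f"
      show "k = ?h"
      proof (rule psh_hom_eqI[OF conjunct1[OF k] h])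
        fix z y assume z: "z \<in> obj D" "y \<in> el ?R z"
        then obtain t' where t': "t' \<in> T z" "y = enc (el K z) (cls z t')" by (auto simp: small_simps kan_simps)
        have km: "pmap D ?R Z k" using k psh_hom_pmap by blast
        have "k z y = kan_val F Z f z t'"
        proof (cases t')
          case None
          thus ?thesis using pmapD(2)[OF km z(1)] t' by (simp add: small_simps kan_simps)
        next
          case (Some p)
          then obtain c x g where p: "t' = Some (c, x, g)" "c \<in> obj C" "x \<in> el P c" "g \<in> hom D z (fobj F c)"
            using t'(1) by (auto simp: kan_terms_def)
          \<comment> \<open>A formal element \<open>x \<cdot> g\<close> is the restriction along
            \<open>g\<close> of the unit at \<open>x\<close>, so the value of \<open>k\<close> on it
            is determined by \<open>f\<close>.\<close>
          have "kan_pre D F z (fobj F c) g (Some (c, x, ide D (fobj F c))) = t'"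
            using p cat_idl[OF catD p(4) z(1)] fun_obj[OF F] by simp
          hence "y = act ?R z (fobj F c) g (\<eta> c x)"
            using t'(2) p act_small[OF fit, of "fobj F c" "cls (fobj F c) (Some (c, x, ide D (fobj F c)))" z g]
              t[OF p(2,3)] kan_act[OF t[OF p(2,3)] p(4) z(1)] fun_obj[OF F] by (simp add: kan_simps \<eta>_def u_def)
          hence "k z y = act Z z (fobj F c) g (k (fobj F c) (\<eta> c x))"
            using pmapD(3)[OF km p(4) el\<eta>[OF p(2,3)] z(1)] fun_obj[OF F] p by simp
          also have "k (fobj F c) (\<eta> c x) = f c x"
            using conjunct2[OF k] psh_comp_apply[of c C x P "\<lambda>c\<in>obj C. k (fobj F c)" \<eta>] p by auto
          finally show ?thesis using p by simp
        qed
        thus "k z y = ?h z y" using z v[OF z(1) t'(1)] t' by simp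
      qed
    qed
  qed
  show ?thesis
    by (rule exI[where x = ?R], rule exI[where x = \<eta>], intro conjI allI impI R \<eta>) (rule univ)
qed

end

lemma restrict_ftor_left_adjoint:
  fixes F :: "('c, 'k, 'o, 'm) ftor"
  assumes F: "is_functor C D F" and c: "countable (obj C)" "\<And>z w. countable (hom D z w)"
  shows "\<exists>L \<eta> \<epsilon>. adjunction (psh C :: (('c, 'k, 'u::infinite) ppsh, _) cat) (psh D) L (restrict_ftor C F) \<eta> \<epsilon>"
proof -
  have "\<forall>P \<in> obj (psh C :: (('c, 'k, 'u) ppsh, _) cat). \<exists>R \<eta>. pointed_presheaf D (R :: ('o, 'm, 'u) ppsh) \<and>
    \<eta> \<in> psh_hom C P (restrict_psh F R) \<and>
    (\<forall>(Z :: ('o, 'm, 'u) ppsh) f. pointed_presheaf D Z \<longrightarrow> f \<in> psh_hom C P (restrict_psh F Z) \<longrightarrow>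
      (\<exists>!h. h \<in> psh_hom D R Z \<and> psh_comp C P (\<lambda>c\<in>obj C. h (fobj F c)) \<eta> = f))"
    using kan_universal[OF F _ kan_fits[OF F _ c]] by (auto simp: psh_simps)
  then obtain R \<eta> where "\<forall>P \<in> obj (psh C :: (('c, 'k, 'u) ppsh, _) cat). pointed_presheaf D (R P :: ('o, 'm, 'u) ppsh) \<and>
    \<eta> P \<in> psh_hom C P (restrict_psh F (R P)) \<and>
    (\<forall>(Z :: ('o, 'm, 'u) ppsh) f. pointed_presheaf D Z \<longrightarrow> f \<in> psh_hom C P (restrict_psh F Z) \<longrightarrow>
      (\<exists>!h. h \<in> psh_hom D (R P) Z \<and> psh_comp C P (\<lambda>c\<in>obj C. h (fobj F c)) (\<eta> P) = f))"
    by metis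
  hence R: "pointed_presheaf D (R P)" "\<eta> P \<in> psh_hom C P (restrict_psh F (R P))"
    "\<And>(Z :: ('o, 'm, 'u) ppsh) f. pointed_presheaf D Z \<Longrightarrow> f \<in> psh_hom C P (restrict_psh F Z) \<Longrightarrow>
      \<exists>!h. h \<in> psh_hom D (R P) Z \<and> psh_comp C P (\<lambda>c\<in>obj C. h (fobj F c)) (\<eta> P) = f"
    if "pointed_presheaf C P" for P :: "('c, 'k, 'u) ppsh"
    using that by (simp_all add: psh_simps)
  show ?thesis
    by (rule left_adjoint_from_universal_arrows[OF restrict_ftor_functor[OF F], where ?F0.0 = R and \<eta> = \<eta>];
      simp add: psh_simps restrict_ftor_def; fact R)
qed

section \<open>The simplex category\<close>

lemma smp_hom_iff:
  "\<phi> \<in> hom smp n m \<longleftrightarrow> \<phi> \<in> extensional {..n} \<and> (\<forall>x\<le>n. \<phi> x \<le> m) \<and>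
     (\<forall>x y. x \<le> y \<longrightarrow> y \<le> n \<longrightarrow> \<phi> x \<le> \<phi> y)"
  unfolding smp_def mono_on_def PiE_iff by (auto dest: order_trans)

lemma smp_simps:
  "obj smp = UNIV" "ide smp n = (\<lambda>x\<in>{..n}. x)" "cmp smp n m p g f = compose {..n} g f"
  by (simp_all add: smp_def)

lemma smp_cmp_apply: "x \<le> n \<Longrightarrow> cmp smp n m p g f x = g (f x)"
  by (simp add: smp_simps compose_def)

lemma category_smp: "category smp"
  unfolding category_def
  by (auto simp: smp_hom_iff smp_simps compose_def extensional_def fun_eq_iff)

lemma coface_hom: "i \<le> Suc n \<Longrightarrow> coface n i \<in> hom smp n (Suc n)"
  by (auto simp: smp_hom_iff coface_def)

lemma codegen_hom: "j \<le> n \<Longrightarrow> codegen n j \<in> hom smp (Suc n) n"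
  by (auto simp: smp_hom_iff codegen_def)

lemma smp_hom_eqI:
  "\<phi> \<in> hom smp n m \<Longrightarrow> \<psi> \<in> hom smp n m' \<Longrightarrow> (\<And>x. x \<le> n \<Longrightarrow> \<phi> x = \<psi> x) \<Longrightarrow> \<phi> = \<psi>"
  by (rule extensionalityI[where A = "{..n}"]) (simp_all add: smp_hom_iff)

section \<open>A model of the stable simplex category\<close>

text \<open>Models the maps from any \<open>[z]\<close> to \<open>[z + k]\<close>: every generator
  exists at every object, so a hom-set of \<open>stab\<close> depends only on the degree
  \<open>k\<close>.\<close>

definition shifts :: "int \<Rightarrow> (nat \<Rightarrow> nat) set" where
  "shifts k = {f. mono f \<and> (\<exists>N. \<forall>x\<ge>N. int (f x) = int x + k)}"

fun gen_map :: "gen \<Rightarrow> nat \<Rightarrow> nat" where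
  "gen_map (Face i) x = (if x < i then x else Suc x)"
| "gen_map (Degen j) x = (if x \<le> j then x else x - 1)"

fun word_map :: "gen list \<Rightarrow> nat \<Rightarrow> nat" where
  "word_map [] = id"
| "word_map (g # w) = gen_map g \<circ> word_map w"

lemma word_map_append: "word_map (u @ v) = word_map u \<circ> word_map v"
  by (induction u) (simp_all add: o_assoc)

lemma shifts_id: "id \<in> shifts 0"
  by (simp add: shifts_def mono_def)

lemma shifts_comp:
  assumes "f \<in> shifts j" "g \<in> shifts k" shows "g \<circ> f \<in> shifts (j + k)"
proof -
  obtain M N where M: "\<And>x. x \<ge> M \<Longrightarrow> int (f x) = int x + j" and N: "\<And>x. x \<ge> N \<Longrightarrow> int (g x) = int x + k"
    using assms unfolding shifts_def by blast
  have "int ((g \<circ> f) x) = int x + (j + k)" if "x \<ge> max M (nat (int N - j))" for x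
  proof -
    have "int (f x) = int x + j" using M that by simp
    moreover from this have "f x \<ge> N" using that by linarith
    ultimately show ?thesis using N by simp
  qed
  moreover have "mono (g \<circ> f)" using assms by (auto simp: shifts_def mono_def)
  ultimately show ?thesis unfolding shifts_def by blast
qed

lemma shifts_unique: "f \<in> shifts j \<Longrightarrow> f \<in> shifts k \<Longrightarrow> j = k"
proof -
  assume "f \<in> shifts j" "f \<in> shifts k"
  then obtain M N where "\<And>x. x \<ge> M \<Longrightarrow> int (f x) = int x + j" "\<And>x. x \<ge> N \<Longrightarrow> int (f x) = int x + k"
    unfolding shifts_def by blast
  from this[of "max M N"] show ?thesis by simp
qed

lemma gen_map_shifts: "gen_map g \<in> shifts (gdeg g)"
proof (cases g)
  case (Face i)
  thus ?thesis by (auto simp: shifts_def mono_def intro!: exI[where x = i])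
next
  case (Degen j)
  thus ?thesis by (auto simp: shifts_def mono_def intro!: exI[where x = "Suc j"])
qed

lemma word_map_shifts: "word_map w \<in> shifts (wdeg w)"
proof (induction w)
  case (Cons g w)
  have "gdeg g + wdeg w = wdeg (g # w)" by (simp add: wdeg_def)
  thus ?case using shifts_comp[OF Cons gen_map_shifts[of g]] by (simp add: add.commute comp_def)
qed (simp add: wdeg_def shifts_id[unfolded id_def])

lemma word_map_cosimp_eq: "cosimp_eq u v \<Longrightarrow> word_map u = word_map v"
  by (induction rule: cosimp_eq.induct) (auto simp: fun_eq_iff word_map_append)

section \<open>Normal forms of words in the generators\<close>

lemma cosimp_eq_append: "cosimp_eq u u' \<Longrightarrow> cosimp_eq v v' \<Longrightarrow> cosimp_eq (u @ v) (u' @ v')"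
  using cosimp_eq.cong[of u u' "[]" v] cosimp_eq.cong[of v v' u' "[]"] cosimp_eq.trans by simp

lemma cosimp_eq_Cons: "cosimp_eq u v \<Longrightarrow> cosimp_eq (g # u) (g # v)"
  using cosimp_eq.cong[of u v "[g]" "[]"] by simp

text \<open>Insertion sort with the rule d^i d^x = d^(x+1) d^i for i \<le> x. The bound on the new
  entries keeps the head \<open>Suc x\<close> strictly above the sorted tail.\<close>

lemma face_insert:
  "sorted_wrt (>) xs \<Longrightarrow> \<exists>ys. cosimp_eq (Face i # map Face xs) (map Face ys) \<and> sorted_wrt (>) ys \<and>
     (\<forall>y\<in>set ys. y \<le> i \<or> (\<exists>x\<in>set xs. y \<le> Suc x))"
proof (induction xs)
  case Nil
  show ?case by (rule exI[where x = "[i]"]) (auto intro: cosimp_eq.refl)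
next
  case (Cons x xs)
  show ?case
  proof (cases "i > x")
    case True
    thus ?thesis using Cons.prems
      by (intro exI[where x = "i # x # xs"]) (auto intro: cosimp_eq.refl)
  next
    case False
    obtain ys where ys: "cosimp_eq (Face i # map Face xs) (map Face ys)" "sorted_wrt (>) ys"
      "\<forall>y\<in>set ys. y \<le> i \<or> (\<exists>x\<in>set xs. y \<le> Suc x)" using Cons by auto
    have "cosimp_eq [Face i, Face x] [Face (Suc x), Face i]"
      using False cosimp_eq.sym[OF cosimp_eq.face_face[of i "Suc x"]] by simp
    from cosimp_eq_append[OF this cosimp_eq.refl[of "map Face xs"]]
    have "cosimp_eq (Face i # map Face (x # xs)) (Face (Suc x) # Face i # map Face xs)" by simp
    hence "cosimp_eq (Face i # map Face (x # xs)) (map Face (Suc x # ys))"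
      using cosimp_eq.trans cosimp_eq_Cons[OF ys(1)] by simp
    moreover have "sorted_wrt (>) (Suc x # ys)"
      using ys(2,3) False Cons.prems by fastforce
    ultimately show ?thesis using ys(3) by (intro exI[where x = "Suc x # ys"]) auto
  qed
qed

text \<open>Insertion sort with the rule s^i s^x = s^x s^(i+1) for x \<le> i. The inserted index
  grows while it moves inwards, so the induction is over all \<open>i\<close>.\<close>

lemma degen_insert:
  "sorted_wrt (<) xs \<Longrightarrow> \<exists>ys. cosimp_eq (Degen i # map Degen xs) (map Degen ys) \<and> sorted_wrt (<) ys \<and>
     (\<forall>y\<in>set ys. i \<le> y \<or> (\<exists>x\<in>set xs. x \<le> y))"
proof (induction xs arbitrary: i)
  case Nil
  show ?case by (rule exI[where x = "[i]"]) (auto intro: cosimp_eq.refl)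
next
  case (Cons x xs)
  show ?case
  proof (cases "i < x")
    case True
    thus ?thesis using Cons.prems
      by (intro exI[where x = "i # x # xs"]) (auto intro: cosimp_eq.refl)
  next
    case False
    obtain ys where ys: "cosimp_eq (Degen (Suc i) # map Degen xs) (map Degen ys)" "sorted_wrt (<) ys"
      "\<forall>y\<in>set ys. Suc i \<le> y \<or> (\<exists>x\<in>set xs. x \<le> y)" using Cons.IH[of "Suc i"] Cons.prems by auto
    have "cosimp_eq [Degen i, Degen x] [Degen x, Degen (Suc i)]"
      using False cosimp_eq.degen_degen[of x i] by simp
    from cosimp_eq_append[OF this cosimp_eq.refl[of "map Degen xs"]]
    have "cosimp_eq (Degen i # map Degen (x # xs)) (Degen x # Degen (Suc i) # map Degen xs)" by simp
    hence "cosimp_eq (Degen i # map Degen (x # xs)) (map Degen (x # ys))"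
      using cosimp_eq.trans cosimp_eq_Cons[OF ys(1)] by simp
    moreover have "sorted_wrt (<) (x # ys)"
      using ys(2,3) False Cons.prems by fastforce
    ultimately show ?thesis using ys(3) False by (intro exI[where x = "x # ys"]) auto
  qed
qed

lemma face_sort: "\<exists>ys. cosimp_eq (map Face xs) (map Face ys) \<and> sorted_wrt (>) ys"
proof (induction xs)
  case Nil
  show ?case by (rule exI[where x = "[]"]) (simp add: cosimp_eq.refl)
next
  case (Cons x xs)
  then obtain ys where ys: "cosimp_eq (map Face xs) (map Face ys)" "sorted_wrt (>) ys" by blast
  obtain zs where "cosimp_eq (Face x # map Face ys) (map Face zs)" "sorted_wrt (>) zs"
    using face_insert[OF ys(2)] by blast
  thus ?case using cosimp_eq.trans[OF cosimp_eq_Cons[OF ys(1)]] by (intro exI[where x = zs]) simp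
qed

lemma degen_sort: "\<exists>ys. cosimp_eq (map Degen xs) (map Degen ys) \<and> sorted_wrt (<) ys"
proof (induction xs)
  case Nil
  show ?case by (rule exI[where x = "[]"]) (simp add: cosimp_eq.refl)
next
  case (Cons x xs)
  then obtain ys where ys: "cosimp_eq (map Degen xs) (map Degen ys)" "sorted_wrt (<) ys" by blast
  obtain zs where "cosimp_eq (Degen x # map Degen ys) (map Degen zs)" "sorted_wrt (<) zs"
    using degen_insert[OF ys(2)] by blast
  thus ?case using cosimp_eq.trans[OF cosimp_eq_Cons[OF ys(1)]] by (intro exI[where x = zs]) simp
qed

text \<open>At each exchange the degeneracy either survives with a possibly changed index or cancels
  against a face, and cancellation ends the process.\<close>

lemma degen_past_faces:
  "\<exists>ys zs. cosimp_eq (Degen j # map Face xs) (map Face ys @ map Degen zs)"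
proof (induction xs arbitrary: j)
  case Nil
  show ?case by (rule exI[where x = "[]"], rule exI[where x = "[j]"]) (simp add: cosimp_eq.refl)
next
  case (Cons x xs)
  have swap: ?case if "cosimp_eq [Degen j, Face x] [Face x', Degen j']" for x' j'
  proof -
    obtain ys zs where "cosimp_eq (Degen j' # map Face xs) (map Face ys @ map Degen zs)"
      using Cons by blast
    hence "cosimp_eq (Face x' # Degen j' # map Face xs) (map Face (x' # ys) @ map Degen zs)"
      using cosimp_eq_Cons by simp
    moreover have "cosimp_eq (Degen j # map Face (x # xs)) (Face x' # Degen j' # map Face xs)"
      using cosimp_eq_append[OF that cosimp_eq.refl[of "map Face xs"]] by simp
    ultimately show ?thesis using cosimp_eq.trans by blast
  qed
  consider "x < j" | "x = j \<or> x = j + 1" | "x > j + 1" by linarith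
  thus ?case
  proof cases
    case 1 thus ?thesis using swap cosimp_eq.degen_face_lt by blast
  next
    case 2
    have "cosimp_eq (Degen j # map Face (x # xs)) (map Face xs)"
      using cosimp_eq_append[OF cosimp_eq.degen_face_id[OF 2] cosimp_eq.refl[of "map Face xs"]] by simp
    thus ?thesis by (intro exI[where x = xs] exI[where x = "[]"]) simp
  next
    case 3 thus ?thesis using swap cosimp_eq.degen_face_gt by blast
  qed
qed

lemma normal_form:
  "\<exists>xs ys. cosimp_eq w (map Face xs @ map Degen ys) \<and> sorted_wrt (>) xs \<and> sorted_wrt (<) ys"
proof -
  have "\<exists>xs ys. cosimp_eq w (map Face xs @ map Degen ys)"
  proof (induction w)
    case Nil
    show ?case by (rule exI[where x = "[]"], rule exI[where x = "[]"]) (simp add: cosimp_eq.refl)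
  next
    case (Cons g w)
    then obtain xs ys where 1: "cosimp_eq w (map Face xs @ map Degen ys)" by blast
    show ?case
    proof (cases g)
      case (Face i)
      thus ?thesis using cosimp_eq_Cons[OF 1, of g] by (intro exI[where x = "i # xs"] exI[where x = ys]) simp
    next
      case (Degen j)
      obtain us zs where 2: "cosimp_eq (Degen j # map Face xs) (map Face us @ map Degen zs)"
        using degen_past_faces by blast
      have "cosimp_eq (g # w) ((Degen j # map Face xs) @ map Degen ys)"
        using cosimp_eq_Cons[OF 1, of g] Degen by simp
      hence "cosimp_eq (g # w) ((map Face us @ map Degen zs) @ map Degen ys)"
        using cosimp_eq_append[OF 2 cosimp_eq.refl] cosimp_eq.trans by blast
      thus ?thesis by (intro exI[where x = us] exI[where x = "zs @ ys"]) simp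
    qed
  qed
  then obtain xs ys where "cosimp_eq w (map Face xs @ map Degen ys)" by blast
  thus ?thesis using face_sort[of xs] degen_sort[of ys] cosimp_eq_append cosimp_eq.trans by meson
qed

text \<open>The outermost face has the largest index, so it does not move the values omitted by the
  inner ones: the omitted values are the indices themselves.\<close>

lemma range_faces: "sorted_wrt (>) xs \<Longrightarrow> range (word_map (map Face xs)) = - set xs"
proof (induction xs)
  case (Cons x xs)
  hence IH: "range (word_map (map Face xs)) = - set xs" and lt: "\<And>y. y \<in> set xs \<Longrightarrow> y < x" by auto
  have "gen_map (Face x) ` (- set xs) = - set (x # xs)"
  proof (rule set_eqI, rule iffI)
    fix y assume "y \<in> gen_map (Face x) ` (- set xs)"
    thus "y \<in> - set (x # xs)" by (auto split: if_splits dest: lt)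
  next
    fix y assume y: "y \<in> - set (x # xs)"
    show "y \<in> gen_map (Face x) ` (- set xs)"
    proof (cases "y < x")
      case True thus ?thesis using y by (intro image_eqI[where x = y]) auto
    next
      case False thus ?thesis using y lt[of "y - 1"] by (intro image_eqI[where x = "y - 1"]) auto
    qed
  qed
  thus ?case using IH by (simp only: list.map word_map.simps image_comp[symmetric])
qed simp

lemma inj_faces: "inj (word_map (map Face xs))"
proof (induction xs)
  case (Cons x xs)
  have "inj (gen_map (Face x))" by (rule injI) (auto split: if_splits)
  thus ?case using Cons by (simp only: list.map word_map.simps inj_compose)
qed simp

lemma surj_degens: "surj (word_map (map Degen ys))"
proof (induction ys)
  case (Cons y ys)
  have "gen_map (Degen y) (if x \<le> y then x else Suc x) = x" for x by simp
  hence "surj (gen_map (Degen y))" by (rule surjI)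
  thus ?case using Cons by (simp only: list.map word_map.simps comp_surj)
qed simp

lemma degens_fix: "\<forall>y\<in>set ys. x \<le> y \<Longrightarrow> word_map (map Degen ys) x = x"
  by (induction ys) simp_all

text \<open>The outermost degeneracy has the smallest index \<open>y\<close>, and the inner ones fix
  everything up to \<open>Suc y\<close>. So no index is disturbed by the others, and each one
  identifies its own pair of neighbours.\<close>

lemma degens_fibre:
  "sorted_wrt (<) ys \<Longrightarrow> word_map (map Degen ys) k = word_map (map Degen ys) (Suc k) \<longleftrightarrow> k \<in> set ys"
proof (induction ys)
  case (Cons y ys)
  let ?g = "word_map (map Degen ys)"
  have lt: "\<forall>z\<in>set ys. Suc y \<le> z" using Cons.prems by auto
  have fix1: "?g z = z" if "z \<le> Suc y" for z using lt that by (intro degens_fix) auto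
  have "mono ?g" using word_map_shifts by (auto simp: shifts_def)
  hence ge: "?g z \<ge> Suc y" if "z \<ge> Suc y" for z using that fix1[of "Suc y"] by (metis monoD order_refl)
  consider "k < y" | "k = y" | "k > y" by linarith
  thus ?case
  proof cases
    case 1
    hence "?g k = k" "?g (Suc k) = Suc k" "k \<notin> set ys" using fix1 lt by auto
    thus ?thesis using 1 by simp
  next
    case 2 thus ?thesis using fix1[of k] fix1[of "Suc k"] by simp
  next
    case 3
    hence "?g k \<ge> Suc y" "?g (Suc k) \<ge> Suc y" using ge by auto
    thus ?thesis using 3 Cons by auto
  qed
qed simp

text \<open>Completeness of the cosimplicial identities: a normal form can be read off from its
  function. The omitted values give the faces; the faces being injective, they cancel, and the
  identified neighbours give the degeneracies.\<close>

lemma cosimp_eq_iff: "cosimp_eq u v \<longleftrightarrow> word_map u = word_map v"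
proof
  assume eq: "word_map u = word_map v"
  obtain xs ys where u: "cosimp_eq u (map Face xs @ map Degen ys)" "sorted_wrt (>) xs" "sorted_wrt (<) ys"
    using normal_form by blast
  obtain xs' ys' where v: "cosimp_eq v (map Face xs' @ map Degen ys')" "sorted_wrt (>) xs'" "sorted_wrt (<) ys'"
    using normal_form by blast
  have ev: "word_map (map Face xs) \<circ> word_map (map Degen ys) = word_map (map Face xs') \<circ> word_map (map Degen ys')"
    using eq word_map_cosimp_eq[OF u(1)] word_map_cosimp_eq[OF v(1)] by (simp add: word_map_append)
  have "range (word_map (map Face xs) \<circ> word_map (map Degen ys)) = - set xs"
    "range (word_map (map Face xs') \<circ> word_map (map Degen ys')) = - set xs'"
    using surj_degens range_faces u(2) v(2) by (simp_all only: image_comp[symmetric])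
  hence "- set xs = - set xs'" using ev by simp
  hence "set xs = set xs'" by simp
  moreover have "sorted_wrt (<) (rev xs)" "sorted_wrt (<) (rev xs')"
    using u(2) v(2) by (simp_all add: sorted_wrt_rev)
  ultimately have 1: "xs = xs'" using strict_sorted_equal[of "rev xs" "rev xs'"] by simp
  have "word_map (map Degen ys) = word_map (map Degen ys')"
    using ev inj_faces[of xs] unfolding 1 by (simp add: fun.inj_map_strong inj_eq fun_eq_iff)
  hence "set ys = set ys'" using degens_fibre[OF u(3)] degens_fibre[OF v(3)] by auto
  hence 2: "ys = ys'" using strict_sorted_equal[OF u(3) v(3)] by simp
  show "cosimp_eq u v"
    using u(1) v(1) cosimp_eq.sym cosimp_eq.trans unfolding 1 2 by blast
qed (rule word_map_cosimp_eq)

definition map_cls :: "(nat \<Rightarrow> nat) \<Rightarrow> gen list set" where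
  "map_cls f = {u. word_map u = f}"

lemma wcls_map_cls: "wcls w = map_cls (word_map w)"
  unfolding wcls_def map_cls_def cosimp_eq_iff by auto

text \<open>The extension of \<open>\<phi> : [n] \<rightarrow> [m]\<close> by the common value of all \<open>K\<^sup>j \<phi>\<close>.\<close>

definition stab_ext :: "nat \<Rightarrow> nat \<Rightarrow> (nat \<Rightarrow> nat) \<Rightarrow> nat \<Rightarrow> nat" where
  "stab_ext n m \<phi> x = (if x \<le> n then \<phi> x else m + (x - n))"

lemma stab_ext_shifts: "\<phi> \<in> hom smp n m \<Longrightarrow> stab_ext n m \<phi> \<in> shifts (int m - int n)"
  unfolding shifts_def stab_ext_def mono_def smp_hom_iff
  by (auto intro!: exI[where x = "Suc n"] intro: trans_le_add1 order_trans)

lemma stab_ext_cmp: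
  "\<phi> \<in> hom smp n m \<Longrightarrow> \<psi> \<in> hom smp m p \<Longrightarrow> stab_ext n p (cmp smp n m p \<psi> \<phi>) = stab_ext m p \<psi> \<circ> stab_ext n m \<phi>"
  by (auto simp: fun_eq_iff stab_ext_def smp_hom_iff smp_cmp_apply)

lemma stab_ext_ide: "stab_ext n n (ide smp n) = id"
  by (auto simp: fun_eq_iff stab_ext_def smp_simps)

lemma stab_ext_coface: "i \<le> Suc n \<Longrightarrow> stab_ext n (Suc n) (coface n i) = gen_map (Face i)"
  by (auto simp: fun_eq_iff stab_ext_def coface_def)

lemma stab_ext_codegen: "j \<le> n \<Longrightarrow> stab_ext (Suc n) n (codegen n j) = gen_map (Degen j)"
  by (auto simp: fun_eq_iff stab_ext_def codegen_def)

lemma stab_ext_inj: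
  assumes "\<phi> \<in> hom smp n m" "\<psi> \<in> hom smp n m" "stab_ext n m \<phi> = stab_ext n m \<psi>" shows "\<phi> = \<psi>"
proof (rule smp_hom_eqI[OF assms(1,2)])
  fix x assume "x \<le> n" thus "\<phi> x = \<psi> x" using fun_cong[OF assms(3), of x] by (simp add: stab_ext_def)
qed

lemma Kpow_hom: "\<phi> \<in> hom smp n m \<Longrightarrow> Kpow j n m \<phi> \<in> hom smp (n + j) (m + j)"
  by (induction j) (simp_all add: Kmap_hom)

lemma stab_ext_Kmap: "stab_ext (Suc n) (Suc m) (Kmap n m \<phi>) = stab_ext n m \<phi>"
  by (auto simp: fun_eq_iff stab_ext_def Kmap_def)

lemma stab_ext_Kpow: "stab_ext (n + j) (m + j) (Kpow j n m \<phi>) = stab_ext n m \<phi>"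
  by (induction j) (simp_all add: stab_ext_Kmap)

text \<open>Beyond the point where \<open>f\<close> becomes a translation, \<open>f\<close> is
  determined by its restriction to \<open>{..n}\<close>. The bound is uniform in \<open>n\<close>
  because sphericity survives raising \<open>n\<close>, so dimensions are later chosen
  large.\<close>

lemma shifts_eq_ext:
  assumes "f \<in> shifts k"
  shows "\<exists>N. \<forall>n\<ge>N. \<forall>m. int m = int n + k \<longrightarrow> (\<exists>\<phi>\<in>hom smp n m. f = stab_ext n m \<phi>)"
proof -
  obtain N where N: "\<And>x. x \<ge> N \<Longrightarrow> int (f x) = int x + k" and f: "mono f"
    using assms unfolding shifts_def by blast
  have "\<exists>\<phi>\<in>hom smp n m. f = stab_ext n m \<phi>" if n: "n \<ge> N" and m: "int m = int n + k" for n m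
  proof
    have fn: "f n = m" using N[OF n] m by linarith
    show "(\<lambda>x\<in>{..n}. f x) \<in> hom smp n m"
      using f fn by (auto simp: smp_hom_iff mono_def)
    show "f = stab_ext n m (\<lambda>x\<in>{..n}. f x)"
    proof
      fix x show "f x = stab_ext n m (\<lambda>x\<in>{..n}. f x) x"
        using N[of x] n m by (cases "x \<le> n") (simp_all add: stab_ext_def)
    qed
  qed
  thus ?thesis by blast
qed

lemma word_rep_ext: "word_rep n m w \<phi> \<Longrightarrow> \<phi> \<in> hom smp n m \<and> word_map w = stab_ext n m \<phi>"
proof (induction rule: word_rep.induct)
  case (empty n)
  thus ?case using cat_ide[OF category_smp] by (simp add: stab_ext_ide smp_simps(1))
next
  case (face n m w \<phi> i)
  thus ?case using stab_ext_cmp[OF _ coface_hom] cat_cmp[OF category_smp _ coface_hom]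
    by (simp add: stab_ext_coface smp_simps(1))
next
  case (degen n m w \<phi> j)
  thus ?case using stab_ext_cmp[OF _ codegen_hom] cat_cmp[OF category_smp _ codegen_hom]
    by (simp add: stab_ext_codegen smp_simps(1))
qed

lemma word_rep_append:
  "word_rep m p w \<psi> \<Longrightarrow> word_rep n m v \<phi> \<Longrightarrow> word_rep n p (w @ v) (cmp smp n m p \<psi> \<phi>)"
proof (induction rule: word_rep.induct)
  case (empty m)
  thus ?case using word_rep_ext[OF empty] cat_idl[OF category_smp] by (simp add: smp_simps(1))
next
  case (face m p w \<psi> i)
  have "word_rep n (Suc p) (Face i # w @ v) (cmp smp n p (Suc p) (coface p i) (cmp smp n m p \<psi> \<phi>))"
    using face by (intro word_rep.face) auto
  thus ?case
    using word_rep_ext[OF face.prems] word_rep_ext[OF face.hyps(1)] coface_hom[OF face.hyps(2)]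
      cat_assoc[OF category_smp, of \<phi> n m \<psi> p "coface p i" "Suc p"] by (simp add: smp_simps(1))
next
  case (degen m p w \<psi> j)
  have "word_rep n p (Degen j # w @ v) (cmp smp n (Suc p) p (codegen p j) (cmp smp n m (Suc p) \<psi> \<phi>))"
    using degen by (intro word_rep.degen) auto
  thus ?case
    using word_rep_ext[OF degen.prems] word_rep_ext[OF degen.hyps(1)] codegen_hom[OF degen.hyps(2)]
      cat_assoc[OF category_smp, of \<phi> n m \<psi> "Suc p" "codegen p j" p] by (simp add: smp_simps(1))
qed

text \<open>Induction on \<open>n + m\<close>: a value taken twice in a row splits off a degeneracy,
  an omitted value splits off a coface, and a map with neither is an identity.\<close>

lemma word_rep_exists: "\<phi> \<in> hom smp n m \<Longrightarrow> \<exists>w. word_rep n m w \<phi>"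
proof (induction "n + m" arbitrary: n m \<phi> rule: less_induct)
  case less
  note \<phi> = less.prems
  have le: "\<And>x. x \<le> n \<Longrightarrow> \<phi> x \<le> m" and mono: "\<And>x y. x \<le> y \<Longrightarrow> y \<le> n \<Longrightarrow> \<phi> x \<le> \<phi> y"
    using \<phi> by (auto simp: smp_hom_iff)
  consider j where "j < n" "\<phi> j = \<phi> (Suc j)"
    | i where "\<forall>j<n. \<phi> j \<noteq> \<phi> (Suc j)" "i \<le> m" "i \<notin> \<phi> ` {..n}"
    | "\<forall>j<n. \<phi> j \<noteq> \<phi> (Suc j)" "\<forall>i\<le>m. i \<in> \<phi> ` {..n}"
    by blast
  thus ?case
  proof cases
    case 1
    then obtain n' where n: "n = Suc n'" by (cases n) auto
    define \<phi>' where "\<phi>' = (\<lambda>x\<in>{..n'}. if x \<le> j then \<phi> x else \<phi> (Suc x))"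
    have h: "\<phi>' \<in> hom smp n' m"
      unfolding \<phi>'_def smp_hom_iff using le mono n by auto
    obtain w where w: "word_rep n' m w \<phi>'" using less.hyps[OF _ h] n by auto
    have d: "word_rep n n' [Degen j] (codegen n' j)"
      using word_rep.degen[OF word_rep.empty, of j n'] 1 n codegen_hom[of j n']
        cat_idr[OF category_smp, of "codegen n' j" "Suc n'" n'] by (simp add: smp_simps(1))
    have "\<phi> = cmp smp n n' m \<phi>' (codegen n' j)"
    proof (rule smp_hom_eqI[OF \<phi>])
      show "cmp smp n n' m \<phi>' (codegen n' j) \<in> hom smp n m"
        using cat_cmp[OF category_smp codegen_hom h, of j] 1 n by (simp add: smp_simps(1))
      fix x assume x: "x \<le> n"
      thus "\<phi> x = cmp smp n n' m \<phi>' (codegen n' j) x"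
        using 1 n by (cases "x = Suc j") (auto simp: smp_cmp_apply \<phi>'_def codegen_def)
    qed
    thus ?thesis using word_rep_append[OF w d] by auto
  next
    case 2
    have "m \<noteq> 0"
    proof
      assume "m = 0" thus False using 2 le[of 0] imageI[of 0 "{..n}" \<phi>] by auto
    qed
    then obtain m' where m: "m = Suc m'" by (cases m) auto
    have ni: "\<phi> x \<noteq> i" if "x \<le> n" for x using 2 that by auto
    define \<phi>' where "\<phi>' = (\<lambda>x\<in>{..n}. if \<phi> x < i then \<phi> x else \<phi> x - 1)"
    have h: "\<phi>' \<in> hom smp n m'"
      unfolding smp_hom_iff
    proof (intro conjI allI impI)
      fix x assume x: "x \<le> n"
      show "\<phi>' x \<le> m'" using le[OF x] 2(2) m x by (auto simp: \<phi>'_def)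
    next
      fix x y assume "x \<le> y" "y \<le> n"
      thus "\<phi>' x \<le> \<phi>' y" using mono[of x y] ni[of x] ni[of y] by (auto simp: \<phi>'_def)
    qed (simp add: \<phi>'_def)
    obtain w where w: "word_rep n m' w \<phi>'" using less.hyps[OF _ h] m by auto
    have "\<phi> = cmp smp n m' m (coface m' i) \<phi>'"
    proof (rule smp_hom_eqI[OF \<phi>])
      show "cmp smp n m' m (coface m' i) \<phi>' \<in> hom smp n m"
        using cat_cmp[OF category_smp h coface_hom, of i] 2 m by (simp add: smp_simps(1))
      fix x assume x: "x \<le> n"
      hence "\<phi>' x \<le> m'" using h by (simp add: smp_hom_iff)
      thus "\<phi> x = cmp smp n m' m (coface m' i) \<phi>' x"
        using ni[OF x] x by (auto simp: smp_cmp_apply \<phi>'_def coface_def)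
    qed
    thus ?thesis using word_rep.face[OF w, of i] 2 m by auto
  next
    case 3
    \<comment> \<open>Strong induction: the value \<open>x\<close> is attained, and only at a place
      that is at least \<open>x\<close>, so \<open>\<phi> x \<le> x\<close>. Without repetitions
      \<open>\<phi>\<close> also grows by at least one at each place.\<close>
    have id: "\<phi> x = x" if "x \<le> n" "x \<le> m" for x
      using that
    proof (induction x rule: less_induct)
      case (less x)
      obtain y where y: "y \<le> n" "\<phi> y = x" using 3(2) less.prems by force
      have "y \<ge> x" using less.IH[of y] y less.prems by force
      hence up: "\<phi> x \<le> x" using mono[of x y] y by simp
      show ?case
      proof (cases x)
        case (Suc x')
        hence "\<phi> x' = x'" using less by simp
        moreover have "\<phi> x' \<noteq> \<phi> x" using 3(1) Suc less.prems by auto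
        moreover have "\<phi> x' \<le> \<phi> x" using mono[of x' x] Suc less.prems by simp
        ultimately show ?thesis using up Suc by linarith
      qed (use up in simp)
    qed
    have nm: "n = m"
    proof (rule ccontr)
      assume "n \<noteq> m"
      then consider "m < n" | "n < m" by linarith
      thus False
      proof cases
        case 1
        thus False using id[of m] 3(1) mono[of m "Suc m"] le[of "Suc m"] by force
      next
        case 2
        hence "Suc n \<in> \<phi> ` {..n}" using 3(2) by simp
        then obtain y where "y \<le> n" "\<phi> y = Suc n" by auto
        thus False using id[of y] 2 by simp
      qed
    qed
    have "\<phi> = ide smp n"
      by (rule smp_hom_eqI[OF \<phi>[unfolded nm]]; use cat_ide[OF category_smp, of n] id nm in \<open>simp add: smp_simps\<close>)
    thus ?thesis using word_rep.empty[of n] nm by auto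
  qed
qed

text \<open>All words for \<open>\<phi>\<close> evaluate to the extension of \<open>\<phi>\<close>,
  so the union in \<open>stab_word\<close> is a single class, and a word for \<open>\<phi>\<close>
  exists.\<close>

lemma stab_word_map_cls: "\<phi> \<in> hom smp n m \<Longrightarrow> stab_word n m \<phi> = map_cls (stab_ext n m \<phi>)"
  unfolding stab_word_def map_cls_def cosimp_eq_iff
  using word_rep_exists word_rep_ext by fastforce

lemma shifts_word:
  assumes "f \<in> shifts k" shows "\<exists>u. word_map u = f \<and> wdeg u = k"
proof -
  obtain N where N: "\<And>n m. n \<ge> N \<Longrightarrow> int m = int n + k \<Longrightarrow> \<exists>\<phi>\<in>hom smp n m. f = stab_ext n m \<phi>"
    using shifts_eq_ext[OF assms] by blast
  \<comment> \<open>\<open>nat (- k)\<close> makes \<open>?n + k\<close> non-negative, so that a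
    target dimension exists.\<close>
  let ?n = "max N (nat (- k))"
  have "int (nat (int ?n + k)) = int ?n + k" by linarith
  then obtain \<phi> where "\<phi> \<in> hom smp ?n (nat (int ?n + k))" "f = stab_ext ?n (nat (int ?n + k)) \<phi>"
    using N[of ?n "nat (int ?n + k)"] by (meson max.cobounded1)
  then obtain u where "word_map u = f" using word_rep_exists word_rep_ext by metis
  thus ?thesis using word_map_shifts[of u] shifts_unique assms by blast
qed

text \<open>The hypothesis on \<open>f\<close> makes \<open>map_cls f\<close> non-empty, and any
  word in it evaluates to both functions.\<close>

lemma map_cls_inj: "f \<in> shifts k \<Longrightarrow> map_cls f = map_cls g \<Longrightarrow> f = g"
  using shifts_word unfolding map_cls_def by blast

lemma stab_obj: "obj stab = UNIV"
  by (simp add: stab_def)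

lemma stab_hom: "hom stab z w = map_cls ` shifts (w - z)"
proof -
  have "wcls u \<in> map_cls ` shifts (w - z)" if "wdeg u = w - z" for u
    using word_map_shifts[of u] that wcls_map_cls by auto
  moreover have "\<exists>u. map_cls f = wcls u \<and> wdeg u = w - z" if "f \<in> shifts (w - z)" for f
    using shifts_word[OF that] wcls_map_cls by metis
  ultimately show ?thesis unfolding stab_def by auto
qed

lemma stab_homI: "f \<in> shifts k \<Longrightarrow> w - z = k \<Longrightarrow> map_cls f \<in> hom stab z w"
  by (auto simp: stab_hom)

lemma stab_ide: "ide stab z = map_cls id"
  by (simp add: stab_def wcls_map_cls)

lemma stab_cmp:
  assumes "f \<in> shifts j" "g \<in> shifts k"
  shows "cmp stab a b c (map_cls g) (map_cls f) = map_cls (g \<circ> f)"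
proof -
  obtain u v where "word_map u = g" "word_map v = f" using shifts_word assms by metis
  thus ?thesis unfolding stab_def map_cls_def cosimp_eq_iff by (auto simp: word_map_append)
qed

lemma category_stab: "category stab"
  unfolding category_def
proof (intro conjI ballI)
  fix a b c d f g h assume "f \<in> hom stab a b" "g \<in> hom stab b c" "h \<in> hom stab c d"
  then obtain f' g' h' where f: "f = map_cls f'" "f' \<in> shifts (b - a)" and g: "g = map_cls g'" "g' \<in> shifts (c - b)"
    and h: "h = map_cls h'" "h' \<in> shifts (d - c)" unfolding stab_hom by blast
  note gf = shifts_comp[OF f(2) g(2)] and hg = shifts_comp[OF g(2) h(2)]
  show "cmp stab a b d (cmp stab b c d h g) f = cmp stab a c d h (cmp stab a b c g f)"
    unfolding f g h stab_cmp[OF f(2) g(2)] stab_cmp[OF g(2) h(2)] stab_cmp[OF f(2) hg] stab_cmp[OF gf h(2)]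
    by (simp add: o_assoc)
next
  fix a b c f g assume "f \<in> hom stab a b" "g \<in> hom stab b c"
  then obtain f' g' where f: "f = map_cls f'" "f' \<in> shifts (b - a)" and g: "g = map_cls g'" "g' \<in> shifts (c - b)"
    unfolding stab_hom by blast
  show "cmp stab a b c g f \<in> hom stab a c"
    unfolding f g stab_cmp[OF f(2) g(2)] using shifts_comp[OF f(2) g(2)] by (rule stab_homI) simp
next
  fix a b f assume "f \<in> hom stab a b"
  then obtain f' where f: "f = map_cls f'" "f' \<in> shifts (b - a)" unfolding stab_hom by blast
  show "cmp stab a a b f (ide stab a) = f" "cmp stab a b b (ide stab b) f = f"
    unfolding f stab_ide stab_cmp[OF f(2) shifts_id] stab_cmp[OF shifts_id f(2)] by simp_all
qed (simp add: stab_ide stab_homI[OF shifts_id])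

lemma countable_stab_hom: "countable (hom stab z w)"
proof -
  have "UNIV = range Face \<union> range Degen" using gen.exhaust by blast
  hence "countable (UNIV :: gen set)" by (metis countable_Un countable_image uncountable_def countableI_type)
  hence "countable (lists (UNIV :: gen set))" by (rule countable_lists)
  hence "countable (range wcls)" by simp
  thus ?thesis by (rule countable_subset[rotated]) (auto simp: stab_def)
qed

section \<open>The index category of spectrum objects\<close>

lemma coll_simps:
  "obj coll = UNIV" "ide coll (n, a) = ide smp n"
  "cmp coll (n, a) (l, b) (p, c) \<phi> \<psi> =
    cmp smp n (l + (a - b)) (p + (b - c) + (a - b)) (Kpow (a - b) l (p + (b - c)) \<phi>) \<psi>"
  by (simp_all add: coll_def)

lemma coll_hom_iff:
  "\<phi> \<in> hom coll (n, a) (l, b) \<longleftrightarrow> b \<le> a \<and> \<phi> \<in> hom smp n (l + (a - b))"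
  by (simp add: coll_def)

text \<open>\<open>Kpow\<close> does not change the extension to the natural numbers, so the twisted
  composition of \<open>coll\<close> becomes composition of functions. The category laws of
  \<open>coll\<close> and the functoriality of \<open>rho\<close> are read off from this.\<close>

lemma coll_cmp_hom:
  assumes "\<psi> \<in> hom coll (n, a) (l, b)" "\<phi> \<in> hom coll (l, b) (p, c)"
  shows "cmp coll (n, a) (l, b) (p, c) \<phi> \<psi> \<in> hom coll (n, a) (p, c)"
    and "stab_ext n (p + (a - c)) (cmp coll (n, a) (l, b) (p, c) \<phi> \<psi>)
      = stab_ext l (p + (b - c)) \<phi> \<circ> stab_ext n (l + (a - b)) \<psi>"
proof -
  have \<psi>: "\<psi> \<in> hom smp n (l + (a - b))" and \<phi>: "\<phi> \<in> hom smp l (p + (b - c))" and le: "b \<le> a" "c \<le> b"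
    using assms by (auto simp: coll_hom_iff)
  have eq: "p + (b - c) + (a - b) = p + (a - c)" using le by simp
  note K = Kpow_hom[OF \<phi>, of "a - b"]
  show "cmp coll (n, a) (l, b) (p, c) \<phi> \<psi> \<in> hom coll (n, a) (p, c)"
    using cat_cmp[OF category_smp \<psi> K] le unfolding eq coll_simps coll_hom_iff by (simp add: smp_simps(1))
  show "stab_ext n (p + (a - c)) (cmp coll (n, a) (l, b) (p, c) \<phi> \<psi>)
      = stab_ext l (p + (b - c)) \<phi> \<circ> stab_ext n (l + (a - b)) \<psi>"
    using stab_ext_cmp[OF \<psi> K] stab_ext_Kpow[of l "a - b" "p + (b - c)" \<phi>] unfolding eq coll_simps by simp
qed

lemma coll_hom_eqI:
  assumes "\<phi> \<in> hom coll (n, a) (l, b)" "\<psi> \<in> hom coll (n, a) (l, b)"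
    "stab_ext n (l + (a - b)) \<phi> = stab_ext n (l + (a - b)) \<psi>"
  shows "\<phi> = \<psi>"
  using assms stab_ext_inj unfolding coll_hom_iff by blast

lemma coll_ide_hom: "ide coll (n, a) \<in> hom coll (n, a) (n, a)"
  using cat_ide[OF category_smp] by (simp add: coll_simps coll_hom_iff smp_simps(1))

lemma category_coll: "category coll"
proof -
  have E: "stab_ext n (n + (a - a)) (ide coll (n, a)) = id" for n a by (simp add: coll_simps stab_ext_ide)
  have 1: "cmp coll x x y f (ide coll x) = f" "cmp coll x y y (ide coll y) f = f"
    if "f \<in> hom coll x y" for x y f
  proof -
    obtain n a l b where xy: "x = (n, a)" "y = (l, b)" by fastforce
    note f = that[unfolded xy]
    show "cmp coll x x y f (ide coll x) = f" "cmp coll x y y (ide coll y) f = f"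
      unfolding xy
      by (rule coll_hom_eqI[OF _ f], rule coll_cmp_hom[OF coll_ide_hom f],
          simp only: coll_cmp_hom[OF coll_ide_hom f] E comp_id)
        (rule coll_hom_eqI[OF _ f], rule coll_cmp_hom[OF f coll_ide_hom],
          simp only: coll_cmp_hom[OF f coll_ide_hom] E id_comp)
  qed
  have 2: "cmp coll x y w (cmp coll y z w h g) f = cmp coll x z w h (cmp coll x y z g f)"
    if fgh: "f \<in> hom coll x y" "g \<in> hom coll y z" "h \<in> hom coll z w" for x y z w f g h
  proof -
    obtain n a l b p c q d where xy: "x = (n, a)" "y = (l, b)" "z = (p, c)" "w = (q, d)" by fastforce
    note f = fgh(1)[unfolded xy] and g = fgh(2)[unfolded xy] and h = fgh(3)[unfolded xy]
    note hg = coll_cmp_hom[OF g h] and gf = coll_cmp_hom[OF f g]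
    note 1 = coll_cmp_hom[OF f hg(1)] and 2 = coll_cmp_hom[OF gf(1) h]
    show ?thesis
      unfolding xy by (rule coll_hom_eqI[OF 1(1) 2(1)]) (simp only: 1(2) 2(2) hg(2) gf(2) o_assoc)
  qed
  show ?thesis
    unfolding category_def using coll_ide_hom coll_cmp_hom(1) 1 2 by (auto simp: split_paired_all)
qed

lemma rho_simps:
  "fobj rho (n, a) = int n - int a"
  "\<phi> \<in> hom coll (n, a) (l, b) \<Longrightarrow> fmap rho (n, a) (l, b) \<phi> = map_cls (stab_ext n (l + (a - b)) \<phi>)"
  by (auto simp: rho_def coll_hom_iff stab_word_map_cls)

lemma coll_ext_shifts:
  assumes "\<phi> \<in> hom coll (n, a) (l, b)"
  shows "stab_ext n (l + (a - b)) \<phi> \<in> shifts ((int l - int b) - (int n - int a))"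
proof -
  have "\<phi> \<in> hom smp n (l + (a - b))" "b \<le> a" using assms by (auto simp: coll_hom_iff)
  moreover from this have "int (l + (a - b)) - int n = (int l - int b) - (int n - int a)" by simp
  ultimately show ?thesis using stab_ext_shifts by metis
qed

lemma rho_functor: "is_functor coll stab rho"
proof -
  have 1: "fmap rho x y f \<in> hom stab (fobj rho x) (fobj rho y)" if "f \<in> hom coll x y" for x y f
    using that coll_ext_shifts by (cases x; cases y) (auto simp: rho_simps stab_hom)
  have 2: "fmap rho x x (ide coll x) = ide stab (fobj rho x)" for x
    using coll_ide_hom by (cases x) (simp add: rho_simps stab_ide coll_simps stab_ext_ide)
  have 3: "fmap rho x z (cmp coll x y z g f)
     = cmp stab (fobj rho x) (fobj rho y) (fobj rho z) (fmap rho y z g) (fmap rho x y f)"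
    if fg: "f \<in> hom coll x y" "g \<in> hom coll y z" for x y z f g
  proof -
    obtain n a l b p c where xy: "x = (n, a)" "y = (l, b)" "z = (p, c)" by (cases x; cases y; cases z) auto
    note f = fg(1)[unfolded xy] and g = fg(2)[unfolded xy]
    show ?thesis
      unfolding xy using f g coll_cmp_hom[OF f g] stab_cmp[OF coll_ext_shifts[OF f] coll_ext_shifts[OF g]]
      by (simp add: rho_simps(2))
  qed
  show ?thesis
    unfolding is_functor_def using category_coll category_stab 1 2 3
    by (simp add: stab_obj coll_simps(1))
qed

section \<open>Kan suspension\<close>

definition vertex :: "nat \<Rightarrow> nat \<Rightarrow> nat" where
  "vertex n = (\<lambda>x\<in>{..0}. Suc n)"

lemma vertex_hom: "vertex n \<in> hom smp 0 (Suc n)"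
  by (simp add: smp_hom_iff vertex_def)

lemma countable_smp_hom: "countable (hom smp n m)"
proof -
  have "hom smp n m \<subseteq> {..n} \<rightarrow>\<^sub>E {..m}" by (auto simp: smp_def)
  thus ?thesis by (meson countable_finite finite_PiE finite_atMost finite_subset)
qed

lemma bd_cases:
  assumes "y \<in> bd n p"
  obtains h where "y = Some (cmp smp p n (Suc n) (coface n (Suc n)) h)" "h \<in> hom smp p n"
  | h where "y = Some (cmp smp p 0 (Suc n) (vertex n) h)" "h \<in> hom smp p 0"
  using assms unfolding bd_def vertex_def by blast

lemma bd_face: "h \<in> hom smp p n \<Longrightarrow> Some (cmp smp p n (Suc n) (coface n (Suc n)) h) \<in> bd n p"
  unfolding bd_def by blast

lemma bd_vertex: "h \<in> hom smp p 0 \<Longrightarrow> Some (cmp smp p 0 (Suc n) (vertex n) h) \<in> bd n p"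
  unfolding bd_def vertex_def by blast

lemma smp_assoc:
  "f \<in> hom smp a b \<Longrightarrow> g \<in> hom smp b c \<Longrightarrow> h \<in> hom smp c d \<Longrightarrow>
    cmp smp a b d (cmp smp b c d h g) f = cmp smp a c d h (cmp smp a b c g f)"
  by (rule cat_assoc[OF category_smp]) (simp_all add: smp_simps(1))

lemma smp_cmp: "f \<in> hom smp a b \<Longrightarrow> g \<in> hom smp b c \<Longrightarrow> cmp smp a b c g f \<in> hom smp a c"
  by (rule cat_cmp[OF category_smp]) (simp_all add: smp_simps(1))

lemma smp_ide: "ide smp n \<in> hom smp n n"
  by (rule cat_ide[OF category_smp]) (simp add: smp_simps(1))

lemma smp_idl: "f \<in> hom smp a b \<Longrightarrow> cmp smp a b b (ide smp b) f = f"
  by (rule cat_idl[OF category_smp]) (simp_all add: smp_simps(1))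

lemma smp_idr: "f \<in> hom smp a b \<Longrightarrow> cmp smp a a b f (ide smp a) = f"
  by (rule cat_idr[OF category_smp]) (simp_all add: smp_simps(1))

lemma smp_rep_presheaf: "pointed_presheaf smp (rep_plus smp n)"
  by (rule rep_plus_presheaf[OF category_smp]) (simp add: smp_simps(1))

lemmas smp_presheafD =
  presheafD[where C = smp, unfolded smp_simps(1), simplified]

lemma bd_stable:
  assumes "y \<in> bd n q" "\<theta> \<in> hom smp p q"
  shows "act (rep_plus smp (Suc n)) p q \<theta> y \<in> bd n p"
  using assms(1)
proof (cases rule: bd_cases)
  case (1 h)
  thus ?thesis using smp_assoc[OF assms(2) 1(2) coface_hom[of "Suc n" n]] smp_cmp[OF assms(2) 1(2)]
    by (simp add: rep_plus_simps bd_face)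
next
  case (2 h)
  thus ?thesis using smp_assoc[OF assms(2) 2(2) vertex_hom] smp_cmp[OF assms(2) 2(2)]
    by (simp add: rep_plus_simps bd_vertex)
qed

lemma cof_presheaf: "pointed_presheaf smp (cof n)"
  unfolding cof_def by (rule collapse_presheaf[OF smp_rep_presheaf]) (rule bd_stable)

abbreviation cofq :: "nat \<Rightarrow> nat \<Rightarrow> (nat \<Rightarrow> nat) option \<Rightarrow> (nat \<Rightarrow> nat) option" where
  "cofq n \<equiv> quot_el (rep_plus smp (Suc n)) (bd n)"

lemma cofq_None: "cofq n p None = None"
  by (simp add: quot_el_def rep_plus_simps)

lemma pt_cof: "pt (cof n) p = None"
  by (simp add: cof_def collapse_simps rep_plus_simps)

lemma cofq_el: "y \<in> insert None (Some ` hom smp p (Suc n)) \<Longrightarrow> cofq n p y \<in> el (cof n) p"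
  unfolding cof_def collapse_simps rep_plus_simps by (rule imageI)

text \<open>The last fact of the second case records that \<open>g\<close> is not collapsed and
  represents its own class.\<close>

lemma cof_el_cases:
  assumes "y \<in> el (cof n) p"
  obtains "y = None" | g where "y = Some g" "g \<in> hom smp p (Suc n)" "cofq n p (Some g) = y"
proof -
  obtain z where z: "z \<in> insert None (Some ` hom smp p (Suc n))" "y = cofq n p z"
    using assms by (auto simp: cof_def collapse_simps rep_plus_simps)
  show thesis
  proof (cases "y = None")
    case False
    hence "y = z" using z(2) by (auto simp: quot_el_def rep_plus_simps split: if_splits)
    thus ?thesis using that z False by auto
  qed (use that in auto)
qed

lemma act_cofq:
  "\<theta> \<in> hom smp p q \<Longrightarrow> act (cof n) p q \<theta> (cofq n q y) = cofq n p (map_option (\<lambda>g. cmp smp p q (Suc n) g \<theta>) y)"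
  unfolding cof_def
  by (subst act_collapse[OF smp_rep_presheaf bd_stable]) (simp_all add: smp_simps(1) rep_plus_simps)

lemma act_cof_ide:
  "g \<in> hom smp p (Suc n) \<Longrightarrow> act (cof n) p (Suc n) g (cofq n (Suc n) (Some (ide smp (Suc n)))) = cofq n p (Some g)"
  by (simp add: act_cofq smp_idl)

text \<open>\<open>Kmap n m \<phi>\<close> carries the last face to the last face, through
  \<open>\<phi>\<close>, and the last vertex to the last vertex. This makes \<open>cof\<close>
  functorial in \<open>[n]\<close> through \<open>K\<close>.\<close>

lemma bd_Kmap:
  assumes "y \<in> bd n p" "\<phi> \<in> hom smp n m"
  shows "map_option (\<lambda>g. cmp smp p (Suc n) (Suc m) (Kmap n m \<phi>) g) y \<in> bd m p"
  using assms(1)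
proof (cases rule: bd_cases)
  case (1 h)
  have "cmp smp n (Suc n) (Suc m) (Kmap n m \<phi>) (coface n (Suc n)) = cmp smp n m (Suc m) (coface m (Suc m)) \<phi>"
    by (rule smp_hom_eqI[OF smp_cmp[OF coface_hom Kmap_hom] smp_cmp[OF _ coface_hom]])
      (use assms(2) in \<open>auto simp: smp_cmp_apply coface_def Kmap_def smp_hom_iff\<close>)
  hence "cmp smp p (Suc n) (Suc m) (Kmap n m \<phi>) (cmp smp p n (Suc n) (coface n (Suc n)) h)
    = cmp smp p m (Suc m) (coface m (Suc m)) (cmp smp p n m \<phi> h)"
    using smp_assoc[OF 1(2) coface_hom[of "Suc n" n] Kmap_hom[OF assms(2)]]
      smp_assoc[OF 1(2) assms(2) coface_hom[of "Suc m" m]] by simp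
  thus ?thesis using 1 bd_face[OF smp_cmp[OF 1(2) assms(2)]] by simp
next
  case (2 h)
  have "cmp smp 0 (Suc n) (Suc m) (Kmap n m \<phi>) (vertex n) = vertex m"
    by (rule smp_hom_eqI[OF smp_cmp[OF vertex_hom Kmap_hom] vertex_hom])
      (use assms(2) in \<open>auto simp: smp_cmp_apply Kmap_def vertex_def\<close>)
  hence "cmp smp p (Suc n) (Suc m) (Kmap n m \<phi>) (cmp smp p 0 (Suc n) (vertex n) h)
    = cmp smp p 0 (Suc m) (vertex m) h"
    using smp_assoc[OF 2(2) vertex_hom Kmap_hom[OF assms(2)]] by simp
  thus ?thesis using 2 bd_vertex[OF 2(2)] by simp
qed

lemma cof_map_cofq:
  assumes "\<phi> \<in> hom smp n m"
  shows "cof_map n m \<phi> p (cofq n p y)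
    = cofq m p (map_option (\<lambda>g. cmp smp p (Suc n) (Suc m) (Kmap n m \<phi>) g) y)"
  using bd_Kmap[OF _ assms, of y p] unfolding cof_map_def
  by (auto simp: quot_el_def rep_plus_simps)

lemma cof_map_act:
  assumes "y \<in> el (cof n) q" "\<phi> \<in> hom smp n m" "\<theta> \<in> hom smp p q"
  shows "act (cof m) p q \<theta> (cof_map n m \<phi> q y) = cof_map n m \<phi> p (act (cof n) p q \<theta> y)"
proof -
  obtain z where z: "z \<in> insert None (Some ` hom smp q (Suc n))" "y = cofq n q z"
    using assms by (auto simp: cof_def collapse_simps rep_plus_simps)
  show ?thesis
    unfolding z(2) cof_map_cofq[OF assms(2)] act_cofq[OF assms(3)]
    using z(1) smp_assoc[OF assms(3) _ Kmap_hom[OF assms(2)]] by (auto simp: cof_map_cofq[OF assms(2)])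
qed

section \<open>The coend relation and the elements of a suspension\<close>

lemma susp_eq_refl: "(t, t) \<in> susp_eq X p"
  by (simp add: susp_eq_def)

lemma susp_eq_sym: "(t, t') \<in> susp_eq X p \<Longrightarrow> (t', t) \<in> susp_eq X p"
proof -
  have "sym (susp_eq X p)" unfolding susp_eq_def by (rule sym_rtrancl) (auto simp: sym_def)
  thus "(t, t') \<in> susp_eq X p \<Longrightarrow> (t', t) \<in> susp_eq X p" by (rule symD)
qed

lemma susp_eq_trans: "(t, t') \<in> susp_eq X p \<Longrightarrow> (t', t'') \<in> susp_eq X p \<Longrightarrow> (t, t'') \<in> susp_eq X p"
  unfolding susp_eq_def by (rule rtrancl_trans)

lemma susp_gen_eq: "(t, t') \<in> susp_gen X p \<Longrightarrow> (t, t') \<in> susp_eq X p"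
  unfolding susp_eq_def by auto

lemma susp_cls_eq: "susp_eq X p `` {t} = susp_eq X p `` {t'} \<longleftrightarrow> (t, t') \<in> susp_eq X p"
  using susp_eq_refl susp_eq_sym susp_eq_trans by blast

lemma susp_eq_map:
  assumes "\<And>t t'. (t, t') \<in> susp_gen X p \<Longrightarrow> (F t, F t') \<in> susp_eq Y q" "(t, t') \<in> susp_eq X p"
  shows "(F t, F t') \<in> susp_eq Y q"
  using assms(2) unfolding susp_eq_def[of X]
proof (induction rule: rtrancl_induct)
  case (step y z)
  hence "(F y, F z) \<in> susp_eq Y q" using assms(1) susp_eq_sym by blast
  thus ?case using step susp_eq_trans by blast
qed (rule susp_eq_refl)

lemma susp_cls_image:
  assumes "\<And>t t'. (t, t') \<in> susp_gen X p \<Longrightarrow> (F t, F t') \<in> susp_eq Y q"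
  shows "susp_eq Y q `` (F ` (susp_eq X p `` {t})) = susp_eq Y q `` {F t}"
  using susp_eq_map[of X p F Y q, OF assms] susp_eq_refl susp_eq_trans susp_eq_sym by blast

lemma susp_eq_const:
  assumes "\<And>t t'. (t, t') \<in> susp_gen X p \<Longrightarrow> F t = F t'" "(t, t') \<in> susp_eq X p"
  shows "F t = F t'"
  using assms(2) unfolding susp_eq_def
  by (induction rule: rtrancl_induct) (auto dest: assms(1))

lemma susp_gen_cases:
  assumes "(t, t') \<in> susp_gen X p"
  obtains n y where "t = Some (n, pt X n, y)" "t' = None" "y \<in> el (cof n) p"
  | n x where "t = Some (n, x, None)" "t' = None" "x \<in> el X n"
  | n m \<phi> x y where "t = Some (n, act X n m \<phi> x, y)" "t' = Some (m, x, cof_map n m \<phi> p y)"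
      "\<phi> \<in> hom smp n m" "x \<in> el X m" "y \<in> el (cof n) p"
  using assms unfolding susp_gen_def pt_cof by blast

lemma susp_gen_intros:
  "y \<in> el (cof n) p \<Longrightarrow> (Some (n, pt X n, y), None) \<in> susp_gen X p"
  "x \<in> el X n \<Longrightarrow> (Some (n, x, None), None) \<in> susp_gen X p"
  "\<phi> \<in> hom smp n m \<Longrightarrow> x \<in> el X m \<Longrightarrow> y \<in> el (cof n) p \<Longrightarrow>
    (Some (n, act X n m \<phi> x, y), Some (m, x, cof_map n m \<phi> p y)) \<in> susp_gen X p"
  unfolding susp_gen_def pt_cof by blast+

lemma susp_terms_Some: "Some (n, x, y) \<in> susp_terms X p \<longleftrightarrow> x \<in> el X n \<and> y \<in> el (cof n) p"
  by (auto simp: susp_terms_def)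

lemma susp_gen_act:
  assumes "(t, t') \<in> susp_gen X q" "\<theta> \<in> hom smp p q"
  shows "(susp_term_act p q \<theta> t, susp_term_act p q \<theta> t') \<in> susp_eq X p"
  using assms(1)
proof (cases rule: susp_gen_cases)
  case (1 n y)
  thus ?thesis using susp_gen_intros(1) smp_presheafD(2)[OF cof_presheaf 1(3) assms(2)]
    by (auto intro!: susp_gen_eq)
next
  case (2 n x)
  have "act (cof n) p q \<theta> None = None"
    using smp_presheafD(3)[OF cof_presheaf assms(2), of n] by (simp add: pt_cof)
  thus ?thesis using 2 susp_gen_intros(2) by (auto intro!: susp_gen_eq)
next
  case (3 n m \<phi> x y)
  thus ?thesis
    using susp_gen_intros(3)[OF 3(3,4) smp_presheafD(2)[OF cof_presheaf 3(5) assms(2)]]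
      cof_map_act[OF 3(5,3) assms(2)] by (auto intro!: susp_gen_eq)
qed

lemma act_susp_raw:
  "\<theta> \<in> hom smp p q \<Longrightarrow>
    act (susp_raw X) p q \<theta> (susp_eq X q `` {t}) = susp_eq X p `` {susp_term_act p q \<theta> t}"
  unfolding susp_raw_def by (simp add: susp_cls_image[of X q "susp_term_act p q \<theta>" X p, OF susp_gen_act])

lemma susp_raw_simps:
  "el (susp_raw X) p = (\<lambda>t. susp_eq X p `` {t}) ` susp_terms X p"
  "pt (susp_raw X) p = susp_eq X p `` {None}"
  by (auto simp: susp_raw_def quotient_def)

lemma susp_term_act_terms:
  "t \<in> susp_terms X q \<Longrightarrow> \<theta> \<in> hom smp p q \<Longrightarrow> susp_term_act p q \<theta> t \<in> susp_terms X p"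
  using smp_presheafD(2)[OF cof_presheaf] by (auto simp: susp_terms_def)

lemma susp_raw_presheaf: "pointed_presheaf smp (susp_raw X)"
  unfolding pointed_presheaf_def
proof (intro conjI ballI)
  fix p show "pt (susp_raw X) p \<in> el (susp_raw X) p" by (simp add: susp_raw_simps susp_terms_def)
  { fix c assume "c \<in> el (susp_raw X) p"
    then obtain t where t: "t \<in> susp_terms X p" "c = susp_eq X p `` {t}" by (auto simp: susp_raw_simps)
    have "susp_term_act p p (ide smp p) t = t"
      using t(1) smp_presheafD(4)[OF cof_presheaf] by (auto simp: susp_terms_def)
    thus "act (susp_raw X) p p (ide smp p) c = c" using t by (simp add: act_susp_raw smp_ide) }
  fix q \<theta> assume \<theta>: "\<theta> \<in> hom smp p q"
  show "act (susp_raw X) p q \<theta> \<in> el (susp_raw X) q \<rightarrow> el (susp_raw X) p"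
    using susp_term_act_terms[OF _ \<theta>, of _ X] by (auto simp: susp_raw_simps act_susp_raw[OF \<theta>] intro!: imageI)
  show "act (susp_raw X) p q \<theta> (pt (susp_raw X) q) = pt (susp_raw X) p"
    using \<theta> by (simp add: susp_raw_simps act_susp_raw)
  fix r \<theta>' c assume \<theta>': "\<theta>' \<in> hom smp q r" and "c \<in> el (susp_raw X) r"
  then obtain t where t: "t \<in> susp_terms X r" "c = susp_eq X r `` {t}" by (auto simp: susp_raw_simps)
  have "susp_term_act p r (cmp smp p q r \<theta>' \<theta>) t = susp_term_act p q \<theta> (susp_term_act q r \<theta>' t)"
    using t(1) smp_presheafD(5)[OF cof_presheaf \<theta> \<theta>'] by (auto simp: susp_terms_def)
  thus "act (susp_raw X) p r (cmp smp p q r \<theta>' \<theta>) c = act (susp_raw X) p q \<theta> (act (susp_raw X) q r \<theta>' c)"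
    using t \<theta> \<theta>' smp_cmp[OF \<theta> \<theta>'] by (simp add: act_susp_raw)
qed

lemma susp_fits: "psh_fits TYPE('u::infinite) smp (susp_raw (X :: 'u smp_psh))"
  unfolding psh_fits_def
proof
  fix p
  have c: "countable (el (cof n) p)" for n
    using countable_smp_hom by (simp add: cof_def collapse_simps rep_plus_simps)
  have "fits TYPE('u) (insert None (Some ` ((UNIV :: nat set) \<times> (UNIV :: 'u set) \<times> (\<Union>n. el (cof n) p))))"
    using c by (intro fits_insert fits_image fits_Times fits_countable fits_UNIV) auto
  hence "fits TYPE('u) (susp_terms X p)" by (rule fits_subset) (auto simp: susp_terms_def)
  thus "fits TYPE('u) (el (susp_raw X) p)" unfolding susp_raw_simps by (rule fits_image)
qed

lemma susp_presheaf: "pointed_presheaf smp (susp (X :: 'u::infinite smp_psh))"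
  unfolding susp_def by (rule small_presheaf[OF susp_raw_presheaf susp_fits])

text \<open>The element \<open>x \<and> id\<close>; these elements generate the suspension.\<close>

definition smash_id :: "'u smp_psh \<Rightarrow> nat \<Rightarrow> 'u \<Rightarrow> 'u susp_term set" where
  "smash_id X n x = susp_eq X (Suc n) `` {Some (n, x, cofq n (Suc n) (Some (ide smp (Suc n))))}"

lemma cof_ide: "cofq n (Suc n) (Some (ide smp (Suc n))) \<in> el (cof n) (Suc n)"
  by (rule cofq_el) (simp add: smp_ide)

lemma smash_id_el: "x \<in> el X n \<Longrightarrow> smash_id X n x \<in> el (susp_raw X) (Suc n)"
  unfolding smash_id_def susp_raw_simps using cof_ide by (auto simp: susp_terms_Some)

lemma act_smash_id:
  "g \<in> hom smp p (Suc n) \<Longrightarrow>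
    act (susp_raw X) p (Suc n) g (smash_id X n x) = susp_eq X p `` {Some (n, x, cofq n p (Some g))}"
  unfolding smash_id_def by (simp add: act_susp_raw act_cof_ide)

text \<open>The coend relation moves \<open>\<phi>\<close> from the first factor to the second,
  where it acts on the identity as \<open>Kmap n m \<phi>\<close>.\<close>

lemma smash_id_act:
  assumes "\<phi> \<in> hom smp n m" "x \<in> el X m"
  shows "smash_id X n (act X n m \<phi> x) = act (susp_raw X) (Suc n) (Suc m) (Kmap n m \<phi>) (smash_id X m x)"
  unfolding act_smash_id[OF Kmap_hom[OF assms(1)]]
  unfolding smash_id_def susp_cls_eq
  using susp_gen_eq[OF susp_gen_intros(3)[OF assms cof_ide]]
  by (simp add: cof_map_cofq[OF assms(1)] smp_idr[OF Kmap_hom[OF assms(1)]])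

lemma smash_id_pt: "smash_id X n (pt X n) = pt (susp_raw X) (Suc n)"
  unfolding smash_id_def susp_raw_simps susp_cls_eq using susp_gen_eq[OF susp_gen_intros(1)[OF cof_ide]] .

lemma act_smash_id_bd:
  assumes "x \<in> el X n" "g \<in> hom smp p (Suc n)" "Some g \<in> bd n p"
  shows "act (susp_raw X) p (Suc n) g (smash_id X n x) = pt (susp_raw X) p"
  unfolding act_smash_id[OF assms(2)] susp_raw_simps susp_cls_eq
  using susp_gen_eq[OF susp_gen_intros(2)[OF assms(1)]] assms(3) by (simp add: quot_el_def rep_plus_simps)

lemma susp_raw_cases:
  assumes "c \<in> el (susp_raw X) p"
  obtains "c = pt (susp_raw X) p"
  | n x g where "x \<in> el X n" "g \<in> hom smp p (Suc n)" "c = act (susp_raw X) p (Suc n) g (smash_id X n x)"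
proof -
  obtain t where t: "t \<in> susp_terms X p" "c = susp_eq X p `` {t}"
    using assms by (auto simp: susp_raw_simps)
  show thesis
  proof (cases "t = None")
    case True thus ?thesis using that(1) t by (simp add: susp_raw_simps)
  next
    case False
    then obtain n x y where t': "t = Some (n, x, y)" "x \<in> el X n" "y \<in> el (cof n) p"
      using t by (auto simp: susp_terms_def)
    show ?thesis
      using t'(3)
    proof (cases rule: cof_el_cases)
      case 1
      hence "c = pt (susp_raw X) p"
        unfolding t t' susp_raw_simps susp_cls_eq using susp_gen_eq[OF susp_gen_intros(2)[OF t'(2)]] by simp
      thus ?thesis by (rule that(1))
    next
      case (2 g)
      thus ?thesis using that(2)[OF t'(2), of g] t t' by (simp add: act_smash_id)
    qed
  qed
qed

text \<open>A map out of the suspension comes from a map of \<open>X\<close> to the Kan loop object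
  of \<open>W\<close>: operations \<open>s n\<close> raising the dimension by one, equivariant
  through \<open>K\<close>, with trivial last face and last vertex. \<open>\<tau>\<close> is a
  parameter subject to equations because \<open>KPs_bond_term\<close> is given in this recursive
  form.\<close>

lemma susp_raw_universal:
  assumes X: "pointed_presheaf smp X" and W: "pointed_presheaf smp W"
    and s: "\<And>n x. x \<in> el X n \<Longrightarrow> s n x \<in> el W (Suc n)"
    and s_pt: "\<And>n. s n (pt X n) = pt W (Suc n)"
    and s_act: "\<And>n m \<phi> x. \<phi> \<in> hom smp n m \<Longrightarrow> x \<in> el X m \<Longrightarrow>
      s n (act X n m \<phi> x) = act W (Suc n) (Suc m) (Kmap n m \<phi>) (s m x)"
    and s_face: "\<And>n x. x \<in> el X n \<Longrightarrow> act W n (Suc n) (coface n (Suc n)) (s n x) = pt W n"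
    and s_vertex: "\<And>n x. x \<in> el X n \<Longrightarrow> act W 0 (Suc n) (vertex n) (s n x) = pt W 0"
    and \<tau>: "\<And>p. \<tau> p None = pt W p" "\<And>p n x. \<tau> p (Some (n, x, None)) = pt W p"
      "\<And>p n x g. \<tau> p (Some (n, x, Some g)) = act W p (Suc n) g (s n x)"
  shows "pmap smp (susp_raw X) W (\<lambda>p c. the_elem (\<tau> p ` c))"
    and "x \<in> el X n \<Longrightarrow> the_elem (\<tau> (Suc n) ` smash_id X n x) = s n x"
proof -
  note WD = smp_presheafD[OF W] and XD = smp_presheafD[OF X]
  \<comment> \<open>Everything collapsed in \<open>cof n\<close> factors through the last face or
    the last vertex.\<close>
  have bd0: "act W p (Suc n) g (s n x) = pt W p" if "x \<in> el X n" "Some g \<in> bd n p" for p n g x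
    using that(2)
  proof (cases rule: bd_cases)
    case (1 h)
    thus ?thesis using WD(5)[OF 1(2) coface_hom[of "Suc n" n] s[OF that(1)]] s_face[OF that(1)] WD(3)[OF 1(2)] by simp
  next
    case (2 h)
    thus ?thesis using WD(5)[OF 2(2) vertex_hom s[OF that(1)]] s_vertex[OF that(1)] WD(3)[OF 2(2)] by simp
  qed
  have q: "\<tau> p (Some (n, x, cofq n p (Some g))) = act W p (Suc n) g (s n x)"
    if "x \<in> el X n" for p n g x
    using bd0[OF that] by (auto simp: quot_el_def rep_plus_simps \<tau>)
  have gen: "\<tau> p t = \<tau> p t'" if "(t, t') \<in> susp_gen X p" for p t t'
    using that
  proof (cases rule: susp_gen_cases)
    case (1 n y)
    from 1(3) show ?thesis
      by (cases rule: cof_el_cases) (simp_all add: 1 \<tau> s_pt WD)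
  next
    case 2 thus ?thesis by (simp add: \<tau>)
  next
    case (3 n m \<phi> x y)
    from 3(5) show ?thesis
    proof (cases rule: cof_el_cases)
      case 1
      have "cof_map n m \<phi> p None = None" using cof_map_cofq[OF 3(3), of p None] by (simp add: cofq_None)
      thus ?thesis using 1 3 by (simp add: \<tau>)
    next
      case (2 g)
      have "cof_map n m \<phi> p y = cofq m p (Some (cmp smp p (Suc n) (Suc m) (Kmap n m \<phi>) g))"
        using cof_map_cofq[OF 3(3), of p "Some g"] 2 by simp
      thus ?thesis
        using q[OF 3(4), of p] WD(5)[OF 2(2) Kmap_hom[OF 3(3)] s[OF 3(4)]] s_act[OF 3(3,4)]
        unfolding 3(1,2) 2(1) by (simp only: \<tau>)
    qed
  qed
  \<comment> \<open>Constancy on the generating pairs gives constancy on classes, so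
    \<open>the_elem\<close> returns the common value.\<close>
  have the: "the_elem (\<tau> p ` (susp_eq X p `` {t})) = \<tau> p t" for p t
  proof -
    have "\<tau> p t' = \<tau> p t" if "(t, t') \<in> susp_eq X p" for t'
      using susp_eq_const[of X p "\<tau> p", OF gen that] by simp
    moreover have "t \<in> susp_eq X p `` {t}" by (simp add: susp_eq_refl)
    ultimately have "\<tau> p ` (susp_eq X p `` {t}) = {\<tau> p t}" by blast
    thus ?thesis by simp
  qed
  show "x \<in> el X n \<Longrightarrow> the_elem (\<tau> (Suc n) ` smash_id X n x) = s n x"
    unfolding smash_id_def the using q WD(4) s by simp
  show "pmap smp (susp_raw X) W (\<lambda>p c. the_elem (\<tau> p ` c))"
    unfolding pmap_def
  proof (intro conjI ballI)
    fix p
    show "the_elem (\<tau> p ` pt (susp_raw X) p) = pt W p" by (simp add: susp_raw_simps the \<tau>)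
    { fix c assume "c \<in> el (susp_raw X) p"
      thus "the_elem (\<tau> p ` c) \<in> el W p"
        by (cases rule: susp_raw_cases) (auto simp: susp_raw_simps the \<tau> act_smash_id q WD s) }
    fix r \<theta> c assume \<theta>: "\<theta> \<in> hom smp p r" and c: "c \<in> el (susp_raw X) r"
    from c show "the_elem (\<tau> p ` act (susp_raw X) p r \<theta> c) = act W p r \<theta> (the_elem (\<tau> r ` c))"
    proof (cases rule: susp_raw_cases)
      case 1
      have "act (susp_raw X) p r \<theta> c = pt (susp_raw X) p"
        using 1 smp_presheafD(3)[OF susp_raw_presheaf \<theta>] by simp
      thus ?thesis using 1 by (simp add: susp_raw_simps the \<tau> WD(3)[OF \<theta>])
    next
      case (2 n x g)
      have "act (susp_raw X) p r \<theta> c = act (susp_raw X) p (Suc n) (cmp smp p r (Suc n) g \<theta>) (smash_id X n x)"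
        using smp_presheafD(5)[OF susp_raw_presheaf \<theta> 2(2) smash_id_el[OF 2(1)]] 2 by simp
      thus ?thesis
        using 2 act_smash_id[OF smp_cmp[OF \<theta> 2(2)], of X x] act_smash_id[OF 2(2), of X x] WD(5)[OF \<theta> 2(2) s[OF 2(1)]] q[OF 2(1)]
        by (simp add: the)
    qed
  qed
qed

definition smash_id_enc :: "'u smp_psh \<Rightarrow> nat \<Rightarrow> 'u \<Rightarrow> 'u" where
  "smash_id_enc X n x = enc (el (susp_raw X) (Suc n)) (smash_id X n x)"

lemma act_susp:
  "c \<in> el (susp_raw X) q \<Longrightarrow>
    act (susp (X :: 'u::infinite smp_psh)) p q \<theta> (enc (el (susp_raw X) q) c)
      = enc (el (susp_raw X) p) (act (susp_raw X) p q \<theta> c)"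
  unfolding susp_def by (rule act_small[OF susp_fits]) (simp_all add: smp_simps(1))

context
  fixes X :: "'u::infinite smp_psh"
begin

lemma smash_id_enc_el: "x \<in> el X n \<Longrightarrow> smash_id_enc X n x \<in> el (susp X) (Suc n)"
  unfolding smash_id_enc_def susp_def small_simps by (intro imageI smash_id_el)

lemma smash_id_enc_act:
  "\<phi> \<in> hom smp n m \<Longrightarrow> x \<in> el X m \<Longrightarrow>
    smash_id_enc X n (act X n m \<phi> x) = act (susp X) (Suc n) (Suc m) (Kmap n m \<phi>) (smash_id_enc X m x)"
  by (simp add: smash_id_enc_def act_susp smash_id_el smash_id_act)

lemma smash_id_enc_pt: "smash_id_enc X n (pt X n) = pt (susp X) (Suc n)"
  by (simp add: smash_id_enc_def smash_id_pt susp_def small_simps)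

lemma smash_id_enc_face: "x \<in> el X n \<Longrightarrow> act (susp X) n (Suc n) (coface n (Suc n)) (smash_id_enc X n x) = pt (susp X) n"
  using act_smash_id_bd[OF _ coface_hom, of x X n "Suc n"] bd_face[OF smp_ide, of n] smp_idr[OF coface_hom, of "Suc n" n]
  by (simp add: smash_id_enc_def act_susp smash_id_el) (simp add: susp_def small_simps)

lemma smash_id_enc_vertex: "x \<in> el X n \<Longrightarrow> act (susp X) 0 (Suc n) (vertex n) (smash_id_enc X n x) = pt (susp X) 0"
  using act_smash_id_bd[OF _ vertex_hom, of x X n] bd_vertex[OF smp_ide, of n] smp_idr[OF vertex_hom, of n]
  by (simp add: smash_id_enc_def act_susp smash_id_el) (simp add: susp_def small_simps)

lemma susp_cases:
  assumes "y \<in> el (susp X) p"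
  obtains "y = pt (susp X) p"
  | n x g where "x \<in> el X n" "g \<in> hom smp p (Suc n)" "y = act (susp X) p (Suc n) g (smash_id_enc X n x)"
proof -
  obtain c where c: "c \<in> el (susp_raw X) p" "y = enc (el (susp_raw X) p) c"
    using assms by (auto simp: susp_def small_simps)
  from c(1) show thesis
  proof (cases rule: susp_raw_cases)
    case 1 thus ?thesis using that(1) c by (simp add: susp_def small_simps)
  next
    case (2 n x g) thus ?thesis using that(2)[OF 2(1,2)] c by (simp add: smash_id_enc_def act_susp smash_id_el)
  qed
qed

lemma susp_hom_eqI:
  assumes f: "f \<in> psh_hom smp (susp X) W" and f': "f' \<in> psh_hom smp (susp X) W"
    and eq: "\<And>n x. x \<in> el X n \<Longrightarrow> f (Suc n) (smash_id_enc X n x) = f' (Suc n) (smash_id_enc X n x)"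
  shows "f = f'"
proof (rule psh_hom_eqI[OF f f'])
  note D = pmapD[OF psh_hom_pmap[OF f], simplified smp_simps(1), simplified]
    and D' = pmapD[OF psh_hom_pmap[OF f'], simplified smp_simps(1), simplified]
  fix p y assume "y \<in> el (susp X) p"
  thus "f p y = f' p y"
    by (cases rule: susp_cases) (auto simp: D D' eq smash_id_enc_el)
qed

end

lemma susp_term_map_gen:
  assumes \<alpha>: "pmap smp X Y \<alpha>" and "(t, t') \<in> susp_gen X p"
  shows "(susp_term_map \<alpha> t, susp_term_map \<alpha> t') \<in> susp_eq Y p"
  using assms(2)
proof (cases rule: susp_gen_cases)
  case (1 n y)
  thus ?thesis using pmapD(2)[OF \<alpha>, of n] susp_gen_intros(1)[OF 1(3), of Y] by (simp add: susp_gen_eq smp_simps(1))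
next
  case (2 n x)
  thus ?thesis using pmapD(1)[OF \<alpha> 2(3)] susp_gen_intros(2)[of "\<alpha> n x" Y n p] by (simp add: susp_gen_eq smp_simps(1))
next
  case (3 n m \<phi> x y)
  thus ?thesis using pmapD(1)[OF \<alpha> 3(4)] pmapD(3)[OF \<alpha> 3(3,4)] susp_gen_intros(3)[OF 3(3) _ 3(5), of "\<alpha> m x" Y]
    by (simp add: susp_gen_eq smp_simps(1))
qed

context
  fixes X Y :: "'u::infinite smp_psh" and \<alpha>
  assumes \<alpha>: "pmap smp X Y \<alpha>"
begin

private lemma cls: "susp_eq Y p `` (susp_term_map \<alpha> ` (susp_eq X p `` {t})) = susp_eq Y p `` {susp_term_map \<alpha> t}"
  by (rule susp_cls_image[of X p "susp_term_map \<alpha>" Y p, OF susp_term_map_gen[OF \<alpha>]])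

lemma susp_map_hom: "susp_map X Y \<alpha> \<in> psh_hom smp (susp X) (susp Y)"
  unfolding susp_map_def susp_def
proof (rule small_map_hom[OF susp_raw_presheaf susp_fits susp_fits])
  have tm: "susp_term_map \<alpha> t \<in> susp_terms Y p" if "t \<in> susp_terms X p" for t p
    using that pmapD(1)[OF \<alpha>] by (auto simp: susp_terms_def smp_simps(1))
  show "pmap smp (susp_raw X) (susp_raw Y) (\<lambda>p c. susp_eq Y p `` (susp_term_map \<alpha> ` c))"
    unfolding pmap_def
  proof (intro conjI ballI)
    fix p
    { fix c assume "c \<in> el (susp_raw X) p"
      thus "susp_eq Y p `` (susp_term_map \<alpha> ` c) \<in> el (susp_raw Y) p"
        using tm by (auto simp: susp_raw_simps cls) }
    show "susp_eq Y p `` (susp_term_map \<alpha> ` pt (susp_raw X) p) = pt (susp_raw Y) p"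
      by (simp add: susp_raw_simps cls)
    fix q \<theta> c assume \<theta>: "\<theta> \<in> hom smp p q" and "c \<in> el (susp_raw X) q"
    then obtain t where t: "t \<in> susp_terms X q" "c = susp_eq X q `` {t}" by (auto simp: susp_raw_simps)
    have "susp_term_map \<alpha> (susp_term_act p q \<theta> t) = susp_term_act p q \<theta> (susp_term_map \<alpha> t)"
      using t(1) by (auto simp: susp_terms_def)
    thus "susp_eq Y p `` (susp_term_map \<alpha> ` act (susp_raw X) p q \<theta> c)
        = act (susp_raw Y) p q \<theta> (susp_eq Y q `` (susp_term_map \<alpha> ` c))"
      unfolding t(2) by (simp add: cls act_susp_raw[OF \<theta>])
  qed
qed

lemma susp_map_smash_id_enc: "x \<in> el X n \<Longrightarrow> susp_map X Y \<alpha> (Suc n) (smash_id_enc X n x) = smash_id_enc Y n (\<alpha> n x)"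
  unfolding susp_map_def smash_id_enc_def
  by (subst small_map_enc[OF susp_fits _ smash_id_el]) (simp_all add: smp_simps(1) smash_id_def cls)

end

section \<open>Spectrum objects\<close>

lemma smp_apply:
  "x \<in> el P n \<Longrightarrow> psh_comp smp P \<beta> \<alpha> n x = \<beta> n (\<alpha> n x)"
  "x \<in> el P n \<Longrightarrow> psh_id smp P n x = x"
  "x \<in> el P n \<Longrightarrow> psh_zero smp P Q n x = pt Q n"
  by (simp_all add: psh_comp_apply psh_id_apply psh_zero_apply smp_simps(1))

lemma smp_homD:
  assumes "\<alpha> \<in> psh_hom smp P Q"
  shows "x \<in> el P n \<Longrightarrow> \<alpha> n x \<in> el Q n"
    and "\<alpha> n (pt P n) = pt Q n"
    and "\<phi> \<in> hom smp n m \<Longrightarrow> x \<in> el P m \<Longrightarrow> \<alpha> n (act P n m \<phi> x) = act Q n m \<phi> (\<alpha> m x)"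
  using pmapD[OF psh_hom_pmap[OF assms]] by (simp_all add: smp_simps(1))

lemma smp_hom_extI:
  assumes "\<alpha> \<in> psh_hom smp P Q" "\<beta> \<in> psh_hom smp P R" "\<And>n x. x \<in> el P n \<Longrightarrow> \<alpha> n x = \<beta> n x"
  shows "\<alpha> = \<beta>"
  by (rule psh_hom_eqI[OF assms(1,2)]) (rule assms(3))

lemma oplaxlim_simps:
  "Y \<in> obj oplaxlim \<longleftrightarrow> (\<forall>i. pointed_presheaf smp (lev Y i) \<and>
     bond Y i \<in> psh_hom smp (susp (lev Y i)) (lev Y (Suc i)))"
  "hom oplaxlim = spec_hom" "ide oplaxlim Y = (\<lambda>i. psh_id smp (lev Y i))"
  "cmp oplaxlim Y Y' Y'' g f = spec_comp Y g f"
  by (simp_all add: oplaxlim_def)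

text \<open>The bonding map in adjoint form: the degree \<open>n\<close> component of the map from
  level \<open>i\<close> to the Kan loop object of level \<open>Suc i\<close>.\<close>

definition bond_shift :: "'u spectrum \<Rightarrow> nat \<Rightarrow> nat \<Rightarrow> 'u \<Rightarrow> 'u" where
  "bond_shift Y i n x = bond Y i (Suc n) (smash_id_enc (lev Y i) n x)"

fun bond_shift_pow :: "'u spectrum \<Rightarrow> nat \<Rightarrow> nat \<Rightarrow> nat \<Rightarrow> 'u \<Rightarrow> 'u" where
  "bond_shift_pow Y i n 0 x = x"
| "bond_shift_pow Y i n (Suc j) x = bond_shift Y (i + j) (n + j) (bond_shift_pow Y i n j x)"

context
  fixes Y :: "'u::infinite spectrum"
  assumes Y: "Y \<in> obj oplaxlim"
begin

lemma lev_presheaf: "pointed_presheaf smp (lev Y i)"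
  using Y by (simp add: oplaxlim_simps)

lemma bond_hom: "bond Y i \<in> psh_hom smp (susp (lev Y i)) (lev Y (Suc i))"
  using Y by (simp add: oplaxlim_simps)

lemmas levD = smp_presheafD[OF lev_presheaf]

lemma bond_shift_el: "x \<in> el (lev Y i) n \<Longrightarrow> bond_shift Y i n x \<in> el (lev Y (Suc i)) (Suc n)"
  unfolding bond_shift_def by (intro smp_homD[OF bond_hom] smash_id_enc_el)

lemma bond_shift_act:
  "\<phi> \<in> hom smp n m \<Longrightarrow> x \<in> el (lev Y i) m \<Longrightarrow>
    bond_shift Y i n (act (lev Y i) n m \<phi> x) = act (lev Y (Suc i)) (Suc n) (Suc m) (Kmap n m \<phi>) (bond_shift Y i m x)"
  unfolding bond_shift_def by (simp add: smash_id_enc_act smp_homD(3)[OF bond_hom Kmap_hom smash_id_enc_el])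

lemma bond_shift_pt: "bond_shift Y i n (pt (lev Y i) n) = pt (lev Y (Suc i)) (Suc n)"
  by (simp add: bond_shift_def smash_id_enc_pt smp_homD[OF bond_hom])

text \<open>The last face and the last vertex of x \<and> id are collapsed in the suspension. This
  relation and \<open>bond_shift_vertex\<close> are the source of all spherical values.\<close>

lemma bond_shift_face:
  "x \<in> el (lev Y i) n \<Longrightarrow> act (lev Y (Suc i)) n (Suc n) (coface n (Suc n)) (bond_shift Y i n x) = pt (lev Y (Suc i)) n"
  unfolding bond_shift_def
  by (simp add: smp_homD(3)[OF bond_hom coface_hom smash_id_enc_el, symmetric] smash_id_enc_face smp_homD(2)[OF bond_hom])

lemma bond_shift_vertex:
  "x \<in> el (lev Y i) n \<Longrightarrow> act (lev Y (Suc i)) 0 (Suc n) (vertex n) (bond_shift Y i n x) = pt (lev Y (Suc i)) 0"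
  unfolding bond_shift_def
  by (simp add: smp_homD(3)[OF bond_hom vertex_hom smash_id_enc_el, symmetric] smash_id_enc_vertex smp_homD(2)[OF bond_hom])

lemma bond_shift_pow_el: "x \<in> el (lev Y i) n \<Longrightarrow> bond_shift_pow Y i n j x \<in> el (lev Y (i + j)) (n + j)"
  by (induction j) (simp_all add: bond_shift_el)

lemma bond_shift_pow_act:
  "\<phi> \<in> hom smp n m \<Longrightarrow> x \<in> el (lev Y i) m \<Longrightarrow>
    bond_shift_pow Y i n j (act (lev Y i) n m \<phi> x)
      = act (lev Y (i + j)) (n + j) (m + j) (Kpow j n m \<phi>) (bond_shift_pow Y i m j x)"
  by (induction j) (simp_all add: bond_shift_act Kpow_hom bond_shift_pow_el)

lemma bond_shift_pow_pt: "bond_shift_pow Y i n j (pt (lev Y i) n) = pt (lev Y (i + j)) (n + j)"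
  by (induction j) (simp_all add: bond_shift_pt)

end

lemma bond_shift_pow_add: "bond_shift_pow Y i n (j + k) x = bond_shift_pow Y (i + j) (n + j) k (bond_shift_pow Y i n j x)"
  by (induction k) (simp_all add: add.assoc)

lemma spec_homD:
  assumes "f \<in> spec_hom Y Y'"
  shows "f i \<in> psh_hom smp (lev Y i) (lev Y' i)"
    and "psh_comp smp (susp (lev Y i)) (f (Suc i)) (bond Y i)
      = psh_comp smp (susp (lev Y i)) (bond Y' i) (susp_map (lev Y i) (lev Y' i) (f i))"
  using assms by (simp_all add: spec_hom_def)

text \<open>The elements x \<and> id generate the suspension, so compatibility with the bonding maps
  need only be tested on them.\<close>

lemma spec_hom_iff:
  fixes Y Y' :: "'u::infinite spectrum"
  assumes Y: "Y \<in> obj oplaxlim" and Y': "Y' \<in> obj oplaxlim"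
  shows "f \<in> spec_hom Y Y' \<longleftrightarrow> (\<forall>i. f i \<in> psh_hom smp (lev Y i) (lev Y' i)) \<and>
    (\<forall>i n x. x \<in> el (lev Y i) n \<longrightarrow> f (Suc i) (Suc n) (bond_shift Y i n x) = bond_shift Y' i n (f i n x))"
proof -
  have "psh_comp smp (susp (lev Y i)) (f (Suc i)) (bond Y i)
      = psh_comp smp (susp (lev Y i)) (bond Y' i) (susp_map (lev Y i) (lev Y' i) (f i)) \<longleftrightarrow>
    (\<forall>n x. x \<in> el (lev Y i) n \<longrightarrow> f (Suc i) (Suc n) (bond_shift Y i n x) = bond_shift Y' i n (f i n x))"
    (is "?l = ?r \<longleftrightarrow> _") if f: "\<And>i. f i \<in> psh_hom smp (lev Y i) (lev Y' i)" for i
  proof -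
    have l: "?l \<in> psh_hom smp (susp (lev Y i)) (lev Y' (Suc i))"
      by (rule psh_comp_hom[OF bond_hom[OF Y] f susp_presheaf])
    have m: "susp_map (lev Y i) (lev Y' i) (f i) \<in> psh_hom smp (susp (lev Y i)) (susp (lev Y' i))"
      by (rule susp_map_hom[OF psh_hom_pmap[OF f]])
    have r: "?r \<in> psh_hom smp (susp (lev Y i)) (lev Y' (Suc i))"
      by (rule psh_comp_hom[OF m bond_hom[OF Y'] susp_presheaf])
    have le: "?l (Suc n) (smash_id_enc (lev Y i) n x) = f (Suc i) (Suc n) (bond_shift Y i n x)"
      and re: "?r (Suc n) (smash_id_enc (lev Y i) n x) = bond_shift Y' i n (f i n x)" if "x \<in> el (lev Y i) n" for n x
      using that by (simp_all add: smp_apply smash_id_enc_el bond_shift_def susp_map_smash_id_enc[OF psh_hom_pmap[OF f]])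
    show ?thesis
    proof
      assume "?l = ?r" thus "\<forall>n x. x \<in> el (lev Y i) n \<longrightarrow> f (Suc i) (Suc n) (bond_shift Y i n x) = bond_shift Y' i n (f i n x)"
        using le re by simp
    next
      assume "\<forall>n x. x \<in> el (lev Y i) n \<longrightarrow> f (Suc i) (Suc n) (bond_shift Y i n x) = bond_shift Y' i n (f i n x)"
      thus "?l = ?r" by (intro susp_hom_eqI[OF l r]) (simp add: le re)
    qed
  qed
  thus ?thesis unfolding spec_hom_def by blast
qed

lemma spec_hom_bond_shift:
  assumes "Y \<in> obj oplaxlim" "Y' \<in> obj oplaxlim" "f \<in> spec_hom Y (Y' :: 'u::infinite spectrum)" "x \<in> el (lev Y i) n"
  shows "f (Suc i) (Suc n) (bond_shift Y i n x) = bond_shift Y' i n (f i n x)"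
  using assms spec_hom_iff by blast

lemma spec_comp_hom:
  fixes Y Y' Y'' :: "'u::infinite spectrum"
  assumes Y: "Y \<in> obj oplaxlim" "Y' \<in> obj oplaxlim" "Y'' \<in> obj oplaxlim"
    and f: "f \<in> spec_hom Y Y'" and g: "g \<in> spec_hom Y' Y''"
  shows "spec_comp Y g f \<in> spec_hom Y Y''"
  unfolding spec_hom_iff[OF Y(1,3)] spec_comp_def
  using psh_comp_hom[OF spec_homD(1)[OF f] spec_homD(1)[OF g] lev_presheaf[OF Y(1)]]
  by (simp add: smp_apply bond_shift_el[OF Y(1)] spec_hom_bond_shift[OF Y(1,2) f] spec_hom_bond_shift[OF Y(2,3) g]
      smp_homD(1)[OF spec_homD(1)[OF f]])

lemma spec_zero_hom:
  fixes Y Y' :: "'u::infinite spectrum"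
  assumes Y: "Y \<in> obj oplaxlim" "Y' \<in> obj oplaxlim"
  shows "spec_zero Y Y' \<in> spec_hom Y Y'"
  unfolding spec_hom_iff[OF Y] spec_zero_def
  using psh_zero_hom[OF lev_presheaf[OF Y(1)] lev_presheaf[OF Y(2)]]
  by (simp add: smp_apply bond_shift_el[OF Y(1)] bond_shift_pt[OF Y(2)])

lemma category_oplaxlim: "category (oplaxlim :: ('u::infinite spectrum, 'u spec_mor) cat)"
  unfolding category_def
proof (intro conjI ballI)
  fix Y Y' Y'' Y''' :: "'u spectrum" and f g h
  assume Y: "Y \<in> obj oplaxlim"
  have "(\<lambda>i. psh_id smp (lev Y i)) \<in> spec_hom Y Y"
    unfolding spec_hom_iff[OF Y Y] using psh_id_hom[OF lev_presheaf[OF Y]]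
    by (simp add: smp_apply bond_shift_el[OF Y])
  thus "ide oplaxlim Y \<in> hom oplaxlim Y Y" by (simp add: oplaxlim_simps)
  assume Y': "Y' \<in> obj oplaxlim"
  { assume "f \<in> hom oplaxlim Y Y'"
    hence f: "f \<in> spec_hom Y Y'" by (simp add: oplaxlim_simps)
    show "cmp oplaxlim Y Y Y' f (ide oplaxlim Y) = f" "cmp oplaxlim Y Y' Y' (ide oplaxlim Y') f = f"
      unfolding oplaxlim_simps spec_comp_def
      by (simp_all add: psh_comp_id[OF spec_homD(1)[OF f] lev_presheaf[OF Y] lev_presheaf[OF Y']]) }
  assume Y'': "Y'' \<in> obj oplaxlim" and "f \<in> hom oplaxlim Y Y'" "g \<in> hom oplaxlim Y' Y''"
  hence f: "f \<in> spec_hom Y Y'" and g: "g \<in> spec_hom Y' Y''" by (simp_all add: oplaxlim_simps)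
  show "cmp oplaxlim Y Y' Y'' g f \<in> hom oplaxlim Y Y''"
    unfolding oplaxlim_simps(2-) by (rule spec_comp_hom[OF Y Y' Y'' f g])
  assume "h \<in> hom oplaxlim Y'' Y'''"
  hence h: "h \<in> spec_hom Y'' Y'''" by (simp add: oplaxlim_simps)
  show "cmp oplaxlim Y Y' Y''' (cmp oplaxlim Y' Y'' Y''' h g) f
    = cmp oplaxlim Y Y'' Y''' h (cmp oplaxlim Y Y' Y'' g f)"
    unfolding oplaxlim_simps spec_comp_def
    by (simp add: psh_comp_assoc[OF spec_homD(1)[OF f] spec_homD(1)[OF g] spec_homD(1)[OF h] lev_presheaf[OF Y] lev_presheaf[OF Y']])
qed

section \<open>The functor \<open>\<Phi>\<close>\<close>

lemma rep_smp_fits: "psh_fits TYPE('u::infinite) smp (rep_plus smp n)"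
  unfolding psh_fits_def by (auto simp: rep_plus_simps intro!: fits_countable countable_smp_hom)

definition simplex_id :: "nat \<Rightarrow> 'u" where
  "simplex_id n = enc (el (rep_plus smp n) n) (Some (ide smp n))"

lemma simplex_presheaf: "pointed_presheaf smp (simplex n :: 'u::infinite smp_psh)"
  unfolding simplex_def by (rule small_presheaf[OF smp_rep_presheaf rep_smp_fits])

lemma simplex_id_el: "(simplex_id n :: 'u::infinite) \<in> el (simplex n) n"
  by (simp add: simplex_id_def simplex_def small_simps rep_plus_simps smp_ide)

lemma act_simplex:
  "y \<in> el (rep_plus smp n) q \<Longrightarrow>
    act (simplex n :: 'u::infinite smp_psh) p q \<theta> (enc (el (rep_plus smp n) q) y)
      = enc (el (rep_plus smp n) p) (act (rep_plus smp n) p q \<theta> y)"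
  unfolding simplex_def by (rule act_small[OF rep_smp_fits]) (simp_all add: smp_simps(1))

lemma ide_rep_el: "Some (ide smp n) \<in> el (rep_plus smp n) n"
  by (simp add: rep_plus_simps smp_ide)

lemma act_simplex_id:
  "g \<in> hom smp p n \<Longrightarrow> act (simplex n) p n g (simplex_id n :: 'u::infinite) = enc (el (rep_plus smp n) p) (Some g)"
  unfolding simplex_id_def act_simplex[OF ide_rep_el] by (simp add: rep_plus_simps smp_idl)

lemma simplex_cases:
  assumes "y \<in> el (simplex n :: 'u::infinite smp_psh) p"
  obtains "y = pt (simplex n) p" | g where "g \<in> hom smp p n" "y = act (simplex n) p n g (simplex_id n)"
proof -
  obtain z where z: "z \<in> el (rep_plus smp n) p" "y = enc (el (rep_plus smp n) p) z"
    using assms by (auto simp: simplex_def small_simps)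
  show thesis
  proof (cases z)
    case None
    thus ?thesis using that(1) z by (simp add: simplex_def small_simps rep_plus_simps(2))
  next
    case (Some g)
    hence "g \<in> hom smp p n" using z(1) by (auto simp: rep_plus_simps)
    thus ?thesis using that(2)[of g] z(2) Some by (simp add: act_simplex_id)
  qed
qed

lemma simplex_hom_eqI:
  assumes f: "f \<in> psh_hom smp (simplex n :: 'u::infinite smp_psh) W" and f': "f' \<in> psh_hom smp (simplex n) W"
    and eq: "f n (simplex_id n) = f' n (simplex_id n)"
  shows "f = f'"
proof (rule smp_hom_extI[OF f f'])
  fix p y assume "y \<in> el (simplex n :: 'u smp_psh) p"
  thus "f p y = f' p y"
    by (cases rule: simplex_cases) (simp_all add: smp_homD[OF f] smp_homD[OF f'] simplex_id_el eq)
qed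

lemma simplex_hom_exists:
  fixes W :: "('u::infinite) smp_psh"
  assumes W: "pointed_presheaf smp W" and w: "w \<in> el W n"
  shows "\<exists>f\<in>psh_hom smp (simplex n :: 'u smp_psh) W. f n (simplex_id n) = w"
proof -
  note WD = smp_presheafD[OF W]
  \<comment> \<open>\<open>v\<close> decodes \<open>y\<close> and lets the operator found there act
    on \<open>w\<close>; the added base-point \<open>None\<close> goes to the base-point.\<close>
  define v where "v p y = (case dec (el (rep_plus smp n) p) (y :: 'u) of None \<Rightarrow> pt W p | Some g \<Rightarrow> act W p n g w)" for p y
  have dec: "dec (el (rep_plus smp n) p) (enc (el (rep_plus smp n) p) z :: 'u) = z" if "z \<in> el (rep_plus smp n) p" for p z
    using that rep_smp_fits[where 'u = 'u and n = n] by (intro dec_enc) (auto simp: psh_fits_def smp_simps(1))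
  have pt: "v p (pt (simplex n) p) = pt W p" for p
    using dec[of None p] by (simp add: v_def simplex_def small_simps rep_plus_simps)
  have g: "v p (act (simplex n) p n g (simplex_id n)) = act W p n g w" if "g \<in> hom smp p n" for p g
    using dec[of "Some g" p] that by (simp add: v_def act_simplex_id rep_plus_simps)
  have "pmap smp (simplex n) W v"
    unfolding pmap_def smp_simps(1)
  proof (intro conjI ballI pt)
    { fix q y assume "y \<in> el (simplex n :: 'u smp_psh) q"
      thus "v q y \<in> el W q" by (cases rule: simplex_cases) (simp_all add: pt g WD w) }
    fix p q \<theta> y assume y: "y \<in> el (simplex n :: 'u smp_psh) q" and \<theta>: "\<theta> \<in> hom smp p q"
    show "v p (act (simplex n) p q \<theta> y) = act W p q \<theta> (v q y)"
      using y
    proof (cases rule: simplex_cases)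
      case 1 thus ?thesis using \<theta> by (simp add: smp_presheafD(3)[OF simplex_presheaf] pt WD)
    next
      case (2 h)
      have "act (simplex n) p q \<theta> y = act (simplex n) p n (cmp smp p q n h \<theta>) (simplex_id n)"
        by (simp add: 2(2) smp_presheafD(5)[OF simplex_presheaf \<theta> 2(1) simplex_id_el])
      thus ?thesis
        using WD(5)[OF \<theta> 2(1) w] g[OF smp_cmp[OF \<theta> 2(1)]] g[OF 2(1)] 2(2) by simp
    qed
  qed
  hence "(\<lambda>c\<in>obj smp. \<lambda>x\<in>el (simplex n) c. v c x) \<in> psh_hom smp (simplex n) W"
    by (rule restrict_pmap[OF _ simplex_presheaf])
  moreover have "v n (simplex_id n) = w"
    using g[OF smp_ide] WD(4)[OF w] by (simp add: smp_presheafD(4)[OF simplex_presheaf simplex_id_el])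
  ultimately show ?thesis using simplex_id_el by (intro bexI) (auto simp: smp_simps(1))
qed

lemma simplex_map_hom:
  assumes \<phi>: "\<phi> \<in> hom smp n m"
  shows "simplex_map n m \<phi> \<in> psh_hom smp (simplex n :: 'u::infinite smp_psh) (simplex m)"
  unfolding simplex_map_def simplex_def
  using smp_cmp[OF _ \<phi>] smp_assoc[OF _ _ \<phi>]
  by (intro small_map_hom smp_rep_presheaf rep_smp_fits) (auto simp: pmap_def rep_plus_simps)

lemma simplex_map_simplex_id:
  "\<phi> \<in> hom smp n m \<Longrightarrow> simplex_map n m \<phi> n (simplex_id n :: 'u::infinite) = act (simplex m) n m \<phi> (simplex_id m)"
  unfolding simplex_map_def simplex_id_def[of n]
  by (subst small_map_enc[OF rep_smp_fits _ ide_rep_el]) (simp_all add: smp_simps(1) act_simplex_id smp_idr)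

lemma susp_quot_hom: "susp_quot n \<in> psh_hom smp (simplex (Suc n) :: 'u::infinite smp_psh) (susp (simplex n))"
  unfolding susp_quot_def simplex_def[of "Suc n"] susp_def
proof (rule small_map_hom[OF smp_rep_presheaf rep_smp_fits susp_fits])
  let ?s = "simplex_id n :: 'u"
  have N: "susp_eq (simplex n) p `` {Some (n, ?s, None)} = susp_eq (simplex n) p `` {None}" for p
    unfolding susp_cls_eq by (rule susp_gen_eq[OF susp_gen_intros(2)[OF simplex_id_el]])
  show "pmap smp (rep_plus smp (Suc n)) (susp_raw (simplex n)) (\<lambda>p y. susp_eq (simplex n) p ``
      {Some (n, enc (el (rep_plus smp n) n) (Some (ide smp n)) :: 'u, cofq n p y)})"
    unfolding pmap_def simplex_id_def[symmetric]
  proof (intro conjI ballI)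
    fix p
    show "susp_eq (simplex n) p `` {Some (n, ?s, cofq n p (pt (rep_plus smp (Suc n)) p))} = pt (susp_raw (simplex n)) p"
      by (simp add: rep_plus_simps cofq_None N susp_raw_simps)
    { fix y assume "y \<in> el (rep_plus smp (Suc n)) p"
      thus "susp_eq (simplex n) p `` {Some (n, ?s, cofq n p y)} \<in> el (susp_raw (simplex n)) p"
        unfolding susp_raw_simps using cofq_el[of y p n] simplex_id_el
        by (intro imageI) (simp add: susp_terms_Some rep_plus_simps) }
    fix q \<theta> y assume "\<theta> \<in> hom smp p q"
    thus "susp_eq (simplex n) p `` {Some (n, ?s, cofq n p (act (rep_plus smp (Suc n)) p q \<theta> y))}
        = act (susp_raw (simplex n)) p q \<theta> (susp_eq (simplex n) q `` {Some (n, ?s, cofq n q y)})"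
      by (simp add: act_susp_raw act_cofq rep_plus_simps)
  qed
qed

lemma susp_quot_simplex_id: "susp_quot n (Suc n) (simplex_id (Suc n) :: 'u::infinite) = smash_id_enc (simplex n) n (simplex_id n)"
  unfolding susp_quot_def simplex_id_def[of "Suc n"]
  by (subst small_map_enc[OF rep_smp_fits _ ide_rep_el]) (simp_all add: smp_simps(1) smash_id_enc_def smash_id_def simplex_id_def)

lemma susp_pow_presheaf:
  "pointed_presheaf smp (X :: 'u::infinite smp_psh) \<Longrightarrow> pointed_presheaf smp (susp_pow j X)"
  by (cases j) (simp_all add: susp_presheaf)

lemma susp_pow_add: "susp_pow (i + j) X = susp_pow i (susp_pow j X)"
  by (induction i) simp_all

lemma susp_pow_map_hom:
  "\<alpha> \<in> psh_hom smp X (X' :: 'u::infinite smp_psh) \<Longrightarrow>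
    susp_pow_map j X X' \<alpha> \<in> psh_hom smp (susp_pow j X) (susp_pow j X')"
  by (induction j) (simp_all add: susp_map_hom psh_hom_pmap)

lemma susp_quot_pow_hom:
  "susp_quot_pow k n \<in> psh_hom smp (simplex (n + k) :: 'u::infinite smp_psh) (susp_pow k (simplex n))"
proof (induction k)
  case (Suc k)
  thus ?case
    using psh_comp_hom[OF susp_quot_hom susp_map_hom[OF psh_hom_pmap[OF Suc]] simplex_presheaf] by simp
qed (simp add: psh_id_hom simplex_presheaf)

lemma point_presheaf: "pointed_presheaf smp (point :: 'u::infinite smp_psh)"
  unfolding point_def
  by (rule small_presheaf)
    (auto simp: pointed_presheaf_def point_raw_def psh_fits_def intro: fits_countable)

lemma point_el: "x \<in> el point n \<Longrightarrow> x = pt point n"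
  by (simp add: point_def small_simps point_raw_def)

lemma lev_Phi:
  "i < k \<Longrightarrow> lev (Phi_obj (n, k)) i = point"
  "k \<le> i \<Longrightarrow> lev (Phi_obj (n, k)) i = susp_pow (i - k) (simplex n)"
  by simp_all

lemma Phi_obj_oplaxlim: "(Phi_obj c :: 'u::infinite spectrum) \<in> obj oplaxlim"
proof -
  obtain n k where c: "c = (n, k)" by fastforce
  have "pointed_presheaf smp (lev (Phi_obj (n, k) :: 'u spectrum) i)" for i
    by (simp add: point_presheaf susp_pow_presheaf simplex_presheaf)
  moreover have "bond (Phi_obj (n, k)) i \<in> psh_hom smp (susp (lev (Phi_obj (n, k) :: 'u spectrum) i)) (lev (Phi_obj (n, k)) (Suc i))" for i
  proof (cases "i < k")
    \<comment> \<open>If \<open>Suc i = k\<close>, the target level is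
      \<open>susp_pow 0 (simplex n)\<close>, which is the simplex itself.\<close>
    case True
    thus ?thesis
      using psh_zero_hom[OF susp_presheaf point_presheaf] psh_zero_hom[OF susp_presheaf simplex_presheaf]
      by (cases "Suc i < k") (simp_all add: not_less le_antisym)
  next
    case False
    hence "Suc i - k = Suc (i - k)" by simp
    thus ?thesis using False psh_id_hom[OF susp_presheaf] by simp
  qed
  ultimately show ?thesis unfolding oplaxlim_simps c by blast
qed

text \<open>Below \<open>k\<close> the level is a point; from \<open>k\<close> on the bonding maps
  are identities, so a shift is just x \<and> id.\<close>

lemma bond_shift_Phi:
  assumes "x \<in> el (lev (Phi_obj (n, k) :: 'u::infinite spectrum) i) p"
  shows "i < k \<Longrightarrow> bond_shift (Phi_obj (n, k)) i p x = pt (lev (Phi_obj (n, k)) (Suc i)) (Suc p)"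
    and "k \<le> i \<Longrightarrow> bond_shift (Phi_obj (n, k)) i p x = smash_id_enc (susp_pow (i - k) (simplex n)) p x"
proof -
  assume i: "i < k"
  hence "x = pt (lev (Phi_obj (n, k)) i) p" using assms point_el by simp
  thus "bond_shift (Phi_obj (n, k)) i p x = pt (lev (Phi_obj (n, k)) (Suc i)) (Suc p)"
    using bond_shift_pt[OF Phi_obj_oplaxlim] by blast
next
  assume i: "k \<le> i"
  hence "Suc i - k = Suc (i - k)" by simp
  thus "bond_shift (Phi_obj (n, k)) i p x = smash_id_enc (susp_pow (i - k) (simplex n)) p x"
    using i smash_id_enc_el[of x "susp_pow (i - k) (simplex n)" p] assms by (simp add: bond_shift_def smp_apply)
qed

text \<open>Below level \<open>a\<close> the source is a point, where both sides are base-points.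
  From \<open>a\<close> on, the morphism is an iterated suspension, and suspension is natural for x
  \<and> id.\<close>

lemma Phi_map_hom:
  assumes \<phi>: "\<phi> \<in> hom coll (n, a) (l, b)"
  shows "Phi_map (n, a) (l, b) \<phi> \<in> spec_hom (Phi_obj (n, a) :: 'u::infinite spectrum) (Phi_obj (l, b))"
  unfolding spec_hom_iff[OF Phi_obj_oplaxlim Phi_obj_oplaxlim]
proof (intro conjI allI impI)
  have ba: "b \<le> a" and \<phi>': "\<phi> \<in> hom smp n (l + (a - b))" using \<phi> by (auto simp: coll_hom_iff)
  let ?\<alpha> = "psh_comp smp (simplex n :: 'u smp_psh) (susp_quot_pow (a - b) l) (simplex_map n (l + (a - b)) \<phi>)"
  have \<alpha>: "?\<alpha> \<in> psh_hom smp (simplex n) (susp_pow (a - b) (simplex l))"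
    by (rule psh_comp_hom[OF simplex_map_hom[OF \<phi>'] susp_quot_pow_hom simplex_presheaf])
  have m: "Phi_map (n, a) (l, b) \<phi> i = susp_pow_map (i - a) (simplex n) (susp_pow (a - b) (simplex l)) ?\<alpha>" if "a \<le> i" for i
    using that by simp
  \<comment> \<open>The exponents add up, (i - a) + (a - b) = i - b, because b \<le> a \<le>
    i.\<close>
  have lb: "lev (Phi_obj (l, b)) i = susp_pow (i - a) (susp_pow (a - b) (simplex l :: 'u smp_psh))" if "a \<le> i" for i
    using that ba susp_pow_add[of "i - a" "a - b" "simplex l :: 'u smp_psh"] by simp
  show hom: "Phi_map (n, a) (l, b) \<phi> i \<in> psh_hom smp (lev (Phi_obj (n, a)) i) (lev (Phi_obj (l, b) :: 'u spectrum) i)" for i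
  proof (cases "i < a")
    case True
    thus ?thesis using psh_zero_hom[OF point_presheaf lev_presheaf[OF Phi_obj_oplaxlim[of "(l, b)"]]]
      by (simp del: Phi_obj.simps add: lev_Phi)
  next
    case False
    thus ?thesis unfolding m[OF leI[OF False]] lb[OF leI[OF False]] using lev_Phi(2)[of a i n] susp_pow_map_hom[OF \<alpha>] by simp
  qed
  fix i p and x :: 'u assume x: "x \<in> el (lev (Phi_obj (n, a)) i) p"
  show "Phi_map (n, a) (l, b) \<phi> (Suc i) (Suc p) (bond_shift (Phi_obj (n, a)) i p x)
     = bond_shift (Phi_obj (l, b)) i p (Phi_map (n, a) (l, b) \<phi> i p x)"
  proof (cases "i < a")
    case True
    hence "x = pt (lev (Phi_obj (n, a)) i) p" using x point_el by simp
    thus ?thesis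
      using bond_shift_pt[OF Phi_obj_oplaxlim, of _ i p] smp_homD(2)[OF hom] by metis
  next
    case False
    hence i: "a \<le> i" "a \<le> Suc i" "b \<le> i" "Suc i - a = Suc (i - a)" using ba by auto
    have x': "x \<in> el (susp_pow (i - a) (simplex n)) p" using x i by simp
    have y: "Phi_map (n, a) (l, b) \<phi> i p x \<in> el (lev (Phi_obj (l, b)) i) p"
      by (rule smp_homD(1)[OF hom x])
    have e: "susp_pow (i - b) (simplex l) = susp_pow (i - a) (susp_pow (a - b) (simplex l :: 'u smp_psh))"
      using lb[OF i(1)] i(3) by simp
    show ?thesis
      unfolding bond_shift_Phi(2)[OF x i(1)] bond_shift_Phi(2)[OF y i(3)] e unfolding m[OF i(1)] m[OF i(2)] i(4)
      using susp_map_smash_id_enc[OF psh_hom_pmap[OF susp_pow_map_hom[OF \<alpha>]] x'] by simp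
  qed
qed

text \<open>The Yoneda evaluation: \<open>Phi_obj (n, k)\<close> is the spectrum object freely
  generated by an n-simplex at level \<open>k\<close>.\<close>

definition spec_ev :: "nat \<times> nat \<Rightarrow> 'u spec_mor \<Rightarrow> 'u" where
  "spec_ev c h = h (snd c) (fst c) (simplex_id (fst c))"

lemma simplex_id_lev: "(simplex_id n :: 'u::infinite) \<in> el (lev (Phi_obj (n, k)) k) n"
  by (simp add: simplex_id_el)

context
  fixes Y :: "'u::infinite spectrum"
  assumes Y: "Y \<in> obj oplaxlim"
begin

lemma spec_ev_el: "h \<in> spec_hom (Phi_obj (n, k)) Y \<Longrightarrow> spec_ev (n, k) h \<in> el (lev Y k) n"
  unfolding spec_ev_def using smp_homD(1)[OF spec_homD(1) simplex_id_lev] by simp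

text \<open>Below level \<open>k\<close> the source is a point. Above it, each level is the
  suspension of the previous one with identity bonds, so a morphism is determined level by level
  from its value at \<open>k\<close>.\<close>

lemma spec_ev_inj:
  assumes h: "h \<in> spec_hom (Phi_obj (n, k)) Y" and h': "h' \<in> spec_hom (Phi_obj (n, k)) Y"
    and eq: "spec_ev (n, k) h = spec_ev (n, k) h'"
  shows "h = h'"
proof
  have up: "h (k + j) = h' (k + j)" for j
  proof (induction j)
    case 0
    show ?case
      using spec_homD(1)[OF h, of k] spec_homD(1)[OF h', of k] eq
      by (intro simplex_hom_eqI[where n = n and W = "lev Y k"]) (simp_all add: spec_ev_def)
  next
    case (Suc j)
    let ?X = "susp_pow j (simplex n) :: 'u smp_psh"
    have X: "lev (Phi_obj (n, k)) (k + j) = ?X" "lev (Phi_obj (n, k)) (Suc (k + j)) = susp ?X"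
      using lev_Phi(2)[of k "Suc (k + j)" n] by (simp_all add: Suc_diff_le)
    have "h (Suc (k + j)) = h' (Suc (k + j))"
    proof (rule susp_hom_eqI[where X = ?X])
      show "h (Suc (k + j)) \<in> psh_hom smp (susp ?X) (lev Y (Suc (k + j)))"
        "h' (Suc (k + j)) \<in> psh_hom smp (susp ?X) (lev Y (Suc (k + j)))"
        using spec_homD(1)[OF h, of "Suc (k + j)"] spec_homD(1)[OF h', of "Suc (k + j)"] unfolding X by auto
      fix p x assume "x \<in> el ?X p"
      hence x: "x \<in> el (lev (Phi_obj (n, k)) (k + j)) p" unfolding X .
      have "smash_id_enc ?X p x = bond_shift (Phi_obj (n, k)) (k + j) p x"
        using bond_shift_Phi(2)[OF x] by simp
      thus "h (Suc (k + j)) (Suc p) (smash_id_enc ?X p x) = h' (Suc (k + j)) (Suc p) (smash_id_enc ?X p x)"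
        using spec_hom_bond_shift[OF Phi_obj_oplaxlim Y h x] spec_hom_bond_shift[OF Phi_obj_oplaxlim Y h' x] Suc by simp
    qed
    thus ?case by simp
  qed
  fix i show "h i = h' i"
  proof (cases "i < k")
    case True
    show ?thesis
    proof (rule smp_hom_extI[OF spec_homD(1)[OF h] spec_homD(1)[OF h']])
      fix p x assume "x \<in> el (lev (Phi_obj (n, k) :: 'u spectrum) i) p"
      hence "x = pt (lev (Phi_obj (n, k)) i) p" using True point_el by simp
      thus "h i p x = h' i p x"
        using smp_homD(2)[OF spec_homD(1)[OF h]] smp_homD(2)[OF spec_homD(1)[OF h']] by metis
    qed
  next
    case False thus ?thesis using up[of "i - k"] by simp
  qed
qed

text \<open>The only possible extension of \<open>f\<close> to higher levels: the bonds of the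
  source are identities, so compatibility with bonds prescribes the next level.\<close>

primrec spec_lift :: "nat \<Rightarrow> nat \<Rightarrow> 'u smp_mor \<Rightarrow> nat \<Rightarrow> 'u smp_mor" where
  "spec_lift n k f 0 = f"
| "spec_lift n k f (Suc j) = psh_comp smp (susp (susp_pow j (simplex n))) (bond Y (k + j))
     (susp_map (susp_pow j (simplex n)) (lev Y (k + j)) (spec_lift n k f j))"

lemma spec_ev_surj:
  assumes y: "y \<in> el (lev Y k) n"
  shows "\<exists>h\<in>spec_hom (Phi_obj (n, k)) Y. spec_ev (n, k) h = y"
proof -
  obtain f where f: "f \<in> psh_hom smp (simplex n :: 'u smp_psh) (lev Y k)" "f n (simplex_id n) = y"
    using simplex_hom_exists[OF lev_presheaf[OF Y] y] by blast
  let ?X = "\<lambda>j. susp_pow j (simplex n) :: 'u smp_psh"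
  have L: "spec_lift n k f j \<in> psh_hom smp (?X j) (lev Y (k + j))" for j
  proof (induction j)
    case (Suc j)
    show ?case using psh_comp_hom[OF susp_map_hom[OF psh_hom_pmap[OF Suc]] bond_hom[OF Y] susp_presheaf] by simp
  qed (simp add: f)
  define h where "h i = (if i < k then psh_zero smp point (lev Y i) else spec_lift n k f (i - k))" for i
  have hom: "h i \<in> psh_hom smp (lev (Phi_obj (n, k)) i) (lev Y i)" for i
  proof (cases "i < k")
    case True thus ?thesis using psh_zero_hom[OF point_presheaf lev_presheaf[OF Y]] by (simp add: h_def)
  next
    case False thus ?thesis using L[of "i - k"] by (simp add: h_def)
  qed
  have "h \<in> spec_hom (Phi_obj (n, k)) Y"
    unfolding spec_hom_iff[OF Phi_obj_oplaxlim Y]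
  proof (intro conjI allI impI hom)
    fix i p and x :: 'u assume x: "x \<in> el (lev (Phi_obj (n, k)) i) p"
    show "h (Suc i) (Suc p) (bond_shift (Phi_obj (n, k)) i p x) = bond_shift Y i p (h i p x)"
    proof (cases "i < k")
      case True
      hence "x = pt (lev (Phi_obj (n, k)) i) p" using x point_el by simp
      thus ?thesis
        using bond_shift_pt[OF Phi_obj_oplaxlim, of _ i p] bond_shift_pt[OF Y, of i p] smp_homD(2)[OF hom] by metis
    next
      case False
      hence i: "k \<le> i" "k + (i - k) = i" "Suc i - k = Suc (i - k)" by auto
      have x': "x \<in> el (?X (i - k)) p" using x i by simp
      have hi: "h i = spec_lift n k f (i - k)" "h (Suc i) = spec_lift n k f (Suc (i - k))"
        using False i(3) by (simp_all add: h_def)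
      have "h (Suc i) (Suc p) (smash_id_enc (?X (i - k)) p x) = bond Y i (Suc p) (smash_id_enc (lev Y i) p (h i p x))"
        unfolding hi using susp_map_smash_id_enc[OF psh_hom_pmap[OF L[of "i - k"]] x'] smash_id_enc_el[OF x'] i(2) by (simp add: smp_apply)
      thus ?thesis using bond_shift_Phi(2)[OF x i(1)] by (simp add: bond_shift_def)
    qed
  qed
  moreover have "spec_ev (n, k) h = y" by (simp add: spec_ev_def h_def f)
  ultimately show ?thesis by blast
qed

text \<open>The iterated quotient map sends the fundamental simplex to an iterate of x \<and> id.
  These are the shifts of \<open>Phi_obj (l, b)\<close>, and \<open>h\<close> carries them to the
  shifts of \<open>Y\<close>.\<close>

lemma spec_ev_quot:
  assumes h: "h \<in> spec_hom (Phi_obj (l, b)) Y"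
  shows "h (b + j) (l + j) (susp_quot_pow j l (l + j) (simplex_id (l + j))) = bond_shift_pow Y b l j (spec_ev (l, b) h)"
proof (induction j)
  case 0
  show ?case by (simp add: spec_ev_def smp_apply simplex_id_el)
next
  case (Suc j)
  let ?X = "susp_pow j (simplex l) :: 'u smp_psh"
  let ?q = "susp_quot_pow j l (l + j) (simplex_id (l + j)) :: 'u"
  have q: "?q \<in> el ?X (l + j)" by (rule smp_homD(1)[OF susp_quot_pow_hom simplex_id_el])
  hence q': "?q \<in> el (lev (Phi_obj (l, b)) (b + j)) (l + j)" by simp
  have "susp_quot_pow (Suc j) l (l + Suc j) (simplex_id (l + Suc j)) = smash_id_enc ?X (l + j) ?q"
    using simplex_id_el[where 'u = 'u and n = "Suc (l + j)"] susp_quot_simplex_id[where 'u = 'u and n = "l + j"]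
      susp_map_smash_id_enc[OF psh_hom_pmap[OF susp_quot_pow_hom[where 'u = 'u and k = j and n = l]] simplex_id_el]
    by (simp add: smp_apply)
  also have "\<dots> = bond_shift (Phi_obj (l, b)) (b + j) (l + j) ?q" using bond_shift_Phi(2)[OF q'] by simp
  finally show ?case using spec_hom_bond_shift[OF Phi_obj_oplaxlim Y h q'] Suc by simp
qed

text \<open>Makes the presheaf structure of \<open>Phi_star_raw Y\<close> explicit: to restrict
  along \<open>\<phi>\<close>, shift an element up by \<open>a - b\<close> levels and let
  \<open>\<phi>\<close> act there.\<close>

lemma spec_ev_act:
  assumes h: "h \<in> spec_hom (Phi_obj (l, b)) Y" and \<phi>: "\<phi> \<in> hom coll (n, a) (l, b)"
  shows "spec_ev (n, a) (spec_comp (Phi_obj (n, a)) h (Phi_map (n, a) (l, b) \<phi>))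
    = act (lev Y a) n (l + (a - b)) \<phi> (bond_shift_pow Y b l (a - b) (spec_ev (l, b) h))"
proof -
  have ba: "b \<le> a" and \<phi>': "\<phi> \<in> hom smp n (l + (a - b))" using \<phi> by (auto simp: coll_hom_iff)
  let ?l = "l + (a - b)"
  let ?q = "susp_quot_pow (a - b) l :: 'u smp_mor"
  have lev: "lev (Phi_obj (l, b)) a = susp_pow (a - b) (simplex l :: 'u smp_psh)" using ba by simp
  have ha: "h a \<in> psh_hom smp (susp_pow (a - b) (simplex l)) (lev Y a)"
    using spec_homD(1)[OF h, of a] unfolding lev .
  have "spec_ev (n, a) (spec_comp (Phi_obj (n, a)) h (Phi_map (n, a) (l, b) \<phi>))
     = h a n (?q n (act (simplex ?l) n ?l \<phi> (simplex_id ?l)))"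
    by (simp add: spec_ev_def spec_comp_def smp_apply simplex_id_el simplex_map_simplex_id[OF \<phi>'])
  also have "\<dots> = act (lev Y a) n ?l \<phi> (h a ?l (?q ?l (simplex_id ?l)))"
    by (simp add: smp_homD(3)[OF susp_quot_pow_hom \<phi>' simplex_id_el]
        smp_homD(3)[OF ha \<phi>' smp_homD(1)[OF susp_quot_pow_hom simplex_id_el]])
  finally show ?thesis using spec_ev_quot[OF h, of "a - b"] ba by simp
qed

lemma Phi_star_raw_simps:
  "el (Phi_star_raw Y) c = spec_hom (Phi_obj c) Y" "pt (Phi_star_raw Y) c = spec_zero (Phi_obj c) Y"
  "act (Phi_star_raw Y) c c' \<phi> h = spec_comp (Phi_obj c) h (Phi_map c c' \<phi>)"
  by (simp_all add: Phi_star_raw_def Phi_def)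

lemma spec_ev_zero: "spec_ev (n, k) (spec_zero (Phi_obj (n, k)) Y) = pt (lev Y k) n"
  by (simp add: spec_ev_def spec_zero_def smp_apply simplex_id_el)

text \<open>All laws are checked after \<open>spec_ev\<close>. For composition, the twist by
  \<open>Kpow\<close> in \<open>coll\<close> is exactly the one that appears when a shift is moved
  past an operator.\<close>

lemma Phi_star_raw_presheaf: "pointed_presheaf coll (Phi_star_raw Y)"
proof -
  have c: "spec_comp (Phi_obj (n, a)) h (Phi_map (n, a) (l, b) \<phi>) \<in> spec_hom (Phi_obj (n, a)) Y"
    if "h \<in> spec_hom (Phi_obj (l, b)) Y" "\<phi> \<in> hom coll (n, a) (l, b)" for n a l b h \<phi>
    by (rule spec_comp_hom[OF Phi_obj_oplaxlim Phi_obj_oplaxlim Y Phi_map_hom[OF that(2)] that(1)])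
  have z: "spec_zero (Phi_obj c) Y \<in> spec_hom (Phi_obj c) Y" for c
    by (rule spec_zero_hom[OF Phi_obj_oplaxlim Y])
  have 1: "spec_comp (Phi_obj (n, a)) (spec_zero (Phi_obj (l, b)) Y) (Phi_map (n, a) (l, b) \<phi>) = spec_zero (Phi_obj (n, a)) Y"
    if \<phi>: "\<phi> \<in> hom coll (n, a) (l, b)" for n a l b \<phi>
  proof (rule spec_ev_inj[OF c[OF z \<phi>] z])
    have "b \<le> a" "\<phi> \<in> hom smp n (l + (a - b))" using \<phi> by (auto simp: coll_hom_iff)
    thus "spec_ev (n, a) (spec_comp (Phi_obj (n, a)) (spec_zero (Phi_obj (l, b)) Y) (Phi_map (n, a) (l, b) \<phi>))
       = spec_ev (n, a) (spec_zero (Phi_obj (n, a)) Y)"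
      using spec_ev_act[OF z \<phi>] bond_shift_pow_pt[OF Y, of b l "a - b"] levD(3)[OF Y] by (simp add: spec_ev_zero del: Phi_obj.simps)
  qed
  have 2: "spec_comp (Phi_obj (n, a)) h (Phi_map (n, a) (n, a) (ide coll (n, a))) = h"
    if h: "h \<in> spec_hom (Phi_obj (n, a)) Y" for n a h
    by (rule spec_ev_inj[OF c[OF h coll_ide_hom] h])
      (use spec_ev_act[OF h coll_ide_hom] levD(4)[OF Y spec_ev_el[OF h]] in \<open>simp add: coll_simps\<close>)
  have 3: "spec_comp (Phi_obj (n, a)) h (Phi_map (n, a) (p, d) (cmp coll (n, a) (l, b) (p, d) g f))
    = spec_comp (Phi_obj (n, a)) (spec_comp (Phi_obj (l, b)) h (Phi_map (l, b) (p, d) g)) (Phi_map (n, a) (l, b) f)"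
    if f: "f \<in> hom coll (n, a) (l, b)" and g: "g \<in> hom coll (l, b) (p, d)" and h: "h \<in> spec_hom (Phi_obj (p, d)) Y"
    for n a l b p d f g h
  proof (rule spec_ev_inj[OF c[OF h coll_cmp_hom(1)[OF f g]] c[OF c[OF h g] f]])
    have le: "b \<le> a" "d \<le> b" and f': "f \<in> hom smp n (l + (a - b))" and g': "g \<in> hom smp l (p + (b - d))"
      using f g by (auto simp: coll_hom_iff)
    let ?y = "bond_shift_pow Y d p (b - d) (spec_ev (p, d) h)"
    have y: "?y \<in> el (lev Y b) (p + (b - d))" using bond_shift_pow_el[OF Y spec_ev_el[OF h], of "b - d"] le by simp
    have y': "bond_shift_pow Y b (p + (b - d)) (a - b) ?y \<in> el (lev Y a) (p + (b - d) + (a - b))"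
      using bond_shift_pow_el[OF Y y, of "a - b"] le by simp
    have ad: "bond_shift_pow Y d p (a - d) x = bond_shift_pow Y b (p + (b - d)) (a - b) (bond_shift_pow Y d p (b - d) x)" for x
      using bond_shift_pow_add[of Y d p "b - d" "a - b" x] le by simp
    have e: "p + (a - d) = p + (b - d) + (a - b)" using le by simp
    have ba: "b + (a - b) = a" using le by simp
    show "spec_ev (n, a) (spec_comp (Phi_obj (n, a)) h (Phi_map (n, a) (p, d) (cmp coll (n, a) (l, b) (p, d) g f)))
      = spec_ev (n, a) (spec_comp (Phi_obj (n, a)) (spec_comp (Phi_obj (l, b)) h (Phi_map (l, b) (p, d) g)) (Phi_map (n, a) (l, b) f))"
      unfolding spec_ev_act[OF h coll_cmp_hom(1)[OF f g]] spec_ev_act[OF c[OF h g] f] spec_ev_act[OF h g]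
      unfolding bond_shift_pow_act[OF Y g' y] ba ad e coll_simps
      by (rule levD(5)[OF Y f' Kpow_hom[OF g'] y'])
  qed
  show ?thesis
    unfolding pointed_presheaf_def Phi_star_raw_simps
    using c z 1 2 3 by (auto simp del: Phi_obj.simps Phi_map.simps)
qed

text \<open>A morphism of spectra is an infinite family of maps; by Yoneda it is determined by one
  simplex, which bounds the hom-set by the universe.\<close>

lemma Phi_star_raw_fits: "psh_fits TYPE('u) coll (Phi_star_raw Y)"
  unfolding psh_fits_def
proof
  fix c :: "nat \<times> nat"
  have "inj_on (spec_ev c) (spec_hom (Phi_obj c) Y)"
    using spec_ev_inj by (cases c) (auto intro!: inj_onI simp del: Phi_obj.simps)
  thus "fits TYPE('u) (el (Phi_star_raw Y) c)"
    unfolding Phi_star_raw_simps by (rule fits_inj[OF fits_UNIV _ subset_UNIV])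
qed

end

lemma Phi_star_functor: "is_functor (oplaxlim :: ('u::infinite spectrum, 'u spec_mor) cat) (psh coll) Phi_star"
proof -
  have S: "fobj Phi_star Y = small (Phi_star_raw Y)" "fmap Phi_star Y Y' f =
     small_map coll (Phi_star_raw Y) (Phi_star_raw Y') (\<lambda>c h. spec_comp (Phi_obj c) f h)" for Y Y' :: "'u spectrum" and f
    by (simp_all add: Phi_star_def Phi_def)
  have asc: "spec_comp P (spec_comp Q h g) f = spec_comp P h (spec_comp P g f)"
    if "P \<in> obj oplaxlim" "Q \<in> obj oplaxlim" "f \<in> spec_hom P Q" "g \<in> spec_hom Q R" "h \<in> spec_hom R R'" for P Q R R' :: "'u spectrum" and f g h
    unfolding spec_comp_def
    using psh_comp_assoc[OF spec_homD(1)[OF that(3)] spec_homD(1)[OF that(4)] spec_homD(1)[OF that(5)]]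
      lev_presheaf that(1,2) by blast
  have P: "pointed_presheaf coll (small (Phi_star_raw Y) :: 'u coll_psh)" if "Y \<in> obj oplaxlim" for Y :: "'u spectrum"
    by (rule small_presheaf[OF Phi_star_raw_presheaf[OF that] Phi_star_raw_fits[OF that]])
  have pm: "pmap coll (Phi_star_raw Y) (Phi_star_raw Y') (\<lambda>c h. spec_comp (Phi_obj c) f h)"
    if "Y \<in> obj oplaxlim" "Y' \<in> obj oplaxlim" "f \<in> spec_hom Y Y'" for Y Y' :: "'u spectrum" and f
  proof -
    have "spec_comp (Phi_obj c) f (spec_zero (Phi_obj c) Y) = spec_zero (Phi_obj c) Y'" for c
    proof
      fix i
      have z: "spec_comp (Phi_obj c) f (spec_zero (Phi_obj c) Y) \<in> spec_hom (Phi_obj c) Y'"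
        by (rule spec_comp_hom[OF Phi_obj_oplaxlim that(1,2) spec_zero_hom[OF Phi_obj_oplaxlim that(1)] that(3)])
      have z': "spec_zero (Phi_obj c) Y' \<in> spec_hom (Phi_obj c) Y'"
        by (rule spec_zero_hom[OF Phi_obj_oplaxlim that(2)])
      show "spec_comp (Phi_obj c) f (spec_zero (Phi_obj c) Y) i = spec_zero (Phi_obj c) Y' i"
        by (rule smp_hom_extI[OF spec_homD(1)[OF z] spec_homD(1)[OF z']])
          (simp add: spec_comp_def spec_zero_def smp_apply smp_homD(2)[OF spec_homD(1)[OF that(3)]])
    qed
    thus ?thesis
      unfolding pmap_def Phi_star_raw_simps[OF that(1)] Phi_star_raw_simps[OF that(2)]
      using spec_comp_hom[OF Phi_obj_oplaxlim that(1,2) _ that(3)]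
        asc[OF Phi_obj_oplaxlim Phi_obj_oplaxlim Phi_map_hom _ that(3)]
      by (auto simp del: Phi_obj.simps Phi_map.simps)
  qed
  have hom: "small_map coll (Phi_star_raw Y) (Phi_star_raw Y') (\<lambda>c. spec_comp (Phi_obj c) f)
      \<in> psh_hom coll (small (Phi_star_raw Y) :: 'u coll_psh) (small (Phi_star_raw Y'))"
    if "Y \<in> obj oplaxlim" "Y' \<in> obj oplaxlim" "f \<in> spec_hom Y Y'" for Y Y' :: "'u spectrum" and f
    using that by (intro small_map_hom Phi_star_raw_presheaf Phi_star_raw_fits pm)
  have enc: "small_map coll (Phi_star_raw Y) Q \<alpha> c (enc (spec_hom (Phi_obj c) Y) h :: 'u) = enc (el Q c) (\<alpha> c h)"
    if "Y \<in> obj oplaxlim" "h \<in> spec_hom (Phi_obj c) Y"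
    for Y :: "'u spectrum" and Q :: "(nat \<times> nat, nat \<Rightarrow> nat, 'b) ppsh" and \<alpha> c h
    using small_map_enc[OF Phi_star_raw_fits[OF that(1)], of c h Q \<alpha>] that
    by (simp add: Phi_star_raw_simps coll_simps(1))
  have stab_ext: "\<alpha> = \<beta>" if \<alpha>: "\<alpha> \<in> psh_hom coll (small (Phi_star_raw Y)) Q" and \<beta>: "\<beta> \<in> psh_hom coll (small (Phi_star_raw Y)) Q"
    and "\<And>c h. h \<in> spec_hom (Phi_obj c) Y \<Longrightarrow> \<alpha> c (enc (el (Phi_star_raw Y) c) h) = \<beta> c (enc (el (Phi_star_raw Y) c) h)"
    and Y: "Y \<in> obj oplaxlim" for \<alpha> \<beta> :: "'u coll_mor" and Y :: "'u spectrum" and Q :: "'u coll_psh"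
    by (rule psh_hom_eqI[OF \<alpha> \<beta>]) (use that(3) in \<open>auto simp: small_simps Phi_star_raw_simps[OF Y]\<close>)
  show ?thesis
    unfolding is_functor_def psh_simps S
  proof (intro conjI ballI category_oplaxlim category_psh)
    fix Y Y' Y'' :: "'u spectrum" and f g assume Y: "Y \<in> obj oplaxlim"
    show "small (Phi_star_raw Y) \<in> {P :: 'u coll_psh. pointed_presheaf coll P}" using P[OF Y] by simp
    note cat = category_oplaxlim[where 'u = 'u]
    have i: "ide oplaxlim Y \<in> spec_hom Y Y" using cat_ide[OF cat Y] by (simp add: oplaxlim_simps(2))
    show "small_map coll (Phi_star_raw Y) (Phi_star_raw Y) (\<lambda>c. spec_comp (Phi_obj c) (ide oplaxlim Y)) = psh_id coll (small (Phi_star_raw Y) :: 'u coll_psh)"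
    proof (rule stab_ext[OF hom[OF Y Y i] psh_id_hom[OF P[OF Y]] _ Y])
      fix c h assume h: "h \<in> spec_hom (Phi_obj c) Y"
      have "spec_comp (Phi_obj c) (ide oplaxlim Y) h = h"
        using cat_idl[OF cat _ Phi_obj_oplaxlim Y] h by (simp add: oplaxlim_simps(2,4))
      thus "small_map coll (Phi_star_raw Y) (Phi_star_raw Y) (\<lambda>c. spec_comp (Phi_obj c) (ide oplaxlim Y)) c (enc (el (Phi_star_raw Y) c) h)
         = psh_id coll (small (Phi_star_raw Y) :: 'u coll_psh) c (enc (el (Phi_star_raw Y) c) h)"
        using h by (simp add: enc[OF Y] Phi_star_raw_simps[OF Y] psh_id_apply coll_simps(1) small_simps)
    qed
    assume Y': "Y' \<in> obj oplaxlim" and "f \<in> hom oplaxlim Y Y'"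
    hence f: "f \<in> spec_hom Y Y'" by (simp add: oplaxlim_simps)
    show "small_map coll (Phi_star_raw Y) (Phi_star_raw Y') (\<lambda>c. spec_comp (Phi_obj c) f)
       \<in> psh_hom coll (small (Phi_star_raw Y) :: 'u coll_psh) (small (Phi_star_raw Y'))" by (rule hom[OF Y Y' f])
    assume Y'': "Y'' \<in> obj oplaxlim" and "g \<in> hom oplaxlim Y' Y''"
    hence g: "g \<in> spec_hom Y' Y''" by (simp add: oplaxlim_simps)
    have gf: "cmp oplaxlim Y Y' Y'' g f \<in> spec_hom Y Y''"
      using spec_comp_hom[OF Y Y' Y'' f g] by (simp add: oplaxlim_simps)
    show "small_map coll (Phi_star_raw Y) (Phi_star_raw Y'') (\<lambda>c. spec_comp (Phi_obj c) (cmp oplaxlim Y Y' Y'' g f))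
      = psh_comp coll (small (Phi_star_raw Y) :: 'u coll_psh)
          (small_map coll (Phi_star_raw Y') (Phi_star_raw Y'') (\<lambda>c. spec_comp (Phi_obj c) g))
          (small_map coll (Phi_star_raw Y) (Phi_star_raw Y') (\<lambda>c. spec_comp (Phi_obj c) f))"
    proof (rule stab_ext[OF hom[OF Y Y'' gf] psh_comp_hom[OF hom[OF Y Y' f] hom[OF Y' Y'' g] P[OF Y]] _ Y])
      fix c h assume h: "h \<in> spec_hom (Phi_obj c) Y"
      have "spec_comp (Phi_obj c) (cmp oplaxlim Y Y' Y'' g f) h = spec_comp (Phi_obj c) g (spec_comp (Phi_obj c) f h)"
        using asc[OF Phi_obj_oplaxlim Y h f g] by (simp add: oplaxlim_simps)
      moreover have "spec_comp (Phi_obj c) f h \<in> spec_hom (Phi_obj c) Y'"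
        by (rule spec_comp_hom[OF Phi_obj_oplaxlim Y Y' h f])
      ultimately show "small_map coll (Phi_star_raw Y) (Phi_star_raw Y'') (\<lambda>c. spec_comp (Phi_obj c) (cmp oplaxlim Y Y' Y'' g f)) c (enc (el (Phi_star_raw Y) c) h)
        = psh_comp coll (small (Phi_star_raw Y) :: 'u coll_psh)
          (small_map coll (Phi_star_raw Y') (Phi_star_raw Y'') (\<lambda>c. spec_comp (Phi_obj c) g))
          (small_map coll (Phi_star_raw Y) (Phi_star_raw Y') (\<lambda>c. spec_comp (Phi_obj c) f)) c (enc (el (Phi_star_raw Y) c) h)"
        using h by (simp add: enc[OF Y] enc[OF Y'] Phi_star_raw_simps[OF Y] Phi_star_raw_simps[OF Y'] psh_comp_apply coll_simps(1) small_simps)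
    qed
  qed
qed

section \<open>Spherical objects\<close>

text \<open>Functional form of the part collapsed in \<open>sph n z\<close>. The first alternative
  means factoring through some d^j with j > n, the second factoring through d^n ... d^0, which is
  translation by n + 1.\<close>

definition collapsed :: "nat \<Rightarrow> (nat \<Rightarrow> nat) \<Rightarrow> bool" where
  "collapsed n g \<longleftrightarrow> (\<exists>j>n. j \<notin> range g) \<or> (\<forall>x. n < g x)"

lemma collapsed_comp: "collapsed n g \<Longrightarrow> collapsed n (g \<circ> f)"
  unfolding collapsed_def by auto

lemma collapsed_mono: "collapsed m g \<Longrightarrow> n \<le> m \<Longrightarrow> collapsed n g"
  unfolding collapsed_def by (meson le_less_trans)

text \<open>The extension of \<open>\<phi>\<close> is a translation beyond \<open>n\<close> and
  stays within \<open>{..m}\<close> up to \<open>n\<close>. So an omitted j > n yields the omitted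
  value m + (j - n), and values above \<open>n\<close> go above \<open>m\<close>.\<close>

lemma collapsed_ext:
  assumes "\<phi> \<in> hom smp n m" "collapsed n g" shows "collapsed m (stab_ext n m \<phi> \<circ> g)"
  using assms(2) unfolding collapsed_def
proof
  assume "\<exists>j>n. j \<notin> range g"
  then obtain j where j: "j > n" "j \<notin> range g" by blast
  have "stab_ext n m \<phi> (g x) \<noteq> m + (j - n)" for x
  proof
    assume a: "stab_ext n m \<phi> (g x) = m + (j - n)"
    have "g x \<noteq> j" using j(2) by auto
    moreover have "\<phi> (g x) \<le> m" if "g x \<le> n" using assms(1) that by (simp add: smp_hom_iff)
    ultimately show False using a j(1) by (auto simp: stab_ext_def split: if_splits)
  qed
  moreover have "m + (j - n) > m" using j(1) by simp
  ultimately show "(\<exists>j>m. j \<notin> range (stab_ext n m \<phi> \<circ> g)) \<or> (\<forall>x. m < (stab_ext n m \<phi> \<circ> g) x)"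
    by (metis comp_apply rangeE)
next
  assume "\<forall>x. n < g x"
  hence "\<forall>x. m < (stab_ext n m \<phi> \<circ> g) x" by (simp add: stab_ext_def not_le[symmetric])
  thus "(\<exists>j>m. j \<notin> range (stab_ext n m \<phi> \<circ> g)) \<or> (\<forall>x. m < (stab_ext n m \<phi> \<circ> g) x)" by blast
qed

lemma word_map_faces: "word_map (map Face (rev [0..<m])) x = x + m"
  by (induction m arbitrary: x) simp_all

lemma face_shifts: "gen_map (Face i) \<in> shifts 1"
  using gen_map_shifts[of "Face i"] by simp

lemma add_shifts: "(\<lambda>x. x + m) \<in> shifts (int m)"
  by (auto simp: shifts_def mono_def)

text \<open>The factor is obtained from a retraction: d^j s^j acts as the identity on maps that omit
  \<open>j\<close>, and truncated subtraction undoes the translation on maps with all values above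
  \<open>n\<close>.\<close>

lemma collapsed_factor:
  assumes "collapsed n g" "g \<in> shifts k"
  obtains i h where "i \<ge> 1" "h \<in> shifts (k - 1)" "g = gen_map (Face (n + i)) \<circ> h"
  | h where "h \<in> shifts (k - int (n + 1))" "g = (\<lambda>x. x + (n + 1)) \<circ> h"
  using assms(1) unfolding collapsed_def
proof (elim disjE)
  assume "\<exists>j>n. j \<notin> range g"
  then obtain j where j: "j > n" "j \<notin> range g" by blast
  let ?h = "gen_map (Degen j) \<circ> g"
  have "?h \<in> shifts (k - 1)" using shifts_comp[OF assms(2) gen_map_shifts[of "Degen j"]] by simp
  moreover have "g = gen_map (Face (n + (j - n))) \<circ> ?h"
  proof
    fix x show "g x = (gen_map (Face (n + (j - n))) \<circ> ?h) x"
      using j by (cases "g x < j"; cases "g x = j") auto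
  qed
  ultimately show thesis using that(1)[of "j - n" ?h] j by simp
next
  assume a: "\<forall>x. n < g x"
  let ?h = "(\<lambda>x. x - (n + 1)) \<circ> g"
  have "(\<lambda>x. x - (n + 1)) \<in> shifts (- int (n + 1))"
    by (auto simp: shifts_def mono_def intro!: exI[where x = "n + 1"])
  from shifts_comp[OF assms(2) this] have "?h \<in> shifts (k - int (n + 1))" by (simp only: diff_conv_add_uminus)
  moreover have "g = (\<lambda>x. x + (n + 1)) \<circ> ?h"
  proof
    fix x show "g x = ((\<lambda>x. x + (n + 1)) \<circ> ?h) x" using a[rule_format, of x] by simp
  qed
  ultimately show thesis by (rule that(2))
qed

lemma collapsed_face: "i \<ge> 1 \<Longrightarrow> collapsed n (gen_map (Face (n + i)))"
proof -
  assume "i \<ge> 1"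
  moreover have "n + i \<notin> range (gen_map (Face (n + i)))" by (auto split: if_splits)
  ultimately have "n + i > n \<and> n + i \<notin> range (gen_map (Face (n + i)))" by simp
  thus ?thesis unfolding collapsed_def by blast
qed

lemma collapsed_add: "collapsed n (\<lambda>x. x + (n + 1))"
  unfolding collapsed_def by simp

lemma sph_bd_eq: "sph_bd n z w = {Some (map_cls g) | g. g \<in> shifts (z - w) \<and> collapsed n g}"
proof -
  have f: "wcls [Face (n + i)] = map_cls (gen_map (Face (n + i)))" for i by (simp add: wcls_map_cls)
  have a: "wcls (map Face (rev [0..<n + 1])) = map_cls (\<lambda>x. x + (n + 1))"
    unfolding wcls_map_cls by (rule arg_cong[where f = map_cls]) (rule HOL.ext, rule word_map_faces)
  have sf: "z - 1 - w + 1 = z - w" "z - int (n + 1) - w + int (n + 1) = z - w" by simp_all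
  show ?thesis
  proof (intro set_eqI iffI)
    fix y assume "y \<in> sph_bd n z w"
    then consider i h where "i \<ge> 1" "h \<in> hom stab w (z - 1)"
        "y = Some (cmp stab w (z - 1) z (map_cls (gen_map (Face (n + i)))) h)"
      | h where "h \<in> hom stab w (z - int (n + 1))"
        "y = Some (cmp stab w (z - int (n + 1)) z (map_cls (\<lambda>x. x + (n + 1))) h)"
      unfolding sph_bd_def a f by blast
    thus "y \<in> {Some (map_cls g) | g. g \<in> shifts (z - w) \<and> collapsed n g}"
    proof cases
      case 1
      then obtain h' where h: "h = map_cls h'" "h' \<in> shifts (z - 1 - w)" by (auto simp: stab_hom)
      show ?thesis
        using 1(3) shifts_comp[OF h(2) face_shifts[of "n + i"]] collapsed_comp[OF collapsed_face[OF 1(1)]]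
        unfolding h(1) stab_cmp[OF h(2) face_shifts] sf by blast
    next
      case 2
      then obtain h' where h: "h = map_cls h'" "h' \<in> shifts (z - int (n + 1) - w)" by (auto simp: stab_hom)
      show ?thesis
        using 2(2) shifts_comp[OF h(2) add_shifts[of "n + 1"]] collapsed_comp[OF collapsed_add[of n]]
        unfolding h(1) stab_cmp[OF h(2) add_shifts] sf by blast
    qed
  next
    fix y assume "y \<in> {Some (map_cls g) | g. g \<in> shifts (z - w) \<and> collapsed n g}"
    then obtain g where g: "g \<in> shifts (z - w)" "collapsed n g" "y = Some (map_cls g)" by blast
    from g(2,1) show "y \<in> sph_bd n z w"
    proof (cases rule: collapsed_factor)
      case (1 i h)
      have "map_cls g = cmp stab w (z - 1) z (map_cls (gen_map (Face (n + i)))) (map_cls h)"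
        unfolding 1(3) stab_cmp[OF 1(2) face_shifts] ..
      moreover have "map_cls h \<in> hom stab w (z - 1)" using 1(2) by (rule stab_homI) simp
      ultimately show ?thesis unfolding sph_bd_def a f g(3) using 1(1) by blast
    next
      case (2 h)
      have "map_cls g = cmp stab w (z - int (n + 1)) z (map_cls (\<lambda>x. x + (n + 1))) (map_cls h)"
        unfolding 2(2) stab_cmp[OF 2(1) add_shifts] ..
      moreover have "map_cls h \<in> hom stab w (z - int (n + 1))" using 2(1) by (rule stab_homI) simp
      ultimately show ?thesis unfolding sph_bd_def a f g(3) by blast
    qed
  qed
qed

section \<open>Spherical elements of a presheaf\<close>

lemma stabD:
  assumes "pointed_presheaf stab Z"
  shows "pt Z a \<in> el Z a"
    and "x \<in> el Z b \<Longrightarrow> f \<in> shifts (b - a) \<Longrightarrow> act Z a b (map_cls f) x \<in> el Z a"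
    and "f \<in> shifts (b - a) \<Longrightarrow> act Z a b (map_cls f) (pt Z b) = pt Z a"
    and "x \<in> el Z a \<Longrightarrow> act Z a a (map_cls id) x = x"
    and "f \<in> shifts (b - a) \<Longrightarrow> g \<in> shifts (c - b) \<Longrightarrow> x \<in> el Z c \<Longrightarrow>
      act Z a c (map_cls (g \<circ> f)) x = act Z a b (map_cls f) (act Z b c (map_cls g) x)"
proof -
  show "pt Z a \<in> el Z a" using presheafD(1)[OF assms] by (simp add: stab_obj)
  show "x \<in> el Z a \<Longrightarrow> act Z a a (map_cls id) x = x"
    using presheafD(4)[OF assms, of x a] by (simp add: stab_obj stab_ide)
  show "x \<in> el Z b \<Longrightarrow> f \<in> shifts (b - a) \<Longrightarrow> act Z a b (map_cls f) x \<in> el Z a"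
    using presheafD(2)[OF assms, of x b "map_cls f" a] by (simp add: stab_obj stab_homI)
  assume f: "f \<in> shifts (b - a)"
  show "act Z a b (map_cls f) (pt Z b) = pt Z a"
    using presheafD(3)[OF assms, of "map_cls f" a b] f by (simp add: stab_obj stab_homI)
  assume g: "g \<in> shifts (c - b)" and x: "x \<in> el Z c"
  show "act Z a c (map_cls (g \<circ> f)) x = act Z a b (map_cls f) (act Z b c (map_cls g) x)"
    using presheafD(5)[OF assms stab_homI[OF f] stab_homI[OF g] x] stab_cmp[OF f g, of a b c]
    by (simp add: stab_obj)
qed

lemma stab_mapD:
  assumes "\<alpha> \<in> psh_hom stab P Q"
  shows "x \<in> el P z \<Longrightarrow> \<alpha> z x \<in> el Q z"
    and "\<alpha> z (pt P z) = pt Q z"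
    and "f \<in> shifts (z - w) \<Longrightarrow> x \<in> el P z \<Longrightarrow> \<alpha> w (act P w z (map_cls f) x) = act Q w z (map_cls f) (\<alpha> z x)"
  using pmapD[OF psh_hom_pmap[OF assms]] by (simp_all add: stab_obj stab_homI)

lemma stab_apply:
  "x \<in> el P z \<Longrightarrow> psh_comp stab P \<beta> \<alpha> z x = \<beta> z (\<alpha> z x)"
  "x \<in> el P z \<Longrightarrow> psh_id stab P z x = x"
  "x \<in> el P z \<Longrightarrow> psh_zero stab P Q z x = pt Q z"
  by (simp_all add: psh_comp_apply psh_id_apply psh_zero_apply stab_obj)

text \<open>The elements of \<open>Z\<close> that are images of the fundamental element of \<open>sph n z\<close>.\<close>

definition spherical :: "(int, gen list set, 'u) ppsh \<Rightarrow> nat \<Rightarrow> int \<Rightarrow> 'u \<Rightarrow> bool" where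
  "spherical Z n z x \<longleftrightarrow> x \<in> el Z z \<and>
     (\<forall>w g. g \<in> shifts (z - w) \<longrightarrow> collapsed n g \<longrightarrow> act Z w z (map_cls g) x = pt Z w)"

lemma spherical_mono: "spherical Z n z x \<Longrightarrow> n \<le> m \<Longrightarrow> spherical Z m z x"
  unfolding spherical_def using collapsed_mono by blast

text \<open>Every collapsed map factors through d^(n+i) or d^n ... d^0, and restriction preserves
  base-points; so these generators suffice as tests.\<close>

lemma nsphI:
  assumes Z: "pointed_presheaf stab Z" and x: "x \<in> el Z z"
    and face: "\<And>i. i \<ge> 1 \<Longrightarrow> act Z (z - 1) z (map_cls (gen_map (Face (n + i)))) x = pt Z (z - 1)"
    and add: "act Z (z - int (n + 1)) z (map_cls (\<lambda>x. x + (n + 1))) x = pt Z (z - int (n + 1))"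
  shows "spherical Z n z x"
  unfolding spherical_def
proof (intro conjI x allI impI)
  fix w g assume g: "g \<in> shifts (z - w)" "collapsed n g"
  from g(2,1) show "act Z w z (map_cls g) x = pt Z w"
  proof (cases rule: collapsed_factor)
    case (1 i h)
    have h: "h \<in> shifts (z - 1 - w)" "gen_map (Face (n + i)) \<in> shifts (z - (z - 1))"
      using 1(2) face_shifts[of "n + i"] by (simp_all add: algebra_simps)
    show ?thesis unfolding 1(3) stabD(5)[OF Z h x] face[OF 1(1)] by (rule stabD(3)[OF Z h(1)])
  next
    case (2 h)
    have h: "h \<in> shifts (z - int (n + 1) - w)" "(\<lambda>x. x + (n + 1)) \<in> shifts (z - (z - int (n + 1)))"
      using 2(1) add_shifts[of "n + 1"] by (simp_all add: algebra_simps)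
    show ?thesis unfolding 2(2) stabD(5)[OF Z h x] add by (rule stabD(3)[OF Z h(1)])
  qed
qed

lemma spherical_map:
  assumes "f \<in> psh_hom stab Z Z'" "spherical Z n z x" shows "spherical Z' n z (f z x)"
proof -
  have "act Z' w z (map_cls g) (f z x) = pt Z' w" if "g \<in> shifts (z - w)" "collapsed n g" for w g
    using stab_mapD(3)[OF assms(1) that(1), of x] stab_mapD(2)[OF assms(1)] assms(2) that
    by (simp add: spherical_def)
  thus ?thesis using assms stab_mapD(1)[OF assms(1)] by (simp add: spherical_def)
qed

lemma spherical_pt: "pointed_presheaf stab Z \<Longrightarrow> spherical Z n z (pt Z z)"
  by (simp add: spherical_def stabD)

text \<open>Composition with the extension of \<open>\<phi>\<close> turns maps collapsed for
  \<open>n\<close> into maps collapsed for \<open>m\<close>. The equation on degrees says z - m = w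
  - n, that is, \<open>\<phi>\<close> acts within one index of \<open>KPs\<close>.\<close>

lemma spherical_ext:
  assumes Z: "pointed_presheaf stab Z" and x: "spherical Z m z x" and \<phi>: "\<phi> \<in> hom smp n m"
    and w: "z - w = int m - int n"
  shows "spherical Z n w (act Z w z (map_cls (stab_ext n m \<phi>)) x)"
proof -
  have e: "stab_ext n m \<phi> \<in> shifts (z - w)" using stab_ext_shifts[OF \<phi>] w by simp
  have x': "x \<in> el Z z" using x by (simp add: spherical_def)
  have "act Z v w (map_cls g) (act Z w z (map_cls (stab_ext n m \<phi>)) x) = pt Z v" if g: "g \<in> shifts (w - v)" "collapsed n g" for v g
  proof -
    have "stab_ext n m \<phi> \<circ> g \<in> shifts (z - v)" using shifts_comp[OF g(1) e] by simp
    hence "act Z v z (map_cls (stab_ext n m \<phi> \<circ> g)) x = pt Z v"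
      using x collapsed_ext[OF \<phi> g(2)] unfolding spherical_def by blast
    thus ?thesis using stabD(5)[OF Z g(1) e x'] by simp
  qed
  thus ?thesis using stabD(2)[OF Z x' e] by (simp add: spherical_def)
qed

text \<open>Raise the dimension until \<open>f\<close> is the extension of a simplicial operator; an
  element stays spherical while the dimension grows.\<close>

lemma spherical_act:
  assumes Z: "pointed_presheaf stab Z" and x: "spherical Z n z x" and f: "f \<in> shifts (z - w)"
  shows "\<exists>m. spherical Z m w (act Z w z (map_cls f) x)"
proof -
  obtain N where N: "\<And>n' m. n' \<ge> N \<Longrightarrow> int m = int n' + (z - w) \<Longrightarrow> \<exists>\<phi>\<in>hom smp n' m. f = stab_ext n' m \<phi>"
    using shifts_eq_ext[OF f] by blast
  \<comment> \<open>\<open>N\<close> makes \<open>f\<close> an extension; the second bound makes the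
    target dimension \<open>?m\<close> at least \<open>n\<close>, so that \<open>x\<close> is
    spherical there.\<close>
  let ?n = "max N (nat (int n - (z - w)))" let ?m = "nat (int ?n + (z - w))"
  have m: "int ?m = int ?n + (z - w)" "n \<le> ?m" by linarith+
  obtain \<phi> where \<phi>: "\<phi> \<in> hom smp ?n ?m" "f = stab_ext ?n ?m \<phi>" using N[of ?n ?m] m by (meson max.cobounded1)
  have "spherical Z ?n w (act Z w z (map_cls f) x)"
    unfolding \<phi>(2) by (rule spherical_ext[OF Z spherical_mono[OF x m(2)] \<phi>(1)]) (use m(1) in simp)
  thus ?thesis by blast
qed

section \<open>Spherical objects represent spherical elements\<close>

lemma stab_rep_presheaf: "pointed_presheaf stab (rep_plus stab z)"
  by (rule rep_plus_presheaf[OF category_stab]) (simp add: stab_obj)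

lemma sph_bd_stable:
  assumes "y \<in> sph_bd n z w" "h \<in> hom stab v w"
  shows "act (rep_plus stab z) v w h y \<in> sph_bd n z v"
proof -
  obtain g where g: "g \<in> shifts (z - w)" "collapsed n g" "y = Some (map_cls g)" using assms(1) unfolding sph_bd_eq by blast
  obtain f where f: "f \<in> shifts (w - v)" "h = map_cls f" using assms(2) unfolding stab_hom by blast
  have "g \<circ> f \<in> shifts (z - v)" using shifts_comp[OF f(1) g(1)] by simp
  thus ?thesis unfolding sph_bd_eq g(3) f(2) rep_plus_simps
    using collapsed_comp[OF g(2)] stab_cmp[OF f(1) g(1)] by auto
qed

lemma sph_raw_presheaf: "pointed_presheaf stab (sph_raw n z)"
  unfolding sph_raw_def by (rule collapse_presheaf[OF stab_rep_presheaf]) (rule sph_bd_stable)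

lemma sph_fits: "psh_fits TYPE('u::infinite) stab (sph_raw n z)"
  unfolding psh_fits_def sph_raw_def collapse_simps rep_plus_simps
  by (intro ballI fits_countable) (simp add: countable_stab_hom)

lemma sph_presheaf: "pointed_presheaf stab (sph n z :: 'u::infinite stab_psh)"
  unfolding sph_def by (rule small_presheaf[OF sph_raw_presheaf sph_fits])

abbreviation sphq :: "nat \<Rightarrow> int \<Rightarrow> int \<Rightarrow> gen list set option \<Rightarrow> gen list set option" where
  "sphq n z \<equiv> quot_el (rep_plus stab z) (sph_bd n z)"

lemma sph_bd_map_cls: "g \<in> shifts (z - w) \<Longrightarrow> Some (map_cls g) \<in> sph_bd n z w \<longleftrightarrow> collapsed n g"
  unfolding sph_bd_eq using map_cls_inj by blast

lemma sphq_pt: "sphq n z w y = None \<longleftrightarrow> y = None \<or> y \<in> sph_bd n z w"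
  by (auto simp: quot_el_def rep_plus_simps)

lemma sphq_el: "y \<in> el (rep_plus stab z) w \<Longrightarrow> sphq n z w y \<in> el (sph_raw n z) w"
  unfolding sph_raw_def collapse_simps by (rule imageI)

lemma act_sphq:
  "h \<in> hom stab v w \<Longrightarrow> act (sph_raw n z) v w h (sphq n z w y) = sphq n z v (map_option (\<lambda>g. cmp stab v w z g h) y)"
  unfolding sph_raw_def
  by (subst act_collapse[OF stab_rep_presheaf sph_bd_stable]) (simp_all add: stab_obj rep_plus_simps)

definition sph_id :: "nat \<Rightarrow> int \<Rightarrow> 'u" where
  "sph_id n z = enc (el (sph_raw n z) z) (sphq n z z (Some (ide stab z)))"

lemma stab_ide_el: "Some (ide stab z) \<in> el (rep_plus stab z) z"
  using stab_homI[OF shifts_id, of z z] by (simp add: rep_plus_simps stab_ide)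

lemma sph_id_el: "(sph_id n z :: 'u::infinite) \<in> el (sph n z) z"
  unfolding sph_id_def sph_def small_simps by (intro imageI sphq_el stab_ide_el)

lemma act_sph_id:
  assumes g: "g \<in> shifts (z - w)"
  shows "act (sph n z) w z (map_cls g) (sph_id n z :: 'u::infinite) = enc (el (sph_raw n z) w) (sphq n z w (Some (map_cls g)))"
proof -
  have "act (sph_raw n z) w z (map_cls g) (sphq n z z (Some (ide stab z))) = sphq n z w (Some (map_cls g))"
    using stab_cmp[OF g shifts_id] by (simp add: act_sphq[OF stab_homI[OF g]] stab_ide)
  thus ?thesis
    unfolding sph_id_def sph_def by (subst act_small[OF sph_fits]) (simp_all add: sphq_el stab_ide_el stab_obj)
qed

lemma sph_cases:
  assumes "y \<in> el (sph n z :: 'u::infinite stab_psh) w"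
  obtains "y = pt (sph n z) w"
  | g where "g \<in> shifts (z - w)" "y = act (sph n z) w z (map_cls g) (sph_id n z)"
proof -
  obtain t where t: "t \<in> el (rep_plus stab z) w" "y = enc (el (sph_raw n z) w) (sphq n z w t)"
    using assms by (auto simp: sph_def small_simps sph_raw_def collapse_simps)
  show thesis
  proof (cases t)
    case None
    hence "y = pt (sph n z) w"
      using t quot_el_pt[of "rep_plus stab z" "sph_bd n z" w]
      by (simp add: sph_def small_simps sph_raw_def collapse_simps rep_plus_simps(2))
    thus ?thesis by (rule that(1))
  next
    case (Some c)
    then obtain g where "g \<in> shifts (z - w)" "c = map_cls g" using t(1) by (auto simp: rep_plus_simps stab_hom)
    thus ?thesis using that(2) t(2) Some by (simp add: act_sph_id)
  qed
qed

lemma sph_id_spherical: "spherical (sph n z) n z (sph_id n z :: 'u::infinite)"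
proof -
  have "act (sph n z) w z (map_cls g) (sph_id n z :: 'u) = pt (sph n z) w" if "g \<in> shifts (z - w)" "collapsed n g" for w g
  proof -
    have "sphq n z w (Some (map_cls g)) = None" using sph_bd_map_cls[OF that(1)] that(2) by (simp add: sphq_pt)
    thus ?thesis unfolding act_sph_id[OF that(1)]
      by (simp add: sph_def small_simps sph_raw_def collapse_simps rep_plus_simps(2))
  qed
  thus ?thesis using sph_id_el by (simp add: spherical_def)
qed

lemma sph_hom_eqI:
  assumes f: "f \<in> psh_hom stab (sph n z :: 'u::infinite stab_psh) W" and f': "f' \<in> psh_hom stab (sph n z) W"
    and eq: "f z (sph_id n z) = f' z (sph_id n z)"
  shows "f = f'"
proof (rule psh_hom_eqI[OF f f'])
  fix w y assume "y \<in> el (sph n z :: 'u stab_psh) w"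
  thus "f w y = f' w y"
    by (cases rule: sph_cases) (simp_all add: stab_mapD[OF f] stab_mapD[OF f'] sph_id_el eq)
qed

lemma sph_hom_spherical:
  "f \<in> psh_hom stab (sph n z :: 'u::infinite stab_psh) W \<Longrightarrow> spherical W n z (f z (sph_id n z))"
  by (rule spherical_map[OF _ sph_id_spherical])

lemma sph_hom_exists:
  fixes W :: "('u::infinite) stab_psh"
  assumes W: "pointed_presheaf stab W" and x: "spherical W n z x"
  shows "\<exists>f\<in>psh_hom stab (sph n z :: 'u stab_psh) W. f z (sph_id n z) = x"
proof -
  note WD = stabD[OF W]
  have x': "x \<in> el W z" using x by (simp add: spherical_def)
  define v where "v w y = (case dec (el (sph_raw n z) w) (y :: 'u) of None \<Rightarrow> pt W w | Some c \<Rightarrow> act W w z c x)" for w y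
  have dec: "dec (el (sph_raw n z) w) (enc (el (sph_raw n z) w) (sphq n z w t) :: 'u) = sphq n z w t" if "t \<in> el (rep_plus stab z) w" for w t
    using sphq_el[OF that] sph_fits[where 'u = 'u and n = n and z = z] by (intro dec_enc) (auto simp: psh_fits_def stab_obj)
  have pt: "v w (pt (sph n z) w) = pt W w" for w
    using dec[of None w] quot_el_pt[of "rep_plus stab z" "sph_bd n z" w]
    by (simp add: v_def sph_def small_simps sph_raw_def collapse_simps rep_plus_simps)
  have g: "v w (act (sph n z) w z (map_cls g) (sph_id n z)) = act W w z (map_cls g) x" if g: "g \<in> shifts (z - w)" for w g
  proof -
    have "Some (map_cls g) \<in> el (rep_plus stab z) w" using stab_homI[OF g] by (simp add: rep_plus_simps)
    \<comment> \<open>Here sphericity is used: a collapsed operator is decoded as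
      \<open>None\<close> and sent to the base-point, which must agree with its action on
      \<open>x\<close>.\<close>
    moreover have "act W w z (map_cls g) x = pt W w" if "collapsed n g" using x g that by (simp add: spherical_def)
    ultimately show ?thesis
      using dec[of "Some (map_cls g)" w] sph_bd_map_cls[OF g, of n]
      by (auto simp: v_def act_sph_id[OF g] quot_el_def rep_plus_simps)
  qed
  have "pmap stab (sph n z) W v"
    unfolding pmap_def stab_obj
  proof (intro conjI ballI pt)
    { fix w y assume "y \<in> el (sph n z :: 'u stab_psh) w"
      thus "v w y \<in> el W w" by (cases rule: sph_cases) (simp_all add: pt g WD x') }
    fix u w h y assume y: "y \<in> el (sph n z :: 'u stab_psh) w" and "h \<in> hom stab u w"
    then obtain f where f: "f \<in> shifts (w - u)" "h = map_cls f" by (auto simp: stab_hom)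
    show "v u (act (sph n z) u w h y) = act W u w h (v w y)"
      using y
    proof (cases rule: sph_cases)
      case 1 thus ?thesis using f by (simp add: stabD(3)[OF sph_presheaf] pt WD)
    next
      case (2 k)
      have kf: "k \<circ> f \<in> shifts (z - u)" using shifts_comp[OF f(1) 2(1)] by simp
      have "act (sph n z) u w h y = act (sph n z) u z (map_cls (k \<circ> f)) (sph_id n z)"
        by (simp add: 2(2) f(2) stabD(5)[OF sph_presheaf f(1) 2(1) sph_id_el])
      thus ?thesis
        using WD(5)[OF f(1) 2(1) x'] g[OF kf] g[OF 2(1)] 2(2) f(2) by simp
    qed
  qed
  hence "(\<lambda>c\<in>obj stab. \<lambda>x\<in>el (sph n z) c. v c x) \<in> psh_hom stab (sph n z) W"
    by (rule restrict_pmap[OF _ sph_presheaf])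
  moreover have "v z (sph_id n z) = x"
    using g[of id z] shifts_id WD(4)[OF x'] by (simp add: stabD(4)[OF sph_presheaf sph_id_el])
  ultimately show ?thesis using sph_id_el by (intro bexI) (auto simp: stab_obj)
qed

lemma sph_map_hom:
  assumes f: "f \<in> shifts (z' - z)" and bd: "\<And>g. collapsed n g \<Longrightarrow> collapsed n' (f \<circ> g)"
  shows "sph_map n z n' z' (map_cls f) \<in> psh_hom stab (sph n z :: 'u::infinite stab_psh) (sph n' z')"
    and "sph_map n z n' z' (map_cls f) z (sph_id n z :: 'u) = act (sph n' z') z z' (map_cls f) (sph_id n' z')"
proof -
  let ?c = "\<lambda>w. map_option (\<lambda>g. cmp stab w z z' (map_cls f) g)"
  have c_bd: "?c w t \<in> sph_bd n' z' w" if t: "t \<in> sph_bd n z w" for t w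
  proof -
    obtain g where g: "g \<in> shifts (z - w)" "collapsed n g" "t = Some (map_cls g)" using t unfolding sph_bd_eq by blast
    have "f \<circ> g \<in> shifts (z' - w)" using shifts_comp[OF g(1) f] by simp
    thus ?thesis unfolding sph_bd_eq g(3) using bd[OF g(2)] stab_cmp[OF g(1) f] by auto
  qed
  have c_el: "?c w t \<in> el (rep_plus stab z') w" if "t \<in> el (rep_plus stab z) w" for t w
    using that cat_cmp[OF category_stab _ stab_homI[OF f]] by (auto simp: rep_plus_simps stab_obj)
  \<comment> \<open>By the hypothesis on \<open>f\<close>, collapsing the source before applying
    \<open>f\<close> does not change the resulting class.\<close>
  have q: "sphq n' z' w (?c w (sphq n z w t)) = sphq n' z' w (?c w t)" for w t
  proof (cases "t \<in> sph_bd n z w")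
    case True thus ?thesis using c_bd[OF True] by (simp add: quot_el_def rep_plus_simps)
  qed (simp add: quot_el_def)
  have raw: "pmap stab (sph_raw n z) (sph_raw n' z') (\<lambda>w y. sphq n' z' w (?c w y))"
    unfolding pmap_def
  proof (intro conjI ballI)
    fix w
    show "sphq n' z' w (?c w (pt (sph_raw n z) w)) = pt (sph_raw n' z') w"
      using quot_el_pt[of "rep_plus stab z'" "sph_bd n' z'" w] by (simp add: sph_raw_def collapse_simps rep_plus_simps)
    { fix y assume "y \<in> el (sph_raw n z) w"
      then obtain t where "t \<in> el (rep_plus stab z) w" "y = sphq n z w t" by (auto simp: sph_raw_def collapse_simps)
      thus "sphq n' z' w (?c w y) \<in> el (sph_raw n' z') w" using q sphq_el[OF c_el] by simp }
    fix v h y assume h: "h \<in> hom stab w v" and "y \<in> el (sph_raw n z) v"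
    then obtain t where t: "t \<in> el (rep_plus stab z) v" "y = sphq n z v t" by (auto simp: sph_raw_def collapse_simps)
    have "?c w (map_option (\<lambda>g. cmp stab w v z g h) t) = map_option (\<lambda>g. cmp stab w v z' g h) (?c v t)"
      using t(1) cat_assoc[OF category_stab h _ stab_homI[OF f]] by (auto simp: rep_plus_simps stab_obj)
    thus "sphq n' z' w (?c w (act (sph_raw n z) w v h y)) = act (sph_raw n' z') w v h (sphq n' z' v (?c v y))"
      unfolding t(2) act_sphq[OF h] q by simp
  qed
  show "sph_map n z n' z' (map_cls f) \<in> psh_hom stab (sph n z :: 'u::infinite stab_psh) (sph n' z')"
    unfolding sph_map_def sph_def by (rule small_map_hom[OF sph_raw_presheaf sph_fits sph_fits raw])
  have "?c z (Some (ide stab z)) = Some (map_cls f)" using stab_cmp[OF shifts_id f] by (simp add: stab_ide)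
  thus "sph_map n z n' z' (map_cls f) z (sph_id n z :: 'u) = act (sph n' z') z z' (map_cls f) (sph_id n' z')"
    unfolding act_sph_id[OF f] unfolding sph_map_def sph_id_def
    by (subst small_map_enc[OF sph_fits]) (simp_all add: sphq_el stab_ide_el stab_obj q)
qed

section \<open>The functor \<open>KPs\<close>\<close>

definition KPs_eval :: "nat \<Rightarrow> nat \<Rightarrow> 'u stab_mor \<Rightarrow> 'u" where
  "KPs_eval i n h = h (int n - int i) (sph_id n (int n - int i))"

lemma KPs_raw_simps:
  "el (KPs_raw Z i) n = psh_hom stab (sph n (int n - int i)) Z"
  "pt (KPs_raw Z i) n = psh_zero stab (sph n (int n - int i)) Z"
  by (simp_all add: KPs_raw_def)

lemma coll_smp_hom: "\<phi> \<in> hom coll (n, i) (m, i) \<longleftrightarrow> \<phi> \<in> hom smp n m"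
  by (simp add: coll_hom_iff)

context
  fixes Z :: "'u::infinite stab_psh"
  assumes Z: "pointed_presheaf stab Z"
begin

lemma KPs_eval_spherical: "h \<in> el (KPs_raw Z i) n \<Longrightarrow> spherical Z n (int n - int i) (KPs_eval i n h)"
  unfolding KPs_raw_simps KPs_eval_def by (rule sph_hom_spherical)

lemma KPs_eval_inj:
  "h \<in> el (KPs_raw Z i) n \<Longrightarrow> h' \<in> el (KPs_raw Z i) n \<Longrightarrow> KPs_eval i n h = KPs_eval i n h' \<Longrightarrow> h = h'"
  unfolding KPs_raw_simps KPs_eval_def by (rule sph_hom_eqI)

lemma KPs_eval_surj: "spherical Z n (int n - int i) x \<Longrightarrow> \<exists>h\<in>el (KPs_raw Z i) n. KPs_eval i n h = x"
  unfolding KPs_raw_simps KPs_eval_def by (rule sph_hom_exists[OF Z])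

lemma KPs_eval_pt: "KPs_eval i n (pt (KPs_raw Z i) n) = pt Z (int n - int i)"
  unfolding KPs_raw_simps KPs_eval_def by (rule stab_apply(3)[OF sph_id_el])

lemma KPs_raw_pt: "pt (KPs_raw Z i) n \<in> el (KPs_raw Z i) n"
  unfolding KPs_raw_simps by (rule psh_zero_hom[OF sph_presheaf Z])

text \<open>The second part identifies the simplicial operators with restriction in \<open>Z\<close>
  along extended operators. The presheaf laws of \<open>KPs_raw\<close> are all verified through
  it.\<close>

lemma KPs_raw_act:
  assumes \<phi>: "\<phi> \<in> hom smp n m" and h: "h \<in> el (KPs_raw Z i) m"
  shows "act (KPs_raw Z i) n m \<phi> h \<in> el (KPs_raw Z i) n"
    and "KPs_eval i n (act (KPs_raw Z i) n m \<phi> h) = act Z (int n - int i) (int m - int i) (map_cls (stab_ext n m \<phi>)) (KPs_eval i m h)"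
proof -
  have h': "h \<in> psh_hom stab (sph m (int m - int i)) Z" using h by (simp add: KPs_raw_simps)
  have a: "act (KPs_raw Z i) n m \<phi> h = psh_comp stab (sph n (int n - int i)) h
     (sph_map n (int n - int i) m (int m - int i) (map_cls (stab_ext n m \<phi>)))"
    using rho_simps(2)[of \<phi> n i m i] \<phi> by (simp add: KPs_raw_def coll_smp_hom)
  have e: "stab_ext n m \<phi> \<in> shifts ((int m - int i) - (int n - int i))" using stab_ext_shifts[OF \<phi>] by simp
  have s: "sph_map n (int n - int i) m (int m - int i) (map_cls (stab_ext n m \<phi>))
      \<in> psh_hom stab (sph n (int n - int i) :: 'u stab_psh) (sph m (int m - int i))"
    "sph_map n (int n - int i) m (int m - int i) (map_cls (stab_ext n m \<phi>)) (int n - int i) (sph_id n (int n - int i) :: 'u)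
      = act (sph m (int m - int i)) (int n - int i) (int m - int i) (map_cls (stab_ext n m \<phi>)) (sph_id m (int m - int i))"
    by (rule sph_map_hom[OF e]; erule collapsed_ext[OF \<phi>])+
  show "act (KPs_raw Z i) n m \<phi> h \<in> el (KPs_raw Z i) n"
    unfolding a KPs_raw_simps by (rule psh_comp_hom[OF s(1) h' sph_presheaf])
  show "KPs_eval i n (act (KPs_raw Z i) n m \<phi> h) = act Z (int n - int i) (int m - int i) (map_cls (stab_ext n m \<phi>)) (KPs_eval i m h)"
    unfolding a KPs_eval_def stab_apply(1)[OF sph_id_el] s(2) by (rule stab_mapD(3)[OF h' e sph_id_el])
qed

lemma KPs_raw_presheaf: "pointed_presheaf smp (KPs_raw Z i)"
  unfolding pointed_presheaf_def
proof (intro conjI ballI)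
  fix n show "pt (KPs_raw Z i) n \<in> el (KPs_raw Z i) n" by (rule KPs_raw_pt)
  { fix h assume h: "h \<in> el (KPs_raw Z i) n"
    have "KPs_eval i n h \<in> el Z (int n - int i)" using KPs_eval_spherical[OF h] by (simp add: spherical_def)
    thus "act (KPs_raw Z i) n n (ide smp n) h = h"
      by (intro KPs_eval_inj[OF KPs_raw_act(1)[OF smp_ide h] h]) (simp add: KPs_raw_act(2)[OF smp_ide h] stab_ext_ide stabD[OF Z]) }
  fix m \<phi> assume \<phi>: "\<phi> \<in> hom smp n m"
  show "act (KPs_raw Z i) n m \<phi> \<in> el (KPs_raw Z i) m \<rightarrow> el (KPs_raw Z i) n"
    using KPs_raw_act(1)[OF \<phi>] by blast
  have e: "stab_ext n m \<phi> \<in> shifts ((int m - int i) - (int n - int i))" using stab_ext_shifts[OF \<phi>] by simp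
  show "act (KPs_raw Z i) n m \<phi> (pt (KPs_raw Z i) m) = pt (KPs_raw Z i) n"
    by (rule KPs_eval_inj[OF KPs_raw_act(1)[OF \<phi> KPs_raw_pt] KPs_raw_pt])
      (simp add: KPs_raw_act(2)[OF \<phi> KPs_raw_pt] KPs_eval_pt stabD(3)[OF Z e])
  fix p \<psi> h assume \<psi>: "\<psi> \<in> hom smp m p" and h: "h \<in> el (KPs_raw Z i) p"
  have e': "stab_ext m p \<psi> \<in> shifts ((int p - int i) - (int m - int i))" using stab_ext_shifts[OF \<psi>] by simp
  have "KPs_eval i p h \<in> el Z (int p - int i)" using KPs_eval_spherical[OF h] by (simp add: spherical_def)
  thus "act (KPs_raw Z i) n p (cmp smp n m p \<psi> \<phi>) h = act (KPs_raw Z i) n m \<phi> (act (KPs_raw Z i) m p \<psi> h)"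
    by (intro KPs_eval_inj[OF KPs_raw_act(1)[OF smp_cmp[OF \<phi> \<psi>] h] KPs_raw_act(1)[OF \<phi> KPs_raw_act(1)[OF \<psi> h]]])
      (simp add: KPs_raw_act(2)[OF smp_cmp[OF \<phi> \<psi>] h] KPs_raw_act(2)[OF \<phi> KPs_raw_act(1)[OF \<psi> h]]
        KPs_raw_act(2)[OF \<psi> h] stab_ext_cmp[OF \<phi> \<psi>] stabD(5)[OF Z e e'])
qed

lemma KPs_raw_fits: "psh_fits TYPE('u) smp (KPs_raw Z i)"
  unfolding psh_fits_def
proof
  fix n
  have "inj_on (KPs_eval i n) (el (KPs_raw Z i) n)" using KPs_eval_inj by (blast intro: inj_onI)
  thus "fits TYPE('u) (el (KPs_raw Z i) n)" by (rule fits_inj[OF fits_UNIV _ subset_UNIV])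
qed

text \<open>Sends a simplex of dimension \<open>n\<close> and index -i to the spherical element over
  \<open>[n - i]\<close> that it classifies. Identities between simplices, and between morphisms
  into \<open>KPs Z\<close>, are checked through this injection.\<close>

definition KPs_incl :: "nat \<Rightarrow> nat \<Rightarrow> 'u \<Rightarrow> 'u" where
  "KPs_incl i n u = KPs_eval i n (dec (el (KPs_raw Z i) n) u)"

lemma lev_KPs: "lev (KPs_obj Z) i = small (KPs_raw Z i)"
  by (simp add: KPs_obj_def)

lemma KPs_dec_enc: "h \<in> el (KPs_raw Z i) n \<Longrightarrow> dec (el (KPs_raw Z i) n) (enc (el (KPs_raw Z i) n) h :: 'u) = h"
  using KPs_raw_fits[of i] by (intro dec_enc) (auto simp: psh_fits_def smp_simps(1))

lemma KPs_incl_enc: "h \<in> el (KPs_raw Z i) n \<Longrightarrow> KPs_incl i n (enc (el (KPs_raw Z i) n) h) = KPs_eval i n h"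
  by (simp add: KPs_incl_def KPs_dec_enc)

lemma KPs_el_cases:
  assumes "u \<in> el (lev (KPs_obj Z) i) n"
  obtains h where "h \<in> el (KPs_raw Z i) n" "u = enc (el (KPs_raw Z i) n) h"
  using assms by (auto simp: lev_KPs small_simps)

lemma KPs_incl_spherical: "u \<in> el (lev (KPs_obj Z) i) n \<Longrightarrow> spherical Z n (int n - int i) (KPs_incl i n u)"
  by (erule KPs_el_cases) (simp add: KPs_incl_enc KPs_eval_spherical)

lemma KPs_incl_inj:
  "u \<in> el (lev (KPs_obj Z) i) n \<Longrightarrow> v \<in> el (lev (KPs_obj Z) i) n \<Longrightarrow> KPs_incl i n u = KPs_incl i n v \<Longrightarrow> u = v"
  by (elim KPs_el_cases) (simp add: KPs_incl_enc, metis KPs_eval_inj)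

lemma KPs_incl_surj:
  assumes "spherical Z n (int n - int i) x" shows "\<exists>u\<in>el (lev (KPs_obj Z) i) n. KPs_incl i n u = x"
proof -
  obtain h where h: "h \<in> el (KPs_raw Z i) n" "KPs_eval i n h = x" using KPs_eval_surj[OF assms] by blast
  thus ?thesis by (intro bexI[where x = "enc (el (KPs_raw Z i) n) h"]) (simp_all add: KPs_incl_enc lev_KPs small_simps)
qed

lemma KPs_incl_act:
  assumes \<phi>: "\<phi> \<in> hom smp n m" and u: "u \<in> el (lev (KPs_obj Z) i) m"
  shows "KPs_incl i n (act (lev (KPs_obj Z) i) n m \<phi> u) = act Z (int n - int i) (int m - int i) (map_cls (stab_ext n m \<phi>)) (KPs_incl i m u)"
proof -
  obtain h where h: "h \<in> el (KPs_raw Z i) m" "u = enc (el (KPs_raw Z i) m) h" using u by (rule KPs_el_cases)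
  show ?thesis
    using act_small[OF KPs_raw_fits, of m h i n \<phi>] h KPs_raw_act[OF \<phi> h(1)]
    by (simp add: lev_KPs KPs_incl_enc smp_simps(1))
qed

lemma KPs_incl_pt: "KPs_incl i n (pt (lev (KPs_obj Z) i) n) = pt Z (int n - int i)"
  by (simp add: lev_KPs small_simps KPs_incl_enc KPs_raw_pt KPs_eval_pt)

lemma lev_KPs_presheaf: "pointed_presheaf smp (lev (KPs_obj Z) i)"
  unfolding lev_KPs by (rule small_presheaf[OF KPs_raw_presheaf KPs_raw_fits])

text \<open>The quotient map between the two spheres carries fundamental element to fundamental
  element. So a shift leaves the element of \<open>Z\<close> unchanged and only regards it as
  (n+1)-spherical instead of n-spherical.\<close>

lemma KPs_shift_el:
  assumes u: "u \<in> el (lev (KPs_obj Z) i) n"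
  shows "KPs_shift Z i n u \<in> el (KPs_raw Z (Suc i)) (Suc n)"
    and "KPs_eval (Suc i) (Suc n) (KPs_shift Z i n u) = KPs_incl i n u"
proof -
  obtain h where h: "h \<in> el (KPs_raw Z i) n" "u = enc (el (KPs_raw Z i) n) h" using u by (rule KPs_el_cases)
  hence h': "h \<in> psh_hom stab (sph n (int n - int i)) Z" by (simp add: KPs_raw_simps)
  let ?z = "int n - int i"
  have i0: "id \<in> shifts (?z - ?z)" by (simp add: shifts_id)
  have b: "collapsed n (id \<circ> g)" if "collapsed (Suc n) g" for g using collapsed_mono[OF that, of n] by simp
  have s: "sph_map (Suc n) ?z n ?z (map_cls id) \<in> psh_hom stab (sph (Suc n) ?z :: 'u stab_psh) (sph n ?z)"
    "sph_map (Suc n) ?z n ?z (map_cls id) ?z (sph_id (Suc n) ?z :: 'u) = act (sph n ?z) ?z ?z (map_cls id) (sph_id n ?z)"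
    by (rule sph_map_hom[OF i0]; erule b)+
  have sh: "KPs_shift Z i n u = psh_comp stab (sph (Suc n) ?z) h (sph_map (Suc n) ?z n ?z (map_cls id))"
    using h by (simp add: KPs_shift_def KPs_dec_enc stab_ide)
  show "KPs_shift Z i n u \<in> el (KPs_raw Z (Suc i)) (Suc n)"
    unfolding sh KPs_raw_simps using psh_comp_hom[OF s(1) h' sph_presheaf] by simp
  have "KPs_eval (Suc i) (Suc n) (KPs_shift Z i n u) = h ?z (act (sph n ?z) ?z ?z (map_cls id) (sph_id n ?z))"
    unfolding sh KPs_eval_def s(2)[symmetric] by (simp add: stab_apply sph_id_el)
  thus "KPs_eval (Suc i) (Suc n) (KPs_shift Z i n u) = KPs_incl i n u"
    using h by (simp add: KPs_incl_enc KPs_eval_def stabD(4)[OF sph_presheaf sph_id_el])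
qed

text \<open>The universal property of the suspension applied to \<open>KPs_shift\<close>; it also
  justifies the use of \<open>the_elem\<close> in \<open>KPs_obj\<close>.\<close>

lemma KPs_bond_universal:
  shows "pmap smp (susp_raw (lev (KPs_obj Z) i)) (KPs_raw Z (Suc i)) (\<lambda>p c. the_elem (KPs_bond_term Z i p ` c))"
    and "u \<in> el (lev (KPs_obj Z) i) n \<Longrightarrow>
      the_elem (KPs_bond_term Z i (Suc n) ` smash_id (lev (KPs_obj Z) i) n u) = KPs_shift Z i n u"
proof -
  let ?X = "lev (KPs_obj Z) i" and ?W = "KPs_raw Z (Suc i)"
  note S = KPs_shift_el
  have spt: "KPs_shift Z i n (pt ?X n) = pt ?W (Suc n)" for n
    by (rule KPs_eval_inj[OF S(1) KPs_raw_pt])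
      (simp_all add: S(2) smp_presheafD(1)[OF lev_KPs_presheaf] KPs_incl_pt KPs_eval_pt)
  have sact: "KPs_shift Z i n (act ?X n m \<phi> u) = act ?W (Suc n) (Suc m) (Kmap n m \<phi>) (KPs_shift Z i m u)"
    if \<phi>: "\<phi> \<in> hom smp n m" and u: "u \<in> el ?X m" for n m \<phi> u
  proof -
    have u': "act ?X n m \<phi> u \<in> el ?X n" using lev_KPs_presheaf u \<phi> by (rule smp_presheafD(2))
    show ?thesis
      by (rule KPs_eval_inj[OF S(1)[OF u'] KPs_raw_act(1)[OF Kmap_hom[OF \<phi>] S(1)[OF u]]])
        (simp add: S(2)[OF u'] S(2)[OF u] KPs_raw_act(2)[OF Kmap_hom[OF \<phi>] S(1)[OF u]] KPs_incl_act[OF \<phi> u] stab_ext_Kmap)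
  qed
  \<comment> \<open>The element of a shifted simplex is still n-spherical, so any operator whose
    extension is collapsed for \<open>n\<close> kills it. The last face d^(n+1) and the last vertex,
    with extension the translation by n + 1, are of this kind.\<close>
  have kill: "act ?W p (Suc n) \<psi> (KPs_shift Z i n u) = pt ?W p"
    if u: "u \<in> el ?X n" and \<psi>: "\<psi> \<in> hom smp p (Suc n)" and b: "collapsed n (stab_ext p (Suc n) \<psi>)" for p n \<psi> u
  proof (rule KPs_eval_inj[OF KPs_raw_act(1)[OF \<psi> S(1)[OF u]] KPs_raw_pt])
    have "stab_ext p (Suc n) \<psi> \<in> shifts ((int n - int i) - (int p - int (Suc i)))"
      using stab_ext_shifts[OF \<psi>] by (simp add: algebra_simps)
    thus "KPs_eval (Suc i) p (act ?W p (Suc n) \<psi> (KPs_shift Z i n u)) = KPs_eval (Suc i) p (pt ?W p)"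
      using KPs_incl_spherical[OF u] b by (simp add: KPs_raw_act(2)[OF \<psi> S(1)[OF u]] S(2)[OF u] KPs_eval_pt spherical_def)
  qed
  have sface: "act ?W n (Suc n) (coface n (Suc n)) (KPs_shift Z i n u) = pt ?W n" if "u \<in> el ?X n" for n u
    using kill[OF that coface_hom, of "Suc n"] collapsed_face[of 1 n] by (simp add: stab_ext_coface)
  have svertex: "act ?W 0 (Suc n) (vertex n) (KPs_shift Z i n u) = pt ?W 0" if "u \<in> el ?X n" for n u
    by (rule kill[OF that vertex_hom]) (simp add: collapsed_def stab_ext_def vertex_def)
  note U = susp_raw_universal[OF lev_KPs_presheaf KPs_raw_presheaf, of i "KPs_shift Z i" "Suc i" "KPs_bond_term Z i",
    OF S(1) spt sact sface svertex]
  show "pmap smp (susp_raw ?X) ?W (\<lambda>p c. the_elem (KPs_bond_term Z i p ` c))"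
    by (rule U(1)) simp_all
  show "u \<in> el ?X n \<Longrightarrow> the_elem (KPs_bond_term Z i (Suc n) ` smash_id ?X n u) = KPs_shift Z i n u"
    by (rule U(2)) simp_all
qed

lemma bond_KPs: "bond (KPs_obj Z) i = small_map smp (susp_raw (lev (KPs_obj Z) i)) (KPs_raw Z (Suc i))
    (\<lambda>p c. the_elem (KPs_bond_term Z i p ` c))"
  by (simp add: KPs_obj_def)

lemma KPs_obj_oplaxlim: "KPs_obj Z \<in> obj oplaxlim"
  unfolding oplaxlim_simps
proof (intro allI conjI lev_KPs_presheaf)
  fix i
  have "bond (KPs_obj Z) i \<in> psh_hom smp (small (susp_raw (lev (KPs_obj Z) i))) (small (KPs_raw Z (Suc i)))"
    unfolding bond_KPs by (rule small_map_hom[OF susp_raw_presheaf susp_fits KPs_raw_fits KPs_bond_universal(1)])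
  thus "bond (KPs_obj Z) i \<in> psh_hom smp (susp (lev (KPs_obj Z) i)) (lev (KPs_obj Z) (Suc i))"
    by (simp add: susp_def lev_KPs)
qed

lemma KPs_incl_bond_shift:
  assumes "u \<in> el (lev (KPs_obj Z) i) n"
  shows "KPs_incl (Suc i) (Suc n) (bond_shift (KPs_obj Z) i n u) = KPs_incl i n u"
proof -
  have "bond_shift (KPs_obj Z) i n u = enc (el (KPs_raw Z (Suc i)) (Suc n)) (KPs_shift Z i n u)"
    unfolding bond_shift_def bond_KPs smash_id_enc_def
    by (subst small_map_enc[OF susp_fits]) (simp_all add: smp_simps(1) smash_id_el assms KPs_bond_universal(2))
  thus ?thesis using KPs_incl_enc KPs_shift_el[OF assms] by simp
qed

lemma KPs_incl_bond_shift_pow: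
  assumes "u \<in> el (lev (KPs_obj Z) i) n"
  shows "KPs_incl (i + j) (n + j) (bond_shift_pow (KPs_obj Z) i n j u) = KPs_incl i n u"
  by (induction j) (simp_all add: KPs_incl_bond_shift bond_shift_pow_el[OF KPs_obj_oplaxlim assms])

end

lemma KPs_map:
  fixes Z Z' :: "'u::infinite stab_psh"
  assumes Z: "pointed_presheaf stab Z" and Z': "pointed_presheaf stab Z'" and f: "f \<in> psh_hom stab Z Z'"
  shows "fmap KPs Z Z' f \<in> spec_hom (KPs_obj Z) (KPs_obj Z')"
    and "u \<in> el (lev (KPs_obj Z) i) n \<Longrightarrow> KPs_incl Z' i n (fmap KPs Z Z' f i n u) = f (int n - int i) (KPs_incl Z i n u)"
proof -
  let ?F = "fmap KPs Z Z' f"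
  have F: "?F i = small_map smp (KPs_raw Z i) (KPs_raw Z' i) (\<lambda>n h. psh_comp stab (sph n (int n - int i)) f h)" for i
    by (simp add: KPs_def)
  have el: "psh_comp stab (sph n (int n - int i)) f h \<in> el (KPs_raw Z' i) n" if "h \<in> el (KPs_raw Z i) n" for i n h
    using psh_comp_hom[OF _ f sph_presheaf] that by (simp add: KPs_raw_simps)
  have ev: "KPs_eval i n (psh_comp stab (sph n (int n - int i)) f h) = f (int n - int i) (KPs_eval i n h)" for i n h
    unfolding KPs_eval_def by (rule stab_apply(1)[OF sph_id_el])
  have ke: "KPs_eval i n h \<in> el Z (int n - int i)" if "h \<in> el (KPs_raw Z i) n" for h i n
    using KPs_eval_spherical[OF Z that] by (simp add: spherical_def)
  have pm: "pmap smp (KPs_raw Z i) (KPs_raw Z' i) (\<lambda>n h. psh_comp stab (sph n (int n - int i)) f h)" for i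
    unfolding pmap_def
  proof (intro conjI ballI el)
    fix n
    show "psh_comp stab (sph n (int n - int i)) f (pt (KPs_raw Z i) n) = pt (KPs_raw Z' i) n"
      by (rule KPs_eval_inj[OF Z' el[OF KPs_raw_pt[OF Z]] KPs_raw_pt[OF Z']]) (simp add: ev KPs_eval_pt[OF Z] KPs_eval_pt[OF Z'] stab_mapD[OF f])
    fix m \<phi> h assume \<phi>: "\<phi> \<in> hom smp n m" and h: "h \<in> el (KPs_raw Z i) m"
    have e: "stab_ext n m \<phi> \<in> shifts ((int m - int i) - (int n - int i))" using stab_ext_shifts[OF \<phi>] by simp
    show "psh_comp stab (sph n (int n - int i)) f (act (KPs_raw Z i) n m \<phi> h)
       = act (KPs_raw Z' i) n m \<phi> (psh_comp stab (sph m (int m - int i)) f h)"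
      by (rule KPs_eval_inj[OF Z' el[OF KPs_raw_act(1)[OF Z \<phi> h]] KPs_raw_act(1)[OF Z' \<phi> el[OF h]]])
        (simp add: ev KPs_raw_act(2)[OF Z \<phi> h] KPs_raw_act(2)[OF Z' \<phi> el[OF h]] stab_mapD(3)[OF f e ke[OF h]])
  qed
  have hom: "?F i \<in> psh_hom smp (lev (KPs_obj Z) i) (lev (KPs_obj Z') i)" for i
    unfolding F lev_KPs[OF Z] lev_KPs[OF Z']
    by (rule small_map_hom[OF KPs_raw_presheaf[OF Z] KPs_raw_fits[OF Z] KPs_raw_fits[OF Z'] pm])
  have KPs_incl: "KPs_incl Z' i n (?F i n u) = f (int n - int i) (KPs_incl Z i n u)" if u: "u \<in> el (lev (KPs_obj Z) i) n" for i n u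
  proof -
    obtain h where h: "h \<in> el (KPs_raw Z i) n" "u = enc (el (KPs_raw Z i) n) h" using KPs_el_cases[OF Z u] .
    have "?F i n u = enc (el (KPs_raw Z' i) n) (psh_comp stab (sph n (int n - int i)) f h)"
      unfolding F h(2) by (rule small_map_enc[OF KPs_raw_fits[OF Z] _ h(1)]) (simp add: smp_simps(1))
    thus ?thesis using KPs_incl_enc[OF Z' el[OF h(1)]] ev KPs_incl_enc[OF Z h(1)] h(2) by simp
  qed
  thus "u \<in> el (lev (KPs_obj Z) i) n \<Longrightarrow> KPs_incl Z' i n (?F i n u) = f (int n - int i) (KPs_incl Z i n u)" .
  note O = KPs_obj_oplaxlim[OF Z] and O' = KPs_obj_oplaxlim[OF Z']
  show "?F \<in> spec_hom (KPs_obj Z) (KPs_obj Z')"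
    unfolding spec_hom_iff[OF O O']
  proof (intro conjI allI impI hom)
    fix i n u assume u: "u \<in> el (lev (KPs_obj Z) i) n"
    have b: "bond_shift (KPs_obj Z) i n u \<in> el (lev (KPs_obj Z) (Suc i)) (Suc n)" by (rule bond_shift_el[OF O u])
    show "?F (Suc i) (Suc n) (bond_shift (KPs_obj Z) i n u) = bond_shift (KPs_obj Z') i n (?F i n u)"
      by (rule KPs_incl_inj[OF Z' smp_homD(1)[OF hom b] bond_shift_el[OF O' smp_homD(1)[OF hom u]]])
        (simp add: KPs_incl[OF b] KPs_incl[OF u] KPs_incl_bond_shift[OF Z u] KPs_incl_bond_shift[OF Z' smp_homD(1)[OF hom u]])
  qed
qed

lemma KPs_fobj: "fobj KPs Z = KPs_obj Z"
  by (simp add: KPs_def)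

lemma spec_hom_KPs_eqI:
  fixes Z :: "'u::infinite stab_psh"
  assumes Z: "pointed_presheaf stab Z" and f: "f \<in> spec_hom Y (KPs_obj Z)" and f': "f' \<in> spec_hom Y (KPs_obj Z)"
    and eq: "\<And>i n x. x \<in> el (lev Y i) n \<Longrightarrow> KPs_incl Z i n (f i n x) = KPs_incl Z i n (f' i n x)"
  shows "f = f'"
proof
  fix i show "f i = f' i"
    by (rule smp_hom_extI[OF spec_homD(1)[OF f] spec_homD(1)[OF f']],
        rule KPs_incl_inj[OF Z smp_homD(1)[OF spec_homD(1)[OF f]] smp_homD(1)[OF spec_homD(1)[OF f']]])
      (auto intro: eq)
qed

lemma KPs_functor: "is_functor (psh stab :: ('u::infinite stab_psh, 'u stab_mor) cat) oplaxlim KPs"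
  unfolding is_functor_def psh_simps oplaxlim_simps(2-) KPs_fobj
proof (intro conjI ballI category_oplaxlim category_psh)
  fix Z Z' Z'' :: "'u stab_psh" and f g
  assume "Z \<in> {P. pointed_presheaf stab P}"
  hence Z: "pointed_presheaf stab Z" by simp
  note O = KPs_obj_oplaxlim[OF Z]
  show "KPs_obj Z \<in> obj oplaxlim" by (rule O)
  have i: "(\<lambda>i. psh_id smp (lev (KPs_obj Z) i)) \<in> spec_hom (KPs_obj Z) (KPs_obj Z)"
    using cat_ide[OF category_oplaxlim O] by (simp add: oplaxlim_simps)
  show "fmap KPs Z Z (psh_id stab Z) = (\<lambda>i. psh_id smp (lev (KPs_obj Z) i))"
  proof (rule spec_hom_KPs_eqI[OF Z KPs_map(1)[OF Z Z psh_id_hom[OF Z]] i])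
    fix i n x assume x: "x \<in> el (lev (KPs_obj Z) i) n"
    have "KPs_incl Z i n x \<in> el Z (int n - int i)" using KPs_incl_spherical[OF Z x] by (simp add: spherical_def)
    thus "KPs_incl Z i n (fmap KPs Z Z (psh_id stab Z) i n x) = KPs_incl Z i n (psh_id smp (lev (KPs_obj Z) i) n x)"
      by (simp add: KPs_map(2)[OF Z Z psh_id_hom[OF Z] x] stab_apply smp_apply[OF x])
  qed
  assume "Z' \<in> {P. pointed_presheaf stab P}" and f: "f \<in> psh_hom stab Z Z'"
  hence Z': "pointed_presheaf stab Z'" by simp
  note O' = KPs_obj_oplaxlim[OF Z']
  show "fmap KPs Z Z' f \<in> spec_hom (KPs_obj Z) (KPs_obj Z')" by (rule KPs_map(1)[OF Z Z' f])
  assume "Z'' \<in> {P. pointed_presheaf stab P}" and g: "g \<in> psh_hom stab Z' Z''"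
  hence Z'': "pointed_presheaf stab Z''" by simp
  note O'' = KPs_obj_oplaxlim[OF Z'']
  note gf = psh_comp_hom[OF f g Z]
  show "fmap KPs Z Z'' (psh_comp stab Z g f) = spec_comp (KPs_obj Z) (fmap KPs Z' Z'' g) (fmap KPs Z Z' f)"
  proof (rule spec_hom_KPs_eqI[OF Z'' KPs_map(1)[OF Z Z'' gf] spec_comp_hom[OF O O' O'' KPs_map(1)[OF Z Z' f] KPs_map(1)[OF Z' Z'' g]]])
    fix i n x assume x: "x \<in> el (lev (KPs_obj Z) i) n"
    have "KPs_incl Z i n x \<in> el Z (int n - int i)" using KPs_incl_spherical[OF Z x] by (simp add: spherical_def)
    moreover have "fmap KPs Z Z' f i n x \<in> el (lev (KPs_obj Z') i) n"
      by (rule smp_homD(1)[OF spec_homD(1)[OF KPs_map(1)[OF Z Z' f]] x])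
    ultimately show "KPs_incl Z'' i n (fmap KPs Z Z'' (psh_comp stab Z g f) i n x)
       = KPs_incl Z'' i n (spec_comp (KPs_obj Z) (fmap KPs Z' Z'' g) (fmap KPs Z Z' f) i n x)"
      by (simp add: KPs_map(2)[OF Z Z'' gf x] spec_comp_def smp_apply[OF x] stab_apply
          KPs_map(2)[OF Z' Z'' g] KPs_map(2)[OF Z Z' f x])
  qed
qed

section \<open>Colimits of spherical objects\<close>

text \<open>Only the elements are cut down; base-points and restrictions are those of
  \<open>Z\<close>, so one and the same function can be a morphism into either.\<close>

definition spherical_part :: "(int, gen list set, 'u) ppsh \<Rightarrow> (int, gen list set, 'u) ppsh" where
  "spherical_part Z = Z\<lparr>el := (\<lambda>z. {x. \<exists>n. spherical Z n z x})\<rparr>"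

lemma spherical_part_simps:
  "el (spherical_part Z) z = {x. \<exists>n. spherical Z n z x}" "pt (spherical_part Z) = pt Z" "act (spherical_part Z) = act Z"
  by (simp_all add: spherical_part_def)

lemma spherical_part_el: "x \<in> el (spherical_part Z) z \<Longrightarrow> x \<in> el Z z"
  by (auto simp: spherical_part_simps spherical_def)

lemma spherical_part_presheaf:
  assumes Z: "pointed_presheaf stab Z" shows "pointed_presheaf stab (spherical_part Z)"
  unfolding pointed_presheaf_def spherical_part_simps(2,3)
proof (intro conjI ballI)
  fix a show "pt Z a \<in> el (spherical_part Z) a" using spherical_pt[OF Z] by (auto simp: spherical_part_simps)
next
  fix a b f assume "f \<in> hom stab a b"
  then obtain g where g: "g \<in> shifts (b - a)" "f = map_cls g" by (auto simp: stab_hom)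
  show "act Z a b f \<in> el (spherical_part Z) b \<rightarrow> el (spherical_part Z) a"
    using spherical_act[OF Z _ g(1)] by (auto simp: spherical_part_simps g(2))
qed (auto intro: presheafD[OF Z] dest: spherical_part_el)

lemma spherical_part_hom_iff:
  "f \<in> psh_hom stab P (spherical_part Z) \<longleftrightarrow> f \<in> psh_hom stab P Z \<and> (\<forall>z. \<forall>x\<in>el P z. f z x \<in> el (spherical_part Z) z)"
  unfolding psh_hom_iff pmap_def spherical_part_simps(2,3) by (auto simp: stab_obj dest: spherical_part_el)

definition locally_spherical :: "(int, gen list set, 'u) ppsh \<Rightarrow> bool" where
  "locally_spherical Z \<longleftrightarrow> (\<forall>z. \<forall>x\<in>el Z z. \<exists>n. spherical Z n z x)"

lemma locally_spherical_sph: "locally_spherical (sph n z :: 'u::infinite stab_psh)"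
  unfolding locally_spherical_def
proof (intro allI ballI)
  fix w and y :: 'u assume "y \<in> el (sph n z) w"
  thus "\<exists>m. spherical (sph n z) m w y"
    by (cases rule: sph_cases) (auto intro: spherical_pt[OF sph_presheaf] spherical_act[OF sph_presheaf sph_id_spherical])
qed

text \<open>The identity, regarded as a function, already lands in the spherical part. Typing and
  equation are separate hypotheses because the two morphisms have different targets.\<close>

lemma locally_spherical_if_retract:
  assumes "h \<in> psh_hom stab Z (spherical_part Z)" "h = psh_id stab Z" shows "locally_spherical Z"
  unfolding locally_spherical_def
proof (intro allI ballI)
  fix z x assume "x \<in> el Z z"
  hence "h z x = x" "h z x \<in> el (spherical_part Z) z"
    using assms spherical_part_hom_iff[of h Z Z] by (simp_all add: stab_apply)
  thus "\<exists>n. spherical Z n z x" by (simp add: spherical_part_simps)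
qed

text \<open>The legs of the colimit land in the spherical part, which is therefore the vertex of a
  cocone as well. The induced map from \<open>Z\<close> to it is the identity by uniqueness.\<close>

lemma LocSph_locally_spherical:
  fixes Z :: "'u::infinite stab_psh"
  assumes "Z \<in> obj LocSph" shows "pointed_presheaf stab Z \<and> locally_spherical Z"
proof -
  obtain J :: "('u, 'u) cat" and F \<iota> where F: "\<forall>j\<in>obj J. \<exists>n z. fobj F j = sph n z"
    and colim: "is_colimit J (psh stab) F Z \<iota>" and Z: "pointed_presheaf stab Z"
    using assms by (auto simp: LocSph_def full_subcat_def psh_simps)
  have cc: "is_cocone J (psh stab) F Z \<iota>" using colim by (simp add: is_colimit_def)
  have "\<iota> j \<in> psh_hom stab (fobj F j) (spherical_part Z)" if j: "j \<in> obj J" for j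
  proof -
    have i: "\<iota> j \<in> psh_hom stab (fobj F j) Z" using cc j by (simp add: is_cocone_def psh_simps)
    have "locally_spherical (fobj F j)" using F j locally_spherical_sph by fastforce
    thus ?thesis unfolding spherical_part_hom_iff spherical_part_simps locally_spherical_def using i spherical_map[OF i] by blast
  qed
  hence cs: "is_cocone J (psh stab) F (spherical_part Z) \<iota>"
    using cc spherical_part_presheaf[OF Z] unfolding is_cocone_def psh_simps by simp
  obtain h where h: "h \<in> psh_hom stab Z (spherical_part Z)" "\<And>j. j \<in> obj J \<Longrightarrow> psh_comp stab (fobj F j) h (\<iota> j) = \<iota> j"
    using colim cs unfolding is_colimit_def psh_simps by blast
  have h': "h \<in> psh_hom stab Z Z" using h(1) spherical_part_hom_iff by blast
  have "psh_comp stab (fobj F j) (psh_id stab Z) (\<iota> j) = \<iota> j" if "j \<in> obj J" for j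
    using cc that psh_comp_id(2)[of "\<iota> j" stab "fobj F j" Z] Z F sph_presheaf
    unfolding is_cocone_def psh_simps by fastforce
  moreover have "\<exists>!h. h \<in> psh_hom stab Z Z \<and> (\<forall>j\<in>obj J. psh_comp stab (fobj F j) h (\<iota> j) = \<iota> j)"
    using colim cc unfolding is_colimit_def psh_simps by blast
  ultimately have "h = psh_id stab Z" using h h' psh_id_hom[OF Z] by metis
  thus ?thesis using locally_spherical_if_retract[OF h(1)] Z by blast
qed

text \<open>
  Conversely, a locally spherical presheaf is the colimit over the category of the morphisms from
  spherical objects to it. This category is transported to the universe by \<open>enc\<close>.
\<close>

context
  fixes Z :: "'u::infinite stab_psh"
  assumes Z: "pointed_presheaf stab Z" and ls: "locally_spherical Z"
begin

private definition Ob :: "(nat \<times> int \<times> 'u) set" where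
  "Ob = {(n, z, x). spherical Z n z x}"

private definition Sp :: "nat \<times> int \<times> 'u \<Rightarrow> 'u stab_psh" where
  "Sp = (\<lambda>(n, z, x). sph n z)"

private definition fund :: "nat \<times> int \<times> 'u \<Rightarrow> 'u stab_mor" where
  "fund = (\<lambda>(n, z, x). SOME h. h \<in> psh_hom stab (sph n z) Z \<and> h z (sph_id n z) = x)"

private definition Mor :: "nat \<times> int \<times> 'u \<Rightarrow> nat \<times> int \<times> 'u \<Rightarrow> 'u stab_mor set" where
  "Mor p q = {\<alpha> \<in> psh_hom stab (Sp p) (Sp q). psh_comp stab (Sp p) (fund q) \<alpha> = fund p}"

private abbreviation "eo \<equiv> enc Ob :: _ \<Rightarrow> 'u"
private abbreviation "d \<equiv> dec Ob :: 'u \<Rightarrow> _"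
private abbreviation "em \<equiv> (\<lambda>p q. enc (psh_hom stab (Sp p) (Sp q)) :: _ \<Rightarrow> 'u)"
private abbreviation "dm \<equiv> (\<lambda>p q. dec (psh_hom stab (Sp p) (Sp q)) :: 'u \<Rightarrow> _)"

private definition J :: "('u, 'u) cat" where
  "J = \<lparr>obj = eo ` Ob, hom = (\<lambda>a b. em (d a) (d b) ` Mor (d a) (d b)),
     ide = (\<lambda>a. em (d a) (d a) (psh_id stab (Sp (d a)))),
     cmp = (\<lambda>a b c g f. em (d a) (d c) (psh_comp stab (Sp (d a)) (dm (d b) (d c) g) (dm (d a) (d b) f)))\<rparr>"

private definition F :: "('u, 'u, 'u stab_psh, 'u stab_mor) ftor" where
  "F = \<lparr>fobj = (\<lambda>a. Sp (d a)), fmap = (\<lambda>a b. dm (d a) (d b))\<rparr>"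

private lemma d_eo: "p \<in> Ob \<Longrightarrow> d (eo p) = p"
  by (rule dec_enc) (intro fits_subset[OF _ subset_UNIV[of Ob], folded UNIV_Times_UNIV]
      fits_Times fits_countable fits_UNIV; simp)

private lemma Sp_presheaf: "pointed_presheaf stab (Sp p)"
  by (cases p) (simp add: Sp_def sph_presheaf)

text \<open>A map out of a sphere is determined by its value at the fundamental element, so the
  hom-set fits into the universe.\<close>

private lemma dm_em: "\<alpha> \<in> psh_hom stab (Sp p) (Sp q) \<Longrightarrow> dm p q (em p q \<alpha>) = \<alpha>"
proof (rule dec_enc)
  obtain n z x where p: "p = (n, z, x)" by (cases p)
  have "inj_on (\<lambda>h. h z (sph_id n z)) (psh_hom stab (Sp p) (Sp q))"
    unfolding p Sp_def by (auto intro!: inj_onI sph_hom_eqI)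
  thus "fits TYPE('u) (psh_hom stab (Sp p) (Sp q))" by (rule fits_inj[OF fits_UNIV _ subset_UNIV])
qed

private lemma fund:
  assumes "(n, z, x) \<in> Ob"
  shows "fund (n, z, x) \<in> psh_hom stab (sph n z) Z" "fund (n, z, x) z (sph_id n z) = x"
proof -
  have "\<exists>h. h \<in> psh_hom stab (sph n z :: 'u stab_psh) Z \<and> h z (sph_id n z) = x"
    using sph_hom_exists[OF Z, of n z x] assms by (auto simp: Ob_def)
  from someI_ex[OF this] show "fund (n, z, x) \<in> psh_hom stab (sph n z) Z" "fund (n, z, x) z (sph_id n z) = x"
    by (simp_all add: fund_def)
qed

private lemma fund_hom: "p \<in> Ob \<Longrightarrow> fund p \<in> psh_hom stab (Sp p) Z"
  using fund by (cases p) (simp add: Sp_def)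

private lemma J_obj: "a \<in> obj J \<longleftrightarrow> (\<exists>p\<in>Ob. a = eo p)"
  by (auto simp: J_def)

private lemma J_hom:
  assumes "p \<in> Ob" "q \<in> Ob"
  shows "f \<in> hom J (eo p) (eo q) \<longleftrightarrow> (\<exists>\<alpha>\<in>Mor p q. f = em p q \<alpha>)"
  using assms by (auto simp: J_def d_eo)

private lemma Mor_hom: "\<alpha> \<in> Mor p q \<Longrightarrow> \<alpha> \<in> psh_hom stab (Sp p) (Sp q)"
  by (simp add: Mor_def)

private lemma J_cmp:
  assumes "p \<in> Ob" "q \<in> Ob" "r \<in> Ob" "\<alpha> \<in> Mor p q" "\<beta> \<in> Mor q r"
  shows "cmp J (eo p) (eo q) (eo r) (em q r \<beta>) (em p q \<alpha>) = em p r (psh_comp stab (Sp p) \<beta> \<alpha>)"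
  using assms by (simp add: J_def d_eo dm_em Mor_hom)

private lemma J_ide: "p \<in> Ob \<Longrightarrow> ide J (eo p) = em p p (psh_id stab (Sp p))"
  by (simp add: J_def d_eo)

private lemma Mor_cmp:
  assumes "r \<in> Ob" and \<alpha>: "\<alpha> \<in> Mor p q" and \<beta>: "\<beta> \<in> Mor q r"
  shows "psh_comp stab (Sp p) \<beta> \<alpha> \<in> Mor p r"
  unfolding Mor_def
proof (intro CollectI conjI)
  show "psh_comp stab (Sp p) \<beta> \<alpha> \<in> psh_hom stab (Sp p) (Sp r)"
    by (rule psh_comp_hom[OF Mor_hom[OF \<alpha>] Mor_hom[OF \<beta>] Sp_presheaf])
  show "psh_comp stab (Sp p) (fund r) (psh_comp stab (Sp p) \<beta> \<alpha>) = fund p"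
    using psh_comp_assoc[OF Mor_hom[OF \<alpha>] Mor_hom[OF \<beta>] fund_hom[OF assms(1)] Sp_presheaf Sp_presheaf] \<alpha> \<beta>
    by (simp add: Mor_def)
qed

private lemma Mor_ide: "p \<in> Ob \<Longrightarrow> psh_id stab (Sp p) \<in> Mor p p"
  using psh_comp_id[OF fund_hom Sp_presheaf Z] psh_id_hom[OF Sp_presheaf] by (simp add: Mor_def)

private lemma category_J: "category J"
  unfolding category_def
proof (intro conjI ballI)
  fix a b c e f g h assume "a \<in> obj J" "b \<in> obj J" "c \<in> obj J" "e \<in> obj J"
  then obtain p q r s where o: "p \<in> Ob" "a = eo p" "q \<in> Ob" "b = eo q" "r \<in> Ob" "c = eo r" "s \<in> Ob" "e = eo s"
    by (auto simp: J_obj)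
  assume "f \<in> hom J a b" "g \<in> hom J b c" "h \<in> hom J c e"
  then obtain \<alpha> \<beta> \<gamma> where m: "\<alpha> \<in> Mor p q" "f = em p q \<alpha>" "\<beta> \<in> Mor q r" "g = em q r \<beta>"
    "\<gamma> \<in> Mor r s" "h = em r s \<gamma>" using o by (auto simp: J_hom)
  show "cmp J a b e (cmp J b c e h g) f = cmp J a c e h (cmp J a b c g f)"
    using psh_comp_assoc[OF Mor_hom[OF m(1)] Mor_hom[OF m(3)] Mor_hom[OF m(5)] Sp_presheaf Sp_presheaf]
    by (simp add: o m(2,4,6) J_cmp[OF o(1,3,5) m(1,3)] J_cmp[OF o(3,5,7) m(3,5)]
        J_cmp[OF o(1,3,7) m(1) Mor_cmp[OF o(7) m(3,5)]] J_cmp[OF o(1,5,7) Mor_cmp[OF o(5) m(1,3)] m(5)])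
next
  fix a assume "a \<in> obj J"
  then obtain p where o: "p \<in> Ob" "a = eo p" by (auto simp: J_obj)
  show "ide J a \<in> hom J a a" using o Mor_ide[OF o(1)] by (auto simp: J_ide J_hom)
  fix b f assume "b \<in> obj J"
  then obtain q where o': "q \<in> Ob" "b = eo q" by (auto simp: J_obj)
  assume "f \<in> hom J a b"
  then obtain \<alpha> where m: "\<alpha> \<in> Mor p q" "f = em p q \<alpha>" using o o' by (auto simp: J_hom)
  show "cmp J a a b f (ide J a) = f" "cmp J a b b (ide J b) f = f"
    using o o' m psh_comp_id[OF Mor_hom[OF m(1)] Sp_presheaf Sp_presheaf]
    by (simp_all add: J_ide J_cmp Mor_ide)
  fix c g assume "c \<in> obj J"
  then obtain r where o'': "r \<in> Ob" "c = eo r" by (auto simp: J_obj)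
  assume "g \<in> hom J b c"
  then obtain \<beta> where "\<beta> \<in> Mor q r" "g = em q r \<beta>" using o' o'' by (auto simp: J_hom)
  thus "cmp J a b c g f \<in> hom J a c" using o o' o'' m Mor_cmp[OF o''(1) m(1)] by (auto simp: J_hom J_cmp)
qed

private lemma F_simps: "p \<in> Ob \<Longrightarrow> fobj F (eo p) = Sp p" "p \<in> Ob \<Longrightarrow> q \<in> Ob \<Longrightarrow> fmap F (eo p) (eo q) = dm p q"
  by (simp_all add: F_def d_eo)

private lemma functor_F: "is_functor J (psh stab) F"
  unfolding is_functor_def
proof (intro conjI ballI category_J category_psh)
  fix a assume "a \<in> obj J"
  then obtain p where o: "p \<in> Ob" "a = eo p" by (auto simp: J_obj)
  show "fobj F a \<in> obj (psh stab)" using o Sp_presheaf by (simp add: F_simps psh_simps)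
  show "fmap F a a (ide J a) = ide (psh stab) (fobj F a)"
    using o by (simp add: F_simps J_ide psh_simps dm_em psh_id_hom Sp_presheaf)
  fix b f assume "b \<in> obj J"
  then obtain q where o': "q \<in> Ob" "b = eo q" by (auto simp: J_obj)
  assume "f \<in> hom J a b"
  then obtain \<alpha> where m: "\<alpha> \<in> Mor p q" "f = em p q \<alpha>" using o o' by (auto simp: J_hom)
  show "fmap F a b f \<in> hom (psh stab) (fobj F a) (fobj F b)"
    using o o' m by (simp add: F_simps psh_simps dm_em Mor_hom)
  fix c g assume "c \<in> obj J"
  then obtain r where o'': "r \<in> Ob" "c = eo r" by (auto simp: J_obj)
  assume "g \<in> hom J b c"
  then obtain \<beta> where "\<beta> \<in> Mor q r" "g = em q r \<beta>" using o' o'' by (auto simp: J_hom)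
  thus "fmap F a c (cmp J a b c g f) = cmp (psh stab) (fobj F a) (fobj F b) (fobj F c) (fmap F b c g) (fmap F a b f)"
    using o o' o'' m Mor_hom[OF Mor_cmp[OF o''(1) m(1)]] by (simp add: F_simps psh_simps J_cmp dm_em Mor_hom)
qed

text \<open>Removes the encoding of the index category, so that the universal property can be argued
  with spheres and elements.\<close>

private lemma cocone_iff:
  "is_cocone J (psh stab) F W \<kappa> \<longleftrightarrow> pointed_presheaf stab W \<and>
     (\<forall>p\<in>Ob. \<kappa> (eo p) \<in> psh_hom stab (Sp p) W) \<and>
     (\<forall>p\<in>Ob. \<forall>q\<in>Ob. \<forall>\<alpha>\<in>Mor p q. psh_comp stab (Sp p) (\<kappa> (eo q)) \<alpha> = \<kappa> (eo p))"
    (is "?l \<longleftrightarrow> ?r")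
proof
  assume l: ?l
  have "psh_comp stab (Sp p) (\<kappa> (eo q)) \<alpha> = \<kappa> (eo p)" if "p \<in> Ob" "q \<in> Ob" "\<alpha> \<in> Mor p q" for p q \<alpha>
  proof -
    have "eo p \<in> obj J" "eo q \<in> obj J" "em p q \<alpha> \<in> hom J (eo p) (eo q)" using that J_hom by (auto simp: J_obj)
    hence "cmp (psh stab) (fobj F (eo p)) (fobj F (eo q)) W (\<kappa> (eo q)) (fmap F (eo p) (eo q) (em p q \<alpha>)) = \<kappa> (eo p)"
      using l unfolding is_cocone_def by blast
    thus ?thesis using that by (simp add: psh_simps F_simps dm_em Mor_hom)
  qed
  moreover have "\<kappa> (eo p) \<in> psh_hom stab (Sp p) W" if "p \<in> Ob" for p
  proof -
    have "\<kappa> (eo p) \<in> hom (psh stab) (fobj F (eo p)) W"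
      using l that J_obj[of "eo p"] unfolding is_cocone_def by blast
    thus ?thesis using that by (simp add: psh_simps F_simps)
  qed
  ultimately show ?r using l by (simp add: is_cocone_def psh_simps(1))
next
  assume ?r
  thus ?l unfolding is_cocone_def using functor_F
    by (auto simp: psh_simps J_obj J_hom F_simps dm_em Mor_hom)
qed

text \<open>The value of \<open>h\<close> at \<open>x\<close> is read off the leg at any sphere
  classifying \<open>x\<close>. Maps of spheres over \<open>Z\<close> relate the legs; they give
  independence of the sphere, base-points and naturality.\<close>

private lemma universal:
  assumes W: "pointed_presheaf stab W"
    and \<kappa>: "\<And>n z x. spherical Z n z x \<Longrightarrow> \<kappa> (n, z, x) \<in> psh_hom stab (sph n z) W"
    and comm: "\<And>p q \<alpha>. p \<in> Ob \<Longrightarrow> q \<in> Ob \<Longrightarrow> \<alpha> \<in> Mor p q \<Longrightarrow> psh_comp stab (Sp p) (\<kappa> q) \<alpha> = \<kappa> p"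
  shows "\<exists>h\<in>psh_hom stab Z (W :: 'u stab_psh). \<forall>n z x. spherical Z n z x \<longrightarrow> h z x = \<kappa> (n, z, x) z (sph_id n z)"
proof -
  let ?v = "\<lambda>n z x. \<kappa> (n, z, x) z (sph_id n z) :: 'u"
  have Ob: "(n, z, x) \<in> Ob \<longleftrightarrow> spherical Z n z x" for n z x by (simp add: Ob_def)
  \<comment> \<open>A spherical restriction of the fundamental element of one sphere is classified
    by a map from another sphere. That map is a morphism of the diagram, so compatibility of the
    legs applies.\<close>
  have v_act: "?v m w (act Z w z (map_cls f) x) = act W w z (map_cls f) (?v n z x) \<and> spherical Z m w (act Z w z (map_cls f) x)"
    if x: "spherical Z n z x" and f: "f \<in> shifts (z - w)"
      and m: "spherical (sph n z) m w (act (sph n z) w z (map_cls f) (sph_id n z :: 'u))" for n z x m w f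
  proof -
    let ?y = "act Z w z (map_cls f) x"
    obtain \<alpha> where \<alpha>: "\<alpha> \<in> psh_hom stab (sph m w :: 'u stab_psh) (sph n z :: 'u stab_psh)"
        "\<alpha> w (sph_id m w) = act (sph n z) w z (map_cls f) (sph_id n z)"
      using sph_hom_exists[OF sph_presheaf m] by blast
    note H = fund[OF Ob[THEN iffD2, OF x]]
    have Hy: "fund (n, z, x) w (\<alpha> w (sph_id m w)) = ?y"
      unfolding \<alpha>(2) using stab_mapD(3)[OF H(1) f sph_id_el] H(2) by simp
    have y: "spherical Z m w ?y" using spherical_map[OF H(1) m] Hy \<alpha>(2) by simp
    note Hy' = fund[OF Ob[THEN iffD2, OF y]]
    have "psh_comp stab (sph m w) (fund (n, z, x)) \<alpha> = fund (m, w, ?y)"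
      by (rule sph_hom_eqI[OF psh_comp_hom[OF \<alpha>(1) H(1) sph_presheaf] Hy'(1)])
        (simp add: stab_apply sph_id_el Hy Hy'(2))
    hence "\<alpha> \<in> Mor (m, w, ?y) (n, z, x)" using \<alpha>(1) by (simp add: Mor_def Sp_def)
    hence "psh_comp stab (sph m w) (\<kappa> (n, z, x)) \<alpha> = \<kappa> (m, w, ?y)"
      using comm[of "(m, w, ?y)" "(n, z, x)" \<alpha>] x y by (simp add: Ob Sp_def)
    hence "?v m w ?y = \<kappa> (n, z, x) w (\<alpha> w (sph_id m w))"
      using stab_apply(1)[OF sph_id_el, of m w "\<kappa> (n, z, x)" \<alpha>] by simp
    also have "\<dots> = act W w z (map_cls f) (?v n z x)"
      unfolding \<alpha>(2) by (rule stab_mapD(3)[OF \<kappa>[OF x] f sph_id_el])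
    finally show ?thesis using y by blast
  qed
  have v_el: "?v n z x \<in> el W z" if "spherical Z n z x" for n z x
    by (rule stab_mapD(1)[OF \<kappa>[OF that] sph_id_el])
  \<comment> \<open>The case \<open>f = id\<close>: the quotient map from the
    \<open>m\<close>-sphere to the \<open>n\<close>-sphere over the same \<open>[z]\<close>.\<close>
  have v_up: "?v m z x = ?v n z x" if x: "spherical Z n z x" and "n \<le> m" for n m z x
  proof -
    have i: "id \<in> shifts (z - z)" by (simp add: shifts_id)
    have "act (sph n z) z z (map_cls id) (sph_id n z) = (sph_id n z :: 'u)" by (rule stabD(4)[OF sph_presheaf sph_id_el])
    moreover have "act Z z z (map_cls id) x = x" using stabD(4)[OF Z] x by (simp add: spherical_def)
    moreover have "spherical (sph n z) m z (sph_id n z :: 'u)" by (rule spherical_mono[OF sph_id_spherical that(2)])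
    ultimately show ?thesis
      using v_act[OF x i, of m] stabD(4)[OF W v_el[OF x]] by simp
  qed
  define h where "h z x = ?v (SOME n. spherical Z n z x) z x" for z x
  have h: "h z x = ?v n z x" if x: "spherical Z n z x" for n z x
  proof -
    let ?k = "SOME n. spherical Z n z x"
    have k: "spherical Z ?k z x" using x by (rule someI)
    show ?thesis unfolding h_def using v_up[OF k, of "max ?k n"] v_up[OF x, of "max ?k n"] by simp
  qed
  have ex: "\<exists>n. spherical Z n z x" if "x \<in> el Z z" for z x using ls that by (simp add: locally_spherical_def)
  have "pmap stab Z W h"
    unfolding pmap_def stab_obj
  proof (intro conjI ballI)
    { fix z x assume "x \<in> el Z z"
      thus "h z x \<in> el W z" using ex h v_el by metis }
    fix z
    let ?p = "(0, z, pt Z z)"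
    have p: "spherical Z 0 z (pt Z z)" by (rule spherical_pt[OF Z])
    \<comment> \<open>The zero endomorphism is a morphism of the diagram at the base-point of
      \<open>Z\<close>; compatibility with it forces the leg there to vanish on the fundamental
      element.\<close>
    let ?o = "psh_zero stab (sph 0 z) (sph 0 z) :: 'u stab_mor"
    have z0: "?o \<in> psh_hom stab (sph 0 z) (sph 0 z)" by (rule psh_zero_hom[OF sph_presheaf sph_presheaf])
    note H = fund[OF Ob[THEN iffD2, OF p]]
    have "psh_comp stab (sph 0 z) (fund ?p) ?o = fund ?p"
      by (rule sph_hom_eqI[OF psh_comp_hom[OF z0 H(1) sph_presheaf] H(1)])
        (simp add: stab_apply sph_id_el H(2) stab_mapD(2)[OF H(1)])
    hence "?o \<in> Mor ?p ?p" using z0 by (simp add: Mor_def Sp_def)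
    hence "psh_comp stab (sph 0 z) (\<kappa> ?p) ?o = \<kappa> ?p" using comm[of ?p ?p ?o] p by (simp add: Ob Sp_def)
    hence "?v 0 z (pt Z z) = \<kappa> ?p z (?o z (sph_id 0 z))"
      using stab_apply(1)[OF sph_id_el, of 0 z "\<kappa> ?p" ?o] by simp
    thus "h z (pt Z z) = pt W z"
      unfolding h[OF p] by (simp add: stab_apply sph_id_el stab_mapD(2)[OF \<kappa>[OF p]])
    fix w k x assume "k \<in> hom stab w z" and x: "x \<in> el Z z"
    then obtain f where f: "f \<in> shifts (z - w)" "k = map_cls f" by (auto simp: stab_hom)
    obtain n where n: "spherical Z n z x" using ex[OF x] by blast
    obtain m where "spherical (sph n z) m w (act (sph n z) w z (map_cls f) (sph_id n z :: 'u))"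
      using spherical_act[OF sph_presheaf sph_id_spherical f(1)] by blast
    note v = v_act[OF n f(1) this]
    show "h w (act Z w z k x) = act W w z k (h z x)"
      unfolding f(2) h[OF n] h[OF conjunct2[OF v]] by (rule conjunct1[OF v])
  qed
  hence "(\<lambda>z\<in>obj stab. \<lambda>x\<in>el Z z. h z x) \<in> psh_hom stab Z W" by (rule restrict_pmap[OF _ Z])
  thus ?thesis using h by (intro bexI) (auto simp: stab_obj spherical_def)
qed

lemma locally_spherical_LocSph: "Z \<in> obj LocSph"
proof -
  let ?i = "\<lambda>a. fund (d a)"
  have cc: "is_cocone J (psh stab) F Z ?i"
    unfolding cocone_iff using Z fund_hom by (auto simp: d_eo Mor_def)
  have "is_colimit J (psh stab) F Z ?i"
    unfolding is_colimit_def
  proof (intro conjI cc allI impI)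
    fix W \<kappa> assume "is_cocone J (psh stab) F W \<kappa>"
    hence W: "pointed_presheaf stab W" and \<kappa>: "\<And>p. p \<in> Ob \<Longrightarrow> \<kappa> (eo p) \<in> psh_hom stab (Sp p) W"
      and comm: "\<And>p q \<alpha>. p \<in> Ob \<Longrightarrow> q \<in> Ob \<Longrightarrow> \<alpha> \<in> Mor p q \<Longrightarrow> psh_comp stab (Sp p) (\<kappa> (eo q)) \<alpha> = \<kappa> (eo p)"
      unfolding cocone_iff by blast+
    have "\<kappa> (eo (n, z, x)) \<in> psh_hom stab (sph n z) W" if "spherical Z n z x" for n z x
      using \<kappa>[of "(n, z, x)"] that by (simp add: Ob_def Sp_def)
    then obtain h where h: "h \<in> psh_hom stab Z W"
        "\<And>n z x. spherical Z n z x \<Longrightarrow> h z x = \<kappa> (eo (n, z, x)) z (sph_id n z)"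
      using universal[OF W, of "\<lambda>p. \<kappa> (eo p)"] comm by blast
    \<comment> \<open>By Yoneda, the condition at the leg \<open>(n, z, x)\<close> is a condition at
      the single element \<open>x\<close>. This gives both the factorization and its
      uniqueness.\<close>
    have fac: "psh_comp stab (Sp p) g (fund p) = \<kappa> (eo p) \<longleftrightarrow> g z x = \<kappa> (eo p) z (sph_id n z)"
      if g: "g \<in> psh_hom stab Z W" and p: "p = (n, z, x)" "spherical Z n z x" for g p n z x
    proof -
      have Ob: "(n, z, x) \<in> Ob" using p by (simp add: Ob_def)
      note H = fund[OF Ob]
      have e: "psh_comp stab (sph n z) g (fund (n, z, x)) z (sph_id n z) = g z x"
        by (simp add: stab_apply sph_id_el H(2))
      have c: "\<kappa> (eo (n, z, x)) \<in> psh_hom stab (sph n z) W" using \<kappa>[OF Ob] by (simp add: Sp_def)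
      show ?thesis
        unfolding p(1) Sp_def prod.case
        using sph_hom_eqI[OF psh_comp_hom[OF H(1) g sph_presheaf] c] e by auto
    qed
    show "\<exists>!h. h \<in> hom (psh stab) Z W \<and> (\<forall>j\<in>obj J. cmp (psh stab) (fobj F j) Z W h (fund (d j)) = \<kappa> j)"
    proof (rule ex1I[where a = h])
      show "h \<in> hom (psh stab) Z W \<and> (\<forall>j\<in>obj J. cmp (psh stab) (fobj F j) Z W h (fund (d j)) = \<kappa> j)"
        using h(1) fac[OF h(1)] h(2) by (auto simp: psh_simps J_obj F_simps d_eo) (auto simp: Ob_def)
      fix g assume g: "g \<in> hom (psh stab) Z W \<and> (\<forall>j\<in>obj J. cmp (psh stab) (fobj F j) Z W g (fund (d j)) = \<kappa> j)"
      hence g1: "g \<in> psh_hom stab Z W" by (simp add: psh_simps)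
      have g2: "psh_comp stab (Sp p) g (fund p) = \<kappa> (eo p)" if "p \<in> Ob" for p
        using bspec[OF conjunct2[OF g], of "eo p"] that by (simp add: psh_simps F_simps d_eo) (simp add: J_def)
      show "g = h"
      proof (rule psh_hom_eqI[OF g1 h(1)])
        fix z x assume "x \<in> el Z z"
        then obtain n where n: "spherical Z n z x" using ls by (auto simp: locally_spherical_def)
        have "(n, z, x) \<in> Ob" using n by (simp add: Ob_def)
        from fac[OF g1 HOL.refl n] g2[OF this] h(2)[OF n] show "g z x = h z x" by simp
      qed
    qed
  qed
  moreover have "\<forall>j\<in>obj J. \<exists>n z. fobj F j = sph n z"
  proof
    fix j assume "j \<in> obj J"
    then obtain n z x where "(n, z, x) \<in> Ob" "j = eo (n, z, x)" by (auto simp: J_obj)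
    hence "fobj F j = sph n z" by (simp add: F_simps Sp_def)
    thus "\<exists>n z. fobj F j = sph n z" by blast
  qed
  ultimately show ?thesis
    unfolding LocSph_def full_subcat_def using Z by (auto simp: psh_simps)
qed

end

lemma LocSph_iff:
  "(Z :: 'u::infinite stab_psh) \<in> obj LocSph \<longleftrightarrow> pointed_presheaf stab Z \<and> locally_spherical Z"
  using LocSph_locally_spherical locally_spherical_LocSph by blast

section \<open>The adjunction\<close>

lemma Phi_star_simps:
  "fobj Phi_star Y = small (Phi_star_raw Y)"
  "fmap Phi_star Y Y' f = small_map coll (Phi_star_raw Y) (Phi_star_raw Y') (\<lambda>c h. spec_comp (Phi_obj c) f h)"
  by (simp_all add: Phi_star_def Phi_def)

section \<open>Maps from \<open>Phi_star\<close> to a presheaf restricted along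
  \<open>rho\<close>\<close>

context
  fixes Y :: "'u::infinite spectrum" and Z :: "'u stab_psh" and f :: "'u coll_mor"
  assumes Y: "Y \<in> obj oplaxlim" and Z: "pointed_presheaf stab Z"
    and f: "f \<in> psh_hom coll (fobj Phi_star Y) (restrict_psh rho Z)"
begin

private abbreviation hm :: "nat \<Rightarrow> nat \<Rightarrow> 'u spec_mor set" where
  "hm n k \<equiv> spec_hom (Phi_obj (n, k)) Y"

private definition inv_ev :: "nat \<Rightarrow> nat \<Rightarrow> 'u \<Rightarrow> 'u spec_mor" where
  "inv_ev n k y = (SOME h. h \<in> hm n k \<and> spec_ev (n, k) h = y)"

text \<open>The components of \<open>f\<close>, along the Yoneda isomorphism \<open>spec_ev\<close>.\<close>

definition transpose :: "nat \<Rightarrow> nat \<Rightarrow> 'u \<Rightarrow> 'u" where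
  "transpose k n y = f (n, k) (enc (hm n k) (inv_ev n k y))"

private lemma inv_ev:
  assumes "y \<in> el (lev Y k) n" shows "inv_ev n k y \<in> hm n k" "spec_ev (n, k) (inv_ev n k y) = y"
proof -
  have "\<exists>h. h \<in> hm n k \<and> spec_ev (n, k) h = y" using spec_ev_surj[OF Y assms] by blast
  from someI_ex[OF this] show "inv_ev n k y \<in> hm n k" "spec_ev (n, k) (inv_ev n k y) = y"
    by (simp_all add: inv_ev_def)
qed

private lemma fD:
  "h \<in> hm n k \<Longrightarrow> f (n, k) (enc (hm n k) h) \<in> el Z (int n - int k)"
  "f (n, k) (enc (hm n k) (spec_zero (Phi_obj (n, k)) Y)) = pt Z (int n - int k)"
  "h \<in> hm l b \<Longrightarrow> \<phi> \<in> hom coll (n, a) (l, b) \<Longrightarrow>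
    f (n, a) (enc (hm n a) (spec_comp (Phi_obj (n, a)) h (Phi_map (n, a) (l, b) \<phi>)))
      = act Z (int n - int a) (int l - int b) (map_cls (stab_ext n (l + (a - b)) \<phi>)) (f (l, b) (enc (hm l b) h))"
proof -
  note D = pmapD[OF psh_hom_pmap[OF f], unfolded coll_simps(1) restrict_psh_simps Phi_star_simps(1) small_simps Phi_star_raw_simps[OF Y]]
  show "f (n, k) (enc (hm n k) (spec_zero (Phi_obj (n, k)) Y)) = pt Z (int n - int k)"
    using D(2)[of "(n, k)"] by (simp only: UNIV_I rho_simps(1))
  show "h \<in> hm n k \<Longrightarrow> f (n, k) (enc (hm n k) h) \<in> el Z (int n - int k)"
    using D(1)[of "enc (hm n k) h" "(n, k)"] by (simp only: UNIV_I rho_simps(1)) blast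
  assume h: "h \<in> hm l b" and \<phi>: "\<phi> \<in> hom coll (n, a) (l, b)"
  have "act (small (Phi_star_raw Y)) (n, a) (l, b) \<phi> (enc (hm l b) h :: 'u)
     = enc (hm n a) (spec_comp (Phi_obj (n, a)) h (Phi_map (n, a) (l, b) \<phi>))"
    using act_small[OF Phi_star_raw_fits[OF Y], of "(l, b)" h "(n, a)" \<phi>] h
    by (simp only: Phi_star_raw_simps[OF Y] coll_simps(1) UNIV_I)
  thus "f (n, a) (enc (hm n a) (spec_comp (Phi_obj (n, a)) h (Phi_map (n, a) (l, b) \<phi>)))
      = act Z (int n - int a) (int l - int b) (map_cls (stab_ext n (l + (a - b)) \<phi>)) (f (l, b) (enc (hm l b) h))"
    using D(3)[OF \<phi> imageI[OF h] UNIV_I UNIV_I] by (simp only: rho_simps(1) rho_simps(2)[OF \<phi>])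
qed

lemma transpose_spec_ev:
  assumes "h \<in> spec_hom (Phi_obj (n, k)) Y"
  shows "transpose k n (spec_ev (n, k) h) = f (n, k) (enc (spec_hom (Phi_obj (n, k)) Y) h)"
  using spec_ev_inj[OF Y inv_ev(1)[OF spec_ev_el[OF Y assms]] assms inv_ev(2)[OF spec_ev_el[OF Y assms]]]
  by (simp only: transpose_def)

lemma transpose_el: "y \<in> el (lev Y k) n \<Longrightarrow> transpose k n y \<in> el Z (int n - int k)"
  unfolding transpose_def by (rule fD(1)[OF inv_ev(1)])

lemma transpose_pt: "transpose k n (pt (lev Y k) n) = pt Z (int n - int k)"
  using transpose_spec_ev[OF spec_zero_hom[OF Phi_obj_oplaxlim Y], where n = n and k = k] fD(2)[of n k]
  by (simp only: spec_ev_zero[OF Y])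

lemma transpose_coll:
  assumes y: "y \<in> el (lev Y b) l" and \<phi>: "\<phi> \<in> hom coll (n, a) (l, b)"
  shows "transpose a n (act (lev Y a) n (l + (a - b)) \<phi> (bond_shift_pow Y b l (a - b) y))
    = act Z (int n - int a) (int l - int b) (map_cls (stab_ext n (l + (a - b)) \<phi>)) (transpose b l y)"
proof -
  note h = inv_ev[OF y]
  have c: "spec_comp (Phi_obj (n, a)) (inv_ev l b y) (Phi_map (n, a) (l, b) \<phi>) \<in> hm n a"
    by (rule spec_comp_hom[OF Phi_obj_oplaxlim Phi_obj_oplaxlim Y Phi_map_hom[OF \<phi>] h(1)])
  show ?thesis
    using transpose_spec_ev[OF c] spec_ev_act[OF Y h(1) \<phi>] fD(3)[OF h(1) \<phi>] by (simp only: transpose_def h(2))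
qed

lemma transpose_act:
  assumes y: "y \<in> el (lev Y k) m" and \<phi>: "\<phi> \<in> hom smp n m"
  shows "transpose k n (act (lev Y k) n m \<phi> y) = act Z (int n - int k) (int m - int k) (map_cls (stab_ext n m \<phi>)) (transpose k m y)"
  using transpose_coll[OF y, of \<phi> n k] \<phi> by (simp add: coll_smp_hom)

text \<open>The identity of \<open>[n+1]\<close> is also a morphism from
  \<open>([n+1], -(k+1))\<close> to \<open>([n], -k)\<close> in \<open>coll\<close>, and
  \<open>rho\<close> sends it to an identity. So the transpose does not see a shift.\<close>

lemma transpose_bond_shift:
  assumes y: "y \<in> el (lev Y k) n" shows "transpose (Suc k) (Suc n) (bond_shift Y k n y) = transpose k n y"
proof -
  have "ide smp (Suc n) \<in> hom coll (Suc n, Suc k) (n, k)" using smp_ide by (simp add: coll_hom_iff)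
  from transpose_coll[OF y this]
  show ?thesis using levD(4)[OF Y bond_shift_el[OF Y y]] transpose_el[OF y] by (simp add: stab_ext_ide stabD(4)[OF Z])
qed

lemma transpose_bond_shift_pow:
  "y \<in> el (lev Y k) n \<Longrightarrow> transpose (k + j) (n + j) (bond_shift_pow Y k n j y) = transpose k n y"
  by (induction j) (simp_all add: transpose_bond_shift bond_shift_pow_el[OF Y])

text \<open>Shifting keeps the transpose but raises the dimension, so d^(n+i) can be met as a last
  face, where shifts of \<open>Y\<close> vanish. The remaining generator d^n ... d^0 is the last
  vertex of the first shift.\<close>

lemma transpose_spherical:
  assumes y: "y \<in> el (lev Y k) n" shows "spherical Z n (int n - int k) (transpose k n y)"
proof (rule nsphI[OF Z transpose_el[OF y]])
  fix i :: nat assume "i \<ge> 1"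
  then obtain j where i: "i = Suc j" by (cases i) auto
  \<comment> \<open>After j = i - 1 shifts the dimension is n + j, and the last face of one further
    shift is d^(n+j+1) = d^(n+i).\<close>
  let ?u = "bond_shift_pow Y k n j y"
  have u: "?u \<in> el (lev Y (k + j)) (n + j)" by (rule bond_shift_pow_el[OF Y y])
  have "transpose (Suc (k + j)) (n + j) (act (lev Y (Suc (k + j))) (n + j) (Suc (n + j)) (coface (n + j) (Suc (n + j)))
      (bond_shift Y (k + j) (n + j) ?u)) = pt Z (int (n + j) - int (Suc (k + j)))"
    unfolding bond_shift_face[OF Y u] by (rule transpose_pt)
  moreover have "transpose (Suc (k + j)) (Suc (n + j)) (bond_shift Y (k + j) (n + j) ?u) = transpose k n y"
    using transpose_bond_shift[OF u] transpose_bond_shift_pow[OF y] by simp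
  moreover have "int (n + j) - int (Suc (k + j)) = int n - int k - 1"
    "int (Suc (n + j)) - int (Suc (k + j)) = int n - int k" by simp_all
  ultimately show "act Z (int n - int k - 1) (int n - int k) (map_cls (gen_map (Face (n + i)))) (transpose k n y) = pt Z (int n - int k - 1)"
    using transpose_act[OF bond_shift_el[OF Y u] coface_hom[of "Suc (n + j)" "n + j"]]
    unfolding i by (simp only: stab_ext_coface add_Suc_right)
next
  have "transpose (Suc k) 0 (act (lev Y (Suc k)) 0 (Suc n) (vertex n) (bond_shift Y k n y)) = pt Z (int 0 - int (Suc k))"
    unfolding bond_shift_vertex[OF Y y] by (rule transpose_pt)
  moreover have "stab_ext 0 (Suc n) (vertex n) = (\<lambda>x. x + (n + 1))"
    by (auto simp: fun_eq_iff stab_ext_def vertex_def)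
  moreover have "int 0 - int (Suc k) = int n - int k - int (n + 1)" "int (Suc n) - int (Suc k) = int n - int k" by simp_all
  ultimately show "act Z (int n - int k - int (n + 1)) (int n - int k) (map_cls (\<lambda>x. x + (n + 1))) (transpose k n y)
      = pt Z (int n - int k - int (n + 1))"
    using transpose_act[OF bond_shift_el[OF Y y] vertex_hom] transpose_bond_shift[OF y] by (simp only:)
qed

end

lemma spec_ev_comp:
  "spec_ev (n, k) (spec_comp (Phi_obj (n, k)) f (h :: 'u::infinite spec_mor)) = f k n (spec_ev (n, k) h)"
  by (simp add: spec_ev_def spec_comp_def smp_apply simplex_id_el)

lemma Phi_star_presheaf:
  "Y \<in> obj oplaxlim \<Longrightarrow> pointed_presheaf coll (fobj Phi_star Y :: 'u::infinite coll_psh)"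
  using fun_obj[OF Phi_star_functor] by (auto simp: psh_simps)

lemma Phi_star_map_hom:
  fixes Y Y' :: "'u::infinite spectrum"
  assumes "Y \<in> obj oplaxlim" "Y' \<in> obj oplaxlim" "f \<in> spec_hom Y Y'"
  shows "fmap Phi_star Y Y' f \<in> psh_hom coll (fobj Phi_star Y) (fobj Phi_star Y')"
  using fun_hom[OF Phi_star_functor, of f Y Y'] assms by (simp add: psh_simps oplaxlim_simps(2))

lemma Phi_star_map_enc:
  fixes Y Y' :: "'u::infinite spectrum"
  assumes "Y \<in> obj oplaxlim" "Y' \<in> obj oplaxlim" "h \<in> spec_hom (Phi_obj c) Y"
  shows "fmap Phi_star Y Y' f c (enc (spec_hom (Phi_obj c) Y) h)
    = enc (spec_hom (Phi_obj c) Y') (spec_comp (Phi_obj c) f h)"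
  using small_map_enc[OF Phi_star_raw_fits[OF assms(1)], of c h "Phi_star_raw Y'"] assms
  by (simp add: Phi_star_simps Phi_star_raw_simps coll_simps(1))

lemma Phi_star_el:
  "Y \<in> obj oplaxlim \<Longrightarrow> el (fobj Phi_star (Y :: 'u::infinite spectrum)) c
    = enc (spec_hom (Phi_obj c) Y) ` spec_hom (Phi_obj c) Y"
  by (simp add: Phi_star_simps small_simps Phi_star_raw_simps)

text \<open>The inclusion of \<open>\<Phi>\<^sup>* KPs Z\<close> into the restriction of \<open>Z\<close> along \<open>\<rho>\<close>, whose transpose is the co-unit.\<close>

definition counit_incl :: "'u::infinite stab_psh \<Rightarrow> 'u coll_mor" where
  "counit_incl Z = (\<lambda>c\<in>obj coll. \<lambda>v\<in>el (fobj Phi_star (KPs_obj Z)) c.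
     KPs_incl Z (snd c) (fst c) (spec_ev c (dec (spec_hom (Phi_obj c) (KPs_obj Z)) v)))"

context
  fixes Z :: "'u::infinite stab_psh"
  assumes Z: "pointed_presheaf stab Z"
begin

private abbreviation "KZ \<equiv> KPs_obj Z"

private lemma O: "KZ \<in> obj oplaxlim"
  by (rule KPs_obj_oplaxlim[OF Z])

lemma counit_incl_enc:
  assumes "h \<in> spec_hom (Phi_obj (n, k)) KZ"
  shows "counit_incl Z (n, k) (enc (spec_hom (Phi_obj (n, k)) KZ) h) = KPs_incl Z k n (spec_ev (n, k) h)"
proof -
  have "fits TYPE('u) (spec_hom (Phi_obj (n, k)) KZ)"
    using Phi_star_raw_fits[OF O] by (simp only: psh_fits_def Phi_star_raw_simps[OF O] coll_simps(1)) blast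
  hence "dec (spec_hom (Phi_obj (n, k)) KZ) (enc (spec_hom (Phi_obj (n, k)) KZ) h :: 'u) = h"
    using assms by (rule dec_enc)
  thus ?thesis using assms by (simp add: counit_incl_def Phi_star_el[OF O] coll_simps(1) del: Phi_obj.simps)
qed

text \<open>By \<open>spec_ev_act\<close> a restriction in \<open>coll\<close> is a shift followed
  by an operator. \<open>KPs_incl\<close> is blind to the shift and turns the operator into
  restriction along its image under \<open>rho\<close>.\<close>

lemma counit_incl_hom: "counit_incl Z \<in> psh_hom coll (fobj Phi_star KZ) (restrict_psh rho Z)"
proof -
  have P: "pointed_presheaf coll (fobj Phi_star KZ :: 'u coll_psh)" by (rule Phi_star_presheaf[OF O])
  have ev: "spec_ev (n, k) h \<in> el (lev KZ k) n" if "h \<in> spec_hom (Phi_obj (n, k)) KZ" for h n k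
    by (rule spec_ev_el[OF O that])
  have "pmap coll (fobj Phi_star KZ) (restrict_psh rho Z) (counit_incl Z)"
    unfolding pmap_def coll_simps(1)
  proof (intro conjI ballI)
    fix c :: "nat \<times> nat" obtain n k where c: "c = (n, k)" by fastforce
    { fix v assume "v \<in> el (fobj Phi_star KZ) c"
      then obtain h where "h \<in> spec_hom (Phi_obj (n, k)) KZ" "v = enc (spec_hom (Phi_obj (n, k)) KZ) h"
        unfolding c Phi_star_el[OF O] by blast
      thus "counit_incl Z c v \<in> el (restrict_psh rho Z) c"
        using KPs_incl_spherical[OF Z ev] unfolding c by (simp only: counit_incl_enc restrict_psh_simps rho_simps spherical_def) }
    have "pt (fobj Phi_star KZ) (n, k) = enc (spec_hom (Phi_obj (n, k)) KZ) (spec_zero (Phi_obj (n, k)) KZ)"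
      by (simp only: Phi_star_simps small_simps Phi_star_raw_simps[OF O])
    thus "counit_incl Z c (pt (fobj Phi_star KZ) c) = pt (restrict_psh rho Z) c"
      unfolding c
      by (simp only: counit_incl_enc[OF spec_zero_hom[OF Phi_obj_oplaxlim O]] spec_ev_zero[OF O] KPs_incl_pt[OF Z]
          restrict_psh_simps rho_simps)
    fix c' \<phi> v assume \<phi>: "\<phi> \<in> hom coll c c'" and v: "v \<in> el (fobj Phi_star KZ) c'"
    obtain l b where c': "c' = (l, b)" by fastforce
    obtain h where h: "h \<in> spec_hom (Phi_obj (l, b)) KZ" "v = enc (spec_hom (Phi_obj (l, b)) KZ) h"
      using v unfolding c' Phi_star_el[OF O] by blast
    note \<phi>' = \<phi>[unfolded c c']
    let ?j = "k - b"
    have le: "b \<le> k" and \<phi>s: "\<phi> \<in> hom smp n (l + ?j)" using \<phi>' by (auto simp: coll_hom_iff)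
    have comp: "spec_comp (Phi_obj (n, k)) h (Phi_map (n, k) (l, b) \<phi>) \<in> spec_hom (Phi_obj (n, k)) KZ"
      by (rule spec_comp_hom[OF Phi_obj_oplaxlim Phi_obj_oplaxlim O Phi_map_hom[OF \<phi>'] h(1)])
    have "act (fobj Phi_star KZ) c c' \<phi> v
      = enc (spec_hom (Phi_obj (n, k)) KZ) (spec_comp (Phi_obj (n, k)) h (Phi_map (n, k) (l, b) \<phi>))"
      using act_small[OF Phi_star_raw_fits[OF O], of "(l, b)" h "(n, k)" \<phi>] h
      unfolding c c' by (simp only: Phi_star_simps Phi_star_raw_simps[OF O] coll_simps(1) UNIV_I)
    hence "counit_incl Z c (act (fobj Phi_star KZ) c c' \<phi> v)
      = KPs_incl Z k n (act (lev KZ k) n (l + ?j) \<phi> (bond_shift_pow KZ b l ?j (spec_ev (l, b) h)))"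
      unfolding c using counit_incl_enc[OF comp] spec_ev_act[OF O h(1) \<phi>'] by simp
    also have "\<dots> = act Z (int n - int k) (int (l + ?j) - int k) (map_cls (stab_ext n (l + ?j) \<phi>))
        (KPs_incl Z k (l + ?j) (bond_shift_pow KZ b l ?j (spec_ev (l, b) h)))"
      using bond_shift_pow_el[OF O ev[OF h(1)], of ?j] le by (intro KPs_incl_act[OF Z \<phi>s]) simp
    also have "KPs_incl Z k (l + ?j) (bond_shift_pow KZ b l ?j (spec_ev (l, b) h)) = KPs_incl Z b l (spec_ev (l, b) h)"
      using KPs_incl_bond_shift_pow[OF Z ev[OF h(1)], of ?j] le by simp
    also have "int (l + ?j) - int k = int l - int b" using le by simp
    finally show "counit_incl Z c (act (fobj Phi_star KZ) c c' \<phi> v) = act (restrict_psh rho Z) c c' \<phi> (counit_incl Z c' v)"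
      unfolding c c' h(2) counit_incl_enc[OF h(1)] restrict_psh_simps rho_simps(1) rho_simps(2)[OF \<phi>'] .
  qed
  hence "(\<lambda>c\<in>obj coll. \<lambda>v\<in>el (fobj Phi_star KZ) c. counit_incl Z c v) \<in> psh_hom coll (fobj Phi_star KZ) (restrict_psh rho Z)"
    by (rule restrict_pmap[OF _ P])
  moreover have "(\<lambda>c\<in>obj coll. \<lambda>v\<in>el (fobj Phi_star KZ) c. counit_incl Z c v) = counit_incl Z"
    by (auto simp: counit_incl_def fun_eq_iff restrict_def)
  ultimately show ?thesis by simp
qed

lemma counit_incl_comp_enc:
  fixes Y :: "'u spectrum"
  assumes Y: "Y \<in> obj oplaxlim" and g: "g \<in> spec_hom Y KZ" and h: "h \<in> spec_hom (Phi_obj (n, k)) Y"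
  shows "psh_comp coll (fobj Phi_star Y) (counit_incl Z) (fmap Phi_star Y KZ g) (n, k) (enc (spec_hom (Phi_obj (n, k)) Y) h)
    = KPs_incl Z k n (g k n (spec_ev (n, k) h))"
proof -
  have "spec_comp (Phi_obj (n, k)) g h \<in> spec_hom (Phi_obj (n, k)) KZ"
    by (rule spec_comp_hom[OF Phi_obj_oplaxlim Y O h g])
  moreover have "enc (spec_hom (Phi_obj (n, k)) Y) h \<in> el (fobj Phi_star Y) (n, k)"
    unfolding Phi_star_el[OF Y] using h by blast
  ultimately show ?thesis
    by (simp only: psh_comp_apply coll_simps(1) UNIV_I Phi_star_map_enc[OF Y O h] counit_incl_enc spec_ev_comp)
qed

text \<open>The components of \<open>f\<close> are spherical by \<open>transpose_spherical\<close>,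
  so each value lifts uniquely to a simplex of \<open>KPs Z\<close>. Injectivity of
  \<open>KPs_incl\<close> makes the lifts commute with operators and shifts, as their images in
  \<open>Z\<close> do.\<close>

lemma counit_incl_universal:
  fixes Y :: "'u spectrum"
  assumes Y: "Y \<in> obj oplaxlim" and f: "f \<in> psh_hom coll (fobj Phi_star Y) (restrict_psh rho Z)"
  shows "\<exists>!g. g \<in> spec_hom Y KZ \<and> psh_comp coll (fobj Phi_star Y) (counit_incl Z) (fmap Phi_star Y KZ g) = f"
proof -
  let ?g = "transpose Y f"
  define G where "G k n y = (SOME u. u \<in> el (lev KZ k) n \<and> KPs_incl Z k n u = ?g k n y)" for k n y
  have G: "G k n y \<in> el (lev KZ k) n" "KPs_incl Z k n (G k n y) = ?g k n y" if "y \<in> el (lev Y k) n" for k n y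
  proof -
    have "\<exists>u. u \<in> el (lev KZ k) n \<and> KPs_incl Z k n u = ?g k n y"
      using KPs_incl_surj[OF Z transpose_spherical[OF Y Z f that]] by blast
    from someI_ex[OF this] show "G k n y \<in> el (lev KZ k) n" "KPs_incl Z k n (G k n y) = ?g k n y"
      by (simp_all add: G_def)
  qed
  define H where "H k = (\<lambda>n\<in>obj smp. \<lambda>y\<in>el (lev Y k) n. G k n y)" for k
  have HG: "H k n y = G k n y" if "y \<in> el (lev Y k) n" for k n y using that by (simp add: H_def smp_simps(1))
  note levK = levD[OF O]
  have "pmap smp (lev Y k) (lev KZ k) (G k)" for k
    unfolding pmap_def
  proof (intro conjI ballI G(1))
    fix n
    show "G k n (pt (lev Y k) n) = pt (lev KZ k) n"
      by (rule KPs_incl_inj[OF Z G(1) levK(1)]; simp add: levD(1)[OF Y] G(2) transpose_pt[OF Y Z f] KPs_incl_pt[OF Z])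
    fix m \<phi> y assume \<phi>: "\<phi> \<in> hom smp n m" and y: "y \<in> el (lev Y k) m"
    note y' = levD(2)[OF Y y \<phi>]
    show "G k n (act (lev Y k) n m \<phi> y) = act (lev KZ k) n m \<phi> (G k m y)"
      by (rule KPs_incl_inj[OF Z G(1)[OF y'] levK(2)[OF G(1)[OF y] \<phi>]])
        (simp add: G(2)[OF y'] KPs_incl_act[OF Z \<phi> G(1)[OF y]] G(2)[OF y] transpose_act[OF Y Z f y \<phi>])
  qed
  hence Hhom: "H k \<in> psh_hom smp (lev Y k) (lev KZ k)" for k
    unfolding H_def by (rule restrict_pmap[OF _ lev_presheaf[OF Y]])
  have H: "H \<in> spec_hom Y KZ"
    unfolding spec_hom_iff[OF Y O]
  proof (intro conjI allI impI Hhom)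
    fix i n x assume x: "x \<in> el (lev Y i) n"
    note b = bond_shift_el[OF Y x]
    show "H (Suc i) (Suc n) (bond_shift Y i n x) = bond_shift KZ i n (H i n x)"
      unfolding HG[OF x] HG[OF b]
      by (rule KPs_incl_inj[OF Z G(1)[OF b] bond_shift_el[OF O G(1)[OF x]]])
        (simp add: G(2)[OF b] KPs_incl_bond_shift[OF Z G(1)[OF x]] G(2)[OF x] transpose_bond_shift[OF Y Z f x])
  qed
  have P: "pointed_presheaf coll (fobj Phi_star Y :: 'u coll_psh)" by (rule Phi_star_presheaf[OF Y])
  show ?thesis
  proof (rule ex1I[where a = H], intro conjI H)
    show "psh_comp coll (fobj Phi_star Y) (counit_incl Z) (fmap Phi_star Y KZ H) = f"
    proof (rule psh_hom_eqI[OF psh_comp_hom[OF Phi_star_map_hom[OF Y O H] counit_incl_hom P] f])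
      fix c :: "nat \<times> nat" and v :: 'u assume "v \<in> el (fobj Phi_star Y) c"
      moreover obtain n k where c: "c = (n, k)" by fastforce
      ultimately obtain h where h: "h \<in> spec_hom (Phi_obj (n, k)) Y" "v = enc (spec_hom (Phi_obj (n, k)) Y) h"
        unfolding Phi_star_el[OF Y] by blast
      have e: "spec_ev (n, k) h \<in> el (lev Y k) n" by (rule spec_ev_el[OF Y h(1)])
      show "psh_comp coll (fobj Phi_star Y) (counit_incl Z) (fmap Phi_star Y KZ H) c v = f c v"
        unfolding c h(2) counit_incl_comp_enc[OF Y H h(1)] HG[OF e] G(2)[OF e] by (rule transpose_spec_ev[OF Y Z f h(1)])
    qed
    fix g assume g: "g \<in> spec_hom Y KZ \<and> psh_comp coll (fobj Phi_star Y) (counit_incl Z) (fmap Phi_star Y KZ g) = f"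
    show "g = H"
    proof (rule spec_hom_KPs_eqI[OF Z conjunct1[OF g] H])
      fix i n x assume x: "x \<in> el (lev Y i) n"
      obtain h where h: "h \<in> spec_hom (Phi_obj (n, i)) Y" "spec_ev (n, i) h = x"
        using spec_ev_surj[OF Y x] by blast
      have "KPs_incl Z i n (g i n x) = f (n, i) (enc (spec_hom (Phi_obj (n, i)) Y) h)"
        using counit_incl_comp_enc[OF Y conjunct1[OF g] h(1)] g unfolding h(2) by simp
      also have "\<dots> = KPs_incl Z i n (H i n x)"
        unfolding HG[OF x] G(2)[OF x] using transpose_spec_ev[OF Y Z f h(1)] unfolding h(2) by simp
      finally show "KPs_incl Z i n (g i n x) = KPs_incl Z i n (H i n x)" .
    qed
  qed
qed

end

lemma counit_incl_natural:
  fixes Z Z' :: "'u::infinite stab_psh"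
  assumes Z: "pointed_presheaf stab Z" and Z': "pointed_presheaf stab Z'" and g: "g \<in> psh_hom stab Z Z'"
  shows "psh_comp coll (fobj Phi_star (KPs_obj Z)) (counit_incl Z') (fmap Phi_star (KPs_obj Z) (KPs_obj Z') (fmap KPs Z Z' g))
    = psh_comp coll (fobj Phi_star (KPs_obj Z)) (fmap (restrict_ftor coll rho) Z Z' g) (counit_incl Z)"
proof -
  note O = KPs_obj_oplaxlim[OF Z] and O' = KPs_obj_oplaxlim[OF Z']
  have P: "pointed_presheaf coll (fobj Phi_star (KPs_obj Z) :: 'u coll_psh)" by (rule Phi_star_presheaf[OF O])
  note K = KPs_map[OF Z Z' g]
  have R: "fmap (restrict_ftor coll rho) Z Z' g \<in> psh_hom coll (restrict_psh rho Z) (restrict_psh rho Z')"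
    using fun_hom[OF restrict_ftor_functor[OF rho_functor], of g Z Z'] Z Z' g
    by (simp add: psh_simps) (simp add: restrict_ftor_def)
  show ?thesis
  proof (rule psh_hom_eqI[OF psh_comp_hom[OF Phi_star_map_hom[OF O O' K(1)] counit_incl_hom[OF Z'] P]
        psh_comp_hom[OF counit_incl_hom[OF Z] R P]])
    fix c :: "nat \<times> nat" and v :: 'u assume v: "v \<in> el (fobj Phi_star (KPs_obj Z)) c"
    obtain n k where c: "c = (n, k)" by fastforce
    obtain h where h: "h \<in> spec_hom (Phi_obj (n, k)) (KPs_obj Z)" "v = enc (spec_hom (Phi_obj (n, k)) (KPs_obj Z)) h"
      using v unfolding c Phi_star_el[OF O] by blast
    have "psh_comp coll (fobj Phi_star (KPs_obj Z)) (counit_incl Z') (fmap Phi_star (KPs_obj Z) (KPs_obj Z') (fmap KPs Z Z' g)) c v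
      = g (int n - int k) (KPs_incl Z k n (spec_ev (n, k) h))"
      unfolding c h(2) counit_incl_comp_enc[OF Z' O K(1) h(1)] by (rule K(2)[OF spec_ev_el[OF O h(1)]])
    moreover have "psh_comp coll (fobj Phi_star (KPs_obj Z)) (fmap (restrict_ftor coll rho) Z Z' g) (counit_incl Z) c v
      = g (int n - int k) (KPs_incl Z k n (spec_ev (n, k) h))"
      using psh_comp_apply[of c coll v "fobj Phi_star (KPs_obj Z)" "fmap (restrict_ftor coll rho) Z Z' g" "counit_incl Z"] v
        counit_incl_enc[OF Z h(1)]
      by (simp add: c h(2) coll_simps(1) restrict_ftor_def rho_simps(1) del: Phi_obj.simps)
    ultimately show "psh_comp coll (fobj Phi_star (KPs_obj Z)) (counit_incl Z') (fmap Phi_star (KPs_obj Z) (KPs_obj Z') (fmap KPs Z Z' g)) c v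
      = psh_comp coll (fobj Phi_star (KPs_obj Z)) (fmap (restrict_ftor coll rho) Z Z' g) (counit_incl Z) c v" by simp
  qed
qed

section \<open>The functor \<open>KSp\<close> and its right adjoint\<close>

lemma rho_shriek_adjunction:
  "\<exists>\<eta> \<epsilon>. adjunction (psh coll :: ('u::infinite coll_psh, 'u coll_mor) cat) (psh stab) rho_shriek
     (restrict_ftor coll rho) \<eta> \<epsilon>"
  unfolding rho_shriek_def left_adjoint_def
  by (rule someI_ex[OF restrict_ftor_left_adjoint[OF rho_functor]]) (simp_all add: coll_simps(1) countable_stab_hom)

text \<open>Since \<open>rho_shriek\<close> is a choice, only its universal property is available.
  It extends the unit, seen as a map with spherical values, to a map \<open>h\<close>; as
  endomorphisms of the whole presheaf, \<open>h\<close> and the identity agree after the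
  unit.\<close>

lemma KSp_locally_spherical:
  fixes Y :: "'u::infinite spectrum"
  assumes Y: "Y \<in> obj oplaxlim"
  shows "fobj rho_shriek (fobj Phi_star Y) \<in> obj LocSph"
proof -
  obtain \<eta> \<epsilon> where adj: "adjunction (psh coll :: ('u coll_psh, 'u coll_mor) cat) (psh stab) rho_shriek
      (restrict_ftor coll rho) \<eta> \<epsilon>" using rho_shriek_adjunction by blast
  let ?P = "fobj Phi_star Y :: 'u coll_psh" let ?R = "fobj rho_shriek ?P :: 'u stab_psh"
  note A = adjunctionD[OF adj]
  have P: "?P \<in> obj (psh coll)" using Phi_star_presheaf[OF Y] by (simp add: psh_simps)
  have R: "?R \<in> obj (psh stab)" using fun_obj[OF A(1) P] .
  hence R': "pointed_presheaf stab ?R" by (simp add: psh_simps)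
  have rf: "fobj (restrict_ftor coll rho) Z = restrict_psh rho Z"
    "fmap (restrict_ftor coll rho) Z Z' h = (\<lambda>c\<in>obj coll. h (fobj rho c))" for Z Z' :: "'u stab_psh" and h
    by (simp_all add: restrict_ftor_def)
  have e: "\<eta> ?P \<in> psh_hom coll ?P (restrict_psh rho ?R)" using A(3)[OF P] by (simp add: psh_simps rf)
  have "\<eta> ?P c v \<in> el (spherical_part ?R) (fobj rho c)" if v: "v \<in> el ?P c" for c v
  proof -
    obtain n k where c: "c = (n, k)" by fastforce
    obtain h where h: "h \<in> spec_hom (Phi_obj (n, k)) Y" "v = enc (spec_hom (Phi_obj (n, k)) Y) h"
      using v unfolding c Phi_star_el[OF Y] by blast
    have "spherical ?R n (int n - int k) (\<eta> ?P (n, k) v)"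
      unfolding h(2) transpose_spec_ev[OF Y R' e h(1), symmetric]
      by (rule transpose_spherical[OF Y R' e spec_ev_el[OF Y h(1)]])
    thus ?thesis unfolding c spherical_part_simps rho_simps by blast
  qed
  \<comment> \<open>As a function the unit is unchanged; only its target shrinks.\<close>
  hence e': "\<eta> ?P \<in> psh_hom coll ?P (restrict_psh rho (spherical_part ?R))"
    using e unfolding psh_hom_iff pmap_def restrict_psh_simps spherical_part_simps(2,3) by blast
  have S: "spherical_part ?R \<in> obj (psh stab)" using spherical_part_presheaf[OF R'] by (simp add: psh_simps)
  obtain h where h: "h \<in> psh_hom stab ?R (spherical_part ?R)" "psh_comp coll ?P (\<lambda>c\<in>obj coll. h (fobj rho c)) (\<eta> ?P) = \<eta> ?P"
    using adjunction_transpose_ex1[OF adj P S, of "\<eta> ?P"] e' unfolding psh_simps rf by blast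
  have h': "h \<in> psh_hom stab ?R ?R" using h(1) spherical_part_hom_iff by blast
  have i: "psh_id stab ?R \<in> psh_hom stab ?R ?R" by (rule psh_id_hom[OF R'])
  have "psh_comp coll ?P (\<lambda>c\<in>obj coll. psh_id stab ?R (fobj rho c)) (\<eta> ?P) = \<eta> ?P"
    using cat_idl[OF category_psh A(3)[OF P] P fun_obj[OF A(2) R]] fun_ide[OF A(2) R]
    unfolding psh_simps rf by simp
  hence "h = psh_id stab ?R"
    using adjunction_transpose_ex1[OF adj P R A(3)[OF P]] h h' i unfolding psh_simps rf by blast
  thus ?thesis using LocSph_iff R' locally_spherical_if_retract[OF h(1)] by blast
qed

lemma LocSph_full_subcat:
  "\<exists>X. (LocSph :: ('u::infinite stab_psh, 'u stab_mor) cat) = full_subcat (psh stab) X"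
  unfolding LocSph_def by blast

lemma LocSph_simps:
  "hom (LocSph :: ('u::infinite stab_psh, 'u stab_mor) cat) = psh_hom stab"
  by (simp add: LocSph_def full_subcat_def psh_simps)

lemma KPs_LocSph_functor: "is_functor (LocSph :: ('u::infinite stab_psh, 'u stab_mor) cat) oplaxlim KPs"
proof -
  obtain X where X: "(LocSph :: ('u stab_psh, 'u stab_mor) cat) = full_subcat (psh stab) X"
    using LocSph_full_subcat by blast
  show ?thesis
    using KPs_functor[where 'u = 'u] category_full_subcat[OF category_psh, of stab X]
    unfolding X is_functor_def full_subcat_def by simp
qed

lemma KSp_KPs_adjunction:
  "\<exists>\<eta> \<epsilon>. adjunction (oplaxlim :: ('u::infinite spectrum, 'u spec_mor) cat) LocSph KSp KPs \<eta> \<epsilon>"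
proof -
  \<comment> \<open>\<open>relative_adjunction\<close> is stated for a full subcategory on a set of
    objects; \<open>X\<close> stands for the set in the definition of \<open>LocSph\<close>.\<close>
  obtain X where X: "(LocSph :: ('u stab_psh, 'u stab_mor) cat) = full_subcat (psh stab) X"
    using LocSph_full_subcat by blast
  have obX: "obj (full_subcat (psh stab) X) = obj (psh stab) \<inter> (X :: 'u stab_psh set)"
    by (simp add: full_subcat_def)
  obtain \<eta> \<epsilon> where adj: "adjunction (psh coll :: ('u coll_psh, 'u coll_mor) cat) (psh stab) rho_shriek
      (restrict_ftor coll rho) \<eta> \<epsilon>" using rho_shriek_adjunction by blast
  have rf: "fobj (restrict_ftor coll rho) Z = restrict_psh rho Z" for Z :: "'u stab_psh"
    by (simp add: restrict_ftor_def)
  have K: "is_functor (full_subcat (psh stab) X) oplaxlim KPs"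
    unfolding X[symmetric] by (rule KPs_LocSph_functor)
  show ?thesis
    unfolding KSp_def X
  proof (rule relative_adjunction[OF adj Phi_star_functor K, where j = counit_incl])
    fix s :: "'u spectrum" assume "s \<in> obj oplaxlim"
    thus "fobj rho_shriek (fobj Phi_star s) \<in> X" using KSp_locally_spherical[of s] unfolding X obX by blast
  next
    fix d :: "'u stab_psh" assume "d \<in> obj (psh stab)"
    thus "counit_incl d \<in> hom (psh coll) (fobj Phi_star (fobj KPs d)) (fobj (restrict_ftor coll rho) d)"
      using counit_incl_hom[of d] by (simp add: psh_simps rf KPs_fobj)
  next
    fix d d' :: "'u stab_psh" and g
    assume "d \<in> obj (psh stab)" "d' \<in> obj (psh stab)" "g \<in> hom (psh stab) d d'"
    thus "cmp (psh coll) (fobj Phi_star (fobj KPs d)) (fobj Phi_star (fobj KPs d')) (fobj (restrict_ftor coll rho) d') (counit_incl d')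
        (fmap Phi_star (fobj KPs d) (fobj KPs d') (fmap KPs d d' g))
      = cmp (psh coll) (fobj Phi_star (fobj KPs d)) (fobj (restrict_ftor coll rho) d) (fobj (restrict_ftor coll rho) d')
        (fmap (restrict_ftor coll rho) d d' g) (counit_incl d)"
      using counit_incl_natural[of d d' g] by (simp add: psh_simps KPs_fobj)
  next
    fix s :: "'u spectrum" and d :: "'u stab_psh" and f
    assume "s \<in> obj oplaxlim" "d \<in> obj (psh stab)" "f \<in> hom (psh coll) (fobj Phi_star s) (fobj (restrict_ftor coll rho) d)"
    thus "\<exists>!g. g \<in> hom oplaxlim s (fobj KPs d) \<and>
        cmp (psh coll) (fobj Phi_star s) (fobj Phi_star (fobj KPs d)) (fobj (restrict_ftor coll rho) d) (counit_incl d)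
          (fmap Phi_star s (fobj KPs d) g) = f"
      using counit_incl_universal[of d s f] by (simp add: psh_simps rf KPs_fobj oplaxlim_simps(2))
  qed
qed

section \<open>Full faithfulness of \<open>KPs\<close>\<close>

text \<open>For fixed \<open>z\<close>, a dimension \<open>m\<close> \<ge> z determines the index as
  m - z, so \<open>m\<close> may be taken arbitrarily large. The bound \<open>M\<close> is used to
  turn a stable map into a simplicial operator.\<close>

lemma spherical_level:
  assumes "spherical Z n z x" obtains m i where "int m - int i = z" "spherical Z m z x" "M \<le> m"
proof -
  let ?m = "max n (max M (nat z))"
  show thesis
  proof (rule that)
    show "int ?m - int (nat (int ?m - z)) = z" by linarith
    show "spherical Z ?m z x" by (rule spherical_mono[OF assms]) simp
  qed simp
qed

text \<open>In a locally spherical presheaf every element is \<open>KPs_incl\<close> of some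
  simplex, so a morphism is determined by its values on simplices.\<close>

lemma KPs_faithful: "faithful_ftor (LocSph :: ('u::infinite stab_psh, 'u stab_mor) cat) oplaxlim KPs"
  unfolding faithful_ftor_def LocSph_simps
proof (intro conjI KPs_LocSph_functor ballI inj_onI)
  fix Z Z' :: "'u stab_psh" and f f' assume "Z \<in> obj LocSph" "Z' \<in> obj LocSph"
  hence Z: "pointed_presheaf stab Z" "locally_spherical Z" and Z': "pointed_presheaf stab Z'"
    by (simp_all add: LocSph_iff)
  assume f: "f \<in> psh_hom stab Z Z'" and f': "f' \<in> psh_hom stab Z Z'" and eq: "fmap KPs Z Z' f = fmap KPs Z Z' f'"
  show "f = f'"
  proof (rule psh_hom_eqI[OF f f'])
    fix z x assume "x \<in> el Z z"
    then obtain n where "spherical Z n z x" using Z(2) by (auto simp: locally_spherical_def)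
    then obtain m i where m: "int m - int i = z" "spherical Z m z x" by (rule spherical_level[of _ _ _ _ 0])
    then obtain u where u: "u \<in> el (lev (KPs_obj Z) i) m" "KPs_incl Z i m u = x"
      using KPs_incl_surj[OF Z(1), of m i x] by auto
    show "f z x = f' z x"
      using KPs_map(2)[OF Z(1) Z' f u(1)] KPs_map(2)[OF Z(1) Z' f' u(1)] eq u(2) m(1) by simp
  qed
qed

text \<open>Through \<open>KPs_incl\<close> the components of \<open>g\<close> become partial maps
  \<open>V i n\<close> on \<open>Z\<close>, and compatibility with bonds makes them agree.
  Compatibility with operators gives naturality only within one index, so an arbitrary stable map is
  first made simplicial by raising the dimension.\<close>

lemma KPs_map_surj:
  fixes Z Z' :: "'u::infinite stab_psh"
  assumes Z: "pointed_presheaf stab Z" and ls: "locally_spherical Z" and Z': "pointed_presheaf stab Z'"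
    and g: "g \<in> spec_hom (KPs_obj Z) (KPs_obj Z')"
  shows "\<exists>f\<in>psh_hom stab Z Z'. fmap KPs Z Z' f = g"
proof -
  note O = KPs_obj_oplaxlim[OF Z] and O' = KPs_obj_oplaxlim[OF Z']
  note gD = smp_homD[OF spec_homD(1)[OF g]]
  define iv where "iv i n x = (SOME u. u \<in> el (lev (KPs_obj Z) i) n \<and> KPs_incl Z i n u = x)" for i n x
  have iv: "iv i n x \<in> el (lev (KPs_obj Z) i) n" "KPs_incl Z i n (iv i n x) = x"
    if "spherical Z n (int n - int i) x" for i n x
  proof -
    have "\<exists>u. u \<in> el (lev (KPs_obj Z) i) n \<and> KPs_incl Z i n u = x" using KPs_incl_surj[OF Z that] by blast
    from someI_ex[OF this] show "iv i n x \<in> el (lev (KPs_obj Z) i) n" "KPs_incl Z i n (iv i n x) = x"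
      by (simp_all add: iv_def)
  qed
  have iv_inc: "iv i n (KPs_incl Z i n u) = u" if "u \<in> el (lev (KPs_obj Z) i) n" for i n u
    using iv[OF KPs_incl_spherical[OF Z that]] that KPs_incl_inj[OF Z] by blast
  define V where "V i n x = KPs_incl Z' i n (g i n (iv i n x))" for i n x
  have V_inc: "V i n (KPs_incl Z i n u) = KPs_incl Z' i n (g i n u)" if "u \<in> el (lev (KPs_obj Z) i) n" for i n u
    by (simp add: V_def iv_inc[OF that])
  \<comment> \<open>A shift changes neither the element of \<open>Z\<close> nor that of
    \<open>Z'\<close>, so compatibility of \<open>g\<close> with the bonds becomes equality of two
    partial maps.\<close>
  have V_Suc: "V (Suc i) (Suc n) x = V i n x" if x: "spherical Z n (int n - int i) x" for i n x
  proof -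
    note u = iv[OF x]
    have "V (Suc i) (Suc n) (KPs_incl Z (Suc i) (Suc n) (bond_shift (KPs_obj Z) i n (iv i n x)))
      = KPs_incl Z' (Suc i) (Suc n) (bond_shift (KPs_obj Z') i n (g i n (iv i n x)))"
      using V_inc[OF bond_shift_el[OF O u(1)]] spec_hom_bond_shift[OF O O' g u(1)] by simp
    thus ?thesis using KPs_incl_bond_shift[OF Z u(1)] KPs_incl_bond_shift[OF Z' gD(1)[OF u(1)]] u(2) by (simp add: V_def)
  qed
  have V_add: "V (i + j) (n + j) x = V i n x" if x: "spherical Z n (int n - int i) x" for i n j x
  proof (induction j)
    case (Suc j)
    have "spherical Z (n + j) (int (n + j) - int (i + j)) x" using spherical_mono[OF x, of "n + j"] by simp
    thus ?case using V_Suc[of "n + j" "i + j" x] Suc by simp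
  qed simp
  have V_le: "V i n x = V i' n' x"
    if "spherical Z n z x" "int n - int i = z" "int n' - int i' = z" "n \<le> n'" for i n i' n' x z
  proof -
    have "i' = i + (n' - n)" "n' = n + (n' - n)" using that by linarith+
    thus ?thesis using V_add[of n i x "n' - n"] that(1,2) by metis
  qed
  \<comment> \<open>For fixed \<open>z\<close> the index is n - z, so any two pairs are comparable
    by dimension and \<open>V_le\<close> applies in one direction or the other.\<close>
  have V_eq: "V i n x = V i' n' x"
    if "spherical Z n z x" "spherical Z n' z x" "int n - int i = z" "int n' - int i' = z" for i n i' n' x z
    using that V_le[of n z x i n' i'] V_le[of n' z x i' n i] by (cases "n \<le> n'") auto
  \<comment> \<open>By \<open>V_eq\<close> any dimension and index at which \<open>x\<close> is
    spherical give the same value, so the choice is harmless.\<close>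
  define F where "F z x = (let p = (SOME p. spherical Z (fst p) z x \<and> int (fst p) - int (snd p) = z) in V (snd p) (fst p) x)" for z x
  have F: "F z x = V i n x" if "spherical Z n z x" "int n - int i = z" for z x n i
  proof -
    let ?Q = "\<lambda>p. spherical Z (fst p) z x \<and> int (fst p) - int (snd p) = z"
    have "?Q (n, i)" using that by simp
    hence "?Q (SOME p. ?Q p)" by (rule someI)
    thus ?thesis unfolding F_def Let_def using V_eq that by blast
  qed
  have ex: "\<exists>m i. int m - int i = z \<and> spherical Z m z x \<and> M \<le> m" if x: "x \<in> el Z z" for x z M
  proof -
    obtain n where "spherical Z n z x" using ls x by (auto simp: locally_spherical_def)
    thus ?thesis by (rule spherical_level[of _ _ _ _ M]) blast
  qed
  have "pmap stab Z Z' F"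
    unfolding pmap_def stab_obj
  proof (intro conjI ballI)
    { fix z x assume "x \<in> el Z z"
      then obtain m i where m: "int m - int i = z" "spherical Z m z x" using ex by blast
      hence u: "iv i m x \<in> el (lev (KPs_obj Z) i) m" using iv(1) by simp
      have "spherical Z' m z (V i m x)" using KPs_incl_spherical[OF Z' gD(1)[OF u]] m(1) by (simp add: V_def)
      thus "F z x \<in> el Z' z" using F[OF m(2,1)] by (simp add: spherical_def) }
    fix w
    have "pt Z w \<in> el Z w" by (rule stabD(1)[OF Z])
    then obtain m i where m: "int m - int i = w" "spherical Z m w (pt Z w)" using ex by blast
    have "F w (pt Z w) = KPs_incl Z' i m (g i m (pt (lev (KPs_obj Z) i) m))"
      using F[OF m(2,1)] V_inc[of "pt (lev (KPs_obj Z) i) m" i m] levD(1)[OF O] KPs_incl_pt[OF Z] m(1) by simp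
    thus "F w (pt Z w) = pt Z' w" using KPs_incl_pt[OF Z'] m(1) by (simp add: gD(2))
    fix z c x assume "c \<in> hom stab w z" and x: "x \<in> el Z z"
    then obtain f where f: "f \<in> shifts (z - w)" "c = map_cls f" by (auto simp: stab_hom)
    obtain N where N: "\<And>n m. n \<ge> N \<Longrightarrow> int m = int n + (z - w) \<Longrightarrow> \<exists>\<phi>\<in>hom smp n m. f = stab_ext n m \<phi>"
      using shifts_eq_ext[OF f(1)] by blast
    \<comment> \<open>The bound makes m - (z - w) at least \<open>N\<close>, so that
      \<open>f\<close> is the extension of an operator from \<open>[n]\<close> to \<open>[m]\<close>
      at the common index \<open>i\<close>.\<close>
    obtain m i where m: "int m - int i = z" "spherical Z m z x" "nat (int N + \<bar>z - w\<bar>) \<le> m" using ex[OF x] by blast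
    obtain n where n: "n \<ge> N" "int m = int n + (z - w)" "int n - int i = w"
    proof (rule that)
      show "nat (int m - (z - w)) \<ge> N" "int m = int (nat (int m - (z - w))) + (z - w)"
        "int (nat (int m - (z - w))) - int i = w" using m by linarith+
    qed
    obtain \<phi> where \<phi>: "\<phi> \<in> hom smp n m" "f = stab_ext n m \<phi>" using N[OF n(1,2)] by blast
    let ?u = "iv i m x"
    have u: "?u \<in> el (lev (KPs_obj Z) i) m" "KPs_incl Z i m ?u = x" using iv m by simp_all
    have au: "act (lev (KPs_obj Z) i) n m \<phi> ?u \<in> el (lev (KPs_obj Z) i) n" by (rule levD(2)[OF O u(1) \<phi>(1)])
    have "KPs_incl Z i n (act (lev (KPs_obj Z) i) n m \<phi> ?u) = act Z w z (map_cls f) x"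
      using KPs_incl_act[OF Z \<phi>(1) u(1)] m(1) n(3) u(2) \<phi>(2) by simp
    moreover have "spherical Z n w (act Z w z (map_cls f) x)"
      using spherical_ext[OF Z m(2) \<phi>(1), of w] n(2) \<phi>(2) by simp
    ultimately have "F w (act Z w z c x) = KPs_incl Z' i n (g i n (act (lev (KPs_obj Z) i) n m \<phi> ?u))"
      using F[of n w "act Z w z (map_cls f) x" i] n(3) V_inc[OF au] f(2) by simp
    also have "\<dots> = act Z' w z c (KPs_incl Z' i m (g i m ?u))"
      using gD(3)[OF \<phi>(1) u(1)] KPs_incl_act[OF Z' \<phi>(1) gD(1)[OF u(1)]] m(1) n(3) \<phi>(2) f(2) by simp
    finally show "F w (act Z w z c x) = act Z' w z c (F z x)"
      using F[OF m(2,1)] by (simp add: V_def)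
  qed
  hence F': "(\<lambda>z\<in>obj stab. \<lambda>x\<in>el Z z. F z x) \<in> psh_hom stab Z Z'" (is "?F \<in> _")
    by (rule restrict_pmap[OF _ Z])
  have "fmap KPs Z Z' ?F = g"
  proof (rule spec_hom_KPs_eqI[OF Z' KPs_map(1)[OF Z Z' F'] g])
    fix i n u assume u: "u \<in> el (lev (KPs_obj Z) i) n"
    have x: "spherical Z n (int n - int i) (KPs_incl Z i n u)" by (rule KPs_incl_spherical[OF Z u])
    show "KPs_incl Z' i n (fmap KPs Z Z' ?F i n u) = KPs_incl Z' i n (g i n u)"
      unfolding KPs_map(2)[OF Z Z' F' u] using F[OF x HOL.refl] V_inc[OF u] x by (simp add: stab_obj spherical_def)
  qed
  thus ?thesis using F' by blast
qed

lemma KPs_full: "full_ftor (LocSph :: ('u::infinite stab_psh, 'u stab_mor) cat) oplaxlim KPs"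
  unfolding full_ftor_def LocSph_simps oplaxlim_simps(2) KPs_fobj
proof (intro conjI KPs_LocSph_functor ballI equalityI subsetI)
  fix Z Z' :: "'u stab_psh" and g assume "Z \<in> obj LocSph" "Z' \<in> obj LocSph"
  hence Z: "pointed_presheaf stab Z" "locally_spherical Z" and Z': "pointed_presheaf stab Z'"
    by (simp_all add: LocSph_iff)
  { assume "g \<in> fmap KPs Z Z' ` psh_hom stab Z Z'"
    thus "g \<in> spec_hom (KPs_obj Z) (KPs_obj Z')" using KPs_map(1)[OF Z(1) Z'] by blast }
  assume "g \<in> spec_hom (KPs_obj Z) (KPs_obj Z')"
  thus "g \<in> fmap KPs Z Z' ` psh_hom stab Z Z'" using KPs_map_surj[OF Z Z'] by blast
qed

theorem lemma4p5:
  fixes Sp :: "('u::infinite spectrum, 'u spec_mor) cat"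
    and L :: "('u stab_psh, 'u stab_mor) cat"
  defines "Sp \<equiv> oplaxlim" and "L \<equiv> LocSph"
  shows "(\<exists>\<eta> \<epsilon>. adjunction Sp L KSp KPs \<eta> \<epsilon>) \<and>
         (\<forall>\<eta> \<epsilon>. adjunction Sp L KSp KPs \<eta> \<epsilon> \<longrightarrow>
            natural_isomorphism L L (comp_ftor KSp KPs) id_ftor \<epsilon>) \<and>
         full_ftor L Sp KPs \<and> faithful_ftor L Sp KPs"
  unfolding Sp_def L_def
  using KSp_KPs_adjunction KPs_full KPs_faithful counit_iso_if_full_faithful by blast

end
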